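(* Let $d\ge 3$ and $1\le k\le d-1$ be integers, and let $A(k,d)$ be the optimal constant in $$\|\mathcal{R}_k f\|_{L^{d+1}(\mathcal{G}_k,\sigma_k)}\le A(k,d)\,\|f\|_{L^{\frac{d+1}{k+1}}(\mathbb{R}^d)}. \quad ( * )$$ Assume that any nonnegative extremizer for $( * )$ can be written $f\circ L$ with $f$ a radial, nonincreasing extremizer for $( * )$ and $L$ an affine map of $\mathbb{R}^d$. Then any nonnegative extremizer for $( * )$ can be written $$x\mapsto\left[\frac{C}{1+\|Lx\|^2}\right]^{\frac{k+1}{2}}$$ with $C>0$ and $L$ an invertible affine map of $\mathbb{R}^d$.
   Context: $\mathcal{G}_k$ is the set of all $k$-planes ($k$-dimensional affine subspaces) of $\mathbb{R}^d$, and $\mathcal{M}_k\subset\mathcal{G}_k$ is the set of those containing $0$. $\mu_k$ is the unique probability measure on $\mathcal{M}_k$ invariant under orthogonal maps. The measure $\sigma_k$ on $\mathcal{G}_k$ is $\sigma_k(A)=\int_{\Pi\in\mathcal{M}_k}\lambda(\{x\in\Pi^\perp: x+\Pi\in A\})\,d\mu_k(\Pi)$, where $\lambda$ is Lebesgue measure on $\Pi^\perp$. The $k$-plane transform of a continuous compactly supported $f:\mathbb{R}^d\to\mathbb{R}$ is $\mathcal{R}_kf(\Pi)=\int_\Pi f\,d\lambda_\Pi$, where $\lambda_\Pi$ is the $k$-dimensional Lebesgue measure on $\Pi\in\mathcal{G}_k$. It is known that $\mathcal{R}_k$ extends to a bounded operator from $L^{\frac{d+1}{k+1}}(\mathbb{R}^d)$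 to $L^{d+1}(\mathcal{G}_k,\sigma_k)$. An extremizer for $( * )$ is a nonzero $f\in L^{\frac{d+1}{k+1}}(\mathbb{R}^d)$ for which equality holds. A radial function is nonincreasing if it is so as a function of $\|x\|$, where $\|\cdot\|$ is the Euclidean norm. Equalities of functions are understood almost everywhere. *)

theory Defs
  imports "HOL-Analysis.Analysis" "HOL-Probability.Probability"
begin

subsection \<open>Spaces of planes\<close>

definition affine_planes :: "nat \<Rightarrow> ('a::euclidean_space) set set" where
  "affine_planes k = {P. affine P \<and> aff_dim P = int k}"

definition linear_planes :: "nat \<Rightarrow> ('a::euclidean_space) set set" where
  "linear_planes k = {P \<in> affine_planes k. 0 \<in> P}"

text \<open>The Borel sigma-algebra (of the usual topology) on a family of planes, presented as the
  Effros sigma-algebra: it is generated by the sets of planes that hit a given open set.\<close>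

definition plane_algebra :: "('a::euclidean_space) set set \<Rightarrow> 'a set measure" where
  "plane_algebra G = sigma G {{P \<in> G. P \<inter> U \<noteq> {}} |U. open U}"

text \<open>Lebesgue measure on an affine subspace, as a Borel measure on the ambient space: the image
  of the product Lebesgue measure under an orthonormal parametrization of the subspace. It does
  not depend on the orthonormal basis, nor on the base point, chosen here.\<close>

definition orthonormal_basis_of :: "('a::euclidean_space) set \<Rightarrow> 'a set \<Rightarrow> bool" where
  "orthonormal_basis_of V B \<longleftrightarrow>
     B \<subseteq> V \<and> pairwise orthogonal B \<and> (\<forall>b\<in>B. norm b = 1) \<and> span B = V"

definition plane_lebesgue :: "('a::euclidean_space) set \<Rightarrow> 'a measure" where
  "plane_lebesgue P =
     (let p = closest_point P 0;
          B = (SOME B. orthonormal_basis_of ((\<lambda>x. x - p) ` P) B)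
      in distr (\<Pi>\<^sub>M b\<in>B. (lborel :: real measure)) borel (\<lambda>c. p + (\<Sum>b\<in>B. c b *\<^sub>R b)))"

text \<open>There is exactly one measure with the following property; the measures on planes and the
  transform below take it as the parameter \<open>\<mu>\<close>.\<close>

definition invariant_plane_prob :: "nat \<Rightarrow> ('a::euclidean_space) set measure \<Rightarrow> bool" where
  "invariant_plane_prob k \<mu> \<longleftrightarrow>
     prob_space \<mu> \<and> sets \<mu> = sets (plane_algebra (linear_planes k)) \<and>
     (\<forall>T. orthogonal_transformation T \<longrightarrow> distr \<mu> \<mu> (\<lambda>P. T ` P) = \<mu>)"

definition plane_measure :: "nat \<Rightarrow> ('a::euclidean_space) set measure \<Rightarrow> 'a set measure" where
  "plane_measure k \<mu> =
     measure_of (affine_planes k) (sets (plane_algebra (affine_planes k)))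
       (\<lambda>A. \<integral>\<^sup>+P. emeasure (plane_lebesgue (P\<^sup>\<bottom>)) {x \<in> P\<^sup>\<bottom>. (\<lambda>y. x + y) ` P \<in> A} \<partial>\<mu>)"

subsection \<open>Lebesgue spaces of real functions\<close>

text \<open>Elements of \<open>L\<^sup>p\<close> are represented by measurable functions, not by classes.\<close>

definition Lp_space :: "'b measure \<Rightarrow> real \<Rightarrow> ('b \<Rightarrow> real) set" where
  "Lp_space M p = {f \<in> borel_measurable M. integrable M (\<lambda>x. \<bar>f x\<bar> powr p)}"

definition Lp_norm :: "'b measure \<Rightarrow> real \<Rightarrow> ('b \<Rightarrow> real) \<Rightarrow> real" where
  "Lp_norm M p f = (\<integral>x. \<bar>f x\<bar> powr p \<partial>M) powr (1 / p)"

definition Lp_converges :: "'b measure \<Rightarrow> real \<Rightarrow> (nat \<Rightarrow> 'b \<Rightarrow> real) \<Rightarrow> ('b \<Rightarrow> real) \<Rightarrow> bool" where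
  "Lp_converges M p F f \<longleftrightarrow>
     (\<forall>n. (\<lambda>x. F n x - f x) \<in> Lp_space M p) \<and>
     (\<lambda>n. Lp_norm M p (\<lambda>x. F n x - f x)) \<longlonglongrightarrow> 0"

subsection \<open>The plane transform\<close>

definition plane_transform :: "(('a::euclidean_space) \<Rightarrow> real) \<Rightarrow> 'a set \<Rightarrow> real" where
  "plane_transform f P = (\<integral>x. f x \<partial>plane_lebesgue P)"

definition compactly_supported_continuous :: "(('a::euclidean_space) \<Rightarrow> real) \<Rightarrow> bool" where
  "compactly_supported_continuous f \<longleftrightarrow> continuous_on UNIV f \<and> compact (closure {x. f x \<noteq> 0})"

abbreviation source_exponent :: "'a::euclidean_space itself \<Rightarrow> nat \<Rightarrow> real" where
  "source_exponent _ k \<equiv> (real DIM('a) + 1) / (real k + 1)"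

abbreviation target_exponent :: "'a::euclidean_space itself \<Rightarrow> real" where
  "target_exponent _ \<equiv> real DIM('a) + 1"

text \<open>\<open>plane_transform_ext k \<mu> f g\<close> says that \<open>g\<close> represents the value at \<open>f\<close> of the continuous
  extension of the plane transform, from continuous compactly supported functions to \<open>L\<^sup>p\<close>, with
  \<open>p = (d + 1) / (k + 1)\<close>. Such a \<open>g\<close> exists for every \<open>f\<close> in \<open>L\<^sup>p\<close> and is unique almost everywhere.\<close>

definition plane_transform_ext ::
    "nat \<Rightarrow> ('a::euclidean_space) set measure \<Rightarrow> ('a \<Rightarrow> real) \<Rightarrow> ('a set \<Rightarrow> real) \<Rightarrow> bool" where
  "plane_transform_ext k \<mu> f g \<longleftrightarrow>
     f \<in> Lp_space lborel (source_exponent TYPE('a) k) \<and>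
     g \<in> Lp_space (plane_measure k \<mu>) (target_exponent TYPE('a)) \<and>
     (\<exists>F. (\<forall>n. compactly_supported_continuous (F n)) \<and>
          Lp_converges lborel (source_exponent TYPE('a) k) F f \<and>
          Lp_converges (plane_measure k \<mu>) (target_exponent TYPE('a))
            (\<lambda>n. plane_transform (F n)) g)"

definition optimal_constant :: "nat \<Rightarrow> ('a::euclidean_space) set measure \<Rightarrow> ennreal" where
  "optimal_constant k \<mu> =
     Inf {C. \<forall>f g. plane_transform_ext k \<mu> f g \<longrightarrow>
            ennreal (Lp_norm (plane_measure k \<mu>) (target_exponent TYPE('a)) g)
              \<le> C * ennreal (Lp_norm lborel (source_exponent TYPE('a) k) f)}"

definition extremizer :: "nat \<Rightarrow> ('a::euclidean_space) set measure \<Rightarrow> ('a \<Rightarrow> real) \<Rightarrow> bool" where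
  "extremizer k \<mu> f \<longleftrightarrow>
     \<not> (AE x in lborel. f x = 0) \<and>
     (\<exists>g. plane_transform_ext k \<mu> f g \<and>
          ennreal (Lp_norm (plane_measure k \<mu>) (target_exponent TYPE('a)) g)
            = optimal_constant k \<mu> * ennreal (Lp_norm lborel (source_exponent TYPE('a) k) f))"

definition nonneg_extremizer :: "nat \<Rightarrow> ('a::euclidean_space) set measure \<Rightarrow> ('a \<Rightarrow> real) \<Rightarrow> bool" where
  "nonneg_extremizer k \<mu> f \<longleftrightarrow> extremizer k \<mu> f \<and> (AE x in lborel. 0 \<le> f x)"

subsection \<open>Radial functions and affine maps\<close>

text \<open>The profile is only required to be nonincreasing on the positive half-line: a real value of
  \<open>\<phi>\<close> at \<open>0\<close> bounding it would exclude radial functions that are unbounded near the origin.\<close>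

definition radial_nonincreasing :: "(('a::euclidean_space) \<Rightarrow> real) \<Rightarrow> bool" where
  "radial_nonincreasing f \<longleftrightarrow>
     (\<exists>\<phi>. antimono_on {0<..} \<phi> \<and> (AE x in lborel. f x = \<phi> (norm x)))"

definition affine_map :: "(('a::real_vector) \<Rightarrow> 'a) \<Rightarrow> bool" where
  "affine_map L \<longleftrightarrow> (\<exists>A b. linear A \<and> L = (\<lambda>x. A x + b))"

end

theory Submission imports Defs begin

text \<open>Besides affine maps, the inequality has a projective symmetry. For a coordinate e let
  \<open>proj_inv e\<close> divide all coordinates of x by x_e and put 1 / x_e in place e, and let
  the twist of f be |x_e|^-(k+1) times f composed with this map. The map carries planes to planes.
  The twist is an isometry of L^((d+1)/(k+1)); its transform is the transform of f at the moved
  plane times a factor that compensates exactly the change of sigma_k in L^(d+1). Hence twists of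
  extremizers are extremizers (\<open>extremizer_proj_twist\<close>).

  Let f be a nonnegative radial nonincreasing extremizer with profile phi. Its twist is a
  nonnegative extremizer, so the assumption applies to it as well and gives psi (norm (A x + b))
  with psi nonincreasing. The twist of a radial function depends only on |x_e| and norm x. Its level
  sets are ellipsoids norm (A x + b) <= rho, and these inherit all orthogonal symmetries that
  preserve |x_e|. With S = norm x ^ 2 - x_e ^ 2 this forces norm (A x + b) ^ 2 = alpha S + beta x_e
  ^ 2 (\<open>axially_symmetric_ellipsoid\<close>). Put X = norm (proj_inv e x) ^ 2 = (1 + S) / x_e
  ^ 2 and W = alpha S + beta x_e ^ 2. Then W + alpha = x_e ^ 2 (alpha X + beta), and the equation
  between the two forms of the twist reads (alpha X + beta)^((k+1)/2) phi (sqrt X) = (W +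
  alpha)^((k+1)/2) psi (sqrt W). X and W vary independently as long as X W > beta, so both sides are
  constant (\<open>monotone_separation\<close>, \<open>profile_rigidity\<close>), which is the
  claimed form of phi. A general nonnegative extremizer is such an f composed with an affine map;
  this map is invertible because a nonzero function in L^p is not invariant along a direction
  (\<open>extremizer_affine_inj\<close>).

  The symmetry is verified in coordinates. Almost every k-plane is a graph over the coordinates in a
  set K of size k. In terms of its slopes A and offset b, sigma_k has a density that is a constant
  times J^-(d+1), and the transform is J times the integral over the K coordinates, where J is the
  volume factor of the graph (\<open>nn_integral_plane_measure_graph\<close>,
  \<open>nn_integral_plane_lebesgue_graph\<close>). In this chart the projective inversion in a
  direction e in K only exchanges the offset with the column e of the slopes
  (\<open>plane_transform_proj_twist\<close>), and the powers of J cancel. The density is found by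
  identifying mu_k: an invariant probability is unique (\<open>invariant_plane_prob_unique\<close>),
  and the span of k independent vectors uniform in the unit ball has an invariant law whose density
  can be computed (\<open>nn_integral_invariant_plane_prob\<close>). Passing from continuous
  compactly supported functions to f uses approximation by functions that vanish near the hyperplane
  x_e = 0, where the inversion is singular.\<close>

section \<open>Changes of variables for products of Lebesgue measure\<close>

abbreviation leb_prod :: "'i set \<Rightarrow> ('i \<Rightarrow> real) measure" where
  "leb_prod I \<equiv> Pi\<^sub>M I (\<lambda>_. lborel)"

interpretation leb_prod: product_sigma_finite "\<lambda>_::'i. lborel :: real measure"
  by standard

lemma sigma_finite_leb_prod: "finite I \<Longrightarrow> sigma_finite_measure (leb_prod I)"
  by (rule leb_prod.sigma_finite)

text \<open>Rectangles pull back to rectangles with the same sides in another order. Permutations of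
  coordinates therefore preserve the measure, and the column exchange \<open>chart_swap\<close> is
  one of them.\<close>

lemma leb_prod_reindex:
  assumes "bij_betw f I J" "finite I"
  shows "distr (leb_prod J) (leb_prod I) (\<lambda>x. \<lambda>i\<in>I. x (f i)) = leb_prod I"
proof (rule leb_prod.PiM_eqI)
  have f: "f i \<in> J" if "i \<in> I" for i
    using assms that by (auto simp: bij_betw_def)
  have J: "finite J" using assms bij_betw_finite by blast
  have m[measurable]: "(\<lambda>x. \<lambda>i\<in>I. x (f i)) \<in> measurable (leb_prod J) (leb_prod I)"
    using f by (auto intro!: measurable_restrict measurable_component_singleton)
  show "finite I" by fact
  show "sets (distr (leb_prod J) (leb_prod I) (\<lambda>x. \<lambda>i\<in>I. x (f i))) = sets (leb_prod I)" by simp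
  fix A :: "'a \<Rightarrow> real set"
  assume A: "\<And>i. i \<in> I \<Longrightarrow> A i \<in> sets lborel"
  define g where "g = the_inv_into I f"
  have g: "g j \<in> I" "f (g j) = j" if "j \<in> J" for j
    using assms that unfolding g_def bij_betw_def
    by (auto intro: the_inv_into_into f_the_inv_into_f)
  have gf: "g (f i) = i" if "i \<in> I" for i
    using assms that by (simp add: g_def bij_betw_def the_inv_into_f_f)
  have "emeasure (distr (leb_prod J) (leb_prod I) (\<lambda>x. \<lambda>i\<in>I. x (f i))) (Pi\<^sub>E I A)
      = emeasure (leb_prod J) ((\<lambda>x. \<lambda>i\<in>I. x (f i)) -` Pi\<^sub>E I A \<inter> space (leb_prod J))"
    by (rule emeasure_distr[OF m]) (use A \<open>finite I\<close> in \<open>auto intro!: sets_PiM_I_finite\<close>)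
  also have "(\<lambda>x. \<lambda>i\<in>I. x (f i)) -` Pi\<^sub>E I A \<inter> space (leb_prod J) = Pi\<^sub>E J (\<lambda>j. A (g j))"
    using g f gf by (auto simp: space_PiM PiE_iff extensional_def split: if_splits) (metis g)+
  also have "emeasure (leb_prod J) \<dots> = (\<Prod>j\<in>J. emeasure lborel (A (g j)))"
    by (rule leb_prod.emeasure_PiM) (use J g A in auto)
  also have "\<dots> = (\<Prod>i\<in>I. emeasure lborel (A i))"
    by (rule prod.reindex_bij_betw[OF assms(1), symmetric, THEN trans])
       (auto simp: gf intro!: prod.cong)
  finally show "emeasure (distr (leb_prod J) (leb_prod I) (\<lambda>x. \<lambda>i\<in>I. x (f i))) (Pi\<^sub>E I A)
      = (\<Prod>i\<in>I. emeasure lborel (A i))" .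
qed

lemma nn_integral_leb_prod_reindex:
  assumes "bij_betw f I J" "finite I" and [measurable]: "g \<in> borel_measurable (leb_prod I)"
  shows "(\<integral>\<^sup>+x. g (\<lambda>i\<in>I. x (f i)) \<partial>leb_prod J) = (\<integral>\<^sup>+x. g x \<partial>leb_prod I)"
proof -
  have f: "f i \<in> J" if "i \<in> I" for i
    using assms that by (auto simp: bij_betw_def)
  have m[measurable]: "(\<lambda>x. \<lambda>i\<in>I. x (f i)) \<in> measurable (leb_prod J) (leb_prod I)"
    using f by (auto intro!: measurable_restrict measurable_component_singleton)
  show ?thesis
    by (subst leb_prod_reindex[OF assms(1,2), symmetric], subst nn_integral_distr) auto
qed

text \<open>Fubini peels off one coordinate at a time; on the line it is the affine
  substitution.\<close>

lemma nn_integral_leb_prod_scale: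
  assumes "finite I" "\<And>i. i \<in> I \<Longrightarrow> c i \<noteq> 0" and [measurable]: "g \<in> borel_measurable (leb_prod I)"
  shows "ennreal (\<Prod>i\<in>I. \<bar>c i\<bar>) * (\<integral>\<^sup>+x. g (\<lambda>i\<in>I. c i * x i) \<partial>leb_prod I) = (\<integral>\<^sup>+x. g x \<partial>leb_prod I)"
  using assms
proof (induction I arbitrary: g rule: finite_induct)
  case empty
  then show ?case by (simp add: PiM_empty nn_integral_count_space_finite)
next
  case (insert a I)
  note [measurable] = insert.prems(2)
  have [measurable]: "(\<lambda>(x,y). g (x(a := y))) \<in> borel_measurable (leb_prod I \<Otimes>\<^sub>M lborel)"
    using measurable_comp[OF measurable_add_dim insert.prems(2)] by (simp add: comp_def split_def)
  have m2[measurable]: "(\<lambda>x. \<lambda>i\<in>insert a I. c i * x i) \<in> measurable (leb_prod (insert a I)) (leb_prod (insert a I))"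
    by (intro measurable_restrict) measurable
  have [measurable]: "(\<lambda>x. \<lambda>i\<in>I. c i * x i) \<in> measurable (leb_prod I) (leb_prod I)"
    by (intro measurable_restrict) measurable
  have ca: "c a \<noteq> 0" using insert.prems by auto
  define G where "G x = (\<integral>\<^sup>+y. g (x(a := y)) \<partial>lborel)" for x
  have [measurable]: "G \<in> borel_measurable (leb_prod I)"
    unfolding G_def by measurable
  have upd: "(\<lambda>i\<in>insert a I. c i * (x(a:=y)) i) = (\<lambda>i\<in>I. c i * x i)(a := c a * y)" for x y
    using insert.hyps by (auto simp: fun_eq_iff)
  have e1: "(\<integral>\<^sup>+x. g (\<lambda>i\<in>insert a I. c i * x i) \<partial>leb_prod (insert a I))
     = (\<integral>\<^sup>+x. (\<integral>\<^sup>+y. g ((\<lambda>i\<in>I. c i * x i)(a := c a * y)) \<partial>lborel) \<partial>leb_prod I)"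
    by (subst leb_prod.product_nn_integral_insert[OF insert.hyps]) (simp_all only: upd, measurable)
  have "ennreal (\<Prod>i\<in>insert a I. \<bar>c i\<bar>) * (\<integral>\<^sup>+x. g (\<lambda>i\<in>insert a I. c i * x i) \<partial>leb_prod (insert a I))
     = ennreal (\<Prod>i\<in>I. \<bar>c i\<bar>) * (ennreal \<bar>c a\<bar> * (\<integral>\<^sup>+x. (\<integral>\<^sup>+y. g ((\<lambda>i\<in>I. c i * x i)(a := c a * y)) \<partial>lborel) \<partial>leb_prod I))"
    unfolding e1 using insert.hyps by (simp add: ennreal_mult prod_nonneg mult_ac)
  also have "ennreal \<bar>c a\<bar> * (\<integral>\<^sup>+x. (\<integral>\<^sup>+y. g ((\<lambda>i\<in>I. c i * x i)(a := c a * y)) \<partial>lborel) \<partial>leb_prod I)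
     = (\<integral>\<^sup>+x. ennreal \<bar>c a\<bar> * (\<integral>\<^sup>+y. g ((\<lambda>i\<in>I. c i * x i)(a := c a * y)) \<partial>lborel) \<partial>leb_prod I)"
    by (subst nn_integral_cmult) measurable
  also have "\<dots> = (\<integral>\<^sup>+x. G (\<lambda>i\<in>I. c i * x i) \<partial>leb_prod I)"
    unfolding G_def
  proof (rule nn_integral_cong)
    fix x assume x: "x \<in> space (leb_prod I)"
    define x' where "x' = (\<lambda>i\<in>I. c i * x i)"
    have "x' \<in> space (leb_prod I)" by (auto simp: x'_def space_PiM)
    then have [measurable]: "(\<lambda>y. g (x'(a := y))) \<in> borel_measurable lborel"
      using insert.hyps by measurable
    show "ennreal \<bar>c a\<bar> * (\<integral>\<^sup>+y. g ((\<lambda>i\<in>I. c i * x i)(a := c a * y)) \<partial>lborel) = (\<integral>\<^sup>+y. g ((\<lambda>i\<in>I. c i * x i)(a := y)) \<partial>lborel)"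
      using nn_integral_real_affine[of "\<lambda>y. g (x'(a := y))" "c a" 0] ca unfolding x'_def by simp
  qed
  also have "ennreal (\<Prod>i\<in>I. \<bar>c i\<bar>) * \<dots> = (\<integral>\<^sup>+x. G x \<partial>leb_prod I)"
    by (rule insert.IH) (use insert.prems in auto)
  also have "\<dots> = (\<integral>\<^sup>+x. g x \<partial>leb_prod (insert a I))"
    unfolding G_def by (rule leb_prod.product_nn_integral_insert[OF insert.hyps, symmetric]) measurable
  finally show ?case .
qed

lemma nn_integral_leb_prod_translate:
  assumes "finite I" and [measurable]: "g \<in> borel_measurable (leb_prod I)"
  shows "(\<integral>\<^sup>+x. g (\<lambda>i\<in>I. c i + x i) \<partial>leb_prod I) = (\<integral>\<^sup>+x. g x \<partial>leb_prod I)"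
  using assms
proof (induction I arbitrary: g rule: finite_induct)
  case empty
  then show ?case by (simp add: PiM_empty nn_integral_count_space_finite)
next
  case (insert a I)
  note [measurable] = insert.prems
  have [measurable]: "(\<lambda>(x,y). g (x(a := y))) \<in> borel_measurable (leb_prod I \<Otimes>\<^sub>M lborel)"
    using measurable_comp[OF measurable_add_dim insert.prems] by (simp add: comp_def split_def)
  have m2[measurable]: "(\<lambda>x. \<lambda>i\<in>insert a I. c i + x i) \<in> measurable (leb_prod (insert a I)) (leb_prod (insert a I))"
    by (intro measurable_restrict) measurable
  have [measurable]: "(\<lambda>x. \<lambda>i\<in>I. c i + x i) \<in> measurable (leb_prod I) (leb_prod I)"
    by (intro measurable_restrict) measurable
  define G where "G x = (\<integral>\<^sup>+y. g (x(a := y)) \<partial>lborel)" for x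
  have [measurable]: "G \<in> borel_measurable (leb_prod I)"
    unfolding G_def by measurable
  have upd: "(\<lambda>i\<in>insert a I. c i + (x(a:=y)) i) = (\<lambda>i\<in>I. c i + x i)(a := c a + y)" for x y
    using insert.hyps by (auto simp: fun_eq_iff)
  have "(\<integral>\<^sup>+x. g (\<lambda>i\<in>insert a I. c i + x i) \<partial>leb_prod (insert a I))
     = (\<integral>\<^sup>+x. (\<integral>\<^sup>+y. g ((\<lambda>i\<in>I. c i + x i)(a := c a + y)) \<partial>lborel) \<partial>leb_prod I)"
    by (subst leb_prod.product_nn_integral_insert[OF insert.hyps]) (simp_all only: upd, measurable)
  also have "\<dots> = (\<integral>\<^sup>+x. G (\<lambda>i\<in>I. c i + x i) \<partial>leb_prod I)"
    unfolding G_def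
  proof (rule nn_integral_cong)
    fix x assume x: "x \<in> space (leb_prod I)"
    define x' where "x' = (\<lambda>i\<in>I. c i + x i)"
    have "x' \<in> space (leb_prod I)" by (auto simp: x'_def space_PiM)
    then have [measurable]: "(\<lambda>y. g (x'(a := y))) \<in> borel_measurable lborel"
      using insert.hyps by measurable
    show "(\<integral>\<^sup>+y. g ((\<lambda>i\<in>I. c i + x i)(a := c a + y)) \<partial>lborel) = (\<integral>\<^sup>+y. g ((\<lambda>i\<in>I. c i + x i)(a := y)) \<partial>lborel)"
      using nn_integral_real_affine[of "\<lambda>y. g (x'(a := y))" 1 "c a"] unfolding x'_def by simp
  qed
  also have "\<dots> = (\<integral>\<^sup>+x. G x \<partial>leb_prod I)"
    by (rule insert.IH) (use insert.prems in auto)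
  also have "\<dots> = (\<integral>\<^sup>+x. g x \<partial>leb_prod (insert a I))"
    unfolding G_def by (rule leb_prod.product_nn_integral_insert[OF insert.hyps, symmetric]) measurable
  finally show ?case .
qed

text \<open>Row operations suffice by Gaussian elimination.\<close>

lemma nn_integral_leb_prod_matrix_UNIV:
  fixes M :: "real^'n^'n"
  assumes "det M \<noteq> 0" "g \<in> borel_measurable (leb_prod UNIV)"
  shows "ennreal \<bar>det M\<bar> * (\<integral>\<^sup>+x. g (\<lambda>i. \<Sum>j\<in>UNIV. M $ i $ j * x j) \<partial>leb_prod UNIV)
     = (\<integral>\<^sup>+x. g x \<partial>leb_prod UNIV)"
proof -
  have meas: "(\<lambda>x. \<lambda>i. \<Sum>j\<in>UNIV. M $ i $ j * x j) \<in> measurable (leb_prod UNIV) (leb_prod UNIV)" for M :: "real^'n^'n"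
    by (intro measurable_PiM_single') auto
  have "det M \<noteq> 0 \<longrightarrow> (\<forall>g\<in>borel_measurable (leb_prod UNIV).
     ennreal \<bar>det M\<bar> * (\<integral>\<^sup>+x. g (\<lambda>i. \<Sum>j\<in>UNIV. M $ i $ j * x j) \<partial>leb_prod UNIV)
     = (\<integral>\<^sup>+x. g x \<partial>leb_prod UNIV))" (is "?P M")
  proof (induction M rule: induct_matrix_elementary_alt)
    case (1 A B)
    show ?case
    proof (intro impI ballI)
      assume "det (A ** B) \<noteq> 0"
      then have nz: "det A \<noteq> 0" "det B \<noteq> 0" by (auto simp: det_mul)
      fix g :: "('n \<Rightarrow> real) \<Rightarrow> ennreal" assume [measurable]: "g \<in> borel_measurable (leb_prod UNIV)"
      let ?a = "\<lambda>A x. \<lambda>i. \<Sum>j\<in>UNIV. A $ i $ j * x j"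
      have comp: "?a (A ** B) x = ?a A (?a B x)" for x :: "'n \<Rightarrow> real"
        by (rule ext)
           (simp add: matrix_matrix_mult_def sum_distrib_left sum_distrib_right mult.assoc, rule sum.swap)
      have [measurable]: "(\<lambda>x. g (?a A x)) \<in> borel_measurable (leb_prod UNIV)"
        by (rule measurable_compose[OF meas]) fact
      have "ennreal \<bar>det (A ** B)\<bar> * (\<integral>\<^sup>+x. g (?a (A ** B) x) \<partial>leb_prod UNIV)
         = ennreal \<bar>det A\<bar> * (ennreal \<bar>det B\<bar> * (\<integral>\<^sup>+x. g (?a A (?a B x)) \<partial>leb_prod UNIV))"
        by (simp add: det_mul abs_mult ennreal_mult mult.assoc comp)
      also have "ennreal \<bar>det B\<bar> * (\<integral>\<^sup>+x. g (?a A (?a B x)) \<partial>leb_prod UNIV)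
         = (\<integral>\<^sup>+x. g (?a A x) \<partial>leb_prod UNIV)"
        by (rule 1(2)[rule_format]) (use nz in auto)
      also have "ennreal \<bar>det A\<bar> * \<dots> = (\<integral>\<^sup>+x. g x \<partial>leb_prod UNIV)"
        by (rule 1(1)[rule_format]) (use nz in auto)
      finally show "ennreal \<bar>det (A ** B)\<bar> * (\<integral>\<^sup>+x. g (?a (A ** B) x) \<partial>leb_prod UNIV)
         = (\<integral>\<^sup>+x. g x \<partial>leb_prod UNIV)" .
    qed
  next
    \<comment> \<open>A zero row makes the determinant vanish, so the implication is
      vacuous.\<close>
    case (2 A i)
    then show ?case by (metis det_zero_row(2))
  next
    case (3 A)
    show ?case
    proof (intro impI ballI)
      assume nz: "det A \<noteq> 0"
      fix g :: "('n \<Rightarrow> real) \<Rightarrow> ennreal" assume g: "g \<in> borel_measurable (leb_prod UNIV)"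
      have d: "det A = (\<Prod>i\<in>UNIV. A $ i $ i)" by (rule det_diagonal) (use 3 in auto)
      then have "A $ i $ i \<noteq> 0" for i using nz by auto
      moreover have "(\<Sum>j\<in>UNIV. A $ i $ j * x j) = A $ i $ i * x i" for i and x :: "'n \<Rightarrow> real"
        using 3 by (subst sum.remove[of _ i]) (auto intro!: sum.neutral)
      ultimately show "ennreal \<bar>det A\<bar> * (\<integral>\<^sup>+x. g (\<lambda>i. \<Sum>j\<in>UNIV. A $ i $ j * x j) \<partial>leb_prod UNIV)
         = (\<integral>\<^sup>+x. g x \<partial>leb_prod UNIV)"
        using nn_integral_leb_prod_scale[of UNIV "\<lambda>i. A $ i $ i" g] g by (simp add: d abs_prod restrict_UNIV)
    qed
  next
    case (4 m n)
    let ?A = "(\<chi> i j. mat 1 $ i $ Transposition.transpose m n j) :: real^'n^'n"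
    have "det ?A = of_int (sign (Transposition.transpose m n)) * det (mat 1 :: real^'n^'n)"
      by (rule det_permute_columns) (simp add: permutes_swap_id)
    then have d: "\<bar>det ?A\<bar> = 1" by (simp add: sign_def)
    have s: "(\<Sum>j\<in>UNIV. ?A $ i $ j * x j) = x (Transposition.transpose m n i)" for i and x :: "'n \<Rightarrow> real"
    proof -
      have "(\<Sum>j\<in>UNIV. ?A $ i $ j * x j) = (\<Sum>j\<in>UNIV. if j = Transposition.transpose m n i then x j else 0)"
        by (intro sum.cong) (auto simp: mat_def Transposition.transpose_def split: if_splits)
      then show ?thesis by simp
    qed
    show ?case
    proof (intro impI ballI)
      fix g :: "('n \<Rightarrow> real) \<Rightarrow> ennreal" assume g: "g \<in> borel_measurable (leb_prod UNIV)"
      show "ennreal \<bar>det ?A\<bar> * (\<integral>\<^sup>+x. g (\<lambda>i. \<Sum>j\<in>UNIV. ?A $ i $ j * x j) \<partial>leb_prod UNIV)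
         = (\<integral>\<^sup>+x. g x \<partial>leb_prod UNIV)"
        unfolding s d
        using nn_integral_leb_prod_reindex[of "Transposition.transpose m n" UNIV UNIV g] g
        by (simp add: bij_swap restrict_UNIV)
    qed
  next
    case (5 m n)
    let ?A = "(\<chi> i j. of_bool (i = m \<and> j = n \<or> i = j)) :: real^'n^'n"
    have s: "(\<lambda>i. \<Sum>j\<in>UNIV. ?A $ i $ j * x j) = x(m := x n + x m)" for x :: "'n \<Rightarrow> real"
    proof
      fix i
      have "(\<Sum>j\<in>UNIV. ?A $ i $ j * x j) = (\<Sum>j\<in>UNIV. (if j = i then x j else 0) + (if i = m then if j = n then x j else 0 else 0))"
        by (intro sum.cong) (use 5 in auto)
      then show "(\<Sum>j\<in>UNIV. ?A $ i $ j * x j) = (x(m := x n + x m)) i"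
        by (simp add: sum.distrib)
    qed
    have d: "det ?A = 1"
    proof -
      have "?A = (\<chi> i. if i = m then row m (mat 1) + 1 *s row n (mat 1) else row i (mat 1))"
        using 5 by (auto simp: vec_eq_iff row_def mat_def)
      then show ?thesis using det_row_operation[OF 5, of "mat 1" 1] by simp
    qed
    show ?case
    proof (intro impI ballI)
      fix g :: "('n \<Rightarrow> real) \<Rightarrow> ennreal" assume g[measurable]: "g \<in> borel_measurable (leb_prod UNIV)"
      \<comment> \<open>With the other coordinates fixed, the row operation translates coordinate
        \<open>m\<close> by the constant \<open>x n\<close>.\<close>
      have U: "insert m (UNIV - {m}) = UNIV" by auto
      have [measurable]: "(\<lambda>x::'n \<Rightarrow> real. x(m := x n + x m)) \<in> measurable (leb_prod UNIV) (leb_prod UNIV)"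
        using meas[of ?A] unfolding s .
      have ins: "(\<integral>\<^sup>+x. h x \<partial>leb_prod UNIV) = (\<integral>\<^sup>+x. (\<integral>\<^sup>+y. h (x(m := y)) \<partial>lborel) \<partial>leb_prod (UNIV - {m}))"
        if "h \<in> borel_measurable (leb_prod UNIV)" for h :: "('n \<Rightarrow> real) \<Rightarrow> ennreal"
        using leb_prod.product_nn_integral_insert[of "UNIV - {m}" m h] that by (simp add: U)
      have "(\<integral>\<^sup>+x. g (x(m := x n + x m)) \<partial>leb_prod UNIV)
         = (\<integral>\<^sup>+x. (\<integral>\<^sup>+y. g (x(m := x n + y)) \<partial>lborel) \<partial>leb_prod (UNIV - {m}))"
        using 5 by (subst ins) auto
      also have "\<dots> = (\<integral>\<^sup>+x. (\<integral>\<^sup>+y. g (x(m := y)) \<partial>lborel) \<partial>leb_prod (UNIV - {m}))"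
      proof (rule nn_integral_cong)
        fix x assume x: "x \<in> space (leb_prod (UNIV - {m}))"
        have "(\<lambda>y. x(m := y)) \<in> measurable lborel (leb_prod (insert m (UNIV - {m})))"
          using x by (intro measurable_component_update) auto
        then have [measurable]: "(\<lambda>y. g (x(m := y))) \<in> borel_measurable borel"
          unfolding U by simp
        show "(\<integral>\<^sup>+y. g (x(m := x n + y)) \<partial>lborel) = (\<integral>\<^sup>+y. g (x(m := y)) \<partial>lborel)"
          using nn_integral_real_affine[of "\<lambda>y. g (x(m := y))" 1 "x n"] by simp
      qed
      also have "\<dots> = (\<integral>\<^sup>+x. g x \<partial>leb_prod UNIV)" by (rule ins[symmetric]) fact
      finally show "ennreal \<bar>det ?A\<bar> * (\<integral>\<^sup>+x. g (\<lambda>i. \<Sum>j\<in>UNIV. ?A $ i $ j * x j) \<partial>leb_prod UNIV)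
         = (\<integral>\<^sup>+x. g x \<partial>leb_prod UNIV)"
        unfolding s d by simp
    qed
  qed
  with assms show ?thesis by blast
qed


text \<open>Padding by the identity outside \<open>K\<close> gives a full square matrix with the
  determinant of the \<open>K\<close> x \<open>K\<close> block, so that products, transposes and
  kernels of blocks become those of ordinary matrices.\<close>

definition block_matrix :: "'n set \<Rightarrow> ('n \<times> 'n \<Rightarrow> real) \<Rightarrow> real^'n^'n" where
  "block_matrix K S = (\<chi> i j. if i \<in> K \<and> j \<in> K then S (i, j) else of_bool (i = j))"

text \<open>The coordinates outside \<open>K\<close> are integrated over a unit cube, which has mass
  one; the padded identity block leaves this cube alone.\<close>

lemma nn_integral_leb_prod_pad:
  fixes K :: "'n::finite set"
  assumes [measurable]: "u \<in> borel_measurable (leb_prod K)"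
  shows "(\<integral>\<^sup>+x. u (restrict x K) * (\<Prod>i\<in>-K. indicator {0..1} (x i)) \<partial>leb_prod UNIV) = (\<integral>\<^sup>+x. u x \<partial>leb_prod K)"
proof -
  have U: "K \<union> -K = UNIV" by auto
  have [measurable]: "(\<lambda>x. restrict x K) \<in> measurable (leb_prod UNIV) (leb_prod K)"
    by (rule measurable_restrict_subset) auto
  have "(\<integral>\<^sup>+x. u (restrict x K) * (\<Prod>i\<in>-K. indicator {0..1} (x i)) \<partial>leb_prod (K \<union> -K))
    = (\<integral>\<^sup>+x. (\<integral>\<^sup>+z. u (restrict (merge K (-K) (x, z)) K) * (\<Prod>i\<in>-K. indicator {0..1} (merge K (-K) (x, z) i)) \<partial>leb_prod (-K)) \<partial>leb_prod K)"
    by (rule leb_prod.product_nn_integral_fold) (auto simp: U)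
  also have "\<dots> = (\<integral>\<^sup>+x. (\<integral>\<^sup>+z. u x * (\<Prod>i\<in>-K. indicator {0..1} (z i)) \<partial>leb_prod (-K)) \<partial>leb_prod K)"
    by (intro nn_integral_cong arg_cong2[where f="(*)"] prod.cong arg_cong[where f=u])
       (auto simp: space_PiM merge_def fun_eq_iff PiE_iff extensional_def)
  also have "\<dots> = (\<integral>\<^sup>+x. u x * (\<integral>\<^sup>+z. (\<Prod>i\<in>-K. indicator {0..1} (z i)) \<partial>leb_prod (-K)) \<partial>leb_prod K)"
    by (intro nn_integral_cong nn_integral_cmult) measurable
  also have "(\<integral>\<^sup>+z. (\<Prod>i\<in>-K. indicator {0..1} (z i)) \<partial>leb_prod (-K)) = (\<Prod>i\<in>-K. \<integral>\<^sup>+x. indicator {0..1::real} x \<partial>lborel)"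
    by (rule leb_prod.product_nn_integral_prod) auto
  also have "\<dots> = 1" by simp
  finally show ?thesis by (simp only: U mult_1_right)
qed

lemma nn_integral_leb_prod_matrix:
  fixes K :: "'n::finite set"
  assumes "det (block_matrix K S) \<noteq> 0" and g[measurable]: "g \<in> borel_measurable (leb_prod K)"
  shows "ennreal \<bar>det (block_matrix K S)\<bar> * (\<integral>\<^sup>+x. g (\<lambda>i\<in>K. \<Sum>j\<in>K. S (i, j) * x j) \<partial>leb_prod K)
    = (\<integral>\<^sup>+x. g x \<partial>leb_prod K)"
proof -
  let ?M = "block_matrix K S"
  let ?a = "\<lambda>x. \<lambda>i\<in>K. \<Sum>j\<in>K. S (i, j) * x j"
  let ?d = "\<lambda>x. (\<Prod>i\<in>-K. indicator {0..1::real} (x i)) :: ennreal"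
  have [measurable]: "?a \<in> measurable (leb_prod K) (leb_prod K)"
    by (intro measurable_restrict) measurable
  have [measurable]: "(\<lambda>x. restrict x K) \<in> measurable (leb_prod UNIV) (leb_prod K)"
    by (rule measurable_restrict_subset) auto
  have act: "(\<Sum>j\<in>UNIV. ?M $ i $ j * x j) = (if i \<in> K then \<Sum>j\<in>K. S (i, j) * x j else x i)" for i and x :: "'n \<Rightarrow> real"
  proof (cases "i \<in> K")
    case True
    then have "(\<Sum>j\<in>UNIV. ?M $ i $ j * x j) = (\<Sum>j\<in>UNIV. if j \<in> K then S (i, j) * x j else 0)"
      by (intro sum.cong) (auto simp: block_matrix_def)
    with True show ?thesis by (simp add: sum.If_cases)
  next
    case False
    then have "(\<Sum>j\<in>UNIV. ?M $ i $ j * x j) = (\<Sum>j\<in>UNIV. if j = i then x j else 0)"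
      by (intro sum.cong) (auto simp: block_matrix_def)
    with False show ?thesis by simp
  qed
  have "(\<integral>\<^sup>+x. g x \<partial>leb_prod K) = (\<integral>\<^sup>+x. g (restrict x K) * ?d x \<partial>leb_prod UNIV)"
    by (rule nn_integral_leb_prod_pad[symmetric]) measurable
  also have "\<dots> = ennreal \<bar>det ?M\<bar> * (\<integral>\<^sup>+x. (\<lambda>x. g (restrict x K) * ?d x) (\<lambda>i. \<Sum>j\<in>UNIV. ?M $ i $ j * x j) \<partial>leb_prod UNIV)"
    by (rule nn_integral_leb_prod_matrix_UNIV[symmetric]) (use assms in measurable)
  also have "(\<integral>\<^sup>+x. (\<lambda>x. g (restrict x K) * ?d x) (\<lambda>i. \<Sum>j\<in>UNIV. ?M $ i $ j * x j) \<partial>leb_prod UNIV)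
     = (\<integral>\<^sup>+x. g (?a (restrict x K)) * ?d x \<partial>leb_prod UNIV)"
    by (intro nn_integral_cong arg_cong2[where f="(*)"] prod.cong arg_cong[where f=g])
       (auto simp: act intro!: restrict_ext)
  also have "\<dots> = (\<integral>\<^sup>+x. g (?a x) \<partial>leb_prod K)"
    by (rule nn_integral_leb_prod_pad) measurable
  finally show ?thesis by simp
qed

text \<open>The columns are independent blocks of coordinates, so by Fubini \<open>t\<close> can be
  undone one column at a time, each at the price of one factor \<open>c\<close>.\<close>

lemma nn_integral_leb_prod_columns:
  fixes t :: "('i \<Rightarrow> real) \<Rightarrow> 'i \<Rightarrow> real" and R :: "'r set"
  assumes K: "finite K" and R: "finite R"
    and t[measurable]: "t \<in> measurable (leb_prod K) (leb_prod K)"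
    and c: "\<And>g. g \<in> borel_measurable (leb_prod K) \<Longrightarrow> c * (\<integral>\<^sup>+y. g (t y) \<partial>leb_prod K) = (\<integral>\<^sup>+y. g y \<partial>leb_prod K)"
    and g: "g \<in> borel_measurable (leb_prod (K \<times> R))"
  shows "c ^ card R * (\<integral>\<^sup>+X. g (\<lambda>p\<in>K \<times> R. t (\<lambda>i\<in>K. X (i, snd p)) (fst p)) \<partial>leb_prod (K \<times> R))
     = (\<integral>\<^sup>+X. g X \<partial>leb_prod (K \<times> R))"
  using R g
proof (induction R arbitrary: g rule: finite_induct)
  case empty
  then show ?case by (simp add: PiM_empty nn_integral_count_space_finite)
next
  case (insert r R)
  let ?T = "\<lambda>R X. \<lambda>p\<in>K \<times> R. t (\<lambda>i\<in>K. X (i, snd p)) (fst p)"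
  note [measurable] = insert.prems
  have U: "K \<times> insert r R = K \<times> R \<union> K \<times> {r}" by auto
  have col: "(\<lambda>X. t (\<lambda>i\<in>K. X (i, q)) j) \<in> borel_measurable (leb_prod (K \<times> R))" if "q \<in> R" "j \<in> K" for q j R
  proof -
    have [measurable]: "(\<lambda>X. \<lambda>i\<in>K. X (i, q)) \<in> measurable (leb_prod (K \<times> R)) (leb_prod K)"
      using that by (intro measurable_restrict) auto
    have "(\<lambda>X. t (\<lambda>i\<in>K. X (i, q)) j) \<in> measurable (leb_prod (K \<times> R)) lborel"
      by (rule measurable_compose[OF measurable_compose[OF _ t] measurable_component_singleton[OF that(2)]]) measurable
    then show ?thesis by simp
  qed
  have T: "?T R \<in> measurable (leb_prod (K \<times> R)) (leb_prod (K \<times> R))" for R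
    by (intro measurable_restrict) (auto intro!: col)
  note [measurable] = T[of R] T[of "{r}"] T[of "insert r R"]
  have disj: "K \<times> R \<inter> K \<times> {r} = {}" "finite (K \<times> R)" "finite (K \<times> {r})"
    using insert.hyps K by auto
  \<comment> \<open>Acting on all columns commutes with splitting off the column
    \<open>r\<close>.\<close>
  have mT: "?T (insert r R) (merge (K \<times> R) (K \<times> {r}) (X, Z)) = merge (K \<times> R) (K \<times> {r}) (?T R X, ?T {r} Z)" for X Z
  proof (rule ext, clarify)
    fix i q
    define M where "M = merge (K \<times> R) (K \<times> {r}) (X, Z)"
    have M: "M (j, q) = (if j \<in> K \<and> q \<in> R then X (j, q) else if j \<in> K \<and> q = r then Z (j, q) else undefined)" for j q
      by (auto simp: M_def merge_def)
    have MX: "(\<lambda>i\<in>K. M (i, q)) = (\<lambda>i\<in>K. X (i, q))" if "q \<in> R"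
      using that by (auto simp: M)
    have MZ: "(\<lambda>i\<in>K. M (i, r)) = (\<lambda>i\<in>K. Z (i, r))"
      using insert.hyps by (auto simp: M)
    consider "i \<in> K" "q = r" | "i \<in> K" "q \<in> R" "q \<noteq> r" | "i \<notin> K \<or> (q \<noteq> r \<and> q \<notin> R)" by blast
    then show "?T (insert r R) (merge (K \<times> R) (K \<times> {r}) (X, Z)) (i, q) = merge (K \<times> R) (K \<times> {r}) (?T R X, ?T {r} Z) (i, q)"
      unfolding M_def[symmetric]
    proof cases
      case 1
      have "?T (insert r R) M (i, q) = t (\<lambda>i\<in>K. M (i, r)) i" using 1 by simp
      with 1 show "?T (insert r R) M (i, q) = merge (K \<times> R) (K \<times> {r}) (?T R X, ?T {r} Z) (i, q)"
        unfolding MZ using insert.hyps by (simp add: merge_def)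
    next
      case 2
      have "?T (insert r R) M (i, q) = t (\<lambda>i\<in>K. M (i, q)) i" using 2 by simp
      with 2 show "?T (insert r R) M (i, q) = merge (K \<times> R) (K \<times> {r}) (?T R X, ?T {r} Z) (i, q)"
        unfolding MX[OF 2(2)] by (simp add: merge_def)
    next
      case 3
      then show "?T (insert r R) M (i, q) = merge (K \<times> R) (K \<times> {r}) (?T R X, ?T {r} Z) (i, q)"
        by (auto simp: merge_def)
    qed
  qed
  \<comment> \<open>A single column is the hypothesis on \<open>t\<close>, after renaming
    \<open>(i, r)\<close> to \<open>i\<close>.\<close>
  have one: "c * (\<integral>\<^sup>+Z. u (?T {r} Z) \<partial>leb_prod (K \<times> {r})) = (\<integral>\<^sup>+Z. u Z \<partial>leb_prod (K \<times> {r}))"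
    if [measurable]: "u \<in> borel_measurable (leb_prod (K \<times> {r}))" for u
  proof -
    have b: "bij_betw fst (K \<times> {r}) K" by (auto simp: bij_betw_def inj_on_def image_def)
    let ?e = "\<lambda>y. \<lambda>p\<in>K \<times> {r}. y (fst p)"
    have [measurable]: "?e \<in> measurable (leb_prod K) (leb_prod (K \<times> {r}))"
      by (intro measurable_restrict) auto
    have re: "(\<integral>\<^sup>+y. h (?e y) \<partial>leb_prod K) = (\<integral>\<^sup>+Z. h Z \<partial>leb_prod (K \<times> {r}))"
      if "h \<in> borel_measurable (leb_prod (K \<times> {r}))" for h
      by (rule nn_integral_leb_prod_reindex[OF b]) (use that K in auto)
    have Te: "?T {r} (?e y) = ?e (t y)" if "y \<in> space (leb_prod K)" for y
    proof -
      have "(\<lambda>i\<in>K. ?e y (i, r)) = y" using that by (auto simp: space_PiM PiE_def extensional_def)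
      moreover have "?T {r} (?e y) = (\<lambda>p\<in>K \<times> {r}. t (\<lambda>i\<in>K. ?e y (i, r)) (fst p))"
        by (intro restrict_ext, elim SigmaE) (simp only: fst_conv snd_conv singleton_iff)
      ultimately show ?thesis by simp
    qed
    have "c * (\<integral>\<^sup>+Z. u (?T {r} Z) \<partial>leb_prod (K \<times> {r})) = c * (\<integral>\<^sup>+y. u (?T {r} (?e y)) \<partial>leb_prod K)"
      by (subst re[symmetric]) auto
    also have "\<dots> = c * (\<integral>\<^sup>+y. (\<lambda>y. u (?e y)) (t y) \<partial>leb_prod K)"
      by (intro arg_cong2[where f="(*)"] nn_integral_cong) (simp_all only: Te)
    also have "\<dots> = (\<integral>\<^sup>+y. u (?e y) \<partial>leb_prod K)"
      by (rule c) measurable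
    also have "\<dots> = (\<integral>\<^sup>+Z. u Z \<partial>leb_prod (K \<times> {r}))" by (rule re) measurable
    finally show ?thesis .
  qed
  define G where "G X = (\<integral>\<^sup>+Z. g (merge (K \<times> R) (K \<times> {r}) (X, Z)) \<partial>leb_prod (K \<times> {r}))" for X
  have gU[measurable]: "g \<in> borel_measurable (leb_prod (K \<times> R \<union> K \<times> {r}))"
    using insert.prems unfolding U .
  interpret S: sigma_finite_measure "leb_prod (K \<times> {r})" by (rule sigma_finite_leb_prod) fact
  have [measurable]: "G \<in> borel_measurable (leb_prod (K \<times> R))"
    unfolding G_def by measurable
  have TU: "?T (insert r R) \<in> measurable (leb_prod (K \<times> R \<union> K \<times> {r})) (leb_prod (K \<times> R \<union> K \<times> {r}))"
    using T[of "insert r R"] by (simp only: U)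
  have "(\<integral>\<^sup>+X. g (?T (insert r R) X) \<partial>leb_prod (K \<times> insert r R))
      = (\<integral>\<^sup>+X. (\<integral>\<^sup>+Z. g (?T (insert r R) (merge (K \<times> R) (K \<times> {r}) (X, Z))) \<partial>leb_prod (K \<times> {r})) \<partial>leb_prod (K \<times> R))"
    using leb_prod.product_nn_integral_fold[OF disj measurable_compose[OF TU gU]] by (simp only: U)
  then have "c ^ card (insert r R) * (\<integral>\<^sup>+X. g (?T (insert r R) X) \<partial>leb_prod (K \<times> insert r R))
      = c ^ card R * (c * (\<integral>\<^sup>+X. (\<integral>\<^sup>+Z. g (merge (K \<times> R) (K \<times> {r}) (?T R X, ?T {r} Z)) \<partial>leb_prod (K \<times> {r})) \<partial>leb_prod (K \<times> R)))"
    using insert.hyps by (simp only: mT) (simp add: mult_ac)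
  also have "c * (\<integral>\<^sup>+X. (\<integral>\<^sup>+Z. g (merge (K \<times> R) (K \<times> {r}) (?T R X, ?T {r} Z)) \<partial>leb_prod (K \<times> {r})) \<partial>leb_prod (K \<times> R))
      = (\<integral>\<^sup>+X. c * (\<integral>\<^sup>+Z. g (merge (K \<times> R) (K \<times> {r}) (?T R X, ?T {r} Z)) \<partial>leb_prod (K \<times> {r})) \<partial>leb_prod (K \<times> R))"
    by (subst nn_integral_cmult) measurable
  also have "\<dots> = (\<integral>\<^sup>+X. G (?T R X) \<partial>leb_prod (K \<times> R))"
    unfolding G_def
  proof (rule nn_integral_cong)
    fix X assume "X \<in> space (leb_prod (K \<times> R))"
    then have X': "?T R X \<in> space (leb_prod (K \<times> R))" by (rule measurable_space[OF T])
    show "c * (\<integral>\<^sup>+Z. g (merge (K \<times> R) (K \<times> {r}) (?T R X, ?T {r} Z)) \<partial>leb_prod (K \<times> {r}))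
      = (\<integral>\<^sup>+Z. g (merge (K \<times> R) (K \<times> {r}) (?T R X, Z)) \<partial>leb_prod (K \<times> {r}))"
      by (rule one) (use X' in measurable)
  qed
  also have "c ^ card R * \<dots> = (\<integral>\<^sup>+X. G X \<partial>leb_prod (K \<times> R))"
    by (rule insert.IH) measurable
  also have "\<dots> = (\<integral>\<^sup>+X. g X \<partial>leb_prod (K \<times> insert r R))"
    unfolding G_def using leb_prod.product_nn_integral_fold[OF disj gU] by (simp only: U)
  finally show ?case .
qed

lemma lborel_eq_distr_vec: "(lborel :: (real^'n) measure) = distr (leb_prod UNIV) borel (\<lambda>x. \<chi> i. x i)"
proof -
  have b: "bij_betw (\<lambda>i::'n. axis i (1::real)) UNIV Basis"
    by (auto simp: bij_betw_def inj_on_def Basis_vec_def axis_eq_axis)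
  have v: "(\<Sum>b\<in>Basis. f b *\<^sub>R b) = (\<chi> i. f (axis i 1))" for f :: "real^'n \<Rightarrow> real"
  proof -
    have "(\<Sum>b\<in>Basis. f b *\<^sub>R b) = (\<Sum>i\<in>UNIV. f (axis i 1) *\<^sub>R axis (i::'n) 1)"
      by (rule sum.reindex_bij_betw[OF b, symmetric])
    then show ?thesis
      by (simp add: vec_eq_iff axis_def if_distrib cong: if_cong)
  qed
  have [measurable]: "(\<lambda>x. \<chi> i. x i) \<in> borel_measurable (leb_prod (UNIV::'n set))"
    by (subst borel_measurable_euclidean_space) (auto simp: Basis_vec_def inner_axis)
  have [measurable]: "(\<lambda>x. \<lambda>i. x (axis i 1)) \<in> measurable (leb_prod (Basis::(real^'n) set)) (leb_prod UNIV)"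
  proof (rule measurable_PiM_single')
    fix i :: 'n
    have "axis i (1::real) \<in> Basis" by (auto simp: Basis_vec_def)
    then show "(\<lambda>x. (\<lambda>i. x (axis i 1)) i) \<in> measurable (leb_prod (Basis::(real^'n) set)) lborel"
      by measurable
  qed auto
  have r: "distr (leb_prod (Basis :: (real^'n) set)) (leb_prod UNIV) (\<lambda>x. \<lambda>i\<in>UNIV. x (axis i 1)) = leb_prod (UNIV :: 'n set)"
    by (rule leb_prod_reindex[OF b]) simp
  have "distr (leb_prod UNIV) borel (\<lambda>x. \<chi> i::'n. x i)
      = distr (distr (leb_prod (Basis :: (real^'n) set)) (leb_prod UNIV) (\<lambda>x. \<lambda>i\<in>UNIV. x (axis i 1))) borel (\<lambda>x. \<chi> i. x i)"
    by (simp only: r)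
  also have "\<dots> = distr (leb_prod (Basis :: (real^'n) set)) borel (\<lambda>x. \<chi> i. x (axis i 1))"
    by (subst distr_distr) (auto simp: restrict_UNIV comp_def)
  also have "\<dots> = lborel"
    by (subst lborel_eq) (simp add: v)
  finally show ?thesis ..
qed

lemma vec_lambda_measurable_leb_prod [measurable]:
  "(\<lambda>x. \<chi> i. x i) \<in> borel_measurable (leb_prod (UNIV::'n::finite set))"
  by (subst borel_measurable_euclidean_space) (auto simp: Basis_vec_def inner_axis)

lemma nn_integral_lborel_vec:
  fixes f :: "real^'n \<Rightarrow> ennreal"
  assumes [measurable]: "f \<in> borel_measurable borel"
  shows "(\<integral>\<^sup>+x. f x \<partial>lborel) = (\<integral>\<^sup>+x. f (\<chi> i. x i) \<partial>leb_prod UNIV)"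
  by (subst lborel_eq_distr_vec, subst nn_integral_distr) auto

lemma distr_inversion_real:
  "distr (density lborel (\<lambda>s::real. ennreal (inverse (s\<^sup>2)))) borel (\<lambda>s. 1 / s) = lborel"
proof (rule lborel_eqI[symmetric])
  fix l u :: real assume lu: "\<And>b. b \<in> Basis \<Longrightarrow> l \<bullet> b \<le> u \<bullet> b"
  then have lu: "l \<le> u" by auto
  let ?f = "indicator {l<..<u} :: real \<Rightarrow> real"
  have img: "(\<lambda>s::real. 1 / s) ` (UNIV - {0}) = UNIV - {0}"
  proof -
    have "x \<in> (\<lambda>s. 1 / s) ` (UNIV - {0})" if "x \<noteq> 0" for x :: real
      using that by (intro image_eqI[of _ _ "1 / x"]) auto
    then show ?thesis by auto
  qed
  have "?f absolutely_integrable_on UNIV" "integral UNIV ?f = u - l"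
    using lu lmeasure_integral_UNIV[of "{l<..<u}"]
    by (auto simp: set_integrable_def lmeasurable_iff_integrable[symmetric])
  \<comment> \<open>The substitution is made on the line without 0, where the inversion is a
    diffeomorphism onto itself.\<close>
  moreover have "negligible {x. x = 0 \<and> ?f x \<noteq> 0}"
    by (rule negligible_subset[OF negligible_sing[of 0]]) auto
  ultimately have "?f absolutely_integrable_on (UNIV - {0})" "integral (UNIV - {0}) ?f = u - l"
    using absolutely_integrable_spike_set_eq[of UNIV "UNIV - {0}" ?f] integral_spike_set[of UNIV "UNIV - {0}" ?f]
    by auto
  then have "?f absolutely_integrable_on (\<lambda>s. 1 / s) ` (UNIV - {0}) \<and> integral ((\<lambda>s. 1 / s) ` (UNIV - {0})) ?f = u - l"
    by (simp only: img)
  then have *: "(\<lambda>x. \<bar>- (1 / x\<^sup>2)\<bar> * ?f (1 / x)) absolutely_integrable_on (UNIV - {0}) \<and>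
      integral (UNIV - {0}) (\<lambda>x. \<bar>- (1 / x\<^sup>2)\<bar> * ?f (1 / x)) = u - l"
    by (subst has_absolute_integral_change_of_variables_1')
       (auto intro!: derivative_eq_intros simp: inj_on_def power2_eq_square)
  then have "((\<lambda>x. \<bar>- (1 / x\<^sup>2)\<bar> * ?f (1 / x)) has_integral (u - l)) (UNIV - {0})"
    using absolutely_integrable_on_def integrable_integral by metis
  then have "((\<lambda>x. if x \<in> UNIV - {0} then \<bar>- (1 / x\<^sup>2)\<bar> * ?f (1 / x) else 0) has_integral (u - l)) UNIV"
    by (simp only: has_integral_restrict_UNIV)
  moreover have "(\<lambda>x. if x \<in> UNIV - {0} then \<bar>- (1 / x\<^sup>2)\<bar> * ?f (1 / x) else 0) = (\<lambda>x. \<bar>- (1 / x\<^sup>2)\<bar> * ?f (1 / x))"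
    by auto
  ultimately have "((\<lambda>x. \<bar>- (1 / x\<^sup>2)\<bar> * ?f (1 / x)) has_integral (u - l)) UNIV" by simp
  then have "(\<integral>\<^sup>+x. ennreal (\<bar>- (1 / x\<^sup>2)\<bar> * ?f (1 / x)) \<partial>lborel) = ennreal (u - l)"
    by (rule nn_integral_has_integral_lborel[rotated 2]) auto
  moreover have "emeasure (distr (density lborel (\<lambda>s::real. ennreal (inverse (s\<^sup>2)))) borel (\<lambda>s. 1 / s)) (box l u)
     = (\<integral>\<^sup>+x. ennreal (\<bar>- (1 / x\<^sup>2)\<bar> * ?f (1 / x)) \<partial>lborel)"
  proof -
    have m: "(\<lambda>s::real. 1 / s) -` box l u \<in> sets lborel"
      using measurable_sets[of "\<lambda>s::real. 1 / s" borel borel "box l u"] by simp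
    have "emeasure (distr (density lborel (\<lambda>s::real. ennreal (inverse (s\<^sup>2)))) borel (\<lambda>s. 1 / s)) (box l u)
       = emeasure (density lborel (\<lambda>s::real. ennreal (inverse (s\<^sup>2)))) ((\<lambda>s::real. 1 / s) -` box l u)"
      by (subst emeasure_distr) auto
    also have "\<dots> = (\<integral>\<^sup>+s. ennreal (inverse (s\<^sup>2)) * indicator ((\<lambda>s::real. 1 / s) -` box l u) s \<partial>lborel)"
      by (rule emeasure_density[OF _ m]) simp
    also have "\<dots> = (\<integral>\<^sup>+x. ennreal (\<bar>- (1 / x\<^sup>2)\<bar> * ?f (1 / x)) \<partial>lborel)"
      by (auto simp: divide_inverse box_real intro!: nn_integral_cong split: split_indicator)
    finally show ?thesis .
  qed
  ultimately show "emeasure (distr (density lborel (\<lambda>s::real. ennreal (inverse (s\<^sup>2)))) borel (\<lambda>s. 1 / s)) (box l u)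
     = ennreal (\<Prod>b\<in>Basis. (u - l) \<bullet> b)"
    by simp
qed simp

lemma nn_integral_inversion_real:
  fixes G :: "real \<Rightarrow> ennreal"
  assumes [measurable]: "G \<in> borel_measurable borel"
  shows "(\<integral>\<^sup>+s. ennreal (inverse (s\<^sup>2)) * G (1 / s) \<partial>lborel) = (\<integral>\<^sup>+s. G s \<partial>lborel)"
  by (subst (2) distr_inversion_real[symmetric], subst nn_integral_distr, simp, simp, subst nn_integral_density) auto

text \<open>In homogeneous coordinates [1 : y] this exchanges the entry 1 with the entry
  \<open>y e\<close>.\<close>

definition projective_inversion :: "'i set \<Rightarrow> 'i \<Rightarrow> ('i \<Rightarrow> real) \<Rightarrow> 'i \<Rightarrow> real" where
  "projective_inversion K e y = (\<lambda>i\<in>K. if i = e then 1 / y e else y i / y e)"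

lemma projective_inversion_measurable [measurable]:
  assumes "e \<in> K"
  shows "projective_inversion K e \<in> measurable (leb_prod K) (leb_prod K)"
  unfolding projective_inversion_def using assms by (intro measurable_restrict) measurable

text \<open>The inversion of the coordinate s = \<open>y e\<close> costs s^-2 and the division of
  the other card K - 1 coordinates by s costs |s|^-(card K - 1), which together make the exponent
  card K + 1.\<close>

lemma nn_integral_projective_inversion:
  assumes K: "finite K" "e \<in> K" and [measurable]: "g \<in> borel_measurable (leb_prod K)"
  shows "(\<integral>\<^sup>+y. ennreal (inverse (\<bar>y e\<bar> ^ (card K + 1))) * g (projective_inversion K e y) \<partial>leb_prod K)
    = (\<integral>\<^sup>+y. g y \<partial>leb_prod K)"
proof -
  define I where "I = K - {e}"
  have I: "finite I" "e \<notin> I" and KI: "K = insert e I" using K by (auto simp: I_def)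
  have gI[measurable]: "g \<in> borel_measurable (leb_prod (insert e I))" using assms KI by simp
  have [measurable]: "(\<lambda>(x,y). g (x(e := y))) \<in> borel_measurable (leb_prod I \<Otimes>\<^sub>M lborel)"
    using measurable_comp[OF measurable_add_dim gI] by (simp add: comp_def split_def)
  have [measurable]: "projective_inversion (insert e I) e \<in> measurable (leb_prod (insert e I)) (leb_prod (insert e I))"
    by (rule projective_inversion_measurable) simp
  interpret S: sigma_finite_measure "leb_prod I" by (rule sigma_finite_leb_prod) fact
  define G where "G s = (\<integral>\<^sup>+x. g (x(e := s)) \<partial>leb_prod I)" for s
  have [measurable]: "G \<in> borel_measurable borel"
    unfolding G_def by measurable
  have pu: "projective_inversion (insert e I) e (x(e := s)) = (\<lambda>i\<in>I. (1/s) * x i)(e := 1/s)" for x s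
    using I by (auto simp: projective_inversion_def fun_eq_iff)
  have "(\<integral>\<^sup>+y. ennreal (inverse (\<bar>y e\<bar> ^ (card K + 1))) * g (projective_inversion K e y) \<partial>leb_prod K)
     = (\<integral>\<^sup>+s. (\<integral>\<^sup>+x. ennreal (inverse (\<bar>s\<bar> ^ (card K + 1))) * g ((\<lambda>i\<in>I. (1/s) * x i)(e := 1/s)) \<partial>leb_prod I) \<partial>lborel)"
    unfolding KI by (subst leb_prod.product_nn_integral_insert_rev[OF I]) (measurable, simp only: pu fun_upd_same)
  also have "\<dots> = (\<integral>\<^sup>+s. ennreal (inverse (s\<^sup>2)) * G (1 / s) \<partial>lborel)"
  proof (rule nn_integral_cong)
    fix s :: real
    let ?u = "\<lambda>x. g (x(e := 1/s))"
    have [measurable]: "?u \<in> borel_measurable (leb_prod I)"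
      by measurable
    show "(\<integral>\<^sup>+x. ennreal (inverse (\<bar>s\<bar> ^ (card K + 1))) * g ((\<lambda>i\<in>I. (1/s) * x i)(e := 1/s)) \<partial>leb_prod I)
      = ennreal (inverse (s\<^sup>2)) * G (1 / s)"
    proof (cases "s = 0")
      \<comment> \<open>At s = 0 both weights are the inverse of 0, hence 0.\<close>
      case True
      then show ?thesis by (simp add: KI)
    next
      case False
      have [measurable]: "(\<lambda>x. \<lambda>i\<in>I. (1/s) * x i) \<in> measurable (leb_prod I) (leb_prod I)"
        by (intro measurable_restrict) measurable
      have "G (1/s) = ennreal (\<Prod>i\<in>I. \<bar>1/s\<bar>) * (\<integral>\<^sup>+x. ?u (\<lambda>i\<in>I. (1/s) * x i) \<partial>leb_prod I)"
        unfolding G_def by (rule nn_integral_leb_prod_scale[symmetric]) (use I False in auto)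
      also have "ennreal (inverse (s\<^sup>2)) * \<dots> = ennreal (inverse (s\<^sup>2) * \<bar>1/s\<bar> ^ card I) * (\<integral>\<^sup>+x. ?u (\<lambda>i\<in>I. (1/s) * x i) \<partial>leb_prod I)"
        by (simp add: ennreal_mult mult.assoc)
      also have "inverse (s\<^sup>2) * \<bar>1/s\<bar> ^ card I = inverse (\<bar>s\<bar> ^ (card K + 1))"
      proof -
        have "s\<^sup>2 = \<bar>s\<bar>\<^sup>2" "card K + 1 = 2 + card I" using I by (simp_all add: KI)
        then show ?thesis by (simp only: power_add) (simp add: power_divide divide_inverse power_inverse)
      qed
      finally have "ennreal (inverse (s\<^sup>2)) * G (1 / s) = ennreal (inverse (\<bar>s\<bar> ^ (card K + 1))) * (\<integral>\<^sup>+x. ?u (\<lambda>i\<in>I. (1/s) * x i) \<partial>leb_prod I)" .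
      moreover have m: "(\<lambda>x. ?u (\<lambda>i\<in>I. (1/s) * x i)) \<in> borel_measurable (leb_prod I)"
        by (rule measurable_compose[of _ _ _ ?u]) measurable
      ultimately show ?thesis by (simp only: nn_integral_cmult[OF m])
    qed
  qed
  also have "\<dots> = (\<integral>\<^sup>+s. G s \<partial>lborel)"
    by (rule nn_integral_inversion_real) measurable
  also have "\<dots> = (\<integral>\<^sup>+y. g y \<partial>leb_prod K)"
    unfolding G_def KI by (rule leb_prod.product_nn_integral_insert_rev[OF I, symmetric]) measurable
  finally show ?thesis .
qed

section \<open>Orthogonal projection onto affine subspaces\<close>

lemma closest_point_affine_in:
  fixes P :: "'a::euclidean_space set"
  assumes "affine P" "P \<noteq> {}"
  shows "closest_point P z \<in> P"
  using assms by (simp add: affine_closed closest_point_in_set)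

lemma closest_point_affine_orth:
  fixes P :: "'a::euclidean_space set"
  assumes "affine P" "x \<in> P"
  shows "(z - closest_point P z) \<bullet> (x - closest_point P z) = 0"
proof -
  let ?c = "closest_point P z"
  have c: "?c \<in> P" using assms closest_point_affine_in by blast
  have cv: "convex P" "closed P" using assms by (auto simp: affine_imp_convex affine_closed)
  \<comment> \<open>The reflection of x in the projection also lies in the affine set, so the
    variational inequality holds with both signs.\<close>
  have "2 *\<^sub>R ?c - x \<in> P"
    using mem_affine[OF assms(1) c assms(2), of 2 "-1"] by simp
  from closest_point_dot[OF cv this, of z] have "(z - ?c) \<bullet> (?c - x) \<le> 0"
    by (simp add: scaleR_2)
  moreover have "(z - ?c) \<bullet> (x - ?c) \<le> 0" by (rule closest_point_dot[OF cv assms(2)])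
  ultimately show ?thesis by (simp add: inner_diff_right)
qed

lemma closest_point_affine_unique:
  fixes P :: "'a::euclidean_space set"
  assumes P: "affine P" "c \<in> P" and orth: "\<And>x. x \<in> P \<Longrightarrow> (z - c) \<bullet> (x - c) = 0"
  shows "closest_point P z = c"
proof -
  let ?c = "closest_point P z"
  have c: "?c \<in> P" using P closest_point_affine_in by blast
  have "(z - c) \<bullet> (?c - c) = 0" "(z - ?c) \<bullet> (c - ?c) = 0"
    using orth[OF c] closest_point_affine_orth[OF P] by auto
  then have "(?c - c) \<bullet> (?c - c) = 0" by (simp add: inner_diff_left inner_diff_right inner_commute)
  then show ?thesis by simp
qed

lemma infdist_affine:
  fixes P :: "'a::euclidean_space set"
  assumes "affine P" "P \<noteq> {}"
  shows "infdist z P = norm (z - closest_point P z)"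
  using setdist_closest_point[OF affine_closed[OF assms(1)] assms(2), of z]
  by (simp add: infdist_eq_setdist dist_norm)

text \<open>Polarization of the quadratic function \<open>infdist\<^sup>2\<close>: this makes the projection a measurable
  function of the plane as soon as the distance is.\<close>

lemma closest_point_affine_eq_infdist:
  fixes P :: "'a::euclidean_space set"
  assumes P: "affine P" "P \<noteq> {}"
  shows "closest_point P z = z - (\<Sum>b\<in>Basis. (((infdist (z + b) P)\<^sup>2 - (infdist (z - b) P)\<^sup>2) / 4) *\<^sub>R b)"
proof -
  let ?c = "closest_point P"
  have "(infdist (z + b) P)\<^sup>2 - (infdist (z - b) P)\<^sup>2 = 4 * ((z - ?c z) \<bullet> b)" for b
  proof -
    have in': "?c w \<in> P" for w using P closest_point_affine_in by blast
    \<comment> \<open>Projection is an affine map, and z is the midpoint of z + b and z - b.\<close>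
    have mid: "?c z = (1/2) *\<^sub>R ?c (z + b) + (1/2) *\<^sub>R ?c (z - b)" (is "_ = ?m")
    proof (rule closest_point_affine_unique)
      show "?m \<in> P" using mem_affine[OF P(1) in' in', of "1/2" "1/2"] by simp
      fix x assume x: "x \<in> P"
      have y: "(z + b - ?c (z + b)) \<bullet> (y - w) = 0" "(z - b - ?c (z - b)) \<bullet> (y - w) = 0" if "y \<in> P" "w \<in> P" for y w
        using closest_point_affine_orth[OF P(1) that(1), of "z + b"] closest_point_affine_orth[OF P(1) that(2), of "z + b"]
          closest_point_affine_orth[OF P(1) that(1), of "z - b"] closest_point_affine_orth[OF P(1) that(2), of "z - b"]
        by (simp_all add: inner_diff_right)
      have "z - ?m = (1/2) *\<^sub>R (z + b - ?c (z + b)) + (1/2) *\<^sub>R (z - b - ?c (z - b))"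
        by (simp add: algebra_simps flip: scaleR_add_left)
      with y[OF x \<open>?m \<in> P\<close>] show "(z - ?m) \<bullet> (x - ?m) = 0"
        by (simp only: inner_add_left inner_scaleR_left)
    qed (rule P)
    let ?p = "z + b - ?c (z + b)" and ?q = "z - b - ?c (z - b)"
    have "(z - ?c z) \<bullet> (?c (z + b) - ?c (z - b)) = 0"
      using closest_point_affine_orth[OF P(1) in', of z "z + b"] closest_point_affine_orth[OF P(1) in', of z "z - b"]
      by (simp add: inner_diff_right)
    moreover have "?p + ?q = 2 *\<^sub>R (z - ?c z)"
      unfolding mid by (simp add: algebra_simps scaleR_2)
    moreover have "?p - ?q = 2 *\<^sub>R b - (?c (z + b) - ?c (z - b))" by (simp add: scaleR_2)
    ultimately have "(?p + ?q) \<bullet> (?p - ?q) = 4 * ((z - ?c z) \<bullet> b)"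
      by (simp add: inner_diff_right)
    moreover have "(p + q) \<bullet> (p - q) = (norm p)\<^sup>2 - (norm q)\<^sup>2" for p q :: 'a
      by (simp add: power2_norm_eq_inner inner_add_left inner_add_right inner_diff_left inner_diff_right inner_commute)
    note this[of ?p ?q]
    ultimately show ?thesis by (simp add: infdist_affine[OF P])
  qed
  then show ?thesis by (simp add: euclidean_representation)
qed

section \<open>Measurable dependence on a plane\<close>

lemma space_plane_algebra [simp]: "space (plane_algebra G) = G"
  unfolding plane_algebra_def by (intro space_measure_of) auto

lemma plane_algebra_hitting [measurable]:
  "open U \<Longrightarrow> {P \<in> G. P \<inter> U \<noteq> {}} \<in> sets (plane_algebra G)"
  unfolding plane_algebra_def by (subst sets_measure_of) auto

lemma measurable_plane_algebra:
  assumes "\<And>\<omega>. \<omega> \<in> space N \<Longrightarrow> f \<omega> \<in> G"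
    and "\<And>U. open U \<Longrightarrow> {\<omega> \<in> space N. f \<omega> \<inter> U \<noteq> {}} \<in> sets N"
  shows "f \<in> measurable N (plane_algebra G)"
  unfolding plane_algebra_def
proof (rule measurable_measure_of)
  show "f \<in> space N \<rightarrow> G" using assms by auto
  fix A assume "A \<in> {{P \<in> G. P \<inter> U \<noteq> {}} |U. open U}"
  then obtain U where U: "open U" "A = {P \<in> G. P \<inter> U \<noteq> {}}" by auto
  have "f -` A \<inter> space N = {\<omega> \<in> space N. f \<omega> \<inter> U \<noteq> {}}" using assms(1) U by auto
  then show "f -` A \<inter> space N \<in> sets N" using assms(2)[OF U(1)] by simp
qed auto

text \<open>A set meets an open set as soon as a dense sequence of its points does, so countably
  many measurable selections decide every generator of the sigma-algebra.\<close>

lemma measurable_plane_algebra_selections: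
  fixes f :: "'b \<Rightarrow> 'a::euclidean_space set"
  assumes f: "\<And>\<omega>. \<omega> \<in> space N \<Longrightarrow> f \<omega> \<in> G"
    and p: "\<And>n::nat. p n \<in> borel_measurable N" "\<And>n \<omega>. \<omega> \<in> space N \<Longrightarrow> p n \<omega> \<in> f \<omega>"
    and dense: "\<And>\<omega>. \<omega> \<in> space N \<Longrightarrow> f \<omega> \<subseteq> closure (range (\<lambda>n. p n \<omega>))"
  shows "f \<in> measurable N (plane_algebra G)"
proof (rule measurable_plane_algebra)
  show "f \<omega> \<in> G" if "\<omega> \<in> space N" for \<omega> by (rule f[OF that])
  fix U :: "'a set" assume U: "open U"
  have "{\<omega> \<in> space N. f \<omega> \<inter> U \<noteq> {}} = (\<Union>n. {\<omega> \<in> space N. p n \<omega> \<in> U})"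
  proof (intro equalityI subsetI)
    fix \<omega> assume "\<omega> \<in> {\<omega> \<in> space N. f \<omega> \<inter> U \<noteq> {}}"
    then obtain x where \<omega>: "\<omega> \<in> space N" and x: "x \<in> f \<omega>" "x \<in> U" by auto
    have "closure (range (\<lambda>n. p n \<omega>)) \<inter> U \<noteq> {}" using dense[OF \<omega>] x by auto
    then have "range (\<lambda>n. p n \<omega>) \<inter> U \<noteq> {}" using U open_Int_closure_eq_empty by blast
    then show "\<omega> \<in> (\<Union>n. {\<omega> \<in> space N. p n \<omega> \<in> U})" using \<omega> by auto
  qed (use p in auto)
  also have "\<dots> \<in> sets N" 
    using measurable_sets[OF p(1) borel_open[OF U]]
    by (intro sets.countable_UN) (auto simp: vimage_def Int_def conj_commute)
  finally show "{\<omega> \<in> space N. f \<omega> \<inter> U \<noteq> {}} \<in> sets N" .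
qed

definition dense_seq :: "nat \<Rightarrow> 'a::euclidean_space" where
  "dense_seq = (SOME q. \<forall>U. open U \<longrightarrow> U \<noteq> {} \<longrightarrow> (\<exists>n. q n \<in> U))"

lemma dense_seq: "open U \<Longrightarrow> U \<noteq> {} \<Longrightarrow> \<exists>n. dense_seq n \<in> (U :: 'a::euclidean_space set)"
proof -
  obtain D :: "'a set" where D: "countable D" "\<And>X. open X \<Longrightarrow> X \<noteq> {} \<Longrightarrow> \<exists>d \<in> D. d \<in> X"
    by (rule countable_dense_setE) blast
  have "D \<noteq> {}" using D(2)[of UNIV] by auto
  then have "range (from_nat_into D) = D" by (rule range_from_nat_into[OF _ D(1)])
  then have "\<forall>U. open U \<longrightarrow> U \<noteq> {} \<longrightarrow> (\<exists>n. from_nat_into D n \<in> U)" using D(2) by (metis rangeE)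
  then have "\<forall>U. open U \<longrightarrow> U \<noteq> {} \<longrightarrow> (\<exists>n. dense_seq n \<in> (U::'a set))"
    unfolding dense_seq_def by (intro someI_ex[of "\<lambda>q. \<forall>U. open U \<longrightarrow> U \<noteq> {} \<longrightarrow> (\<exists>n. q n \<in> U)"]) blast
  then show "open U \<Longrightarrow> U \<noteq> {} \<Longrightarrow> \<exists>n. dense_seq n \<in> U" by blast
qed

lemma closure_range_dense_seq: "closure (range (dense_seq :: nat \<Rightarrow> 'a::euclidean_space)) = UNIV"
proof -
  have "x \<in> closure (range dense_seq)" for x :: 'a
    unfolding closure_approachable using dense_seq[of "ball x e" for e] by (force simp: dist_commute)
  then show ?thesis by auto
qed

lemma image_subset_closure_dense_seq:
  fixes f :: "'a::euclidean_space \<Rightarrow> 'b::topological_space"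
  assumes "continuous_on UNIV f"
  shows "range f \<subseteq> closure (range (\<lambda>n. f (dense_seq n)))"
proof -
  have "f ` closure (range dense_seq) \<subseteq> closure (range (\<lambda>n. f (dense_seq n)))"
    by (rule image_closure_subset) (auto intro!: continuous_on_subset[OF assms] subsetD[OF closure_subset])
  then show ?thesis by (simp add: closure_range_dense_seq)
qed

text \<open>The distance is below r exactly when some small ball around a point of the dense
  sequence, of rational radius, meets the plane and is close enough to z. This is a countable union
  of measurable rectangles, hence joint measurability.\<close>

lemma measurable_infdist_plane:
  assumes G: "\<And>P. P \<in> G \<Longrightarrow> affine P \<and> P \<noteq> {}"
  shows "(\<lambda>(P, z). infdist z P) \<in> borel_measurable (plane_algebra G \<Otimes>\<^sub>M (borel :: 'a::euclidean_space measure))"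
proof (rule borel_measurable_iff_less[THEN iffD2], rule allI)
  fix r :: real
  let ?M = "plane_algebra G \<Otimes>\<^sub>M (borel :: 'a::euclidean_space measure)"
  let ?A = "\<lambda>n s. {P \<in> G. P \<inter> ball (dense_seq n) s \<noteq> {}} \<times> {z. dist z (dense_seq n) + s < r}"
  have "{w \<in> space ?M. (case w of (P, z) \<Rightarrow> infdist z P) < r} = (\<Union>n. \<Union>s\<in>{s\<in>\<rat>. 0 < s}. ?A n s)"
  proof safe
    fix P and z :: 'a assume "(P, z) \<in> space ?M" and less: "infdist z P < r"
    then have P: "P \<in> G" by (simp add: space_pair_measure)
    obtain x where x: "x \<in> P" "infdist z P = dist z x"
      using infdist_attains_inf[of P z] G[OF P] affine_closed by blast
    define e where "e = (r - dist z x) / 3"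
    have e: "0 < e" using less x by (simp add: e_def)
    then obtain s where s: "s \<in> \<rat>" "0 < s" "s < e" using Rats_dense_in_real by blast
    obtain n where n: "dense_seq n \<in> ball x s" using dense_seq[of "ball x s"] s by auto
    have "dist z (dense_seq n) \<le> dist z x + dist x (dense_seq n)" by (rule dist_triangle)
    also have "\<dots> < dist z x + s" using n by simp
    finally have "dist z (dense_seq n) + s < dist z x + 2 * e" using s by simp
    also have "\<dots> < r" using less x by (simp add: e_def field_simps)
    finally have "dist z (dense_seq n) + s < r" .
    moreover have "x \<in> P \<inter> ball (dense_seq n) s" using x n by (simp add: dist_commute)
    ultimately have "(P, z) \<in> ?A n s" using P by auto
    then show "(P, z) \<in> (\<Union>n. \<Union>s\<in>{s\<in>\<rat>. 0 < s}. ?A n s)" using s by blast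
  next
    fix n s P and z x :: 'a assume "P \<in> G" "x \<in> P" "x \<in> ball (dense_seq n) s" "dist z (dense_seq n) + s < r"
    then show "infdist z P < r"
      using infdist_le[of x P z] dist_triangle[of z x "dense_seq n"] by (simp add: dist_commute)
  qed (auto simp: space_pair_measure)
  also have "\<dots> \<in> sets ?M"
    by (intro sets.countable_UN' sets.countable_UN pair_measureI countable_subset[OF _ countable_rat])
       (auto intro!: plane_algebra_hitting sets.countable_UN' countable_subset[OF _ countable_rat] pair_measureI)
  finally show "{w \<in> space ?M. (case w of (P, z) \<Rightarrow> infdist z P) < r} \<in> sets ?M" .
qed

lemma measurable_infdist_plane' [measurable (raw)]:
  assumes "\<And>P. P \<in> G \<Longrightarrow> affine P \<and> P \<noteq> {}" "f \<in> measurable N (plane_algebra G)" "g \<in> borel_measurable N"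
  shows "(\<lambda>\<omega>. infdist (g \<omega> :: 'a::euclidean_space) (f \<omega>)) \<in> borel_measurable N"
  using measurable_compose[OF measurable_Pair[OF assms(2,3)] measurable_infdist_plane[of G]] assms(1) by simp

lemma measurable_closest_point_plane:
  fixes g :: "'b \<Rightarrow> 'a::euclidean_space"
  assumes G: "\<And>P. P \<in> G \<Longrightarrow> affine P \<and> P \<noteq> {}" and f: "f \<in> measurable N (plane_algebra G)" and g: "g \<in> borel_measurable N"
  shows "(\<lambda>\<omega>. closest_point (f \<omega>) (g \<omega>)) \<in> borel_measurable N"
proof -
  have "f \<omega> \<in> G" if "\<omega> \<in> space N" for \<omega>
    using measurable_space[OF f that] by simp
  then have eq: "closest_point (f \<omega>) (g \<omega>) = g \<omega> - (\<Sum>b\<in>Basis. (((infdist (g \<omega> + b) (f \<omega>))\<^sup>2 - (infdist (g \<omega> - b) (f \<omega>))\<^sup>2) / 4) *\<^sub>R b)"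
    if "\<omega> \<in> space N" for \<omega> using G that by (intro closest_point_affine_eq_infdist) auto
  have "(\<lambda>\<omega>. g \<omega> - (\<Sum>b\<in>Basis. (((infdist (g \<omega> + b) (f \<omega>))\<^sup>2 - (infdist (g \<omega> - b) (f \<omega>))\<^sup>2) / 4) *\<^sub>R b)) \<in> borel_measurable N"
    using g by (intro borel_measurable_diff borel_measurable_sum borel_measurable_scaleR borel_measurable_divide borel_measurable_power
       measurable_infdist_plane'[OF G f] borel_measurable_add) auto
  then show ?thesis by (subst measurable_cong[OF eq])
qed

text \<open>The projection is continuous and fixes the plane. The projected dense sequence supplies
  the measurable selections for planes that depend on a parameter.\<close>

lemma closest_point_dense_seq:
  assumes "affine P" "(P :: 'a::euclidean_space set) \<noteq> {}"
  shows "P \<subseteq> closure (range (\<lambda>n. closest_point P (dense_seq n)))"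
proof -
  have "x \<in> range (closest_point P)" if "x \<in> P" for x
    using closest_point_self[OF that] by (metis rangeI)
  then show ?thesis
    using image_subset_closure_dense_seq[OF continuous_on_closest_point, of P] assms
    by (auto simp: affine_imp_convex affine_closed)
qed

lemma affine_planes_affine: "P \<in> affine_planes k \<Longrightarrow> affine P \<and> P \<noteq> {}"
  by (auto simp: affine_planes_def)

lemma linear_planes_affine: "P \<in> linear_planes k \<Longrightarrow> affine P \<and> P \<noteq> {}"
  by (auto simp: linear_planes_def affine_planes_def)

lemma linear_planes_iff: "P \<in> linear_planes k \<longleftrightarrow> subspace P \<and> dim P = k"
proof
  assume "P \<in> linear_planes k"
  then have "subspace P" "aff_dim P = int k"
    by (auto simp: linear_planes_def affine_planes_def subspace_affine)
  then show "subspace P \<and> dim P = k" by (simp add: aff_dim_subspace)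
next
  assume *: "subspace P \<and> dim P = k"
  then have "aff_dim P = int k" using aff_dim_subspace by blast
  then show "P \<in> linear_planes k" using * 
    by (auto simp: linear_planes_def affine_planes_def subspace_affine)
qed

lemma affine_planes_translate: "P \<in> linear_planes k \<Longrightarrow> (+) v ` P \<in> affine_planes k"
  by (auto simp: linear_planes_def affine_planes_def affine_translation[symmetric] aff_dim_translation_eq)

section \<open>Coordinate subspaces and orthonormal frames\<close>

definition coord_vec :: "'n set \<Rightarrow> ('n \<Rightarrow> real) \<Rightarrow> real^'n" where
  "coord_vec K y = (\<chi> i. if i \<in> K then y i else 0)"

lemma coord_vec_nth [simp]: "coord_vec K y $ i = (if i \<in> K then y i else 0)"
  by (simp add: coord_vec_def)

definition coord_plane :: "'n set \<Rightarrow> (real^'n) set" where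
  "coord_plane K = {v. \<forall>i. i \<notin> K \<longrightarrow> v $ i = 0}"

lemma range_coord_vec: "range (coord_vec K) = coord_plane K"
proof -
  have "v = coord_vec K (\<lambda>i. v $ i)" if "v \<in> coord_plane K" for v
    using that by (auto simp: coord_plane_def vec_eq_iff)
  then show ?thesis by (auto simp: coord_plane_def)
qed

text \<open>Complete \<open>B\<close> by an orthonormal basis of its orthogonal complement and let
  \<open>T\<close> send the standard basis to the result, the axes in \<open>K\<close> going to
  \<open>B\<close>.\<close>

lemma orthonormal_frame:
  fixes B :: "(real^'n) set"
  assumes B: "pairwise orthogonal B" "\<And>b. b \<in> B \<Longrightarrow> norm b = 1" and K: "card B = card (K :: 'n set)"
  shows "\<exists>T \<beta>. orthogonal_transformation T \<and> bij_betw \<beta> K B \<and> (\<forall>y. T (coord_vec K y) = (\<Sum>i\<in>K. y i *\<^sub>R \<beta> i))"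
proof -
  have "0 \<notin> B" using B(2) by force
  then have iB: "independent B" using B(1) pairwise_orthogonal_independent by blast
  obtain C where C: "C \<subseteq> (span B)\<^sup>\<bottom>" "pairwise orthogonal C" "\<And>x. x \<in> C \<Longrightarrow> norm x = 1" "independent C" "span C = (span B)\<^sup>\<bottom>"
    by (rule orthonormal_basis_subspace[OF subspace_orthogonal_comp[of "span B"]]) blast
  have BC: "b \<bullet> c = 0" if "b \<in> B" "c \<in> C" for b c
    using that C(1) span_base[of b B] by (auto simp: orthogonal_comp_def orthogonal_def)
  have disj: "B \<inter> C = {}" using BC B(2) by (metis disjoint_iff inner_eq_zero_iff norm_zero zero_neq_one)
  have po: "pairwise orthogonal (B \<union> C)"
    using B(1) C(2) BC inner_commute unfolding pairwise_def orthogonal_def by (smt (verit) Un_iff)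
  have n1: "norm b = 1" if "b \<in> B \<union> C" for b using that B C by auto
  have "0 \<notin> B \<union> C" using n1 by force
  then have iBC: "independent (B \<union> C)" using po pairwise_orthogonal_independent by blast
  have "x \<in> span (B \<union> C)" for x
  proof -
    have "x \<in> span B + (span B)\<^sup>\<bottom>" using subspace_sum_orthogonal_comp[of "span B"] by simp
    then obtain u v where "x = u + v" "u \<in> span B" "v \<in> span C" using C by (auto elim: set_plus_elim)
    then show ?thesis using span_mono[of B "B \<union> C"] span_mono[of C "B \<union> C"] by (auto intro: span_add)
  qed
  then have sp: "span (B \<union> C) = UNIV" by auto
  have fin: "finite (B \<union> C)" using iBC independent_bound by blast
  have "card (B \<union> C) = dim (UNIV :: (real^'n) set)" using iBC sp by (metis dim_eq_card_independent dim_span)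
  then have "card B + card C = CARD('n)" using disj fin by (simp add: card_Un_disjoint)
  moreover have "card K + card (-K) = CARD('n)" by (metis Compl_partition Compl_disjoint card_Un_disjoint finite)
  ultimately have cC: "card C = card (-K)" using K by simp
  obtain f where f: "bij_betw f K B" using finite_same_card_bij[of K B] fin K by auto
  obtain g where g: "bij_betw g (-K) C" using finite_same_card_bij[of "-K" C] fin cC by auto
  define \<beta> where "\<beta> i = (if i \<in> K then f i else g i)" for i
  have \<beta>K: "bij_betw \<beta> K B" using f by (simp add: \<beta>_def cong: bij_betw_cong)
  have "bij_betw \<beta> (-K) C"
    by (rule bij_betw_cong[THEN iffD1, OF _ g]) (auto simp: \<beta>_def)
  then have \<beta>: "bij_betw \<beta> UNIV (B \<union> C)" using bij_betw_combine[OF \<beta>K _ disj, of "-K"] by (simp add: Compl_partition)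
  have orth: "\<beta> i \<bullet> \<beta> j = of_bool (i = j)" for i j
  proof (cases "i = j")
    case True
    then show ?thesis using n1[of "\<beta> i"] \<beta> by (auto simp: bij_betw_def norm_eq_1)
  next
    case False
    then have "\<beta> i \<noteq> \<beta> j" "\<beta> i \<in> B \<union> C" "\<beta> j \<in> B \<union> C" using \<beta> by (auto simp: bij_betw_def inj_on_def)
    then show ?thesis using po False by (auto simp: pairwise_def orthogonal_def)
  qed
  define T where "T v = (\<Sum>i\<in>UNIV. v $ i *\<^sub>R \<beta> i)" for v :: "real^'n"
  have "linear T" unfolding T_def
    by (intro linearI) (simp_all add: sum.distrib scaleR_add_left scaleR_right.sum)
  moreover have "T v \<bullet> T w = v \<bullet> w" for v w
  proof -
    have "T v \<bullet> T w = (\<Sum>i\<in>UNIV. v $ i * (\<Sum>j\<in>UNIV. w $ j * of_bool (i = j)))"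
      unfolding T_def by (simp add: inner_sum_left inner_sum_right orth sum_distrib_left, simp add: mult.commute)
    also have "\<dots> = (\<Sum>i\<in>UNIV. v $ i * w $ i)" by (intro sum.cong) simp_all
    finally show ?thesis by (simp add: inner_vec_def)
  qed
  ultimately have "orthogonal_transformation T" by (simp add: orthogonal_transformation_def)
  moreover have "T (coord_vec K y) = (\<Sum>i\<in>K. y i *\<^sub>R \<beta> i)" for y
  proof -
    have "T (coord_vec K y) = (\<Sum>i\<in>UNIV. if i \<in> K then y i *\<^sub>R \<beta> i else 0)"
      unfolding T_def by (intro sum.cong) auto
    then show ?thesis by (simp add: sum.If_cases)
  qed
  ultimately show ?thesis using \<beta>K by blast
qed

lemma orthonormal_basis_of_coord:
  fixes V :: "(real^'n) set"
  assumes "orthonormal_basis_of V B" "dim V = card (K :: 'n::finite set)"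
  shows "\<exists>T \<beta>. orthogonal_transformation T \<and> bij_betw \<beta> K B \<and> (\<forall>y. T (coord_vec K y) = (\<Sum>i\<in>K. y i *\<^sub>R \<beta> i))
     \<and> T ` coord_plane K = V"
proof -
  have po: "pairwise orthogonal B" and n: "\<And>b. b \<in> B \<Longrightarrow> norm b = 1" and sp: "span B = V"
    using assms(1) by (auto simp: orthonormal_basis_of_def)
  have "0 \<notin> B" using n by force
  then have iB: "independent B" using po pairwise_orthogonal_independent by blast
  then have "card B = card K" using sp assms(2) by (metis dim_eq_card_independent dim_span)
  then obtain T \<beta> where T: "orthogonal_transformation T" "bij_betw \<beta> K B" "\<And>y. T (coord_vec K y) = (\<Sum>i\<in>K. y i *\<^sub>R \<beta> i)"
    using orthonormal_frame[of B K] po n by auto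
  have fB: "finite B" using iB independent_bound by blast
  have "T ` coord_plane K = range (\<lambda>y. \<Sum>i\<in>K. y i *\<^sub>R \<beta> i)"
    unfolding range_coord_vec[symmetric] by (auto simp: T image_image)
  also have "\<dots> = range (\<lambda>u. \<Sum>b\<in>B. u b *\<^sub>R b)"
  proof safe
    fix y :: "'n \<Rightarrow> real"
    have "(\<Sum>i\<in>K. y i *\<^sub>R \<beta> i) = (\<Sum>b\<in>B. y (the_inv_into K \<beta> b) *\<^sub>R b)"
    proof -
      have "(\<Sum>b\<in>B. y (the_inv_into K \<beta> b) *\<^sub>R b) = (\<Sum>i\<in>K. y (the_inv_into K \<beta> (\<beta> i)) *\<^sub>R \<beta> i)"
        by (rule sum.reindex_bij_betw[OF T(2), symmetric])
      then show ?thesis using T(2) by (simp add: bij_betw_def the_inv_into_f_f)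
    qed
    then show "(\<Sum>i\<in>K. y i *\<^sub>R \<beta> i) \<in> range (\<lambda>u. \<Sum>b\<in>B. u b *\<^sub>R b)" by auto
  next
    fix u
    have "(\<Sum>b\<in>B. u b *\<^sub>R b) = (\<Sum>i\<in>K. u (\<beta> i) *\<^sub>R \<beta> i)"
      by (rule sum.reindex_bij_betw[OF T(2), symmetric])
    then show "(\<Sum>b\<in>B. u b *\<^sub>R b) \<in> range (\<lambda>y. \<Sum>i\<in>K. y i *\<^sub>R \<beta> i)" by auto
  qed
  also have "\<dots> = span B" by (rule span_finite[OF fB, symmetric])
  finally show ?thesis using T sp by blast
qed

lemma orthonormal_basis_of_exists: "subspace V \<Longrightarrow> \<exists>B. orthonormal_basis_of V B"
  unfolding orthonormal_basis_of_def by (metis orthonormal_basis_subspace)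

lemma dim_coord_plane: "dim (coord_plane K :: (real^'n) set) = card K"
proof -
  let ?B = "(\<lambda>i. axis i 1) ` K :: (real^'n) set"
  have "inj_on (\<lambda>i. axis i (1::real)) K" by (auto simp: inj_on_def axis_eq_axis)
  then have c: "card ?B = card K" by (rule card_image)
  have po: "pairwise orthogonal ?B" by (auto simp: pairwise_def orthogonal_def inner_axis_axis)
  have n: "norm b = 1" if "b \<in> ?B" for b using that by auto
  have "0 \<notin> ?B" using n by force
  then have i: "independent ?B" using po pairwise_orthogonal_independent by blast
  have "coord_plane K = span ?B"
  proof (intro equalityI subsetI)
    fix v :: "real^'n" assume v: "v \<in> coord_plane K"
    have "v = (\<Sum>i\<in>UNIV. v $ i *\<^sub>R axis i 1)" by (simp add: vec_eq_iff axis_def if_distrib cong: if_cong)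
    also have "\<dots> = (\<Sum>i\<in>K. v $ i *\<^sub>R axis i 1)"
      using v by (intro sum.mono_neutral_right) (auto simp: coord_plane_def)
    also have "\<dots> \<in> span ?B" by (intro span_sum span_scale span_base) auto
    finally show "v \<in> span ?B" .
  next
    have "subspace (coord_plane K :: (real^'n) set)" by (auto simp: coord_plane_def subspace_def)
    moreover have "?B \<subseteq> coord_plane K" by (auto simp: coord_plane_def axis_def)
    ultimately have "span ?B \<subseteq> coord_plane K" by (simp add: span_minimal)
    then show "v \<in> span ?B \<Longrightarrow> v \<in> coord_plane K" for v by auto
  qed
  then show ?thesis using i c by (metis dim_eq_card_independent dim_span)
qed

lemma subspace_coord_plane: "subspace (coord_plane K)"
  by (auto simp: coord_plane_def subspace_def)

text \<open>Both subspaces are rotated copies of the same coordinate subspace. Transitivity of the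
  rotations is what pins down the invariant measure.\<close>

lemma orthogonal_transformation_transitive:
  fixes V W :: "(real^'n) set"
  assumes "subspace V" "subspace W" "dim V = dim W"
  shows "\<exists>T. orthogonal_transformation T \<and> T ` V = W"
proof -
  have "dim V \<le> CARD('n)" using dim_subset_UNIV[of V] by simp
  then obtain K :: "'n set" where K: "card K = dim V"
    using obtain_subset_with_card_n[of "dim V" "UNIV :: 'n set"] by auto
  obtain S T where S: "orthogonal_transformation S" "S ` coord_plane K = V" and T: "orthogonal_transformation T" "T ` coord_plane K = W"
    using orthonormal_basis_of_coord[of V _ K] orthonormal_basis_of_coord[of W _ K] orthonormal_basis_of_exists assms K by metis
  have "(T \<circ> inv S) ` V = W"
    using S T by (metis image_comp image_inv_f_f orthogonal_transformation_inj)
  then show ?thesis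
    using orthogonal_transformation_compose[OF T(1) orthogonal_transformation_inv[OF S(1)]] by blast
qed

section \<open>Lebesgue measure of the ambient space in rotated and split coordinates\<close>

lemma nn_integral_lborel_matrix:
  fixes M :: "real^'n^'n" and h :: "real^'n \<Rightarrow> ennreal"
  assumes M: "det M \<noteq> 0" and [measurable]: "h \<in> borel_measurable borel"
  shows "ennreal \<bar>det M\<bar> * (\<integral>\<^sup>+v. h (M *v v) \<partial>lborel) = (\<integral>\<^sup>+v. h v \<partial>lborel)"
proof -
  have [measurable]: "(\<lambda>v. M *v v) \<in> borel_measurable borel"
    by (intro borel_measurable_continuous_onI matrix_vector_mult_linear_continuous_on)
  have "(\<integral>\<^sup>+v. h (M *v v) \<partial>lborel) = (\<integral>\<^sup>+x. h (\<chi> i. (\<Sum>j\<in>UNIV. M $ i $ j * x j)) \<partial>leb_prod UNIV)"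
    by (subst nn_integral_lborel_vec, measurable) (simp add: matrix_vector_mult_def)
  then show ?thesis
    using nn_integral_leb_prod_matrix_UNIV[OF M, of "\<lambda>x. h (\<chi> i. x i)"] by (simp add: nn_integral_lborel_vec)
qed

lemma nn_integral_lborel_orthogonal:
  fixes h :: "real^'n \<Rightarrow> ennreal" and T :: "real^'n \<Rightarrow> real^'n"
  assumes T: "orthogonal_transformation T" and h: "h \<in> borel_measurable borel"
  shows "(\<integral>\<^sup>+v. h (p + T v) \<partial>lborel) = (\<integral>\<^sup>+v. h v \<partial>lborel)"
proof -
  have "orthogonal_matrix (matrix T)" "linear T" using T by (auto simp: orthogonal_transformation_matrix)
  then have d: "\<bar>det (matrix T)\<bar> = 1" using det_orthogonal_matrix by fastforce
  then have "det (matrix T) \<noteq> 0" by auto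
  from nn_integral_lborel_matrix[OF this, of "\<lambda>v. h (p + v)"] have "(\<integral>\<^sup>+v. h (p + T v) \<partial>lborel) = (\<integral>\<^sup>+v. h (p + v) \<partial>lborel)"
    using h \<open>linear T\<close> d by (simp add: matrix_works)
  also have "\<dots> = (\<integral>\<^sup>+v. h v \<partial>lborel)"
    using h by (subst (2) lborel_affine[of 1 p]) (auto simp: nn_integral_density nn_integral_distr)
  finally show ?thesis .
qed

lemma coord_vec_measurable:
  assumes "K \<subseteq> I"
  shows "coord_vec K \<in> borel_measurable (leb_prod (I :: 'n::finite set))"
proof -
  have "(\<lambda>x. if i \<in> K then x i else 0) \<in> borel_measurable (leb_prod I)" for i
  proof (cases "i \<in> K")
    case True
    then have "i \<in> I" using assms by auto
    then show ?thesis using True by simp measurable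
  qed simp
  then show ?thesis
    unfolding coord_vec_def by (subst borel_measurable_euclidean_space) (auto simp: Basis_vec_def inner_axis)
qed

lemma coord_vec_measurable_same [measurable]:
  "coord_vec K \<in> borel_measurable (leb_prod (K :: 'n::finite set))"
  by (rule coord_vec_measurable) simp

lemma nn_integral_lborel_split:
  fixes h :: "real^'n \<Rightarrow> ennreal"
  assumes [measurable]: "h \<in> borel_measurable borel"
  shows "(\<integral>\<^sup>+v. h v \<partial>lborel) = (\<integral>\<^sup>+y. (\<integral>\<^sup>+z. h (coord_vec K y + coord_vec (-K) z) \<partial>leb_prod (-K)) \<partial>leb_prod K)"
proof -
  have U: "K \<union> -K = UNIV" by auto
  have "(\<integral>\<^sup>+v. h v \<partial>lborel) = (\<integral>\<^sup>+x. h (\<chi> i. x i) \<partial>leb_prod (K \<union> -K))"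
    unfolding U by (rule nn_integral_lborel_vec) measurable
  also have "\<dots> = (\<integral>\<^sup>+y. (\<integral>\<^sup>+z. h (\<chi> i. merge K (-K) (y, z) i) \<partial>leb_prod (-K)) \<partial>leb_prod K)"
    by (rule leb_prod.product_nn_integral_fold) (auto simp: U)
  also have "\<dots> = (\<integral>\<^sup>+y. (\<integral>\<^sup>+z. h (coord_vec K y + coord_vec (-K) z) \<partial>leb_prod (-K)) \<partial>leb_prod K)"
    by (intro nn_integral_cong arg_cong[where f=h]) (auto simp: vec_eq_iff merge_def)
  finally show ?thesis .
qed

text \<open>The volume of the unit ball in dimension card K. It serves as a normalising factor, and
  only its being positive and finite is used.\<close>

definition coord_ball_volume :: "'n::finite set \<Rightarrow> ennreal" where
  "coord_ball_volume K = emeasure (leb_prod K) {y \<in> space (leb_prod K). norm (coord_vec K y) \<le> 1}"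

lemma nn_integral_coord_ball:
  "(\<integral>\<^sup>+y. indicator {v. norm v \<le> 1} (coord_vec K y) \<partial>leb_prod K) = coord_ball_volume K"
proof -
  have "(\<integral>\<^sup>+y. indicator {v. norm v \<le> 1} (coord_vec K y) \<partial>leb_prod K)
     = (\<integral>\<^sup>+y. indicator {y \<in> space (leb_prod K). norm (coord_vec K y) \<le> 1} y \<partial>leb_prod K)"
    by (intro nn_integral_cong) (auto simp: indicator_def)
  also have "\<dots> = coord_ball_volume K"
    unfolding coord_ball_volume_def by (rule nn_integral_indicator) measurable
  finally show ?thesis .
qed

lemma emeasure_leb_prod_box:
  assumes "finite I" "(0::real) \<le> e"
  shows "emeasure (leb_prod I) (Pi\<^sub>E I (\<lambda>_. {-e..e})) = ennreal (2 * e) ^ card I"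
  using assms by (subst leb_prod.emeasure_PiM) auto

lemma coord_ball_volume_finite: "coord_ball_volume (K :: 'n::finite set) < \<infinity>"
proof -
  have "coord_ball_volume K \<le> emeasure (leb_prod K) (Pi\<^sub>E K (\<lambda>_. {-1..1}))"
    unfolding coord_ball_volume_def
  proof (rule emeasure_mono)
    show "{y \<in> space (leb_prod K). norm (coord_vec K y) \<le> 1} \<subseteq> Pi\<^sub>E K (\<lambda>_. {-1..1})"
    proof (intro subsetI, elim CollectE conjE)
      fix y assume y: "y \<in> space (leb_prod K)" "norm (coord_vec K y) \<le> 1"
      have "\<bar>y i\<bar> \<le> 1" if "i \<in> K" for i
        using component_le_norm_cart[of "coord_vec K y" i] that y by simp
      then show "y \<in> Pi\<^sub>E K (\<lambda>_. {-1..1})" using y by (auto simp: space_PiM PiE_iff abs_le_iff)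
    qed
  qed (auto intro!: sets_PiM_I_finite)
  also have "\<dots> < \<infinity>" 
    using emeasure_leb_prod_box[of K 1] by (simp only: ennreal_power) (simp add: ennreal_power)
  finally show ?thesis .
qed

lemma norm_vec_le_card:
  fixes v :: "real^'n"
  assumes "\<And>i. \<bar>v $ i\<bar> \<le> e"
  shows "norm v \<le> real CARD('n) * e"
  using norm_le_l1_cart[of v] sum_mono[of UNIV "\<lambda>i. \<bar>v $ i\<bar>" "\<lambda>_. e"] assms by simp

lemma coord_ball_volume_pos: "0 < coord_ball_volume (K :: 'n::finite set)"
proof -
  define e where "e = 1 / real CARD('n)"
  have e: "0 < e" by (simp add: e_def)
  have "0 < ennreal (2 * e) ^ card K" using e by (simp add: ennreal_power)
  also have "\<dots> = emeasure (leb_prod K) (Pi\<^sub>E K (\<lambda>_. {-e..e}))"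
    using e by (subst emeasure_leb_prod_box) auto
  also have "\<dots> \<le> coord_ball_volume K"
    unfolding coord_ball_volume_def
  proof (rule emeasure_mono)
    show "Pi\<^sub>E K (\<lambda>_. {-e..e}) \<subseteq> {y \<in> space (leb_prod K). norm (coord_vec K y) \<le> 1}"
    proof (intro subsetI CollectI conjI)
      fix y assume y: "y \<in> Pi\<^sub>E K (\<lambda>_. {-e..e})"
      then show "y \<in> space (leb_prod K)" by (auto simp: space_PiM PiE_iff)
      have "\<bar>coord_vec K y $ i\<bar> \<le> e" for i using y e by (auto simp: PiE_iff abs_le_iff)
      from norm_vec_le_card[OF this] show "norm (coord_vec K y) \<le> 1" by (simp add: e_def)
    qed
  qed measurable
  finally show ?thesis .
qed

section \<open>Lebesgue measure on a plane\<close>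

lemma sets_plane_lebesgue [simp, measurable_cong]: "sets (plane_lebesgue P) = sets borel"
  by (simp add: plane_lebesgue_def Let_def)

lemma space_plane_lebesgue [simp]: "space (plane_lebesgue P) = UNIV"
  by (simp add: plane_lebesgue_def Let_def)

text \<open>Whatever orthonormal basis is selected in \<open>plane_lebesgue\<close>, it is the image
  of the axes in \<open>K\<close> under a rotation of the whole space. Changes of variables in the
  ambient space thus become available.\<close>

lemma plane_lebesgue_coord:
  fixes P :: "(real^'n) set" and K :: "'n set"
  assumes P: "P \<in> affine_planes (card K)"
  shows "\<exists>T. orthogonal_transformation T \<and> T ` coord_plane K = (\<lambda>x. x - closest_point P 0) ` P
     \<and> plane_lebesgue P = distr (leb_prod K) borel (\<lambda>y. closest_point P 0 + T (coord_vec K y))"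
proof -
  define p where "p = closest_point P 0"
  have aff: "affine P" "P \<noteq> {}" "aff_dim P = int (card K)" using P by (auto simp: affine_planes_def)
  have p: "p \<in> P" unfolding p_def by (rule closest_point_affine_in) fact+
  let ?V = "(\<lambda>x. x - p) ` P"
  have V: "subspace ?V" by (rule affine_diffs_subspace_subtract) fact+
  have "?V = (+) (-p) ` P" by auto
  then have "aff_dim ?V = aff_dim P" by (simp only: aff_dim_translation_eq)
  then have "int (dim ?V) = int (card K)" using aff(3) aff_dim_subspace[OF V] by (simp only:)
  then have dimV: "dim ?V = card K" by simp
  define B where "B = (SOME B. orthonormal_basis_of ?V B)"
  have B: "orthonormal_basis_of ?V B"
    unfolding B_def by (rule someI_ex) (rule orthonormal_basis_of_exists[OF V])
  obtain T \<beta> where T: "orthogonal_transformation T" "bij_betw \<beta> K B"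
     "\<And>y. T (coord_vec K y) = (\<Sum>i\<in>K. y i *\<^sub>R \<beta> i)" "T ` coord_plane K = ?V"
    using orthonormal_basis_of_coord[OF B dimV] by metis
  have fB: "finite B" using bij_betw_finite[OF T(2)] by simp
  have lin: "linear T" using T(1) by (rule orthogonal_transformation_linear)
  have [measurable]: "T \<in> borel_measurable borel"
    by (intro borel_measurable_continuous_onI linear_continuous_on) (use lin in \<open>simp add: linear_conv_bounded_linear\<close>)
  have mem: "\<beta> i \<in> B" if "i \<in> K" for i using bij_betwE[OF T(2)] that by blast
  have [measurable]: "(\<lambda>x. \<lambda>i\<in>K. x (\<beta> i)) \<in> measurable (leb_prod B) (leb_prod K)"
    by (rule measurable_restrict) (rule measurable_component_singleton[OF mem])
  have eq: "T (coord_vec K (\<lambda>i\<in>K. x (\<beta> i))) = (\<Sum>b\<in>B. x b *\<^sub>R b)" for x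
  proof -
    have "T (coord_vec K (\<lambda>i\<in>K. x (\<beta> i))) = (\<Sum>i\<in>K. x (\<beta> i) *\<^sub>R \<beta> i)" unfolding T(3) by (intro sum.cong) auto
    also have "\<dots> = (\<Sum>b\<in>B. x b *\<^sub>R b)" by (rule sum.reindex_bij_betw[OF T(2)])
    finally show ?thesis .
  qed
  have "plane_lebesgue P = distr (leb_prod B) borel (\<lambda>c. p + (\<Sum>b\<in>B. c b *\<^sub>R b))"
    unfolding plane_lebesgue_def Let_def p_def[symmetric] B_def[symmetric] ..
  also have "\<dots> = distr (distr (leb_prod B) (leb_prod K) (\<lambda>x. \<lambda>i\<in>K. x (\<beta> i))) borel (\<lambda>y. p + T (coord_vec K y))"
    by (subst distr_distr) (auto simp: comp_def eq)
  also have "distr (leb_prod B) (leb_prod K) (\<lambda>x. \<lambda>i\<in>K. x (\<beta> i)) = leb_prod K"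
    by (rule leb_prod_reindex[OF T(2)]) simp
  finally have "plane_lebesgue P = distr (leb_prod K) borel (\<lambda>y. p + T (coord_vec K y))" .
  with T(1,4) show ?thesis unfolding p_def by (intro exI[of _ T] conjI)
qed

text \<open>In the rotated coordinates the projection forgets the coordinates outside
  \<open>K\<close>, which are orthogonal to the plane.\<close>

lemma closest_point_coord:
  fixes P :: "(real^'n) set"
  assumes T: "orthogonal_transformation T" and TP: "T ` coord_plane K = (\<lambda>x. x - p) ` P"
    and P: "affine P" "p \<in> P"
  shows "closest_point P (p + T (coord_vec K y + coord_vec (-K) z)) = p + T (coord_vec K y)"
proof (rule closest_point_affine_unique[OF P(1)])
  have lin: "linear T" using T by (rule orthogonal_transformation_linear)
  have in_P: "p + T (coord_vec K y) \<in> P" for y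
  proof -
    have "T (coord_vec K y) \<in> (\<lambda>x. x - p) ` P" unfolding TP[symmetric] using range_coord_vec[of K] by blast
    then show ?thesis by auto
  qed
  then show "p + T (coord_vec K y) \<in> P" .
  fix x assume x: "x \<in> P"
  then have "x - p \<in> T ` range (coord_vec K)" unfolding TP range_coord_vec by auto
  then obtain w where w: "x - p = T (coord_vec K w)" by auto
  have "x - (p + T (coord_vec K y)) = T (coord_vec K w - coord_vec K y)"
    using w by (simp add: linear_diff[OF lin] diff_diff_eq[symmetric])
  moreover have "p + T (coord_vec K y + coord_vec (-K) z) - (p + T (coord_vec K y)) = T (coord_vec (-K) z)"
    by (simp add: linear_add[OF lin])
  moreover have "coord_vec (-K) z \<bullet> (coord_vec K w - coord_vec K y) = 0"
    unfolding inner_vec_def by (rule sum.neutral) auto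
  ultimately show "(p + T (coord_vec K y + coord_vec (-K) z) - (p + T (coord_vec K y))) \<bullet> (x - (p + T (coord_vec K y))) = 0"
    using T[unfolded orthogonal_transformation_def] by (simp only:)
qed

text \<open>Averaging over the unit neighbourhood of the plane expresses its Lebesgue measure
  without a choice of basis; this is what makes it depend measurably on the plane.\<close>

lemma nn_integral_plane_lebesgue:
  fixes P :: "(real^'n) set" and K :: "'n set"
  assumes P: "P \<in> affine_planes (card K)" and h[measurable]: "h \<in> borel_measurable borel"
  shows "coord_ball_volume (-K) * (\<integral>\<^sup>+x. h x \<partial>plane_lebesgue P)
     = (\<integral>\<^sup>+v. h (closest_point P v) * indicator {v. infdist v P \<le> 1} v \<partial>lborel)"
proof -
  have aff: "affine P" "P \<noteq> {}" using P by (auto simp: affine_planes_def)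
  define p where "p = closest_point P 0"
  have p: "p \<in> P" unfolding p_def by (rule closest_point_affine_in) fact+
  obtain T where T: "orthogonal_transformation T" "T ` coord_plane K = (\<lambda>x. x - p) ` P"
     "plane_lebesgue P = distr (leb_prod K) borel (\<lambda>y. p + T (coord_vec K y))"
    using plane_lebesgue_coord[OF P] unfolding p_def by blast
  have lin: "linear T" using T(1) by (rule orthogonal_transformation_linear)
  have [measurable]: "T \<in> borel_measurable borel"
    by (intro borel_measurable_continuous_onI linear_continuous_on) (use lin in \<open>simp add: linear_conv_bounded_linear\<close>)
  have [measurable]: "closest_point P \<in> borel_measurable borel"
    by (intro borel_measurable_continuous_onI continuous_on_closest_point) (use aff in \<open>auto simp: affine_imp_convex affine_closed\<close>)
  have [measurable]: "(\<lambda>v. infdist v P) \<in> borel_measurable borel"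
    by (intro borel_measurable_continuous_onI continuous_intros)
  define H where "H v = h (closest_point P v) * indicator {v. infdist v P \<le> 1} v" for v
  have [measurable]: "H \<in> borel_measurable borel" unfolding H_def by measurable
  \<comment> \<open>One factor depends only on the position along the plane and the other only on
    the normal part, so the integral over the tube splits.\<close>
  have HT: "H (p + T (coord_vec K y + coord_vec (-K) z)) = h (p + T (coord_vec K y)) * indicator {v. norm v \<le> 1} (coord_vec (-K) z)" for y z
  proof -
    have c: "closest_point P (p + T (coord_vec K y + coord_vec (-K) z)) = p + T (coord_vec K y)"
      by (rule closest_point_coord[OF T(1,2) aff(1) p])
    have "infdist (p + T (coord_vec K y + coord_vec (-K) z)) P = norm (coord_vec (-K) z)"
      unfolding infdist_affine[OF aff] c by (simp add: linear_add[OF lin] orthogonal_transformation_norm[OF T(1)])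
    with c show ?thesis by (simp add: H_def indicator_def)
  qed
  have "(\<integral>\<^sup>+v. H v \<partial>lborel) = (\<integral>\<^sup>+v. H (p + T v) \<partial>lborel)"
    by (rule nn_integral_lborel_orthogonal[OF T(1), symmetric]) measurable
  also have "\<dots> = (\<integral>\<^sup>+y. (\<integral>\<^sup>+z. H (p + T (coord_vec K y + coord_vec (-K) z)) \<partial>leb_prod (-K)) \<partial>leb_prod K)"
    by (rule nn_integral_lborel_split) measurable
  also have "\<dots> = (\<integral>\<^sup>+y. h (p + T (coord_vec K y)) * coord_ball_volume (-K) \<partial>leb_prod K)"
    unfolding HT by (subst nn_integral_cmult) (auto simp: nn_integral_coord_ball)
  also have "\<dots> = coord_ball_volume (-K) * (\<integral>\<^sup>+y. h (p + T (coord_vec K y)) \<partial>leb_prod K)"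
    by (subst nn_integral_multc) (auto simp: mult.commute)
  also have "(\<integral>\<^sup>+y. h (p + T (coord_vec K y)) \<partial>leb_prod K) = (\<integral>\<^sup>+x. h x \<partial>plane_lebesgue P)"
    unfolding T(3) by (subst nn_integral_distr) auto
  finally show ?thesis unfolding H_def ..
qed

section \<open>The measure on affine planes as an image of a product measure\<close>

lemma dim_orthogonal_comp:
  fixes P :: "(real^'n) set"
  assumes "subspace P"
  shows "dim (P\<^sup>\<bottom>) = CARD('n) - dim P"
proof -
  have "dim {y \<in> UNIV. \<forall>x \<in> P. orthogonal x y} + dim P = dim (UNIV :: (real^'n) set)"
    by (rule dim_subspace_orthogonal_to_vectors[OF assms]) auto
  then show ?thesis by (simp add: orthogonal_comp_def)
qed

lemma closest_point_orthogonal_comp: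
  fixes P :: "'a::euclidean_space set"
  assumes P: "subspace P"
  shows "closest_point (P\<^sup>\<bottom>) v = v - closest_point P v"
proof (rule closest_point_affine_unique)
  have aff: "affine P" "P \<noteq> {}" "0 \<in> P" using P subspace_0[OF P] by (auto simp: subspace_imp_affine)
  have c: "closest_point P v \<in> P" by (rule closest_point_affine_in) fact+
  show "affine (P\<^sup>\<bottom>)" by (simp add: subspace_imp_affine subspace_orthogonal_comp)
  have orth: "(v - closest_point P v) \<bullet> x = 0" if "x \<in> P" for x
    using closest_point_affine_orth[OF aff(1) that, of v] closest_point_affine_orth[OF aff(1) aff(3), of v]
    by (simp add: inner_diff_right)
  then show "v - closest_point P v \<in> P\<^sup>\<bottom>"
    by (auto simp: orthogonal_comp_def orthogonal_def inner_commute)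
  fix x assume "x \<in> P\<^sup>\<bottom>"
  then have "x \<bullet> closest_point P v = 0" using c by (auto simp: orthogonal_comp_def orthogonal_def inner_commute)
  then show "(v - (v - closest_point P v)) \<bullet> (x - (v - closest_point P v)) = 0"
    using orth[OF c] by (simp add: inner_diff_right inner_commute)
qed

lemma measurable_translate_plane:
  fixes g :: "'b \<Rightarrow> 'a::euclidean_space"
  assumes f: "f \<in> measurable N (plane_algebra (linear_planes k))" and g: "g \<in> borel_measurable N"
  shows "(\<lambda>\<omega>. (+) (g \<omega>) ` f \<omega>) \<in> measurable N (plane_algebra (affine_planes k))"
proof (rule measurable_plane_algebra_selections[where p="\<lambda>n \<omega>. g \<omega> + closest_point (f \<omega>) (dense_seq n)"])
  have f': "f \<omega> \<in> linear_planes k" if "\<omega> \<in> space N" for \<omega> using measurable_space[OF f that] by simp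
  show "(+) (g \<omega>) ` f \<omega> \<in> affine_planes k" if "\<omega> \<in> space N" for \<omega>
    by (rule affine_planes_translate) (rule f'[OF that])
  show "(\<lambda>\<omega>. g \<omega> + closest_point (f \<omega>) (dense_seq n)) \<in> borel_measurable N" for n
    by (intro borel_measurable_add g measurable_closest_point_plane[OF linear_planes_affine f]) simp_all
  show "g \<omega> + closest_point (f \<omega>) (dense_seq n) \<in> (+) (g \<omega>) ` f \<omega>" if "\<omega> \<in> space N" for n \<omega>
    using closest_point_affine_in[of "f \<omega>"] linear_planes_affine[OF f'[OF that]] by auto
  fix \<omega> assume "\<omega> \<in> space N"
  have "(+) (g \<omega>) ` f \<omega> \<subseteq> (+) (g \<omega>) ` closure (range (\<lambda>n. closest_point (f \<omega>) (dense_seq n)))"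
    using closest_point_dense_seq[of "f \<omega>"] linear_planes_affine[OF f'[OF \<open>\<omega> \<in> space N\<close>]] by blast
  also have "\<dots> = closure ((+) (g \<omega>) ` range (\<lambda>n. closest_point (f \<omega>) (dense_seq n)))"
    by (rule closure_translation[symmetric])
  finally show "(+) (g \<omega>) ` f \<omega> \<subseteq> closure (range (\<lambda>n. g \<omega> + closest_point (f \<omega>) (dense_seq n)))"
    by (simp add: image_image)
qed

lemma ennreal_eq_divideI:
  fixes c :: ennreal
  assumes "c \<noteq> 0" "c \<noteq> \<infinity>" "c * x = y"
  shows "x = y / c"
  unfolding assms(3)[symmetric] using mult_divide_eq_ennreal[of c x] assms(1,2) by (simp add: mult.commute)

lemma ennreal_mult_divide_cancel:
  fixes c :: ennreal
  assumes "c \<noteq> 0" "c \<noteq> \<infinity>"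
  shows "c * (x / c) = x"
  using mult_divide_eq_ennreal[of c x] assms by (simp add: ennreal_times_divide mult.commute)

locale plane_prob =
  fixes \<mu> :: "(real^'n) set measure" and K :: "'n set"
  assumes prob: "prob_space \<mu>" and sets_mu[measurable_cong]: "sets \<mu> = sets (plane_algebra (linear_planes (card K)))"
begin

lemma space_mu: "space \<mu> = linear_planes (card K)"
  using sets_eq_imp_space_eq[OF sets_mu] by simp

text \<open>For fixed P the slab is the orthogonal complement of P times the unit ball of P. It
  trades the measure on the complement, which varies with P, for Lebesgue measure of the ambient
  space.\<close>

definition unit_slab :: "(real^'n) set \<times> (real^'n) \<Rightarrow> ennreal" where
  "unit_slab = (\<lambda>(P, v). indicator {v. norm (closest_point P v) \<le> 1} v)"

lemma measurable_closest_point_pair [measurable]: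
  "(\<lambda>w. closest_point (fst w) (snd w)) \<in> borel_measurable (\<mu> \<Otimes>\<^sub>M borel)"
proof (rule measurable_closest_point_plane[where G="linear_planes (card K)"])
  show "fst \<in> measurable (\<mu> \<Otimes>\<^sub>M borel) (plane_algebra (linear_planes (card K)))"
    using measurable_fst[of \<mu> borel] measurable_cong_sets[OF refl sets_mu] by blast
qed (use linear_planes_affine in auto)

lemma measurable_unit_slab [measurable]: "unit_slab \<in> borel_measurable (\<mu> \<Otimes>\<^sub>M borel)"
  unfolding unit_slab_def split_def indicator_def by measurable

lemma measurable_translate_pair [measurable]:
  "(\<lambda>w. (+) (snd w) ` fst w) \<in> measurable (\<mu> \<Otimes>\<^sub>M borel) (plane_algebra (affine_planes (card K)))"
proof (rule measurable_translate_plane)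
  show "fst \<in> measurable (\<mu> \<Otimes>\<^sub>M borel) (plane_algebra (linear_planes (card K)))"
    using measurable_fst[of \<mu> borel] measurable_cong_sets[OF refl sets_mu] by blast
qed simp

text \<open>This is \<open>nn_integral_plane_lebesgue\<close> for the orthogonal complement of P:
  translating P by v or by the normal part of v gives the same plane, and the distance from v to the
  complement is the norm of the projection of v to P.\<close>

lemma unit_slab_section:
  assumes "P \<in> linear_planes (card K)" and A: "A \<in> sets (plane_algebra (affine_planes (card K)))"
  shows "coord_ball_volume K * emeasure (plane_lebesgue (P\<^sup>\<bottom>)) {x \<in> P\<^sup>\<bottom>. (\<lambda>y. x + y) ` P \<in> A}
     = (\<integral>\<^sup>+v. indicator A ((+) v ` P) * unit_slab (P, v) \<partial>lborel)"
proof -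
  have P: "subspace P" "dim P = card K" using assms(1) by (auto simp: linear_planes_iff)
  have "P\<^sup>\<bottom> \<in> linear_planes (card (-K))"
    unfolding linear_planes_iff
    by (simp add: subspace_orthogonal_comp dim_orthogonal_comp P Compl_eq_Diff_UNIV card_Diff_subset)
  then have Pc: "P\<^sup>\<bottom> \<in> affine_planes (card (-K))" by (auto simp: linear_planes_def)
  have [measurable]: "(\<lambda>x. (+) x ` P) \<in> measurable borel (plane_algebra (affine_planes (card K)))"
    by (rule measurable_translate_plane) (use assms in auto)
  note [measurable] = A
  have cl: "P\<^sup>\<bottom> \<in> sets borel" by (intro borel_closed closed_subspace subspace_orthogonal_comp)
  have S[measurable]: "{x \<in> P\<^sup>\<bottom>. (+) x ` P \<in> A} \<in> sets borel"
  proof -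
    have "(\<lambda>x. (+) x ` P) -` A \<inter> space borel \<in> sets borel" by (rule measurable_sets) measurable
    then have "P\<^sup>\<bottom> \<inter> ((\<lambda>x. (+) x ` P) -` A \<inter> space borel) \<in> sets borel" using cl by (rule sets.Int[rotated])
    also have "P\<^sup>\<bottom> \<inter> ((\<lambda>x. (+) x ` P) -` A \<inter> space borel) = {x \<in> P\<^sup>\<bottom>. (+) x ` P \<in> A}" by auto
    finally show ?thesis .
  qed
  have "coord_ball_volume K * emeasure (plane_lebesgue (P\<^sup>\<bottom>)) {x \<in> P\<^sup>\<bottom>. (+) x ` P \<in> A}
     = coord_ball_volume (- (- K)) * (\<integral>\<^sup>+x. indicator {x \<in> P\<^sup>\<bottom>. (+) x ` P \<in> A} x \<partial>plane_lebesgue (P\<^sup>\<bottom>))"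
    by simp
  also have "\<dots> = (\<integral>\<^sup>+v. indicator {x \<in> P\<^sup>\<bottom>. (+) x ` P \<in> A} (closest_point (P\<^sup>\<bottom>) v) * indicator {v. infdist v (P\<^sup>\<bottom>) \<le> 1} v \<partial>lborel)"
    by (rule nn_integral_plane_lebesgue[OF Pc]) measurable
  also have "\<dots> = (\<integral>\<^sup>+v. indicator A ((+) v ` P) * unit_slab (P, v) \<partial>lborel)"
  proof (rule nn_integral_cong)
    fix v
    have aff: "affine P" "P \<noteq> {}" "affine (P\<^sup>\<bottom>)" "P\<^sup>\<bottom> \<noteq> {}"
      using P subspace_0 subspace_orthogonal_comp[of P] by (auto simp: subspace_imp_affine)
    have c: "closest_point (P\<^sup>\<bottom>) v = v - closest_point P v" by (rule closest_point_orthogonal_comp) fact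
    have cP: "closest_point P v \<in> P" by (rule closest_point_affine_in) fact+
    have "(+) (v - closest_point P v) ` P = (+) v ` (+) (- closest_point P v) ` P"
      by (auto simp: image_image)
    also have "(+) (- closest_point P v) ` P = P"
    proof (intro equalityI subsetI)
      fix y assume "y \<in> P"
      then have "y = - closest_point P v + (y + closest_point P v)" "y + closest_point P v \<in> P"
        using subspace_add[OF P(1) _ cP] by auto
      then show "y \<in> (+) (- closest_point P v) ` P" by (rule image_eqI)
    qed (use subspace_add[OF P(1) subspace_neg[OF P(1) cP]] in auto)
    finally have t: "(+) (v - closest_point P v) ` P = (+) v ` P" .
    have "v - closest_point P v \<in> P\<^sup>\<bottom>" using closest_point_affine_in[OF aff(3,4), of v] c by simp
    moreover have "infdist v (P\<^sup>\<bottom>) = norm (closest_point P v)" unfolding infdist_affine[OF aff(3,4)] c by simp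
    ultimately show "indicator {x \<in> P\<^sup>\<bottom>. (+) x ` P \<in> A} (closest_point (P\<^sup>\<bottom>) v) * indicator {v. infdist v (P\<^sup>\<bottom>) \<le> 1} v
       = indicator A ((+) v ` P) * unit_slab (P, v)"
      by (simp add: c t unit_slab_def indicator_def)
  qed
  finally show ?thesis .
qed

text \<open>A model of \<open>plane_measure\<close> built as an image measure, so that it is
  additive and has an integration formula from the start.\<close>

definition slab_measure :: "(real^'n) set measure" where
  "slab_measure = distr (density (\<mu> \<Otimes>\<^sub>M lborel) (\<lambda>w. unit_slab w / coord_ball_volume K))
     (plane_algebra (affine_planes (card K))) (\<lambda>w. (+) (snd w) ` fst w)"

lemma nn_integral_slab_measure:
  assumes [measurable]: "\<psi> \<in> borel_measurable (plane_algebra (affine_planes (card K)))"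
  shows "coord_ball_volume K * (\<integral>\<^sup>+Q. \<psi> Q \<partial>slab_measure)
    = (\<integral>\<^sup>+P. (\<integral>\<^sup>+v. \<psi> ((+) v ` P) * unit_slab (P, v) \<partial>lborel) \<partial>\<mu>)"
proof -
  interpret prob_space \<mu> by (rule prob)
  interpret pair_sigma_finite \<mu> lborel ..
  have cv: "coord_ball_volume K \<noteq> 0" "coord_ball_volume K \<noteq> \<infinity>"
    using coord_ball_volume_pos[of K] coord_ball_volume_finite[of K] by auto
  have [measurable]: "(\<lambda>w. (+) (snd w) ` fst w) \<in> measurable (\<mu> \<Otimes>\<^sub>M lborel) (plane_algebra (affine_planes (card K)))"
    "unit_slab \<in> borel_measurable (\<mu> \<Otimes>\<^sub>M lborel)"
    using measurable_translate_pair measurable_unit_slab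
    by (simp_all only: measurable_cong_sets[OF sets_pair_measure_cong[OF refl sets_lborel] refl])
  have "(\<integral>\<^sup>+Q. \<psi> Q \<partial>slab_measure) = (\<integral>\<^sup>+w. unit_slab w / coord_ball_volume K * \<psi> ((+) (snd w) ` fst w) \<partial>(\<mu> \<Otimes>\<^sub>M lborel))"
    unfolding slab_measure_def by (subst nn_integral_distr, simp, simp, subst nn_integral_density) auto
  then have "coord_ball_volume K * (\<integral>\<^sup>+Q. \<psi> Q \<partial>slab_measure)
     = (\<integral>\<^sup>+w. coord_ball_volume K * (unit_slab w / coord_ball_volume K * \<psi> ((+) (snd w) ` fst w)) \<partial>(\<mu> \<Otimes>\<^sub>M lborel))"
    by (simp add: nn_integral_cmult)
  also have "\<dots> = (\<integral>\<^sup>+w. \<psi> ((+) (snd w) ` fst w) * unit_slab w \<partial>(\<mu> \<Otimes>\<^sub>M lborel))"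
  proof (rule nn_integral_cong)
    fix w
    have "coord_ball_volume K * (unit_slab w / coord_ball_volume K) = unit_slab w"
      by (rule ennreal_mult_divide_cancel[OF cv])
    then show "coord_ball_volume K * (unit_slab w / coord_ball_volume K * \<psi> ((+) (snd w) ` fst w)) = \<psi> ((+) (snd w) ` fst w) * unit_slab w"
      by (simp only: mult.assoc[symmetric] mult.commute)
  qed
  also have "\<dots> = (\<integral>\<^sup>+P. (\<integral>\<^sup>+v. \<psi> ((+) v ` P) * unit_slab (P, v) \<partial>lborel) \<partial>\<mu>)"
    by (subst lborel.nn_integral_fst[symmetric]) auto
  finally show ?thesis .
qed

text \<open>\<open>measure_of\<close> assumes the prescribed values only if they form a measure.
  They do, because they agree with \<open>slab_measure\<close> on every measurable set; both are
  compared after multiplication by the ball volume, where \<open>unit_slab_section\<close> applies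
  under the integral.\<close>

lemma plane_measure_eq: "plane_measure (card K) \<mu> = slab_measure"
proof -
  have cv: "coord_ball_volume K \<noteq> 0" "coord_ball_volume K \<noteq> \<infinity>"
    using coord_ball_volume_pos[of K] coord_ball_volume_finite[of K] by auto
  have em: "(\<integral>\<^sup>+P. emeasure (plane_lebesgue (P\<^sup>\<bottom>)) {x \<in> P\<^sup>\<bottom>. (\<lambda>y. x + y) ` P \<in> A} \<partial>\<mu>) = emeasure slab_measure A"
    if A[measurable]: "A \<in> sets (plane_algebra (affine_planes (card K)))" for A
  proof -
    have "coord_ball_volume K * emeasure slab_measure A = coord_ball_volume K * (\<integral>\<^sup>+Q. indicator A Q \<partial>slab_measure)"
      by (subst nn_integral_indicator) (auto simp: slab_measure_def)
    also have "\<dots> = (\<integral>\<^sup>+P. (\<integral>\<^sup>+v. indicator A ((+) v ` P) * unit_slab (P, v) \<partial>lborel) \<partial>\<mu>)"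
      by (rule nn_integral_slab_measure) measurable
    also have "\<dots> = (\<integral>\<^sup>+P. coord_ball_volume K * emeasure (plane_lebesgue (P\<^sup>\<bottom>)) {x \<in> P\<^sup>\<bottom>. (\<lambda>y. x + y) ` P \<in> A} \<partial>\<mu>)"
      by (intro nn_integral_cong unit_slab_section[symmetric]) (auto simp: space_mu)
    finally have *: "emeasure slab_measure A = (\<integral>\<^sup>+P. coord_ball_volume K * emeasure (plane_lebesgue (P\<^sup>\<bottom>)) {x \<in> P\<^sup>\<bottom>. (\<lambda>y. x + y) ` P \<in> A} \<partial>\<mu>) / coord_ball_volume K"
      by (rule ennreal_eq_divideI[OF cv])
    have meas: "(\<lambda>P. emeasure (plane_lebesgue (P\<^sup>\<bottom>)) {x \<in> P\<^sup>\<bottom>. (\<lambda>y. x + y) ` P \<in> A}) \<in> borel_measurable \<mu>"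
    proof -
      have [measurable]: "(\<lambda>w. (+) (snd w) ` fst w) \<in> measurable (\<mu> \<Otimes>\<^sub>M lborel) (plane_algebra (affine_planes (card K)))"
        "unit_slab \<in> borel_measurable (\<mu> \<Otimes>\<^sub>M lborel)"
        using measurable_translate_pair measurable_unit_slab
    by (simp_all only: measurable_cong_sets[OF sets_pair_measure_cong[OF refl sets_lborel] refl])
      have m: "(\<lambda>w. indicator A ((+) (snd w) ` fst w) * unit_slab w) \<in> borel_measurable (\<mu> \<Otimes>\<^sub>M lborel)"
        by measurable
      have "(\<lambda>P. (\<integral>\<^sup>+v. indicator A ((+) v ` P) * unit_slab (P, v) \<partial>lborel) / coord_ball_volume K) \<in> borel_measurable \<mu>"
        using lborel.borel_measurable_nn_integral_fst[OF m] by simp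
      moreover have "emeasure (plane_lebesgue (P\<^sup>\<bottom>)) {x \<in> P\<^sup>\<bottom>. (\<lambda>y. x + y) ` P \<in> A}
         = (\<integral>\<^sup>+v. indicator A ((+) v ` P) * unit_slab (P, v) \<partial>lborel) / coord_ball_volume K" if "P \<in> space \<mu>" for P
        using unit_slab_section[OF _ A, of P] that unfolding space_mu by (intro ennreal_eq_divideI[OF cv]) auto
      ultimately show ?thesis by (subst measurable_cong) auto
    qed
    show ?thesis
      unfolding * nn_integral_cmult[OF meas] by (rule ennreal_eq_divideI[OF cv refl])
  qed
  have "plane_measure (card K) \<mu> = measure_of (affine_planes (card K)) (sets (plane_algebra (affine_planes (card K)))) (emeasure slab_measure)"
    unfolding plane_measure_def
  proof (rule measure_of_eq)
    show "sets (plane_algebra (affine_planes (card K))) \<subseteq> Pow (affine_planes (card K) :: (real^'n) set set)"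
      using sets.sets_into_space[of _ "plane_algebra (affine_planes (card K) :: (real^'n) set set)"] by auto
    fix A assume "A \<in> sigma_sets (affine_planes (card K)) (sets (plane_algebra (affine_planes (card K) :: (real^'n) set set)))"
    then have "A \<in> sets (plane_algebra (affine_planes (card K)))"
      using sets.sigma_sets_eq[of "plane_algebra (affine_planes (card K) :: (real^'n) set set)"] by simp
    then show "(\<integral>\<^sup>+P. emeasure (plane_lebesgue (P\<^sup>\<bottom>)) {x \<in> P\<^sup>\<bottom>. (\<lambda>y. x + y) ` P \<in> A} \<partial>\<mu>) = emeasure slab_measure A"
      by (rule em)
  qed
  also have "\<dots> = measure_of (space slab_measure) (sets slab_measure) (emeasure slab_measure)"
    by (simp add: slab_measure_def)
  also have "\<dots> = slab_measure" by (rule measure_of_of_measure)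
  finally show ?thesis .
qed

lemma sets_plane_measure [simp, measurable_cong]:
  "sets (plane_measure (card K) \<mu>) = sets (plane_algebra (affine_planes (card K)))"
  unfolding plane_measure_eq by (simp add: slab_measure_def)

lemma nn_integral_plane_measure:
  assumes "\<psi> \<in> borel_measurable (plane_algebra (affine_planes (card K)))"
  shows "coord_ball_volume K * (\<integral>\<^sup>+Q. \<psi> Q \<partial>plane_measure (card K) \<mu>)
    = (\<integral>\<^sup>+P. (\<integral>\<^sup>+v. \<psi> ((+) v ` P) * indicator {v. norm (closest_point P v) \<le> 1} v \<partial>lborel) \<partial>\<mu>)"
  using nn_integral_slab_measure[OF assms] unfolding plane_measure_eq by (simp add: unit_slab_def)

end

section \<open>Uniqueness of the invariant probability on linear planes\<close>

text \<open>Fatou's lemma applied to the proportion of a neighbourhood of \<open>x\<close> contained in a set \<open>U\<close>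
  gives \<open>\<mu> U \<le> \<nu> U\<close>, as soon as all neighbourhoods of the same size have the same measure.\<close>

lemma uniform_measure_le:
  fixes \<mu> \<nu> :: "'a measure" and N :: "nat \<Rightarrow> 'a \<Rightarrow> 'a \<Rightarrow> bool"
  assumes \<mu>: "prob_space \<mu>" "sets \<mu> = sets M" and \<nu>: "prob_space \<nu>" "sets \<nu> = sets M"
    and N[measurable]: "\<And>n. Measurable.pred (M \<Otimes>\<^sub>M M) (\<lambda>z. N n (fst z) (snd z))"
    and sym: "\<And>n x y. N n x y \<longleftrightarrow> N n y x"
    and a: "\<And>n x. x \<in> space M \<Longrightarrow> emeasure \<mu> {y \<in> space M. N n x y} = a n"
    and a0: "\<And>n. 0 < a n"
    and U[measurable]: "U \<in> sets M" and ev: "\<And>x. x \<in> U \<Longrightarrow> \<forall>\<^sub>F n in sequentially. {y \<in> space M. N n x y} \<subseteq> U"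
    and b: "\<And>n x. x \<in> space M \<Longrightarrow> emeasure \<nu> {y \<in> space M. N n x y} = a n"
  shows "emeasure \<mu> U \<le> emeasure \<nu> U"
proof -
  interpret \<mu>: prob_space \<mu> by fact
  interpret \<nu>: prob_space \<nu> by fact
  interpret P: pair_sigma_finite \<mu> \<nu> ..
  note [measurable_cong] = \<mu>(2) \<nu>(2)
  have sp[simp]: "space \<mu> = space M" "space \<nu> = space M"
    using sets_eq_imp_space_eq[OF \<mu>(2)] sets_eq_imp_space_eq[OF \<nu>(2)] by simp_all
  have afin: "a n \<noteq> \<infinity>" for n
  proof -
    obtain x where "x \<in> space M" using \<mu>.not_empty by auto
    from a[OF this, of n, symmetric] show ?thesis using \<mu>.emeasure_finite by simp
  qed
  have Nx[measurable]: "{y \<in> space M. N n x y} \<in> sets M" if "x \<in> space M" for n x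
  proof -
    have "(\<lambda>y. N n (fst (x, y)) (snd (x, y))) \<in> measurable M (count_space UNIV)"
      using that by (intro measurable_compose[OF _ N]) auto
    then show ?thesis by simp
  qed
  define F where "F n x = emeasure \<nu> (U \<inter> {y \<in> space M. N n x y}) / a n" for n x
  have Fm: "emeasure \<nu> (U \<inter> {y \<in> space M. N n x y}) = (\<integral>\<^sup>+y. indicator U y * of_bool (N n x y) \<partial>\<nu>)" if "x \<in> space M" for n x
  proof -
    have "(\<integral>\<^sup>+y. indicator U y * of_bool (N n x y) \<partial>\<nu>) = (\<integral>\<^sup>+y. indicator (U \<inter> {y \<in> space M. N n x y}) y \<partial>\<nu>)"
      by (intro nn_integral_cong) (auto simp: indicator_def)
    also have "\<dots> = emeasure \<nu> (U \<inter> {y \<in> space M. N n x y})"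
      by (rule nn_integral_indicator) (use that \<nu>(2) U Nx in auto)
    finally show ?thesis ..
  qed
  have meas: "(\<lambda>z. indicator U (snd z) * of_bool (N n (fst z) (snd z)) :: ennreal) \<in> borel_measurable (\<mu> \<Otimes>\<^sub>M \<nu>)" for n
    unfolding of_bool_def by measurable
  have Gm: "(\<lambda>x. \<integral>\<^sup>+y. indicator U y * of_bool (N n x y) \<partial>\<nu>) \<in> borel_measurable \<mu>" for n
    using \<nu>.borel_measurable_nn_integral_fst[OF meas] by simp
  have Fm2[measurable]: "F n \<in> borel_measurable \<mu>" for n
  proof -
    have "(\<lambda>x. (\<integral>\<^sup>+y. indicator U y * of_bool (N n x y) \<partial>\<nu>) / a n) \<in> borel_measurable \<mu>"
      using Gm by measurable
    then show ?thesis by (rule measurable_cong[THEN iffD1, rotated]) (simp add: F_def Fm)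
  qed
  \<comment> \<open>Fubini and the symmetry of \<open>N n\<close> turn the mean proportion into an
    integral over y in U of the mass of a neighbourhood of y, which is always
    \<open>a n\<close>.\<close>
  have int: "(\<integral>\<^sup>+x. F n x \<partial>\<mu>) = emeasure \<nu> U" for n
  proof -
    have "(\<integral>\<^sup>+x. F n x \<partial>\<mu>) = (\<integral>\<^sup>+x. (\<integral>\<^sup>+y. indicator U y * of_bool (N n x y) \<partial>\<nu>) / a n \<partial>\<mu>)"
      by (intro nn_integral_cong) (simp add: F_def Fm)
    also have "\<dots> = (\<integral>\<^sup>+x. (\<integral>\<^sup>+y. indicator U y * of_bool (N n x y) \<partial>\<nu>) \<partial>\<mu>) / a n"
      using Gm by (rule nn_integral_divide)
    also have "(\<integral>\<^sup>+x. (\<integral>\<^sup>+y. indicator U y * of_bool (N n x y) \<partial>\<nu>) \<partial>\<mu>)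
       = (\<integral>\<^sup>+y. (\<integral>\<^sup>+x. indicator U y * of_bool (N n x y) \<partial>\<mu>) \<partial>\<nu>)"
      by (rule P.Fubini'[symmetric]) (use meas[of n] in \<open>simp add: split_def\<close>)
    also have "\<dots> = (\<integral>\<^sup>+y. indicator U y * a n \<partial>\<nu>)"
    proof (rule nn_integral_cong)
      fix y assume y: "y \<in> space \<nu>"
      have "(\<integral>\<^sup>+x. indicator U y * of_bool (N n x y) \<partial>\<mu>) = (\<integral>\<^sup>+x. indicator U y * indicator {x \<in> space M. N n y x} x \<partial>\<mu>)"
        by (intro nn_integral_cong) (auto simp: indicator_def sym)
      also have "\<dots> = indicator U y * a n"
        using y Nx[of y n] \<mu>(2) by (subst nn_integral_cmult_indicator) (auto simp: a)
      finally show "(\<integral>\<^sup>+x. indicator U y * of_bool (N n x y) \<partial>\<mu>) = indicator U y * a n" .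
    qed
    also have "\<dots> = emeasure \<nu> U * a n"
      by (subst nn_integral_multc) auto
    finally show ?thesis using afin[of n] a0[of n] by (simp add: mult_divide_eq_ennreal)
  qed
  have "emeasure \<mu> U = (\<integral>\<^sup>+x. indicator U x \<partial>\<mu>)" by (rule nn_integral_indicator[symmetric]) (simp add: \<mu>(2) U)
  also have "\<dots> \<le> (\<integral>\<^sup>+x. liminf (\<lambda>n. F n x) \<partial>\<mu>)"
  proof (rule nn_integral_mono)
    fix x assume x: "x \<in> space \<mu>"
    show "indicator U x \<le> liminf (\<lambda>n. F n x)"
    proof (cases "x \<in> U")
      case True
      have "\<forall>\<^sub>F n in sequentially. 1 \<le> F n x"
        using ev[OF True]
      proof eventually_elim
        case (elim n)
        then have "U \<inter> {y \<in> space M. N n x y} = {y \<in> space M. N n x y}" by auto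
        then have "F n x = a n / a n" using x by (simp add: F_def b)
        then show ?case using a0[of n] afin[of n] by (simp add: ennreal_divide_self less_top)
      qed
      then show ?thesis using True by (auto intro!: Liminf_bounded)
    qed simp
  qed
  also have "\<dots> \<le> liminf (\<lambda>n. \<integral>\<^sup>+x. F n x \<partial>\<mu>)" by (rule nn_integral_liminf) measurable
  also have "\<dots> = emeasure \<nu> U" unfolding int by (simp add: Liminf_const)
  finally show ?thesis .
qed

text \<open>The uniqueness argument for uniformly distributed measures: neighbourhoods of equal size
  turn out to have the same positive mass under both measures, so \<open>uniform_measure_le\<close>
  applies in both directions on a generating family that is stable under intersections.\<close>

lemma uniform_measure_unique:
  fixes \<mu> \<nu> :: "'a measure" and N :: "nat \<Rightarrow> 'a \<Rightarrow> 'a \<Rightarrow> bool"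
  assumes \<mu>: "prob_space \<mu>" "sets \<mu> = sets M" and \<nu>: "prob_space \<nu>" "sets \<nu> = sets M"
    and N[measurable]: "\<And>n. Measurable.pred (M \<Otimes>\<^sub>M M) (\<lambda>z. N n (fst z) (snd z))"
    and sym: "\<And>n x y. N n x y \<longleftrightarrow> N n y x"
    and a: "\<And>n x x'. x \<in> space M \<Longrightarrow> x' \<in> space M \<Longrightarrow> emeasure \<mu> {y \<in> space M. N n x y} = emeasure \<mu> {y \<in> space M. N n x' y}"
    and b: "\<And>n x x'. x \<in> space M \<Longrightarrow> x' \<in> space M \<Longrightarrow> emeasure \<nu> {y \<in> space M. N n x y} = emeasure \<nu> {y \<in> space M. N n x' y}"
    and cover: "\<And>n. \<exists>C. countable C \<and> C \<subseteq> space M \<and> (\<forall>y\<in>space M. \<exists>x\<in>C. N n x y)"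
    and G: "G \<subseteq> Pow (space M)" "sets M = sigma_sets (space M) G" "Int_stable G" "space M \<in> G"
    and ev: "\<And>U x. U \<in> G \<Longrightarrow> x \<in> U \<Longrightarrow> \<forall>\<^sub>F n in sequentially. {y \<in> space M. N n x y} \<subseteq> U"
  shows "\<mu> = \<nu>"
proof -
  interpret \<mu>: prob_space \<mu> by fact
  interpret \<nu>: prob_space \<nu> by fact
  interpret P: pair_sigma_finite \<mu> \<nu> ..
  note [measurable_cong] = \<mu>(2) \<nu>(2)
  have sp[simp]: "space \<mu> = space M" "space \<nu> = space M"
    using sets_eq_imp_space_eq[OF \<mu>(2)] sets_eq_imp_space_eq[OF \<nu>(2)] by simp_all
  obtain x0 where x0: "x0 \<in> space M" using \<mu>.not_empty by auto
  define a' where "a' n = emeasure \<mu> {y \<in> space M. N n x0 y}" for n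
  define b' where "b' n = emeasure \<nu> {y \<in> space M. N n x0 y}" for n
  have Nx[measurable]: "{y \<in> space M. N n x y} \<in> sets M" if "x \<in> space M" for n x
  proof -
    have "(\<lambda>y. N n (fst (x, y)) (snd (x, y))) \<in> measurable M (count_space UNIV)"
      using that by (intro measurable_compose[OF _ N]) auto
    then show ?thesis by simp
  qed
  have meas: "(\<lambda>z. of_bool (N n (fst z) (snd z)) :: ennreal) \<in> borel_measurable (\<mu> \<Otimes>\<^sub>M \<nu>)" for n
    unfolding of_bool_def by measurable
  have ind: "(\<integral>\<^sup>+y. of_bool (N n x y) \<partial>\<kappa>) = emeasure \<kappa> {y \<in> space M. N n x y}"
    if "x \<in> space M" "sets \<kappa> = sets M" for n x \<kappa>
  proof -
    have "space \<kappa> = space M" using that(2) by (rule sets_eq_imp_space_eq)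
    then have "(\<integral>\<^sup>+y. of_bool (N n x y) \<partial>\<kappa>) = (\<integral>\<^sup>+y. indicator {y \<in> space M. N n x y} y \<partial>\<kappa>)"
      by (intro nn_integral_cong) (auto simp: indicator_def)
    then show ?thesis using Nx[OF that(1)] that(2) by simp
  qed
  \<comment> \<open>The double integral of the symmetric relation \<open>N n\<close> is the mass of
    a neighbourhood under one measure or the other, according to the order of integration.\<close>
  have ab: "a' n = b' n" for n
  proof -
    have "b' n = (\<integral>\<^sup>+x. b' n \<partial>\<mu>)" by (simp add: \<mu>.emeasure_space_1[simplified])
    also have "\<dots> = (\<integral>\<^sup>+x. (\<integral>\<^sup>+y. of_bool (N n x y) \<partial>\<nu>) \<partial>\<mu>)"
    proof (rule nn_integral_cong)
      fix x assume "x \<in> space \<mu>"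
      then have x: "x \<in> space M" by simp
      show "b' n = (\<integral>\<^sup>+y. of_bool (N n x y) \<partial>\<nu>)"
        unfolding ind[OF x \<nu>(2)] b'_def by (rule b[OF x0 x])
    qed
    also have "\<dots> = (\<integral>\<^sup>+y. (\<integral>\<^sup>+x. of_bool (N n x y) \<partial>\<mu>) \<partial>\<nu>)"
      by (rule P.Fubini'[symmetric]) (use meas[of n] in \<open>simp add: split_def\<close>)
    also have "\<dots> = (\<integral>\<^sup>+y. a' n \<partial>\<nu>)"
    proof (rule nn_integral_cong)
      fix y assume "y \<in> space \<nu>"
      then have y: "y \<in> space M" by simp
      have "(\<integral>\<^sup>+x. of_bool (N n x y) \<partial>\<mu>) = (\<integral>\<^sup>+x. of_bool (N n y x) \<partial>\<mu>)"
        by (intro nn_integral_cong) (simp only: sym)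
      also have "\<dots> = a' n" unfolding ind[OF y \<mu>(2)] a'_def by (rule a[OF y x0])
      finally show "(\<integral>\<^sup>+x. of_bool (N n x y) \<partial>\<mu>) = a' n" .
    qed
    also have "\<dots> = a' n" by (simp add: \<nu>.emeasure_space_1[simplified])
    finally show ?thesis ..
  qed
  have aa: "emeasure \<mu> {y \<in> space M. N n x y} = a' n" "emeasure \<nu> {y \<in> space M. N n x y} = a' n" if "x \<in> space M" for x n
    using a[OF that x0, of n] b[OF that x0, of n] unfolding ab unfolding a'_def[symmetric] b'_def[symmetric] ab by simp_all
  \<comment> \<open>Otherwise the countably many neighbourhoods in \<open>cover\<close> would
    exhaust the space by null sets.\<close>
  have pos: "0 < a' n" for n
  proof (rule ccontr)
    assume "\<not> 0 < a' n"
    then have z: "a' n = 0" by (simp add: zero_less_iff_neq_zero)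
    obtain C where C: "countable C" "C \<subseteq> space M" "\<forall>y\<in>space M. \<exists>x\<in>C. N n x y" using cover by blast
    have "(\<Union>x\<in>C. {y \<in> space M. N n x y}) \<in> null_sets \<mu>"
    proof (rule null_sets_UN'[OF C(1)])
      fix x assume "x \<in> C"
      then have "x \<in> space M" using C by auto
      then show "{y \<in> space M. N n x y} \<in> null_sets \<mu>"
        using aa(1)[of x n] z Nx[of x n] \<mu>(2) by (intro null_setsI) auto
    qed
    moreover have "(\<Union>x\<in>C. {y \<in> space M. N n x y}) = space M" using C by auto
    ultimately show False using \<mu>.emeasure_space_1 by auto
  qed
  show ?thesis
  proof (rule measure_eqI_generator_eq[OF G(3,1), where A="\<lambda>_. space M"])
    fix U assume U: "U \<in> G"
    then have Us: "U \<in> sets M" using G by auto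
    note e = ev[OF U]
    show "emeasure \<mu> U = emeasure \<nu> U"
      using uniform_measure_le[OF \<mu> \<nu> N sym aa(1) pos Us e aa(2)]
        uniform_measure_le[OF \<nu> \<mu> N sym aa(2) pos Us e aa(1)]
      by (auto intro: antisym)
  qed (use G \<mu>(2) \<nu>(2) \<mu>.emeasure_finite in auto)
qed

lemma infdist_isometry:
  assumes "\<And>x y. dist (T x) (T y) = dist x y"
  shows "infdist (T x) (T ` P) = infdist x P"
  by (simp add: infdist_def image_image assms)

lemma infdist_scaleR_subspace:
  fixes P :: "'a::euclidean_space set"
  assumes "subspace P"
  shows "infdist (c *\<^sub>R x) P = \<bar>c\<bar> * infdist x P"
proof -
  have aff: "affine P" "P \<noteq> {}" "0 \<in> P" using assms subspace_0[OF assms] by (auto simp: subspace_imp_affine)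
  have c: "closest_point P x \<in> P" by (rule closest_point_affine_in) fact+
  have orth: "(x - closest_point P x) \<bullet> y = 0" if "y \<in> P" for y
    using closest_point_affine_orth[OF aff(1) that, of x] closest_point_affine_orth[OF aff(1) aff(3), of x]
    by (simp add: inner_diff_right)
  have "closest_point P (c *\<^sub>R x) = c *\<^sub>R closest_point P x"
  proof (rule closest_point_affine_unique[OF aff(1)])
    show "c *\<^sub>R closest_point P x \<in> P" using assms c by (rule subspace_scale)
    fix y assume "y \<in> P"
    then have "y - c *\<^sub>R closest_point P x \<in> P" using assms c by (intro subspace_diff subspace_scale)
    from orth[OF this] show "(c *\<^sub>R x - c *\<^sub>R closest_point P x) \<bullet> (y - c *\<^sub>R closest_point P x) = 0"
      by (simp flip: scaleR_diff_right)
  qed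
  then show ?thesis by (simp add: infdist_affine[OF aff(1,2)] flip: scaleR_diff_right)
qed

text \<open>A metric neighbourhood among linear planes, the distance being the supremum of |infdist
  x P - infdist x Q| over unit vectors x. In terms of distance functions it is visibly measurable
  and invariant under rotations.\<close>

definition near_planes :: "nat \<Rightarrow> 'a::euclidean_space set \<Rightarrow> 'a set \<Rightarrow> bool" where
  "near_planes n P Q \<longleftrightarrow> (\<forall>x. \<bar>infdist x P - infdist x Q\<bar> \<le> norm x / Suc n)"

lemma near_planes_sym: "near_planes n P Q \<longleftrightarrow> near_planes n Q P"
  by (simp add: near_planes_def abs_minus_commute)

text \<open>Both sides of the inequality are continuous in x. The countable form is the one that
  shows measurability.\<close>

lemma near_planes_dense_seq:
  fixes P Q :: "'a::euclidean_space set"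
  shows
  "near_planes n P Q \<longleftrightarrow> (\<forall>m. \<bar>infdist (dense_seq m) P - infdist (dense_seq m) Q\<bar> \<le> norm (dense_seq m :: 'a::euclidean_space) / Suc n)"
proof
  assume *: "\<forall>m. \<bar>infdist (dense_seq m) P - infdist (dense_seq m) Q\<bar> \<le> norm (dense_seq m :: 'a) / Suc n"
  have "closed {x. \<bar>infdist x P - infdist x Q\<bar> \<le> norm x / Suc n}"
    by (intro closed_Collect_le continuous_intros) auto
  then have "closure (range dense_seq) \<subseteq> {x. \<bar>infdist x P - infdist x Q\<bar> \<le> norm x / Suc n}"
    using * by (intro closure_minimal) (auto simp del: of_nat_Suc)
  then show "near_planes n P Q" by (auto simp: near_planes_def closure_range_dense_seq)
qed (simp add: near_planes_def)

lemma near_planes_isometry: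
  fixes T :: "'a::euclidean_space \<Rightarrow> 'a"
  assumes "orthogonal_transformation T"
  shows "near_planes n (T ` P) (T ` Q) \<longleftrightarrow> near_planes n P Q"
proof -
  have d: "dist (T x) (T y) = dist x y" for x y
    by (simp add: dist_norm orthogonal_transformation_norm[OF assms]
        flip: linear_diff[OF orthogonal_transformation_linear[OF assms]])
  have i: "infdist (T x) (T ` P) = infdist x P" for x P by (rule infdist_isometry) (rule d)
  have s: "surj T" using assms by (rule orthogonal_transformation_surj)
  have "near_planes n (T ` P) (T ` Q) \<longleftrightarrow> (\<forall>x. \<bar>infdist (T x) (T ` P) - infdist (T x) (T ` Q)\<bar> \<le> norm (T x) / Suc n)"
  proof
    assume *: "\<forall>x. \<bar>infdist (T x) (T ` P) - infdist (T x) (T ` Q)\<bar> \<le> norm (T x) / Suc n"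
    show "near_planes n (T ` P) (T ` Q)"
      unfolding near_planes_def
    proof
      fix y
      obtain x where "y = T x" using surjD[OF s] by blast
      then show "\<bar>infdist y (T ` P) - infdist y (T ` Q)\<bar> \<le> norm y / Suc n" using * by simp
    qed
  qed (simp add: near_planes_def)
  then show ?thesis
    by (simp add: near_planes_def i orthogonal_transformation_norm[OF assms])
qed

lemma measurable_near_planes:
  "Measurable.pred (plane_algebra (linear_planes k) \<Otimes>\<^sub>M plane_algebra (linear_planes k)) (\<lambda>z. near_planes n (fst z) (snd z :: 'a::euclidean_space set))"
proof -
  have [measurable]: "(\<lambda>z. infdist x (fst z)) \<in> borel_measurable (plane_algebra (linear_planes k) \<Otimes>\<^sub>M plane_algebra (linear_planes k))"
    "(\<lambda>z. infdist x (snd z)) \<in> borel_measurable (plane_algebra (linear_planes k) \<Otimes>\<^sub>M plane_algebra (linear_planes k))" for x :: 'a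
    by (rule measurable_infdist_plane'[where G="linear_planes k"]; simp add: linear_planes_affine)+
  show ?thesis unfolding near_planes_dense_seq by measurable
qed

text \<open>Round the distances from a plane to the points of a finite net of the unit ball. There
  are countably many such codes, and two planes with the same code are near each other.\<close>

lemma near_planes_countable_cover:
  "\<exists>C. countable C \<and> C \<subseteq> linear_planes k \<and> (\<forall>Q\<in>linear_planes k. \<exists>P\<in>C. near_planes n P (Q :: 'a::euclidean_space set))"
proof -
  \<comment> \<open>A third of the tolerance for each error: moving to a net point for P, the same
    for Q, and the rounding.\<close>
  define \<delta> where "\<delta> = 1 / (3 * real (Suc n))"
  have \<delta>: "0 < \<delta>" by (simp add: \<delta>_def)
  obtain X where X: "finite X" "X \<subseteq> cball (0::'a) 1" "cball 0 1 \<subseteq> (\<Union>x\<in>X. ball x \<delta>)"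
    using compactE_image[OF compact_cball, of "cball (0::'a) 1" "\<lambda>x. ball x \<delta>" 0 1] \<delta>
    by (metis (no_types, lifting) UN_I centre_in_ball open_ball subsetI)
  define code where "code P = (\<lambda>x\<in>X. \<lfloor>infdist x P / \<delta>\<rfloor>)" for P :: "'a set"
  define C where "C = inv_into (linear_planes k) code ` code ` linear_planes k"
  have "countable (Pi\<^sub>E X (\<lambda>_. UNIV :: int set))" using X(1) by (intro countable_PiE) auto
  then have "countable (code ` linear_planes k)"
    by (rule countable_subset[rotated]) (auto simp: code_def)
  then have "countable C" by (simp add: C_def)
  moreover have "C \<subseteq> linear_planes k" by (auto simp: C_def inv_into_into)
  moreover have "\<exists>P\<in>C. near_planes n P Q" if Q: "Q \<in> linear_planes k" for Q
  proof
    define P where "P = inv_into (linear_planes k) code (code Q)"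
    show "P \<in> C" using Q by (auto simp: C_def P_def)
    have P: "P \<in> linear_planes k" "code P = code Q" using Q by (auto simp: P_def f_inv_into_f inv_into_into)
    have sub: "subspace P" "subspace Q" using P Q by (auto simp: linear_planes_iff)
    have net: "\<bar>infdist x P - infdist x Q\<bar> \<le> \<delta>" if "x \<in> X" for x
    proof -
      have "\<lfloor>infdist x P / \<delta>\<rfloor> = \<lfloor>infdist x Q / \<delta>\<rfloor>" using P(2) that by (auto simp: code_def fun_eq_iff) metis
      then have "\<bar>infdist x P / \<delta> - infdist x Q / \<delta>\<bar> \<le> 1" by linarith
      then have "\<bar>(infdist x P - infdist x Q) / \<delta>\<bar> \<le> 1" by (simp add: diff_divide_distrib)
      then show ?thesis using \<delta> by (simp add: abs_divide)
    qed
    have u: "\<bar>infdist u P - infdist u Q\<bar> \<le> 3 * \<delta>" if u: "u \<in> cball 0 1" for u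
    proof -
      obtain x where x: "x \<in> X" "dist x u < \<delta>" using subsetD[OF X(3) u] by auto
      have "\<bar>infdist u P - infdist x P\<bar> \<le> dist x u" "\<bar>infdist u Q - infdist x Q\<bar> \<le> dist x u"
        using infdist_triangle[of u P x] infdist_triangle[of x P u] infdist_triangle[of u Q x] infdist_triangle[of x Q u]
        by (auto simp: dist_commute)
      moreover have "\<bar>infdist x P - infdist x Q\<bar> \<le> \<delta>" by (rule net[OF x(1)])
      ultimately show ?thesis using x by linarith
    qed
    show "near_planes n P Q"
      unfolding near_planes_def
    proof
      fix x
      show "\<bar>infdist x P - infdist x Q\<bar> \<le> norm x / Suc n"
      proof (cases "x = 0")
        case True
        then show ?thesis using sub by (simp add: subspace_0)
      next
        case False
        define u where "u = x /\<^sub>R norm x"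
        have x: "x = norm x *\<^sub>R u" using False by (simp add: u_def)
        have "u \<in> cball 0 1" using False by (simp add: u_def)
        have "infdist x P - infdist x Q = norm x * (infdist u P - infdist u Q)"
          by (subst (1 2) x) (simp add: infdist_scaleR_subspace sub algebra_simps)
        then have "\<bar>infdist x P - infdist x Q\<bar> = norm x * \<bar>infdist u P - infdist u Q\<bar>" by (simp add: abs_mult)
        also have "\<dots> \<le> norm x * (3 * \<delta>)" by (intro mult_left_mono u) (fact, simp)
        also have "3 * \<delta> = 1 / real (Suc n)" unfolding \<delta>_def by (simp del: of_nat_Suc)
        finally show ?thesis by simp
      qed
    qed
  qed
  ultimately show ?thesis by blast
qed

lemma invariant_plane_prob_transform:
  assumes "invariant_plane_prob k \<mu>" "orthogonal_transformation (T :: 'a::euclidean_space \<Rightarrow> 'a)"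
  shows "(\<lambda>P. T ` P) \<in> measurable \<mu> \<mu>"
proof -
  have s: "sets \<mu> = sets (plane_algebra (linear_planes k))" using assms(1) by (simp add: invariant_plane_prob_def)
  have lin: "linear T" using assms(2) by (rule orthogonal_transformation_linear)
  have cont: "continuous_on A T" for A using lin by (simp add: linear_conv_bounded_linear linear_continuous_on)
  have "(\<lambda>P. T ` P) \<in> measurable (plane_algebra (linear_planes k)) (plane_algebra (linear_planes k))"
  proof (rule measurable_plane_algebra)
    fix P :: "'a set" assume "P \<in> space (plane_algebra (linear_planes k))"
    then show "T ` P \<in> linear_planes k"
      using orthogonal_transformation_inj[OF assms(2)] lin
      by (auto simp: linear_planes_iff dim_image_eq linear_subspace_image inj_on_subset)
  next
    fix U :: "'a set" assume U: "open U"
    have "{P \<in> space (plane_algebra (linear_planes k)). T ` P \<inter> U \<noteq> {}} = {P \<in> linear_planes k. P \<inter> T -` U \<noteq> {}}" by auto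
    then show "{P \<in> space (plane_algebra (linear_planes k)). T ` P \<inter> U \<noteq> {}} \<in> sets (plane_algebra (linear_planes k))"
      using U cont[of UNIV] by (simp add: plane_algebra_hitting open_vimage)
  qed
  then show ?thesis using measurable_cong_sets[OF s s] by blast
qed

text \<open>A rotation that takes P to P' maps the one neighbourhood onto the other.\<close>

lemma invariant_plane_prob_near:
  fixes \<mu> :: "(real^'n) set measure"
  assumes \<mu>: "invariant_plane_prob k \<mu>" and P: "P \<in> linear_planes k" "P' \<in> linear_planes k"
  shows "emeasure \<mu> {Q \<in> linear_planes k. near_planes n P Q} = emeasure \<mu> {Q \<in> linear_planes k. near_planes n P' Q}"
proof -
  have s: "sets \<mu> = sets (plane_algebra (linear_planes k))" using \<mu> by (simp add: invariant_plane_prob_def)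
  have sp: "space \<mu> = linear_planes k" using sets_eq_imp_space_eq[OF s] by simp
  obtain T where T: "orthogonal_transformation T" "T ` P = P'"
    using orthogonal_transformation_transitive[of P P'] P by (auto simp: linear_planes_iff)
  have m: "(\<lambda>P. T ` P) \<in> measurable \<mu> \<mu>" by (rule invariant_plane_prob_transform[OF \<mu> T(1)])
  have "(\<lambda>Q. near_planes n (fst (P', Q)) (snd (P', Q))) \<in> measurable (plane_algebra (linear_planes k)) (count_space UNIV)"
    using measurable_compose[OF measurable_Pair1'[of P' "plane_algebra (linear_planes k)" "plane_algebra (linear_planes k)"] measurable_near_planes[of n k]] P by simp
  then have S: "{Q \<in> linear_planes k. near_planes n P' Q} \<in> sets \<mu>" unfolding s by (simp add: pred_def)
  have "emeasure \<mu> {Q \<in> linear_planes k. near_planes n P' Q} = emeasure (distr \<mu> \<mu> (\<lambda>P. T ` P)) {Q \<in> linear_planes k. near_planes n P' Q}"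
    using \<mu> T(1) by (simp add: invariant_plane_prob_def)
  also have "\<dots> = emeasure \<mu> ((\<lambda>P. T ` P) -` {Q \<in> linear_planes k. near_planes n P' Q} \<inter> space \<mu>)"
    by (rule emeasure_distr[OF m S])
  also have "(\<lambda>P. T ` P) -` {Q \<in> linear_planes k. near_planes n P' Q} \<inter> space \<mu> = {Q \<in> linear_planes k. near_planes n P Q}"
    using measurable_space[OF m] by (auto simp: sp T(2)[symmetric] near_planes_isometry[OF T(1)])
  finally show ?thesis ..
qed

text \<open>Invariance gives all neighbourhoods of the same size the same mass, so the argument for
  uniformly distributed measures applies.\<close>

lemma invariant_plane_prob_unique:
  fixes \<mu> \<nu> :: "(real^'n) set measure"
  assumes \<mu>: "invariant_plane_prob k \<mu>" and \<nu>: "invariant_plane_prob k \<nu>"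
  shows "\<mu> = \<nu>"
proof -
  let ?M = "plane_algebra (linear_planes k) :: (real^'n) set measure"
  let ?hit = "\<lambda>U. {P \<in> linear_planes k. P \<inter> U \<noteq> {}} :: (real^'n) set set"
  \<comment> \<open>Sets of planes hitting an open set need not be stable under intersection. Their
    finite intersections are, and they generate the same sigma-algebra.\<close>
  let ?G = "{linear_planes k \<inter> (\<Inter>U\<in>F. ?hit U) |F. finite F \<and> (\<forall>U\<in>F. open U)}"
  show ?thesis
  proof (rule uniform_measure_unique[where M="?M" and N=near_planes and G="?G"])
    show "prob_space \<mu>" "sets \<mu> = sets ?M" "prob_space \<nu>" "sets \<nu> = sets ?M"
      using \<mu> \<nu> by (auto simp: invariant_plane_prob_def)
    show "Measurable.pred (?M \<Otimes>\<^sub>M ?M) (\<lambda>z. near_planes n (fst z) (snd z))" for n by (rule measurable_near_planes)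
    show "near_planes n x y \<longleftrightarrow> near_planes n y x" for n and x y :: "(real^'n) set" by (rule near_planes_sym)
    show "emeasure \<mu> {y \<in> space ?M. near_planes n x y} = emeasure \<mu> {y \<in> space ?M. near_planes n x' y}"
      if "x \<in> space ?M" "x' \<in> space ?M" for n x x'
      using that unfolding space_plane_algebra by (rule invariant_plane_prob_near[OF \<mu>])
    show "emeasure \<nu> {y \<in> space ?M. near_planes n x y} = emeasure \<nu> {y \<in> space ?M. near_planes n x' y}"
      if "x \<in> space ?M" "x' \<in> space ?M" for n x x'
      using that unfolding space_plane_algebra by (rule invariant_plane_prob_near[OF \<nu>])
    show "\<exists>C. countable C \<and> C \<subseteq> space ?M \<and> (\<forall>y\<in>space ?M. \<exists>x\<in>C. near_planes n x y)" for n
      using near_planes_countable_cover by simp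
    show "?G \<subseteq> Pow (space ?M)" by auto
    show "space ?M \<in> ?G" by (intro CollectI exI[of _ "{}"]) auto
    show "Int_stable ?G"
    proof (rule Int_stableI)
      fix a b assume "a \<in> ?G" "b \<in> ?G"
      then obtain F1 F2 where F: "a = linear_planes k \<inter> (\<Inter>U\<in>F1. ?hit U)" "finite F1" "\<forall>U\<in>F1. open U"
         "b = linear_planes k \<inter> (\<Inter>U\<in>F2. ?hit U)" "finite F2" "\<forall>U\<in>F2. open U"
        by (elim CollectE exE conjE) simp
      have "a \<inter> b = linear_planes k \<inter> (\<Inter>U\<in>F1 \<union> F2. ?hit U)"
        unfolding F(1,4) INT_Un by (simp only: Int_ac Int_absorb Int_left_absorb)
      then show "a \<inter> b \<in> ?G" using F(2,3,5,6) by (intro CollectI exI[of _ "F1 \<union> F2"]) auto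
    qed
    show "sets ?M = sigma_sets (space ?M) ?G"
    proof (rule antisym)
      have sM: "sets ?M = sigma_sets (linear_planes k) {?hit U |U. open U}"
        unfolding plane_algebra_def by (rule sets_measure_of) auto
      have "?hit U \<in> ?G" if "open U" for U
        using that by (intro CollectI exI[of _ "{U}"]) auto
      then have "{?hit U |U. open U} \<subseteq> sigma_sets (linear_planes k) ?G"
        by (intro subsetI sigma_sets.Basic) (elim CollectE exE conjE, simp only:)
      then show "sets ?M \<subseteq> sigma_sets (space ?M) ?G"
        unfolding sM space_plane_algebra by (rule sigma_sets_mono)
      have "linear_planes k \<inter> (\<Inter>U\<in>F. ?hit U) \<in> sets ?M" if "finite F" "\<forall>U\<in>F. open U" for F
      proof (cases "F = {}")
        case True
        then show ?thesis using sets.top[of ?M] by simp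
      next
        case False
        then show ?thesis using that sets.top[of ?M]
          by (intro sets.Int sets.finite_INT) (auto intro: plane_algebra_hitting)
      qed
      then have "?G \<subseteq> sets ?M" by (intro subsetI) (elim CollectE exE conjE, simp only:)
      then show "sigma_sets (space ?M) ?G \<subseteq> sets ?M" by (rule sets.sigma_sets_subset)
    qed
    fix A P assume "A \<in> ?G" and P: "P \<in> A"
    then obtain F where F: "A = linear_planes k \<inter> (\<Inter>U\<in>F. ?hit U)" "finite F" "\<forall>U\<in>F. open U"
      by (elim CollectE exE conjE) simp
    \<comment> \<open>If P meets U in x, a plane close enough to P comes so close to x that it meets
      a ball about x inside U.\<close>
    have "\<forall>\<^sub>F n in sequentially. \<forall>Q\<in>linear_planes k. near_planes n P Q \<longrightarrow> Q \<inter> U \<noteq> {}" if U: "U \<in> F" for U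
    proof -
      obtain x where x: "x \<in> P" "x \<in> U" using P F U by auto
      then obtain e where e: "0 < e" "ball x e \<subseteq> U" using F(3) U open_contains_ball by blast
      have "(\<lambda>n. norm x / real (Suc n)) \<longlonglongrightarrow> 0"
        by (rule LIMSEQ_Suc) (rule lim_const_over_n)
      then have "\<forall>\<^sub>F n in sequentially. norm x / real (Suc n) < e" using e(1) by (rule order_tendstoD)
      then show ?thesis
      proof eventually_elim
        case (elim n)
        show ?case
        proof (intro ballI impI)
          fix Q :: "(real^'n) set" assume Q: "Q \<in> linear_planes k" and near: "near_planes n P Q"
          have "infdist x Q < e" 
          proof -
            have "\<bar>infdist x P - infdist x Q\<bar> \<le> norm x / real (Suc n)" using near unfolding near_planes_def by (rule spec)
            moreover have "infdist x P = 0" by (rule infdist_zero[OF x(1)])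
            ultimately show ?thesis using elim by linarith
          qed
          moreover obtain q where "q \<in> Q" "infdist x Q = dist x q"
            using infdist_attains_inf[of Q x] linear_planes_affine[OF Q] affine_closed by blast
          ultimately show "Q \<inter> U \<noteq> {}" using e(2) by auto
        qed
      qed
    qed
    then have "\<forall>\<^sub>F n in sequentially. \<forall>U\<in>F. \<forall>Q\<in>linear_planes k. near_planes n P Q \<longrightarrow> Q \<inter> U \<noteq> {}"
      using F(2) by (intro eventually_ball_finite) auto
    then show "\<forall>\<^sub>F n in sequentially. {y \<in> space ?M. near_planes n P y} \<subseteq> A"
      by eventually_elim (auto simp: F(1))
  qed
qed

section \<open>Linear planes as graphs over the coordinates in K\<close>

text \<open>The matrix \<open>A\<close> has a row for each coordinate outside \<open>K\<close> and a
  column for each coordinate in \<open>K\<close>; the plane is the graph of the linear map with this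
  matrix. The slopes serve as coordinates on the set of linear planes.\<close>

definition graph_pt :: "'n::finite set \<Rightarrow> ('n \<times> 'n \<Rightarrow> real) \<Rightarrow> ('n \<Rightarrow> real) \<Rightarrow> real^'n" where
  "graph_pt K A y = (\<chi> i. if i \<in> K then y i else \<Sum>j\<in>K. A (i, j) * y j)"

definition graph_plane :: "'n::finite set \<Rightarrow> ('n \<times> 'n \<Rightarrow> real) \<Rightarrow> (real^'n) set" where
  "graph_plane K A = range (graph_pt K A)"

lemma graph_pt_nth [simp]: "graph_pt K A y $ i = (if i \<in> K then y i else \<Sum>j\<in>K. A (i, j) * y j)"
  by (simp add: graph_pt_def)

lemma graph_pt_cong: "(\<And>i. i \<in> K \<Longrightarrow> y i = z i) \<Longrightarrow> graph_pt K A y = graph_pt K A z"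
  by (simp add: vec_eq_iff)

lemma graph_pt_add: "graph_pt K A (\<lambda>i. y i + z i) = graph_pt K A y + graph_pt K A z"
  by (simp add: vec_eq_iff algebra_simps sum.distrib)

lemma linear_graph_pt: "linear (\<lambda>v. graph_pt K A (\<lambda>i. v $ i))"
  by (rule linearI) (simp_all add: vec_eq_iff algebra_simps sum.distrib sum_distrib_left)

lemma graph_plane_eq: "graph_plane K A = range (\<lambda>v :: real^'n::finite. graph_pt K A (\<lambda>i. v $ i))"
proof -
  have "graph_pt K A y = graph_pt K A (\<lambda>i. (\<chi> i. y i) $ i)" for y by simp
  then show ?thesis unfolding graph_plane_def by fast
qed

lemma subspace_graph_plane: "subspace (graph_plane K A)"
  unfolding graph_plane_eq by (intro linear_subspace_image linear_graph_pt subspace_UNIV)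

lemma graph_plane_linear_planes:
  fixes K :: "'n::finite set"
  shows "graph_plane K A \<in> linear_planes (card K)"
proof -
  let ?L = "\<lambda>v :: real^'n. graph_pt K A (\<lambda>i. v $ i)"
  have "graph_plane K A = ?L ` coord_plane K"
  proof -
    have "graph_pt K A = (\<lambda>y. ?L (coord_vec K y))" by (intro ext graph_pt_cong) simp
    from arg_cong[OF this, of range] show ?thesis
      unfolding graph_plane_def range_coord_vec[symmetric] image_image .
  qed
  moreover have "inj_on ?L (coord_plane K)"
  proof (rule inj_onI)
    fix v w assume v: "v \<in> coord_plane K" "w \<in> coord_plane K" "?L v = ?L w"
    have "v $ i = w $ i" for i
    proof (cases "i \<in> K")
      case True
      from v(3) have "?L v $ i = ?L w $ i" by simp
      with True show ?thesis by simp
    next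
      case False
      with v show ?thesis by (simp add: coord_plane_def)
    qed
    then show "v = w" by (simp add: vec_eq_iff)
  qed
  ultimately have "dim (graph_plane K A) = card K"
    using dim_image_eq[OF linear_graph_pt[of K A], of "coord_plane K"] subspace_coord_plane[of K]
    by (simp add: span_eq_iff[THEN iffD2] dim_coord_plane)
  then show ?thesis by (simp add: linear_planes_iff subspace_graph_plane)
qed

lemma borel_measurable_vec_lambda:
  fixes f :: "'n::finite \<Rightarrow> 'b \<Rightarrow> real"
  assumes "\<And>i. f i \<in> borel_measurable N"
  shows "(\<lambda>\<omega>. \<chi> i. f i \<omega>) \<in> borel_measurable N"
  by (subst borel_measurable_euclidean_space) (auto simp: Basis_vec_def inner_axis assms)

lemma measurable_leb_prod_component:
  "f \<in> measurable N (leb_prod I) \<Longrightarrow> i \<in> I \<Longrightarrow> (\<lambda>\<omega>. f \<omega> i) \<in> borel_measurable N"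
  by (drule measurable_compose[OF _ measurable_component_singleton]) simp_all

lemma leb_prod_component: "i \<in> I \<Longrightarrow> (\<lambda>x. x i) \<in> borel_measurable (leb_prod I)"
  by simp

lemma graph_pt_measurable:
  assumes f: "f \<in> measurable N (leb_prod ((-K) \<times> K))" and g: "\<And>i. i \<in> K \<Longrightarrow> g i \<in> borel_measurable N"
  shows "(\<lambda>\<omega>. graph_pt K (f \<omega>) (\<lambda>i. g i \<omega>)) \<in> borel_measurable N"
  unfolding graph_pt_def
proof (rule borel_measurable_vec_lambda)
  fix i
  show "(\<lambda>\<omega>. if i \<in> K then g i \<omega> else \<Sum>j\<in>K. f \<omega> (i, j) * g j \<omega>) \<in> borel_measurable N"
    by (cases "i \<in> K") (auto intro!: borel_measurable_sum borel_measurable_times measurable_leb_prod_component[OF f] g)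
qed

lemma graph_plane_measurable:
  "graph_plane K \<in> measurable (leb_prod ((-K) \<times> K)) (plane_algebra (linear_planes (card K)))"
proof (rule measurable_plane_algebra_selections[where p="\<lambda>n A. graph_pt K A (\<lambda>i. dense_seq n $ i)"])
  show "(\<lambda>A. graph_pt K A (\<lambda>i. dense_seq n $ i)) \<in> borel_measurable (leb_prod ((-K) \<times> K))" for n
    by (rule graph_pt_measurable) auto
  fix A
  show "graph_plane K A \<subseteq> closure (range (\<lambda>n. graph_pt K A (\<lambda>i. dense_seq n $ i)))"
    unfolding graph_plane_eq
    by (rule image_subset_closure_dense_seq) (use linear_graph_pt[of K A] in \<open>simp add: linear_conv_bounded_linear linear_continuous_on\<close>)
qed (simp add: graph_plane_linear_planes, auto simp: graph_plane_def)

lemma block_matrix_mult: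
  "block_matrix K (\<lambda>p. \<Sum>l\<in>K. S (fst p, l) * Y (l, snd p)) = block_matrix K S ** block_matrix K Y"
proof -
  have "(\<Sum>l\<in>UNIV. block_matrix K S $ i $ l * block_matrix K Y $ l $ j)
     = (if i \<in> K \<and> j \<in> K then \<Sum>l\<in>K. S (i, l) * Y (l, j) else of_bool (i = j))" for i j
  proof (cases "i \<in> K")
    case True
    have "(\<Sum>l\<in>UNIV. block_matrix K S $ i $ l * block_matrix K Y $ l $ j) = (\<Sum>l\<in>K. block_matrix K S $ i $ l * block_matrix K Y $ l $ j)"
      using True by (intro sum.mono_neutral_right) (auto simp: block_matrix_def)
    also have "\<dots> = (\<Sum>l\<in>K. S (i, l) * (if j \<in> K then Y (l, j) else 0))"
      using True by (intro sum.cong) (auto simp: block_matrix_def)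
    finally show ?thesis using True by (auto intro!: sum.neutral)
  next
    case False
    have "(\<Sum>l\<in>UNIV. block_matrix K S $ i $ l * block_matrix K Y $ l $ j) = (\<Sum>l\<in>UNIV. if l = i then block_matrix K Y $ l $ j else 0)"
      using False by (intro sum.cong) (auto simp: block_matrix_def)
    then show ?thesis using False by (simp add: block_matrix_def)
  qed
  then show ?thesis by (simp add: vec_eq_iff matrix_matrix_mult_def) (simp add: block_matrix_def)
qed

lemma block_matrix_transpose: "block_matrix K (\<lambda>p. Y (snd p, fst p)) = transpose (block_matrix K Y)"
  by (auto simp: vec_eq_iff block_matrix_def transpose_def)

lemma block_matrix_cong: "(\<And>i j. i \<in> K \<Longrightarrow> j \<in> K \<Longrightarrow> S (i, j) = Y (i, j)) \<Longrightarrow> block_matrix K S = block_matrix K Y"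
  by (simp add: vec_eq_iff block_matrix_def)

lemma block_matrix_vec:
  "block_matrix K S *v v = (\<chi> i. if i \<in> K then \<Sum>j\<in>K. S (i, j) * v $ j else v $ i)"
proof -
  have "(\<Sum>j\<in>UNIV. block_matrix K S $ i $ j * v $ j) = (if i \<in> K then \<Sum>j\<in>K. S (i, j) * v $ j else v $ i)" for i
  proof (cases "i \<in> K")
    case True
    then have "(\<Sum>j\<in>UNIV. block_matrix K S $ i $ j * v $ j) = (\<Sum>j\<in>K. S (i, j) * v $ j)"
      by (intro sum.mono_neutral_cong_right) (auto simp: block_matrix_def)
    with True show ?thesis by simp
  next
    case False
    then have "(\<Sum>j\<in>UNIV. block_matrix K S $ i $ j * v $ j) = (\<Sum>j\<in>UNIV. if j = i then v $ j else 0)"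
      by (intro sum.cong) (auto simp: block_matrix_def)
    with False show ?thesis by simp
  qed
  then show ?thesis by (simp add: matrix_vector_mult_def)
qed

lemma block_matrix_det_measurable:
  assumes "K \<times> K \<subseteq> I"
  shows "(\<lambda>X. det (block_matrix K X)) \<in> borel_measurable (leb_prod (I :: ('n::finite \<times> 'n) set))"
proof -
  have "(\<lambda>X. block_matrix K X $ i $ j) \<in> borel_measurable (leb_prod I)" for i j
  proof (cases "i \<in> K \<and> j \<in> K")
    case True
    then have "(i, j) \<in> I" using assms by auto
    with True show ?thesis by (simp add: block_matrix_def leb_prod_component)
  next
    case False
    then show ?thesis by (auto simp: block_matrix_def)
  qed
  then show ?thesis
    unfolding det_def by (intro borel_measurable_sum borel_measurable_times borel_measurable_prod) auto
qed

lemma det_eq_0_imp_kernel: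
  fixes M :: "real^'n^'n"
  shows "det M = 0 \<Longrightarrow> \<exists>v. v \<noteq> 0 \<and> M *v v = 0"
  by (metis invertible_det_nz invertible_left_inverse matrix_left_invertible_ker)

text \<open>The determinant is a polynomial in s. It is not the zero polynomial, because for s
  larger than the operator norm of the block the shifted block is invertible.\<close>

lemma block_matrix_shift_det_finite:
  "finite {s. det (block_matrix K (\<lambda>p. s * of_bool (fst p = snd p) + X p)) = 0}"
proof -
  let ?B = "\<lambda>s. block_matrix K (\<lambda>p. s * of_bool (fst p = snd p) + X p)"
  have "real_polynomial_function (\<lambda>s. ?B s $ i $ j)" for i j
  proof (cases "i \<in> K \<and> j \<in> K")
    case True
    then have "(\<lambda>s. ?B s $ i $ j) = (\<lambda>s. s * of_bool (i = j) + X (i, j))" by (simp add: block_matrix_def)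
    then show ?thesis
      using real_polynomial_function.intros(3)[OF real_polynomial_function.intros(4)[OF
        real_polynomial_function.intros(1)[OF bounded_linear_ident] real_polynomial_function.intros(2)]
        real_polynomial_function.intros(2)] by simp
  next
    case False
    then have "(\<lambda>s. ?B s $ i $ j) = (\<lambda>s. of_bool (i = j))" by (auto simp: block_matrix_def)
    then show ?thesis by (simp only: real_polynomial_function.intros(2))
  qed
  then have "real_polynomial_function (\<lambda>s. det (?B s))"
    unfolding det_def
    by (intro real_polynomial_function_sum real_polynomial_function.intros(4) real_polynomial_function_prod real_polynomial_function.intros(2)) auto
  then obtain a n where "(\<lambda>s. det (?B s)) = (\<lambda>s. \<Sum>i\<le>n. a i * s ^ i)"
    unfolding real_polynomial_function_iff_sum by blast
  then have an: "det (?B s) = (\<Sum>i\<le>n. a i * s ^ i)" for s by (rule fun_cong)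
  obtain c where c: "0 < c" "\<And>v. norm (block_matrix K X *v v) \<le> norm v * c"
    using bounded_linear.pos_bounded[of "(*v) (block_matrix K X)"] matrix_vector_mul_bounded_linear by blast
  \<comment> \<open>A kernel vector would be an eigenvector of the block for -2 c, although
    \<open>c\<close> bounds its operator norm; outside \<open>K\<close> the kernel equation makes
    the vector vanish.\<close>
  have "det (?B (2 * c)) \<noteq> 0"
  proof
    assume "det (?B (2 * c)) = 0"
    then obtain v where v: "v \<noteq> 0" "?B (2 * c) *v v = 0"
      using det_eq_0_imp_kernel by blast
    have "block_matrix K X *v v = (- 2 * c) *\<^sub>R v"
    proof (subst vec_eq_iff, rule allI)
      fix i
      have e: "(?B (2 * c) *v v) $ i = 0" using v by simp
      show "(block_matrix K X *v v) $ i = ((- 2 * c) *\<^sub>R v) $ i"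
      proof (cases "i \<in> K")
        case True
        then have "(\<Sum>j\<in>K. (2 * c * of_bool (i = j) + X (i, j)) * v $ j) = 0" using e by (simp add: block_matrix_vec)
        then have "(\<Sum>j\<in>K. 2 * c * of_bool (i = j) * v $ j) + (\<Sum>j\<in>K. X (i, j) * v $ j) = 0"
          by (simp add: distrib_right sum.distrib)
        moreover have "(\<Sum>j\<in>K. 2 * c * of_bool (i = j) * v $ j) = (\<Sum>j\<in>K. if j = i then 2 * c * v $ j else 0)"
          by (intro sum.cong) auto
        ultimately show ?thesis using True by (simp add: block_matrix_vec)
      next
        case False
        then show ?thesis using e by (simp add: block_matrix_vec)
      qed
    qed
    then have "2 * c * norm v \<le> norm v * c" using c(2)[of v] c(1) by simp
    moreover have "0 < norm v * c" using v(1) c(1) by simp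
    ultimately show False by (simp add: mult.commute)
  qed
  then have "\<exists>i\<le>n. a i \<noteq> 0" unfolding an by (metis (no_types, lifting) atMost_iff mult_zero_left sum.neutral)
  then have "finite {s. (\<Sum>i\<le>n. a i * s ^ i) = 0}" by (simp add: polyfun_finite_roots)
  then show ?thesis by (simp add: an)
qed

text \<open>Translating by multiples of the identity, all but finitely many of which make a given matrix
  invertible.\<close>

lemma AE_block_matrix_det:
  assumes KI: "K \<times> K \<subseteq> I"
  shows "AE X in leb_prod (I :: ('n::finite \<times> 'n) set). det (block_matrix K X) \<noteq> 0"
proof -
  note [measurable] = block_matrix_det_measurable[OF KI]
  interpret L: sigma_finite_measure "leb_prod I" by (rule sigma_finite_leb_prod) simp
  interpret P: pair_sigma_finite lborel "leb_prod I" ..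
  define B where "B X = (of_bool (det (block_matrix K X) = 0) :: ennreal)" for X :: "'n \<times> 'n \<Rightarrow> real"
  have [measurable]: "B \<in> borel_measurable (leb_prod I)" unfolding B_def of_bool_def by measurable
  define sh where "sh s X = (\<lambda>p\<in>I. s * of_bool (fst p = snd p) + X p)" for s :: real and X
  have shm[measurable]: "(\<lambda>w. sh (fst w) (snd w)) \<in> measurable (lborel \<Otimes>\<^sub>M leb_prod I) (leb_prod I)"
    unfolding sh_def
    by (intro measurable_restrict) (auto intro!: borel_measurable_add borel_measurable_times measurable_leb_prod_component[OF measurable_snd])
  have shB: "B (sh s X) = of_bool (det (block_matrix K (\<lambda>p. s * of_bool (fst p = snd p) + X p)) = 0)" for s X
    unfolding B_def sh_def by (subst block_matrix_cong[of K]) (use KI in auto)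
  have meas: "(\<lambda>(s, X). indicator {0..1::real} s * B (sh s X)) \<in> borel_measurable (lborel \<Otimes>\<^sub>M leb_prod I)"
    unfolding split_def by measurable
  have "(\<integral>\<^sup>+X. B X \<partial>leb_prod I) = (\<integral>\<^sup>+s. indicator {0..1::real} s * (\<integral>\<^sup>+X. B X \<partial>leb_prod I) \<partial>lborel)"
    by (subst nn_integral_multc) auto
  also have "\<dots> = (\<integral>\<^sup>+s. (\<integral>\<^sup>+X. indicator {0..1} s * B (sh s X) \<partial>leb_prod I) \<partial>lborel)"
  proof (rule nn_integral_cong)
    fix s :: real
    have [measurable]: "sh s \<in> measurable (leb_prod I) (leb_prod I)"
      using measurable_compose[OF measurable_Pair1'[of s lborel "leb_prod I"] shm] by simp
    have "(\<integral>\<^sup>+X. B (sh s X) \<partial>leb_prod I) = (\<integral>\<^sup>+X. B X \<partial>leb_prod I)"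
      unfolding sh_def by (rule nn_integral_leb_prod_translate) auto
    then show "indicator {0..1} s * (\<integral>\<^sup>+X. B X \<partial>leb_prod I) = (\<integral>\<^sup>+X. indicator {0..1} s * B (sh s X) \<partial>leb_prod I)"
      by (subst nn_integral_cmult) auto
  qed
  also have "\<dots> = (\<integral>\<^sup>+X. (\<integral>\<^sup>+s. indicator {0..1} s * B (sh s X) \<partial>lborel) \<partial>leb_prod I)"
    by (rule P.Fubini'[symmetric]) (rule meas)
  also have "\<dots> = (\<integral>\<^sup>+X. 0 \<partial>leb_prod I)"
  proof (rule nn_integral_cong)
    fix X
    have "AE s in lborel. s \<notin> {s. det (block_matrix K (\<lambda>p. s * of_bool (fst p = snd p) + X p)) = 0}"
      by (intro AE_not_in finite_imp_null_set_lborel block_matrix_shift_det_finite)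
    then have "(\<integral>\<^sup>+s. indicator {0..1} s * B (sh s X) \<partial>lborel) = (\<integral>\<^sup>+s. 0 \<partial>(lborel :: real measure))"
      by (intro nn_integral_cong_AE, eventually_elim) (simp add: shB)
    then show "(\<integral>\<^sup>+s. indicator {0..1} s * B (sh s X) \<partial>lborel) = 0" by simp
  qed
  finally have "AE X in leb_prod I. B X = 0" by (simp add: nn_integral_0_iff_AE)
  then show ?thesis by eventually_elim (simp add: B_def)
qed

lemma nn_integral_leb_prod_left_mult:
  fixes K :: "'n::finite set"
  assumes d: "det (block_matrix K S) \<noteq> 0" and R: "finite R" and g: "g \<in> borel_measurable (leb_prod (K \<times> R))"
  shows "ennreal \<bar>det (block_matrix K S)\<bar> ^ card R * (\<integral>\<^sup>+X. g (\<lambda>p\<in>K \<times> R. \<Sum>l\<in>K. S (fst p, l) * X (l, snd p)) \<partial>leb_prod (K \<times> R))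
     = (\<integral>\<^sup>+X. g X \<partial>leb_prod (K \<times> R))"
proof -
  let ?t = "\<lambda>y. \<lambda>i\<in>K. \<Sum>l\<in>K. S (i, l) * y l"
  have eq: "(\<lambda>p\<in>K \<times> R. ?t (\<lambda>i\<in>K. X (i, snd p)) (fst p)) = (\<lambda>p\<in>K \<times> R. \<Sum>l\<in>K. S (fst p, l) * X (l, snd p))" for X
    by (rule restrict_ext) auto
  have "?t \<in> measurable (leb_prod K) (leb_prod K)" by (intro measurable_restrict) measurable
  from nn_integral_leb_prod_columns[OF _ R this nn_integral_leb_prod_matrix[OF d] g]
  show ?thesis unfolding eq by simp
qed

text \<open>Transposition turns right multiplication into left multiplication, so that every row
  contributes one determinant.\<close>

lemma nn_integral_leb_prod_right_mult:
  fixes K :: "'n::finite set" and R :: "'r set"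
  assumes d: "det (block_matrix K Y) \<noteq> 0" and R: "finite R" and g: "g \<in> borel_measurable (leb_prod (R \<times> K))"
  shows "ennreal \<bar>det (block_matrix K Y)\<bar> ^ card R * (\<integral>\<^sup>+A. g (\<lambda>p\<in>R \<times> K. \<Sum>l\<in>K. A (fst p, l) * Y (l, snd p)) \<partial>leb_prod (R \<times> K))
     = (\<integral>\<^sup>+A. g A \<partial>leb_prod (R \<times> K))"
proof -
  have b: "bij_betw prod.swap (R \<times> K) (K \<times> R)" by (auto simp: bij_betw_def inj_on_def image_def)
  let ?s = "\<lambda>X. \<lambda>p\<in>R \<times> K. X (prod.swap p)"
  have [measurable]: "?s \<in> measurable (leb_prod (K \<times> R)) (leb_prod (R \<times> K))"
    by (intro measurable_restrict measurable_component_singleton) auto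
  have re: "(\<integral>\<^sup>+X. h (?s X) \<partial>leb_prod (K \<times> R)) = (\<integral>\<^sup>+A. h A \<partial>leb_prod (R \<times> K))"
    if "h \<in> borel_measurable (leb_prod (R \<times> K))" for h
    by (rule nn_integral_leb_prod_reindex[OF b]) (use R that in auto)
  let ?m = "\<lambda>A. \<lambda>p\<in>R \<times> K. \<Sum>l\<in>K. A (fst p, l) * Y (l, snd p)"
  let ?Yt = "\<lambda>p. Y (snd p, fst p)"
  have dt: "det (block_matrix K ?Yt) = det (block_matrix K Y)"
    by (simp only: block_matrix_transpose det_transpose)
  have [measurable]: "?m \<in> measurable (leb_prod (R \<times> K)) (leb_prod (R \<times> K))"
    by (intro measurable_restrict) (auto intro!: borel_measurable_sum borel_measurable_times leb_prod_component)
  have eq: "?m (?s X) = ?s (\<lambda>p\<in>K \<times> R. \<Sum>l\<in>K. ?Yt (fst p, l) * X (l, snd p))" for X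
    by (rule restrict_ext) (auto intro!: sum.cong simp: mult.commute)
  note [measurable] = g
  have "(\<integral>\<^sup>+A. g (?m A) \<partial>leb_prod (R \<times> K)) = (\<integral>\<^sup>+X. g (?m (?s X)) \<partial>leb_prod (K \<times> R))"
    by (rule re[symmetric]) measurable
  also have "\<dots> = (\<integral>\<^sup>+X. (\<lambda>X. g (?s X)) (\<lambda>p\<in>K \<times> R. \<Sum>l\<in>K. ?Yt (fst p, l) * X (l, snd p)) \<partial>leb_prod (K \<times> R))"
    by (simp only: eq)
  finally have "ennreal \<bar>det (block_matrix K Y)\<bar> ^ card R * (\<integral>\<^sup>+A. g (?m A) \<partial>leb_prod (R \<times> K))
     = (\<integral>\<^sup>+X. g (?s X) \<partial>leb_prod (K \<times> R))"
    using nn_integral_leb_prod_left_mult[of K ?Yt R "\<lambda>X. g (?s X)"] d R unfolding dt by simp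
  also have "\<dots> = (\<integral>\<^sup>+A. g A \<partial>leb_prod (R \<times> K))" by (rule re) measurable
  finally show ?thesis .
qed

text \<open>A rotation takes the graph to the coordinate plane. Composed with the parametrisation it
  becomes a linear map of the \<open>K\<close> coordinates, and \<open>S\<close> is its matrix,
  invertible since the parametrisation is injective.\<close>

lemma graph_isometry_ex:
  "\<exists>S. det (block_matrix K S) \<noteq> 0 \<and> (\<forall>y. norm (graph_pt K A y) = norm (coord_vec K (\<lambda>i. \<Sum>j\<in>K. S (i, j) * y j)))"
proof -
  have "dim (graph_plane K A) = dim (coord_plane K)"
    using graph_plane_linear_planes[of K A] by (simp add: linear_planes_iff dim_coord_plane)
  then obtain T where T: "orthogonal_transformation T" "T ` graph_plane K A = coord_plane K"
    using orthogonal_transformation_transitive[OF subspace_graph_plane subspace_coord_plane] by blast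
  have lin: "linear T" using T(1) by (rule orthogonal_transformation_linear)
  define S where "S p = T (graph_pt K A (\<lambda>l. of_bool (l = snd p))) $ fst p" for p
  have TS: "T (graph_pt K A y) = coord_vec K (\<lambda>i. \<Sum>j\<in>K. S (i, j) * y j)" for y
  proof (subst vec_eq_iff, rule allI)
    fix i
    have "graph_pt K A y = (\<Sum>j\<in>K. y j *\<^sub>R graph_pt K A (\<lambda>l. of_bool (l = j)))"
    proof (subst vec_eq_iff, rule allI)
      fix l
      have "(\<Sum>j\<in>K. y j * of_bool (l = j)) = y l" if "l \<in> K"
        using that by simp
      moreover have "(\<Sum>j\<in>K. A (l, j) * y j) = (\<Sum>j\<in>K. y j * (\<Sum>m\<in>K. A (l, m) * of_bool (m = j)))"
        by (intro sum.cong) (auto simp: mult.commute)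
      ultimately show "graph_pt K A y $ l = (\<Sum>j\<in>K. y j *\<^sub>R graph_pt K A (\<lambda>l. of_bool (l = j))) $ l"
        by simp
    qed
    then have "T (graph_pt K A y) = (\<Sum>j\<in>K. y j *\<^sub>R T (graph_pt K A (\<lambda>l. of_bool (l = j))))"
      by (simp add: linear_sum[OF lin] linear_scale[OF lin])
    then have "T (graph_pt K A y) $ i = (\<Sum>j\<in>K. S (i, j) * y j)"
      by (simp add: S_def mult.commute)
    moreover have "T (graph_pt K A y) $ i = 0" if "i \<notin> K"
    proof -
      have "T (graph_pt K A y) \<in> coord_plane K" unfolding T(2)[symmetric] graph_plane_def by auto
      then show ?thesis using that by (simp add: coord_plane_def)
    qed
    ultimately show "T (graph_pt K A y) $ i = coord_vec K (\<lambda>i. \<Sum>j\<in>K. S (i, j) * y j) $ i" by simp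
  qed
  have n: "norm (graph_pt K A y) = norm (coord_vec K (\<lambda>i. \<Sum>j\<in>K. S (i, j) * y j))" for y
    unfolding TS[symmetric] by (rule orthogonal_transformation_norm[OF T(1), symmetric])
  have "det (block_matrix K S) \<noteq> 0"
  proof
    assume "det (block_matrix K S) = 0"
    then obtain v where v: "v \<noteq> 0" "block_matrix K S *v v = 0"
      using det_eq_0_imp_kernel by blast
    have e: "(block_matrix K S *v v) $ i = 0" for i using v by simp
    have "coord_vec K (\<lambda>i. \<Sum>j\<in>K. S (i, j) * v $ j) = 0"
    proof (subst vec_eq_iff, rule allI)
      fix i show "coord_vec K (\<lambda>i. \<Sum>j\<in>K. S (i, j) * v $ j) $ i = 0 $ i"
        using e[of i] by (cases "i \<in> K") (simp_all add: block_matrix_vec)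
    qed
    then have z: "graph_pt K A (\<lambda>j. v $ j) = 0" using n[of "\<lambda>j. v $ j"] by simp
    have "v $ i = 0" for i
    proof (cases "i \<in> K")
      case True
      from z have "graph_pt K A (\<lambda>j. v $ j) $ i = 0" by simp
      with True show ?thesis by simp
    next
      case False
      with e[of i] show ?thesis by (simp add: block_matrix_vec)
    qed
    then show False using v(1) by (simp add: vec_eq_iff)
  qed
  with n show ?thesis by blast
qed

text \<open>Every admissible S satisfies S^T S = 1 + A^T A, so this is sqrt (det (1 + A^T A)), the
  volume factor of the parametrisation \<open>graph_pt\<close>.\<close>

definition graph_jacobian :: "'n::finite set \<Rightarrow> ('n \<times> 'n \<Rightarrow> real) \<Rightarrow> real" where
  "graph_jacobian K A = \<bar>det (block_matrix K (SOME S. det (block_matrix K S) \<noteq> 0 \<and>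
     (\<forall>y. norm (graph_pt K A y) = norm (coord_vec K (\<lambda>i. \<Sum>j\<in>K. S (i, j) * y j)))))\<bar>"

lemma graph_jacobian:
  obtains S where "det (block_matrix K S) \<noteq> 0" "\<And>y. norm (graph_pt K A y) = norm (coord_vec K (\<lambda>i. \<Sum>j\<in>K. S (i, j) * y j))"
    "graph_jacobian K A = \<bar>det (block_matrix K S)\<bar>"
  using someI_ex[OF graph_isometry_ex[of K A]] unfolding graph_jacobian_def by blast

lemma graph_jacobian_pos: "0 < graph_jacobian K A"
  by (rule graph_jacobian[of K A]) (simp only: zero_less_abs_iff not_False_eq_True)

definition graph_volume :: "'n::finite set \<Rightarrow> ('n \<times> 'n \<Rightarrow> real) \<Rightarrow> ennreal" where
  "graph_volume K A = (\<integral>\<^sup>+y. indicator {v. norm v \<le> 1} (graph_pt K A y) \<partial>leb_prod K)"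

text \<open>The substitution \<open>S\<close> turns the norm on the graph into the Euclidean norm.
  Read backwards, it expresses the Jacobian by an integral free of choices, from which its
  measurability follows.\<close>

lemma graph_volume: "ennreal (graph_jacobian K A) * graph_volume K A = coord_ball_volume K"
proof -
  obtain S where S: "det (block_matrix K S) \<noteq> 0" "\<And>y. norm (graph_pt K A y) = norm (coord_vec K (\<lambda>i. \<Sum>j\<in>K. S (i, j) * y j))"
    "graph_jacobian K A = \<bar>det (block_matrix K S)\<bar>" by (rule graph_jacobian[of K A]) (rule that)
  have c: "coord_vec K (\<lambda>i. \<Sum>j\<in>K. S (i, j) * y j) = coord_vec K (\<lambda>i\<in>K. \<Sum>j\<in>K. S (i, j) * y j)" for y
    by (simp add: vec_eq_iff)
  have "graph_volume K A = (\<integral>\<^sup>+y. (\<lambda>x. indicator {v. norm v \<le> 1} (coord_vec K x)) (\<lambda>i\<in>K. \<Sum>j\<in>K. S (i, j) * y j) \<partial>leb_prod K)"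
    unfolding graph_volume_def by (intro nn_integral_cong) (simp add: indicator_def S(2) c)
  moreover have "ennreal \<bar>det (block_matrix K S)\<bar> * (\<integral>\<^sup>+y. (\<lambda>x. indicator {v. norm v \<le> 1} (coord_vec K x)) (\<lambda>i\<in>K. \<Sum>j\<in>K. S (i, j) * y j) \<partial>leb_prod K)
    = (\<integral>\<^sup>+x. indicator {v. norm v \<le> 1} (coord_vec K x) \<partial>leb_prod K)"
    by (rule nn_integral_leb_prod_matrix[OF S(1)]) measurable
  ultimately show ?thesis
    unfolding S(3) nn_integral_coord_ball by (simp only:)
qed

text \<open>Up to normalisation this is the density, at the slopes \<open>A\<close>, of the span of
  card K independent vectors uniform in the unit ball. \<open>Y\<close> is the block of their
  coordinates in \<open>K\<close>, and the power of its determinant is the Jacobian of multiplying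
  slope matrices by Y on the right.\<close>

definition graph_weight :: "'n::finite set \<Rightarrow> ('n \<times> 'n \<Rightarrow> real) \<Rightarrow> ennreal" where
  "graph_weight K A = (\<integral>\<^sup>+Y. (\<Prod>j\<in>K. indicator {v. norm v \<le> 1} (graph_pt K A (\<lambda>i. Y (i, j))))
     * ennreal (\<bar>det (block_matrix K Y)\<bar> ^ card (-K)) \<partial>leb_prod (K \<times> K))"

lemma coord_vec_measurable':
  assumes "\<And>i. i \<in> K \<Longrightarrow> g i \<in> borel_measurable N"
  shows "(\<lambda>\<omega>. coord_vec K (\<lambda>i. g i \<omega>)) \<in> borel_measurable N"
  unfolding coord_vec_def
proof (rule borel_measurable_vec_lambda)
  fix i show "(\<lambda>\<omega>. if i \<in> K then g i \<omega> else 0) \<in> borel_measurable N"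
    by (cases "i \<in> K") (auto intro: assms)
qed

text \<open>Replace Y by S Y. The card K columns contribute |det S|^(card K), the determinant in the
  weight contributes |det S|^(card (-K)), and the constraints become those for zero slopes.\<close>

lemma graph_weight_jacobian:
  "ennreal (graph_jacobian K A) ^ CARD('n) * graph_weight K A = graph_weight (K :: 'n::finite set) (\<lambda>_. 0)"
proof -
  obtain S where S: "det (block_matrix K S) \<noteq> 0" "\<And>y. norm (graph_pt K A y) = norm (coord_vec K (\<lambda>i. \<Sum>j\<in>K. S (i, j) * y j))"
    "graph_jacobian K A = \<bar>det (block_matrix K S)\<bar>" by (rule graph_jacobian[of K A]) (rule that)
  have g0: "graph_pt K (\<lambda>_. 0) y = coord_vec K y" for y by (simp add: vec_eq_iff)
  define g where "g Y = (\<Prod>j\<in>K. indicator {v. norm v \<le> 1} (coord_vec K (\<lambda>i. Y (i, j))))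
     * ennreal (\<bar>det (block_matrix K Y)\<bar> ^ card (-K))" for Y
  let ?m = "\<lambda>Y. \<lambda>p\<in>K \<times> K. \<Sum>l\<in>K. S (fst p, l) * Y (l, snd p)"
  have [measurable]: "(\<lambda>Y. det (block_matrix K Y)) \<in> borel_measurable (leb_prod (K \<times> K))"
    by (rule block_matrix_det_measurable) simp
  have g[measurable]: "g \<in> borel_measurable (leb_prod (K \<times> K))"
  proof -
    have "(\<lambda>Y. coord_vec K (\<lambda>i. Y (i, j))) \<in> borel_measurable (leb_prod (K \<times> K))" if "j \<in> K" for j
      by (rule coord_vec_measurable') (use that in auto)
    then have "(\<lambda>Y. indicator {v. norm v \<le> 1} (coord_vec K (\<lambda>i. Y (i, j))) :: ennreal) \<in> borel_measurable (leb_prod (K \<times> K))" if "j \<in> K" for j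
      using that by (intro measurable_compose[OF _ borel_measurable_indicator]) auto
    then show ?thesis unfolding g_def
      by (intro borel_measurable_times_ennreal borel_measurable_prod_ennreal) auto
  qed
  have [measurable]: "?m \<in> measurable (leb_prod (K \<times> K)) (leb_prod (K \<times> K))"
    by (intro measurable_restrict) (auto intro!: borel_measurable_sum borel_measurable_times leb_prod_component)
  define D where "D = \<bar>det (block_matrix K S)\<bar>"
  have D: "0 \<le> D" by (simp add: D_def)
  have gm: "g (?m Y) = ennreal (D ^ card (-K)) * ((\<Prod>j\<in>K. indicator {v. norm v \<le> 1} (graph_pt K A (\<lambda>i. Y (i, j))))
     * ennreal (\<bar>det (block_matrix K Y)\<bar> ^ card (-K)))" for Y
  proof -
    have "coord_vec K (\<lambda>i. ?m Y (i, j)) = coord_vec K (\<lambda>i. \<Sum>l\<in>K. S (i, l) * Y (l, j))" if "j \<in> K" for j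
      using that by (simp add: vec_eq_iff)
    then have 1: "indicator {v. norm v \<le> 1} (coord_vec K (\<lambda>i. ?m Y (i, j))) = (indicator {v. norm v \<le> 1} (graph_pt K A (\<lambda>i. Y (i, j))) :: ennreal)" if "j \<in> K" for j
      using that by (simp add: indicator_def S(2))
    have "block_matrix K (?m Y) = block_matrix K (\<lambda>p. \<Sum>l\<in>K. S (fst p, l) * Y (l, snd p))"
      by (rule block_matrix_cong) simp
    then have 2: "det (block_matrix K (?m Y)) = det (block_matrix K S) * det (block_matrix K Y)"
      by (simp only: block_matrix_mult det_mul)
    have 3: "(\<Prod>j\<in>K. indicator {v. norm v \<le> 1} (coord_vec K (\<lambda>i. ?m Y (i, j)))) = (\<Prod>j\<in>K. indicator {v. norm v \<le> 1} (graph_pt K A (\<lambda>i. Y (i, j))) :: ennreal)"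
      by (rule prod.cong[OF refl 1])
    show ?thesis
      unfolding g_def 2 3 by (simp add: abs_mult power_mult_distrib ennreal_mult D_def mult_ac)
  qed
  have m: "(\<lambda>Y. (\<Prod>j\<in>K. indicator {v. norm v \<le> 1} (graph_pt K A (\<lambda>i. Y (i, j)))) * ennreal (\<bar>det (block_matrix K Y)\<bar> ^ card (-K))) \<in> borel_measurable (leb_prod (K \<times> K))"
  proof -
    have "(\<lambda>Y. graph_pt K A (\<lambda>i. Y (i, j))) \<in> borel_measurable (leb_prod (K \<times> K))" if "j \<in> K" for j
      unfolding graph_pt_def
    proof (rule borel_measurable_vec_lambda)
      fix i show "(\<lambda>Y. if i \<in> K then Y (i, j) else \<Sum>l\<in>K. A (i, l) * Y (l, j)) \<in> borel_measurable (leb_prod (K \<times> K))"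
        using that by (cases "i \<in> K") (auto intro!: borel_measurable_sum borel_measurable_times leb_prod_component)
    qed
    then have "(\<lambda>Y. indicator {v. norm v \<le> 1} (graph_pt K A (\<lambda>i. Y (i, j))) :: ennreal) \<in> borel_measurable (leb_prod (K \<times> K))" if "j \<in> K" for j
      using that by (intro measurable_compose[OF _ borel_measurable_indicator]) auto
    then show ?thesis
      by (intro borel_measurable_times_ennreal borel_measurable_prod_ennreal) auto
  qed
  have "graph_weight K (\<lambda>_. 0) = (\<integral>\<^sup>+Y. g Y \<partial>leb_prod (K \<times> K))"
    by (simp add: graph_weight_def g_def g0)
  also have "\<dots> = ennreal D ^ card K * (\<integral>\<^sup>+Y. g (?m Y) \<partial>leb_prod (K \<times> K))"
    unfolding D_def by (rule nn_integral_leb_prod_left_mult[OF S(1), symmetric]) simp_all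
  also have "(\<integral>\<^sup>+Y. g (?m Y) \<partial>leb_prod (K \<times> K)) = ennreal (D ^ card (-K)) * graph_weight K A"
    unfolding gm graph_weight_def by (rule nn_integral_cmult[OF m])
  also have "ennreal D ^ card K * (ennreal (D ^ card (-K)) * graph_weight K A) = ennreal D ^ (card K + card (-K)) * graph_weight K A"
    using D by (simp add: power_add ennreal_power mult.assoc)
  also have "card K + card (-K) = CARD('n)"
    by (metis Compl_partition Compl_disjoint card_Un_disjoint finite)
  finally show ?thesis unfolding S(3) D_def ..
qed

section \<open>An explicit invariant law: the span of random vectors\<close>

definition column_span :: "'n::finite set \<Rightarrow> ('n \<times> 'n \<Rightarrow> real) \<Rightarrow> (real^'n) set" where
  "column_span K X = range (\<lambda>v :: real^'n. \<Sum>j\<in>K. v $ j *\<^sub>R (\<chi> i. X (i, j)))"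

lemma column_span_linear_planes:
  fixes K :: "'n::finite set"
  assumes d: "det (block_matrix K X) \<noteq> 0"
  shows "column_span K X \<in> linear_planes (card K)"
proof -
  let ?L = "\<lambda>v :: real^'n. \<Sum>j\<in>K. v $ j *\<^sub>R (\<chi> i. X (i, j))"
  have lin: "linear ?L"
    by (rule linearI) (simp_all add: algebra_simps sum.distrib scaleR_right.sum)
  have Lc: "?L v = ?L (coord_vec K (\<lambda>i. v $ i))" for v by (intro sum.cong) auto
  then have img: "column_span K X = ?L ` coord_plane K"
    unfolding column_span_def range_coord_vec[symmetric] image_image
  proof (intro equalityI subsetI)
    fix x assume "x \<in> range ?L"
    then obtain v where "x = ?L (coord_vec K (\<lambda>i. v $ i))" using Lc by blast
    then show "x \<in> range (\<lambda>y. ?L (coord_vec K y))" by blast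
  next
    fix x assume "x \<in> range (\<lambda>y. ?L (coord_vec K y))"
    then show "x \<in> range ?L" by blast
  qed
  have "inj_on ?L (coord_plane K)"
  proof (rule inj_onI)
    fix v w assume v: "v \<in> coord_plane K" "w \<in> coord_plane K" "?L v = ?L w"
    have "block_matrix K X *v (v - w) = 0"
    proof (subst vec_eq_iff, rule allI)
      fix i
      have "?L v $ i = ?L w $ i" using v(3) by simp
      then have "(\<Sum>j\<in>K. X (i, j) * (v - w) $ j) = 0" by (simp add: algebra_simps sum_subtractf)
      then show "(block_matrix K X *v (v - w)) $ i = 0 $ i"
        using v(1,2) by (simp add: block_matrix_vec coord_plane_def)
    qed
    moreover have "invertible (block_matrix K X)" using d by (simp add: invertible_det_nz)
    ultimately have "v - w = 0" by (metis invertible_def matrix_left_invertible_ker)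
    then show "v = w" by simp
  qed
  then have "dim (column_span K X) = card K"
    unfolding img using dim_image_eq[OF lin, of "coord_plane K"] subspace_coord_plane[of K]
    by (simp add: span_eq_iff[THEN iffD2] dim_coord_plane)
  moreover have "subspace (column_span K X)"
    unfolding column_span_def by (intro linear_subspace_image lin subspace_UNIV)
  ultimately show ?thesis by (simp add: linear_planes_iff)
qed

text \<open>Matrices with a singular \<open>K\<close> block form a null set. They get an arbitrary
  linear plane as value, so that the map is defined everywhere.\<close>

definition column_span' :: "'n::finite set \<Rightarrow> ('n \<times> 'n \<Rightarrow> real) \<Rightarrow> (real^'n) set" where
  "column_span' K X = (if det (block_matrix K X) \<noteq> 0 then column_span K X else coord_plane K)"

lemma column_span'_linear_planes: "column_span' K X \<in> linear_planes (card K)"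
  using column_span_linear_planes[of K X]
  by (auto simp: column_span'_def linear_planes_iff subspace_coord_plane dim_coord_plane)

lemma column_measurable:
  assumes "j \<in> K"
  shows "(\<lambda>X. \<chi> i. X (i, j)) \<in> borel_measurable (leb_prod ((UNIV :: 'n::finite set) \<times> K))"
  by (rule borel_measurable_vec_lambda) (use assms in auto)

lemma column_span'_measurable:
  "column_span' (K :: 'n::finite set) \<in> measurable (leb_prod (UNIV \<times> K)) (plane_algebra (linear_planes (card K)))"
proof (rule measurable_plane_algebra_selections[where p="\<lambda>n X. if det (block_matrix K X) \<noteq> 0
     then \<Sum>j\<in>K. dense_seq n $ j *\<^sub>R (\<chi> i. X (i, j)) else coord_vec K (\<lambda>i. dense_seq n $ i)"])
  have [measurable]: "(\<lambda>Y. det (block_matrix K Y)) \<in> borel_measurable (leb_prod (UNIV \<times> K))"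
    by (rule block_matrix_det_measurable) auto
  show "(\<lambda>X. if det (block_matrix K X) \<noteq> 0 then \<Sum>j\<in>K. dense_seq n $ j *\<^sub>R (\<chi> i. X (i, j)) else coord_vec K (\<lambda>i. dense_seq n $ i))
     \<in> borel_measurable (leb_prod (UNIV \<times> K))" for n
    by (intro measurable_If borel_measurable_sum borel_measurable_scaleR column_measurable) auto
  show "(if det (block_matrix K X) \<noteq> 0 then \<Sum>j\<in>K. dense_seq n $ j *\<^sub>R (\<chi> i. X (i, j)) else coord_vec K (\<lambda>i. dense_seq n $ i)) \<in> column_span' K X" for n X
    using range_coord_vec[of K] by (auto simp: column_span'_def column_span_def)
  fix X :: "'n \<times> 'n \<Rightarrow> real"
  have l1: "linear (\<lambda>v :: real^'n. \<Sum>j\<in>K. v $ j *\<^sub>R (\<chi> i. X (i, j)))"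
    by (rule linearI) (simp_all add: algebra_simps sum.distrib scaleR_right.sum)
  have l2: "linear (\<lambda>v :: real^'n. coord_vec K (\<lambda>i. v $ i))"
    by (rule linearI) (simp_all add: vec_eq_iff)
  have r: "coord_plane K = range (\<lambda>v :: real^'n. coord_vec K (\<lambda>i. v $ i))"
  proof -
    have "coord_vec K y = coord_vec K (\<lambda>i. (\<chi> i. y i) $ i)" for y by simp
    then show ?thesis unfolding range_coord_vec[symmetric] by fast
  qed
  show "column_span' K X \<subseteq> closure (range (\<lambda>n. if det (block_matrix K X) \<noteq> 0
     then \<Sum>j\<in>K. dense_seq n $ j *\<^sub>R (\<chi> i. X (i, j)) else coord_vec K (\<lambda>i. dense_seq n $ i)))"
  proof (cases "det (block_matrix K X) \<noteq> 0")
    case True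
    then show ?thesis
      using image_subset_closure_dense_seq[of "\<lambda>v :: real^'n. \<Sum>j\<in>K. v $ j *\<^sub>R (\<chi> i. X (i, j))"] l1
      by (simp add: column_span'_def column_span_def linear_conv_bounded_linear linear_continuous_on)
  next
    case False
    then show ?thesis
      using image_subset_closure_dense_seq[of "\<lambda>v :: real^'n. coord_vec K (\<lambda>i. v $ i)"] l2
      by (simp add: column_span'_def r linear_conv_bounded_linear linear_continuous_on)
  qed
qed (rule column_span'_linear_planes)

definition column_ball :: "'n::finite set \<Rightarrow> ('n \<times> 'n \<Rightarrow> real) \<Rightarrow> ennreal" where
  "column_ball K X = (\<Prod>j\<in>K. indicator {v. norm v \<le> 1} (\<chi> i. X (i, j)))"

lemma column_ball_measurable [measurable]: "column_ball K \<in> borel_measurable (leb_prod (UNIV \<times> K))"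
  unfolding column_ball_def
  by (intro borel_measurable_prod_ennreal measurable_compose[OF column_measurable borel_measurable_indicator]) auto

text \<open>The unnormalised expectation of \<open>\<Phi>\<close> at the plane spanned by card K
  independent vectors, each uniform in the unit ball.\<close>

definition column_law :: "'n::finite set \<Rightarrow> ((real^'n) set \<Rightarrow> ennreal) \<Rightarrow> ennreal" where
  "column_law K \<Phi> = (\<integral>\<^sup>+X. \<Phi> (column_span' K X) * column_ball K X \<partial>leb_prod (UNIV \<times> K))"

text \<open>Split the matrix of column vectors into its \<open>K\<close> block Y and the rest Z, and
  write Z = A Y. For fixed invertible Y this substitution has Jacobian |det Y|^(card (-K)), and the
  columns span the graph with slopes A.\<close>

lemma nn_integral_graph_weight:
  fixes K :: "'n::finite set"
  assumes K: "K \<noteq> UNIV" and \<Phi>: "\<Phi> \<in> borel_measurable (plane_algebra (linear_planes (card K)))"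
  shows "(\<integral>\<^sup>+A. \<Phi> (graph_plane K A) * graph_weight K A \<partial>leb_prod ((-K) \<times> K)) = column_law K \<Phi>"
proof -
  let ?MA = "leb_prod ((-K) \<times> K)" and ?MY = "leb_prod (K \<times> K)"
  interpret LA: sigma_finite_measure ?MA by (rule sigma_finite_leb_prod) simp
  interpret LY: sigma_finite_measure ?MY by (rule sigma_finite_leb_prod) simp
  interpret P: pair_sigma_finite ?MA ?MY ..
  have n0: "card (-K) \<noteq> 0" using K by auto
  have [measurable]: "(\<lambda>Y. det (block_matrix K Y)) \<in> borel_measurable ?MY"
    by (rule block_matrix_det_measurable) auto
  have [measurable]: "(\<lambda>A. \<Phi> (graph_plane K A)) \<in> borel_measurable ?MA"
    by (rule measurable_compose[OF graph_plane_measurable \<Phi>])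
  define u where "u A Y = (\<Prod>j\<in>K. indicator {v. norm v \<le> 1} (graph_pt K A (\<lambda>i. Y (i, j))))
     * ennreal (\<bar>det (block_matrix K Y)\<bar> ^ card (-K))" for A Y
  have u[measurable]: "(\<lambda>w. u (fst w) (snd w)) \<in> borel_measurable (?MA \<Otimes>\<^sub>M ?MY)"
  proof -
    have "(\<lambda>w. graph_pt K (fst w) (\<lambda>i. snd w (i, j))) \<in> borel_measurable (?MA \<Otimes>\<^sub>M ?MY)" if "j \<in> K" for j
      by (rule graph_pt_measurable) (auto intro!: measurable_leb_prod_component[OF measurable_snd] that)
    then have "(\<lambda>w. indicator {v. norm v \<le> 1} (graph_pt K (fst w) (\<lambda>i. snd w (i, j))) :: ennreal) \<in> borel_measurable (?MA \<Otimes>\<^sub>M ?MY)" if "j \<in> K" for j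
      using that by (intro measurable_compose[OF _ borel_measurable_indicator]) auto
    then show ?thesis unfolding u_def
      by (intro borel_measurable_times_ennreal borel_measurable_prod_ennreal) auto
  qed
  have uA: "u A \<in> borel_measurable ?MY" if "A \<in> space ?MA" for A
    using measurable_compose[OF measurable_Pair1'[OF that] u] by simp
  have uY: "(\<lambda>A. u A Y) \<in> borel_measurable ?MA" if "Y \<in> space ?MY" for Y
    using measurable_compose[OF measurable_Pair2'[OF that] u] by simp
  define G where "G X = \<Phi> (column_span' K X) * column_ball K X" for X
  have UK: "K \<times> K \<union> (-K) \<times> K = UNIV \<times> K" by auto
  have G: "G \<in> borel_measurable (leb_prod (K \<times> K \<union> (-K) \<times> K))"
    unfolding UK G_def using measurable_compose[OF column_span'_measurable \<Phi>] by measurable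
  have "(\<integral>\<^sup>+A. \<Phi> (graph_plane K A) * graph_weight K A \<partial>?MA) = (\<integral>\<^sup>+A. (\<integral>\<^sup>+Y. \<Phi> (graph_plane K A) * u A Y \<partial>?MY) \<partial>?MA)"
    unfolding graph_weight_def u_def[symmetric] by (intro nn_integral_cong nn_integral_cmult[symmetric] uA)
  also have "\<dots> = (\<integral>\<^sup>+Y. (\<integral>\<^sup>+A. \<Phi> (graph_plane K A) * u A Y \<partial>?MA) \<partial>?MY)"
    by (rule P.Fubini'[symmetric]) (simp add: split_def)
  also have "\<dots> = (\<integral>\<^sup>+Y. (\<integral>\<^sup>+Z. G (merge (K \<times> K) ((-K) \<times> K) (Y, Z)) \<partial>?MA) \<partial>?MY)"
  proof (rule nn_integral_cong_AE)
    have "AE Y in ?MY. det (block_matrix K Y) \<noteq> 0" by (rule AE_block_matrix_det) simp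
    then show "AE Y in ?MY. (\<integral>\<^sup>+A. \<Phi> (graph_plane K A) * u A Y \<partial>?MA) = (\<integral>\<^sup>+Z. G (merge (K \<times> K) ((-K) \<times> K) (Y, Z)) \<partial>?MA)"
      using AE_space
    proof eventually_elim
      case (elim Y)
      let ?mg = "\<lambda>Z. merge (K \<times> K) ((-K) \<times> K) (Y, Z)"
      let ?m = "\<lambda>A. \<lambda>p\<in>(-K) \<times> K. \<Sum>l\<in>K. A (fst p, l) * Y (l, snd p)"
      have Gm: "(\<lambda>Z. G (?mg Z)) \<in> borel_measurable ?MA"
        by (rule measurable_compose[OF _ G], rule measurable_compose[OF measurable_Pair1'[OF elim(2)] measurable_merge])
      \<comment> \<open>The columns of the matrix with blocks Y and A Y are the graph points over
        the columns of Y. They span the whole graph because Y is invertible.\<close>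
      have eq: "ennreal \<bar>det (block_matrix K Y)\<bar> ^ card (-K) * G (?mg (?m A)) = \<Phi> (graph_plane K A) * u A Y" for A
      proof -
        let ?X = "?mg (?m A)"
        have X: "?X (i, j) = graph_pt K A (\<lambda>i. Y (i, j)) $ i" if "j \<in> K" for i j
          using that by (simp add: merge_def)
        have col: "(\<chi> i. ?X (i, j)) = graph_pt K A (\<lambda>i. Y (i, j))" if "j \<in> K" for j
          using X[OF that] by (simp add: vec_eq_iff)
        have bm: "block_matrix K ?X = block_matrix K Y"
          by (rule block_matrix_cong, subst X) simp_all
        have "column_span K ?X = range (\<lambda>v :: real^'n. graph_pt K A (\<lambda>i. (block_matrix K Y *v v) $ i))"
        proof -
          have "(\<Sum>j\<in>K. v $ j *\<^sub>R (\<chi> i. ?X (i, j))) = graph_pt K A (\<lambda>i. (block_matrix K Y *v v) $ i)" for v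
          proof (subst vec_eq_iff, rule allI)
            fix i
            have "(\<Sum>j\<in>K. v $ j *\<^sub>R (\<chi> i. ?X (i, j))) = (\<Sum>j\<in>K. v $ j *\<^sub>R graph_pt K A (\<lambda>i. Y (i, j)))"
              by (intro sum.cong refl) (simp only: col)
            then have "(\<Sum>j\<in>K. v $ j *\<^sub>R (\<chi> i. ?X (i, j))) $ i = (\<Sum>j\<in>K. v $ j *\<^sub>R graph_pt K A (\<lambda>i. Y (i, j))) $ i"
              by (simp only:)
            also have "\<dots> = (\<Sum>j\<in>K. v $ j * graph_pt K A (\<lambda>i. Y (i, j)) $ i)" by simp
            also have "\<dots> = graph_pt K A (\<lambda>i. (block_matrix K Y *v v) $ i) $ i"
            proof (cases "i \<in> K")
              case True
              then show ?thesis by (simp add: block_matrix_vec mult.commute)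
            next
              case False
              have "(\<Sum>j\<in>K. v $ j * (\<Sum>l\<in>K. A (i, l) * Y (l, j))) = (\<Sum>l\<in>K. A (i, l) * (\<Sum>j\<in>K. Y (l, j) * v $ j))"
                unfolding sum_distrib_left by (subst sum.swap) (simp add: mult_ac)
              then show ?thesis using False by (simp add: block_matrix_vec)
            qed
            finally show "(\<Sum>j\<in>K. v $ j *\<^sub>R (\<chi> i. ?X (i, j))) $ i = graph_pt K A (\<lambda>i. (block_matrix K Y *v v) $ i) $ i" .
          qed
          then show ?thesis unfolding column_span_def by simp
        qed
        also have "\<dots> = graph_plane K A"
        proof -
          have "surj ((*v) (block_matrix K Y))"
            using elim(1) by (metis invertible_det_nz invertible_right_inverse matrix_right_invertible_surjective)
          then have "range (\<lambda>v. (\<lambda>w :: real^'n. graph_pt K A (\<lambda>i. w $ i)) (block_matrix K Y *v v)) = range (\<lambda>w :: real^'n. graph_pt K A (\<lambda>i. w $ i))"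
            by (metis (no_types) image_image)
          then show ?thesis by (simp add: graph_plane_eq)
        qed
        finally have "column_span' K ?X = graph_plane K A"
          unfolding column_span'_def bm using elim(1) by (simp only: if_True not_False_eq_True)
        moreover have "column_ball K ?X = (\<Prod>j\<in>K. indicator {v. norm v \<le> 1} (graph_pt K A (\<lambda>i. Y (i, j))))"
          unfolding column_ball_def by (intro prod.cong) (simp_all only: col)
        ultimately show ?thesis
          unfolding G_def u_def by (simp only: ennreal_power[OF abs_ge_zero] mult_ac)
      qed
      have mm: "?m \<in> measurable ?MA ?MA"
        by (intro measurable_restrict) (auto intro!: borel_measurable_sum borel_measurable_times leb_prod_component)
      have "(\<integral>\<^sup>+A. \<Phi> (graph_plane K A) * u A Y \<partial>?MA) = (\<integral>\<^sup>+A. ennreal \<bar>det (block_matrix K Y)\<bar> ^ card (-K) * G (?mg (?m A)) \<partial>?MA)"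
        by (simp only: eq)
      also have "\<dots> = ennreal \<bar>det (block_matrix K Y)\<bar> ^ card (-K) * (\<integral>\<^sup>+A. (\<lambda>Z. G (?mg Z)) (?m A) \<partial>?MA)"
        by (rule nn_integral_cmult) (rule measurable_compose[OF mm Gm])
      also have "\<dots> = (\<integral>\<^sup>+Z. G (?mg Z) \<partial>?MA)"
        by (rule nn_integral_leb_prod_right_mult[OF elim(1) _ Gm]) simp
      finally show ?case .
    qed
  qed
  also have "\<dots> = (\<integral>\<^sup>+X. G X \<partial>leb_prod (K \<times> K \<union> (-K) \<times> K))"
    by (rule leb_prod.product_nn_integral_fold[symmetric]) (use G in auto)
  finally show ?thesis unfolding UK G_def column_law_def .
qed

text \<open>An orthogonal map acts on every column with determinant of modulus one, preserves the
  unit ball, and moves the span along.\<close>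

lemma column_law_invariant:
  fixes K :: "'n::finite set"
  assumes T: "orthogonal_transformation T" and \<Phi>: "\<Phi> \<in> borel_measurable (plane_algebra (linear_planes (card K)))"
  shows "column_law K (\<lambda>P. \<Phi> (T ` P)) = column_law K \<Phi>"
proof -
  let ?L = "leb_prod (UNIV \<times> K) :: ('n \<times> 'n \<Rightarrow> real) measure"
  have lin: "linear T" and om: "orthogonal_matrix (matrix T)" using T by (auto simp: orthogonal_transformation_matrix)
  define S where "S p = matrix T $ fst p $ snd p" for p
  have bS: "block_matrix UNIV S = matrix T" by (simp add: vec_eq_iff block_matrix_def S_def)
  have dT: "\<bar>det (matrix T)\<bar> = 1" using det_orthogonal_matrix[OF om] by auto
  let ?m = "\<lambda>X. \<lambda>p\<in>UNIV \<times> K. \<Sum>l\<in>UNIV. S (fst p, l) * X (l, snd p)"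
  have inv: "(\<integral>\<^sup>+X. g (?m X) \<partial>?L) = (\<integral>\<^sup>+X. g X \<partial>?L)" if "g \<in> borel_measurable ?L" for g
    using nn_integral_leb_prod_left_mult[of UNIV S K g] that dT unfolding bS by force
  have mm: "?m \<in> measurable ?L ?L"
    by (intro measurable_restrict) (auto intro!: borel_measurable_sum borel_measurable_times leb_prod_component)
  have col: "(\<chi> i. ?m X (i, j)) = T (\<chi> i. X (i, j))" if "j \<in> K" for X j
  proof -
    have "T (\<chi> i. X (i, j)) = matrix T *v (\<chi> i. X (i, j))" by (simp add: matrix_works lin)
    then show ?thesis using that by (simp add: vec_eq_iff matrix_vector_mult_def S_def)
  qed
  have ball: "column_ball K (?m X) = column_ball K X" for X
    unfolding column_ball_def by (intro prod.cong refl) (simp only: col indicator_def mem_Collect_eq orthogonal_transformation_norm[OF T])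
  have span: "column_span K (?m X) = T ` column_span K X" for X
  proof -
    have "(\<Sum>j\<in>K. v $ j *\<^sub>R (\<chi> i. ?m X (i, j))) = T (\<Sum>j\<in>K. v $ j *\<^sub>R (\<chi> i. X (i, j)))" for v :: "real^'n"
      unfolding linear_sum[OF lin] by (intro sum.cong refl) (simp only: col linear_scale[OF lin])
    then show ?thesis unfolding column_span_def image_image by simp
  qed
  have dm: "(\<lambda>Y. det (block_matrix K Y)) \<in> borel_measurable ?L" by (rule block_matrix_det_measurable) auto
  have ae: "AE X in ?L. det (block_matrix K X) \<noteq> 0" by (rule AE_block_matrix_det) auto
  \<comment> \<open>The rotated matrix has the same law, so its \<open>K\<close> block is almost
    surely invertible too and the default value plays no part on either side.\<close>
  have ae2: "AE X in ?L. det (block_matrix K (?m X)) \<noteq> 0"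
  proof -
    define B where "B X = (of_bool (det (block_matrix K X) = 0) :: ennreal)" for X
    have B: "B \<in> borel_measurable ?L" unfolding B_def of_bool_def using dm by measurable
    have "(\<integral>\<^sup>+X. B (?m X) \<partial>?L) = (\<integral>\<^sup>+X. B X \<partial>?L)" by (rule inv[OF B])
    also have "\<dots> = (\<integral>\<^sup>+X. 0 \<partial>?L)" by (intro nn_integral_cong_AE, use ae in eventually_elim) (simp add: B_def)
    finally have "AE X in ?L. B (?m X) = 0" using measurable_compose[OF mm B] by (simp add: nn_integral_0_iff_AE)
    then show ?thesis by eventually_elim (simp add: B_def)
  qed
  have "column_law K \<Phi> = (\<integral>\<^sup>+X. \<Phi> (column_span' K (?m X)) * column_ball K (?m X) \<partial>?L)"
    unfolding column_law_def
    by (rule inv[symmetric]) (intro borel_measurable_times_ennreal column_ball_measurable measurable_compose[OF column_span'_measurable \<Phi>])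
  also have "\<dots> = column_law K (\<lambda>P. \<Phi> (T ` P))"
    unfolding column_law_def using ae ae2
    by (intro nn_integral_cong_AE, eventually_elim) (simp only: ball column_span'_def span if_True not_False_eq_True)
  finally show ?thesis ..
qed

text \<open>The product of unit balls lies between two cubes of positive finite volume, so the law
  can be normalised.\<close>

lemma column_law_one:
  fixes K :: "'n::finite set"
  shows "0 < column_law K (\<lambda>_. 1)" "column_law K (\<lambda>_. 1) < \<infinity>"
proof -
  let ?L = "leb_prod (UNIV \<times> K) :: ('n \<times> 'n \<Rightarrow> real) measure"
  have eq: "column_law K (\<lambda>_. 1) = (\<integral>\<^sup>+X. column_ball K X \<partial>?L)" by (simp add: column_law_def)
  have box: "emeasure ?L (Pi\<^sub>E (UNIV \<times> K) (\<lambda>_. {-e..e})) = ennreal ((2 * e) ^ card ((UNIV :: 'n set) \<times> K))" if "0 \<le> e" for e :: real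
    using emeasure_leb_prod_box[of "(UNIV :: 'n set) \<times> K" e] that by (simp only: ennreal_power) (simp add: ennreal_power)
  have boxm: "Pi\<^sub>E (UNIV \<times> K) (\<lambda>_. {-e..e}) \<in> sets ?L" for e :: real
    by (intro sets_PiM_I_finite) auto
  define e where "e = 1 / real CARD('n)"
  have e: "0 < e" by (simp add: e_def)
  have "0 < ennreal ((2 * e) ^ card ((UNIV :: 'n set) \<times> K))" using e by simp
  also have "\<dots> = (\<integral>\<^sup>+X. indicator (Pi\<^sub>E (UNIV \<times> K) (\<lambda>_. {-e..e})) X \<partial>?L)"
    using e box[of e] boxm by (simp del: Sigma_empty1)
  also have "\<dots> \<le> (\<integral>\<^sup>+X. column_ball K X \<partial>?L)"
  proof (rule nn_integral_mono)
    fix X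
    show "indicator (Pi\<^sub>E (UNIV \<times> K) (\<lambda>_. {-e..e})) X \<le> column_ball K X"
    proof (cases "X \<in> Pi\<^sub>E (UNIV \<times> K) (\<lambda>_. {-e..e})")
      case True
      have "norm (\<chi> i. X (i, j)) \<le> 1" if "j \<in> K" for j
      proof -
        have "\<bar>(\<chi> i. X (i, j)) $ i\<bar> \<le> e" for i using PiE_mem[OF True, of "(i, j)"] that by (simp add: abs_le_iff)
        from norm_vec_le_card[OF this] show ?thesis by (simp add: e_def)
      qed
      then show ?thesis using True by (simp add: column_ball_def)
    qed simp
  qed
  finally show "0 < column_law K (\<lambda>_. 1)" unfolding eq .
  have "(\<integral>\<^sup>+X. column_ball K X \<partial>?L) \<le> (\<integral>\<^sup>+X. indicator (Pi\<^sub>E (UNIV \<times> K) (\<lambda>_. {-1..1})) X \<partial>?L)"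
  proof (rule nn_integral_mono)
    fix X assume X: "X \<in> space ?L"
    show "column_ball K X \<le> indicator (Pi\<^sub>E (UNIV \<times> K) (\<lambda>_. {-1..1})) X"
    proof (cases "\<forall>j\<in>K. norm (\<chi> i. X (i, j)) \<le> 1")
      case True
      have "\<bar>X (i, j)\<bar> \<le> 1" if "j \<in> K" for i j
        using component_le_norm_cart[of "\<chi> i. X (i, j)" i] True that by force
      then have "X \<in> Pi\<^sub>E (UNIV \<times> K) (\<lambda>_. {-1..1})"
        using X by (auto simp: space_PiM PiE_iff abs_le_iff)
      then show ?thesis using True by (simp add: column_ball_def)
    next
      case False
      then have "column_ball K X = 0" unfolding column_ball_def by (auto simp: indicator_def)
      then show ?thesis by simp
    qed
  qed
  also have "\<dots> < \<infinity>" using box[of 1] boxm by simp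
  finally show "column_law K (\<lambda>_. 1) < \<infinity>" unfolding eq .
qed

lemma graph_weight_measurable:
  fixes K :: "'n::finite set"
  shows "graph_weight K \<in> borel_measurable (leb_prod ((-K) \<times> K))"
proof -
  let ?MA = "leb_prod ((-K) \<times> K)" and ?MY = "leb_prod (K \<times> K)"
  interpret LY: sigma_finite_measure ?MY by (rule sigma_finite_leb_prod) simp
  have [measurable]: "(\<lambda>Y. det (block_matrix K Y)) \<in> borel_measurable ?MY"
    by (rule block_matrix_det_measurable) auto
  have "(\<lambda>w. graph_pt K (fst w) (\<lambda>i. snd w (i, j))) \<in> borel_measurable (?MA \<Otimes>\<^sub>M ?MY)" if "j \<in> K" for j
    by (rule graph_pt_measurable) (auto intro!: measurable_leb_prod_component[OF measurable_snd] that)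
  then have "(\<lambda>w. indicator {v. norm v \<le> 1} (graph_pt K (fst w) (\<lambda>i. snd w (i, j))) :: ennreal) \<in> borel_measurable (?MA \<Otimes>\<^sub>M ?MY)" if "j \<in> K" for j
    using that by (intro measurable_compose[OF _ borel_measurable_indicator]) auto
  then have "(\<lambda>w. (\<Prod>j\<in>K. indicator {v. norm v \<le> 1} (graph_pt K (fst w) (\<lambda>i. snd w (i, j)))) * ennreal (\<bar>det (block_matrix K (snd w))\<bar> ^ card (-K))) \<in> borel_measurable (?MA \<Otimes>\<^sub>M ?MY)"
    by (intro borel_measurable_times_ennreal borel_measurable_prod_ennreal) auto
  from LY.borel_measurable_nn_integral_fst[OF this] show ?thesis
    unfolding graph_weight_def by simp
qed

text \<open>The normalised column law is an invariant probability, so uniqueness identifies it with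
  \<open>\<mu>\<close>; its density in the slopes is already known.\<close>

theorem nn_integral_invariant_plane_prob:
  fixes K :: "'n::finite set"
  assumes K: "K \<noteq> UNIV" and \<mu>: "invariant_plane_prob (card K) \<mu>"
    and \<Phi>: "\<Phi> \<in> borel_measurable (plane_algebra (linear_planes (card K)))"
  shows "column_law K (\<lambda>_. 1) * (\<integral>\<^sup>+P. \<Phi> P \<partial>\<mu>) = (\<integral>\<^sup>+A. \<Phi> (graph_plane K A) * graph_weight K A \<partial>leb_prod ((-K) \<times> K))"
proof -
  let ?c = "column_law K (\<lambda>_. 1)" and ?A = "plane_algebra (linear_planes (card K)) :: (real^'n) set measure"
  let ?MA = "leb_prod ((-K) \<times> K)"
  have c: "?c \<noteq> 0" "?c \<noteq> \<infinity>" using column_law_one[of K] by auto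
  note [measurable] = graph_weight_measurable graph_plane_measurable
  define \<nu> where "\<nu> = distr (density ?MA (\<lambda>A. graph_weight K A / ?c)) ?A (graph_plane K)"
  have int: "?c * (\<integral>\<^sup>+P. \<Phi> P \<partial>\<nu>) = column_law K \<Phi>" if [measurable]: "\<Phi> \<in> borel_measurable ?A" for \<Phi>
  proof -
    have "(\<integral>\<^sup>+P. \<Phi> P \<partial>\<nu>) = (\<integral>\<^sup>+A. graph_weight K A / ?c * \<Phi> (graph_plane K A) \<partial>?MA)"
      unfolding \<nu>_def by (subst nn_integral_distr, simp, simp, subst nn_integral_density) auto
    then have "?c * (\<integral>\<^sup>+P. \<Phi> P \<partial>\<nu>) = (\<integral>\<^sup>+A. ?c * (graph_weight K A / ?c * \<Phi> (graph_plane K A)) \<partial>?MA)"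
      by (subst nn_integral_cmult) auto
    also have "\<dots> = (\<integral>\<^sup>+A. \<Phi> (graph_plane K A) * graph_weight K A \<partial>?MA)"
      by (simp only: mult.assoc[symmetric] ennreal_mult_divide_cancel[OF c] mult.commute)
    also have "\<dots> = column_law K \<Phi>" by (rule nn_integral_graph_weight[OF K that])
    finally show ?thesis .
  qed
  have s: "sets \<nu> = sets ?A" by (simp add: \<nu>_def)
  have sp: "space \<nu> = linear_planes (card K)" by (simp add: \<nu>_def)
  have "?c * emeasure \<nu> (space \<nu>) = ?c * 1" using int[of "\<lambda>_. 1"] by simp
  \<comment> \<open>The density was divided by the total mass of the column law.\<close>
  then have e1: "emeasure \<nu> (space \<nu>) = 1" using c by (metis ennreal_mult_cancel_left infinity_ennreal_def)
  have inv: "invariant_plane_prob (card K) \<nu>"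
  proof -
    have "distr \<nu> \<nu> (\<lambda>P. T ` P) = \<nu>" if T: "orthogonal_transformation T" for T
    proof (rule measure_eqI)
      have m: "(\<lambda>P. T ` P) \<in> measurable \<nu> \<nu>"
        using invariant_plane_prob_transform[OF \<mu> T] \<mu> s
        unfolding invariant_plane_prob_def by (metis measurable_cong_sets)
      then have m': "(\<lambda>P. T ` P) \<in> measurable ?A ?A" using measurable_cong_sets[OF s s] by blast
      show "sets (distr \<nu> \<nu> (\<lambda>P. T ` P)) = sets \<nu>" by simp
      fix B assume "B \<in> sets (distr \<nu> \<nu> (\<lambda>P. T ` P))"
      then have B: "B \<in> sets \<nu>" "B \<in> sets ?A" using s by auto
      have i[measurable]: "indicator B \<in> borel_measurable ?A" using B by simp
      have i2: "(\<lambda>P. indicator B (T ` P) :: ennreal) \<in> borel_measurable ?A" by (rule measurable_compose[OF m' i])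
      have "?c * emeasure (distr \<nu> \<nu> (\<lambda>P. T ` P)) B = ?c * (\<integral>\<^sup>+P. indicator B P \<partial>distr \<nu> \<nu> (\<lambda>P. T ` P))"
        using B by (subst nn_integral_indicator) auto
      also have "\<dots> = ?c * (\<integral>\<^sup>+P. indicator B (T ` P) \<partial>\<nu>)"
        using B by (subst nn_integral_distr[OF m]) auto
      also have "\<dots> = column_law K (\<lambda>P. indicator B (T ` P))" by (rule int[OF i2])
      also have "\<dots> = column_law K (indicator B)" by (rule column_law_invariant[OF T i])
      also have "\<dots> = ?c * (\<integral>\<^sup>+P. indicator B P \<partial>\<nu>)" by (rule int[OF i, symmetric])
      also have "\<dots> = ?c * emeasure \<nu> B" using B by (subst nn_integral_indicator) auto
      finally show "emeasure (distr \<nu> \<nu> (\<lambda>P. T ` P)) B = emeasure \<nu> B"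
        using c by (metis ennreal_mult_cancel_left infinity_ennreal_def)
    qed
    moreover have "prob_space \<nu>" by (rule prob_spaceI) (rule e1)
    ultimately show ?thesis using s unfolding invariant_plane_prob_def by blast
  qed
  have "\<mu> = \<nu>" by (rule invariant_plane_prob_unique[OF \<mu> inv])
  then show ?thesis using int[OF \<Phi>] nn_integral_graph_weight[OF K \<Phi>] by simp
qed

section \<open>The measure on affine planes and the plane measures in graph coordinates\<close>

text \<open>The shear that adds the value of the linear map to the coordinates outside
  \<open>K\<close> is a translation in these coordinates, hence preserves volume.\<close>

lemma nn_integral_lborel_graph:
  fixes h :: "real^'n \<Rightarrow> ennreal" and K :: "'n set"
  assumes [measurable]: "h \<in> borel_measurable borel"
  shows "(\<integral>\<^sup>+v. h v \<partial>lborel) = (\<integral>\<^sup>+y. (\<integral>\<^sup>+b. h (coord_vec (-K) b + graph_pt K A y) \<partial>leb_prod (-K)) \<partial>leb_prod K)"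
proof -
  have "(\<integral>\<^sup>+z. h (coord_vec K y + coord_vec (-K) z) \<partial>leb_prod (-K)) = (\<integral>\<^sup>+b. h (coord_vec (-K) b + graph_pt K A y) \<partial>leb_prod (-K))" for y
  proof -
    let ?g = "\<lambda>z. h (coord_vec K y + coord_vec (-K) z)"
    have [measurable]: "coord_vec (-K) \<in> borel_measurable (leb_prod (-K))" by (rule coord_vec_measurable_same)
    have "(\<integral>\<^sup>+z. ?g z \<partial>leb_prod (-K)) = (\<integral>\<^sup>+b. ?g (\<lambda>i\<in>-K. (\<Sum>j\<in>K. A (i, j) * y j) + b i) \<partial>leb_prod (-K))"
      by (rule nn_integral_leb_prod_translate[symmetric]) auto
    also have "\<dots> = (\<integral>\<^sup>+b. h (coord_vec (-K) b + graph_pt K A y) \<partial>leb_prod (-K))"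
      by (intro nn_integral_cong arg_cong[where f=h]) (simp add: vec_eq_iff)
    finally show ?thesis .
  qed
  then show ?thesis by (simp only: nn_integral_lborel_split[OF assms, of K])
qed

lemma closest_point_subspace_add:
  fixes P :: "'a::euclidean_space set"
  assumes "subspace P" "p \<in> P"
  shows "closest_point P (p + v) = p + closest_point P v"
proof (rule closest_point_affine_unique)
  show aff: "affine P" using assms by (simp add: subspace_imp_affine)
  have c: "closest_point P v \<in> P" using aff assms closest_point_affine_in by blast
  then show "p + closest_point P v \<in> P" using assms subspace_add by blast
  fix x assume x: "x \<in> P"
  have "(v - closest_point P v) \<bullet> ((x - p) - closest_point P v) = 0"
    by (rule closest_point_affine_orth[OF aff]) (use assms x subspace_diff in blast)
  then show "(p + v - (p + closest_point P v)) \<bullet> (x - (p + closest_point P v)) = 0"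
    by (simp add: diff_diff_eq)
qed

lemma closest_point_translation:
  fixes P :: "'a::euclidean_space set"
  assumes "affine P" "P \<noteq> {}"
  shows "closest_point ((+) b ` P) (b + v) = b + closest_point P v"
proof (rule closest_point_affine_unique)
  show "affine ((+) b ` P)" using assms affine_translation by blast
  show "b + closest_point P v \<in> (+) b ` P" using closest_point_affine_in[OF assms] by blast
  fix x assume "x \<in> (+) b ` P"
  then obtain y where y: "y \<in> P" "x = b + y" by auto
  have "(v - closest_point P v) \<bullet> (y - closest_point P v) = 0"
    by (rule closest_point_affine_orth[OF assms(1) y(1)])
  then show "(b + v - (b + closest_point P v)) \<bullet> (x - (b + closest_point P v)) = 0"
    by (simp add: y)
qed

lemma borel_measurable_closest_point_affine:
  fixes P :: "'a::euclidean_space set"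
  assumes "affine P" "P \<noteq> {}"
  shows "closest_point P \<in> borel_measurable borel"
  by (intro borel_measurable_continuous_onI continuous_on_closest_point affine_imp_convex affine_closed assms)

lemma ennreal_mult_cancelI: "c \<noteq> 0 \<Longrightarrow> c \<noteq> \<infinity> \<Longrightarrow> c * x = c * y \<Longrightarrow> x = (y :: ennreal)"
  by (simp add: ennreal_mult_cancel_left)

lemma graph_pt_in: "graph_pt K A y \<in> graph_plane K A"
  by (simp add: graph_plane_def)

lemma graph_translate_cancel: "p \<in> graph_plane K A \<Longrightarrow> (+) (b + p) ` graph_plane K A = (+) b ` graph_plane K A"
proof -
  assume p: "p \<in> graph_plane K A"
  have s: "subspace (graph_plane K A)" by (rule subspace_graph_plane)
  show "(+) (b + p) ` graph_plane K A = (+) b ` graph_plane K A"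
  proof (intro equalityI subsetI)
    fix x assume "x \<in> (+) (b + p) ` graph_plane K A"
    then obtain y where "y \<in> graph_plane K A" "x = b + (p + y)" by (auto simp: add.assoc)
    then show "x \<in> (+) b ` graph_plane K A" using subspace_add[OF s p] by blast
  next
    fix x assume "x \<in> (+) b ` graph_plane K A"
    then obtain y where "y \<in> graph_plane K A" "x = (b + p) + (y - p)" by auto
    then show "x \<in> (+) (b + p) ` graph_plane K A" using subspace_diff[OF s _ p] by blast
  qed
qed

lemma graph_pt_measurable_point: "graph_pt K A \<in> borel_measurable (leb_prod (K :: 'n::finite set))"
  unfolding graph_pt_def[abs_def]
proof (rule borel_measurable_vec_lambda)
  fix i show "(\<lambda>y. if i \<in> K then y i else \<Sum>j\<in>K. A (i, j) * y j) \<in> borel_measurable (leb_prod K)"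
    by (cases "i \<in> K") (auto intro!: borel_measurable_sum borel_measurable_times leb_prod_component)
qed

lemma nn_integral_graph_translate:
  fixes K :: "'n::finite set"
  assumes p: "p \<in> graph_plane K A" and [measurable]: "h \<in> borel_measurable borel"
  shows "(\<integral>\<^sup>+y. h (graph_pt K A y + p) \<partial>leb_prod K) = (\<integral>\<^sup>+y. h (graph_pt K A y) \<partial>leb_prod K)"
proof -
  obtain c where c: "p = graph_pt K A c" using p by (auto simp: graph_plane_def)
  note [measurable] = graph_pt_measurable_point
  have "graph_pt K A (\<lambda>i\<in>K. c i + y i) = graph_pt K A y + p" for y
  proof -
    have "graph_pt K A (\<lambda>i\<in>K. c i + y i) = graph_pt K A (\<lambda>i. c i + y i)" by (rule graph_pt_cong) simp
    then show ?thesis by (simp add: graph_pt_add c)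
  qed
  then have "(\<integral>\<^sup>+y. h (graph_pt K A y + p) \<partial>leb_prod K) = (\<integral>\<^sup>+y. h (graph_pt K A (\<lambda>i\<in>K. c i + y i)) \<partial>leb_prod K)"
    by simp
  also have "\<dots> = (\<integral>\<^sup>+y. h (graph_pt K A y) \<partial>leb_prod K)"
    by (rule nn_integral_leb_prod_translate) auto
  finally show ?thesis .
qed

text \<open>Write v as an offset b plus a graph point. The translated plane depends only on b, and
  the slab condition only asks that the graph point, shifted within the plane, lie in the unit ball;
  its volume in the parameters is \<open>graph_volume\<close> for every b.\<close>

lemma nn_integral_graph_slab:
  fixes K :: "'n::finite set" and \<psi> :: "(real^'n) set \<Rightarrow> ennreal"
  assumes \<psi>: "\<psi> \<in> borel_measurable (plane_algebra (affine_planes (card K)))"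
  shows "(\<integral>\<^sup>+v. \<psi> ((+) v ` graph_plane K A) * indicator {v. norm (closest_point (graph_plane K A) v) \<le> 1} v \<partial>lborel)
     = (\<integral>\<^sup>+b. \<psi> ((+) (coord_vec (-K) b) ` graph_plane K A) \<partial>leb_prod (-K)) * graph_volume K A"
proof -
  let ?P = "graph_plane K A"
  interpret LK: sigma_finite_measure "leb_prod K" by (rule sigma_finite_leb_prod) simp
  interpret LC: sigma_finite_measure "leb_prod (-K)" by (rule sigma_finite_leb_prod) simp
  interpret PP: pair_sigma_finite "leb_prod K" "leb_prod (-K)" ..
  have s: "subspace ?P" by (rule subspace_graph_plane)
  have aff: "affine ?P" "?P \<noteq> {}" using s subspace_0[OF s] by (auto simp: subspace_imp_affine)
  have cpm[measurable]: "closest_point ?P \<in> borel_measurable borel"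
    by (rule borel_measurable_closest_point_affine) fact+
  have tm: "(\<lambda>v. (+) v ` ?P) \<in> measurable borel (plane_algebra (affine_planes (card K)))"
    by (rule measurable_translate_plane) (auto simp: graph_plane_linear_planes)
  have \<psi>m[measurable]: "(\<lambda>v. \<psi> ((+) v ` ?P)) \<in> borel_measurable borel" by (rule measurable_compose[OF tm \<psi>])
  have [measurable]: "coord_vec (-K) \<in> borel_measurable (leb_prod (-K))" by (rule coord_vec_measurable_same)
  note [measurable] = graph_pt_measurable_point
  define h where "h v = \<psi> ((+) v ` ?P) * indicator {v. norm (closest_point ?P v) \<le> 1} v" for v
  have [measurable]: "h \<in> borel_measurable borel" unfolding h_def by measurable
  have hb: "h (coord_vec (-K) b + graph_pt K A y) = \<psi> ((+) (coord_vec (-K) b) ` ?P)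
      * indicator {v. norm v \<le> 1} (graph_pt K A y + closest_point ?P (coord_vec (-K) b))" for b y
  proof -
    have "closest_point ?P (coord_vec (-K) b + graph_pt K A y) = graph_pt K A y + closest_point ?P (coord_vec (-K) b)"
      using closest_point_subspace_add[OF s graph_pt_in, of y "coord_vec (-K) b"] by (simp only: add.commute)
    then show ?thesis unfolding h_def graph_translate_cancel[OF graph_pt_in] by (simp add: indicator_def)
  qed
  have m1: "(\<lambda>(y, b). h (coord_vec (-K) b + graph_pt K A y)) \<in> borel_measurable (leb_prod K \<Otimes>\<^sub>M leb_prod (-K))"
    by measurable
  have "(\<integral>\<^sup>+v. h v \<partial>lborel) = (\<integral>\<^sup>+y. (\<integral>\<^sup>+b. h (coord_vec (-K) b + graph_pt K A y) \<partial>leb_prod (-K)) \<partial>leb_prod K)"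
    by (rule nn_integral_lborel_graph) measurable
  also have "\<dots> = (\<integral>\<^sup>+b. (\<integral>\<^sup>+y. h (coord_vec (-K) b + graph_pt K A y) \<partial>leb_prod K) \<partial>leb_prod (-K))"
    by (rule PP.Fubini'[OF m1, symmetric])
  also have "\<dots> = (\<integral>\<^sup>+b. \<psi> ((+) (coord_vec (-K) b) ` ?P) * graph_volume K A \<partial>leb_prod (-K))"
  proof (rule nn_integral_cong)
    fix b
    have p: "closest_point ?P (coord_vec (-K) b) \<in> ?P" by (rule closest_point_affine_in[OF aff])
    have "(\<integral>\<^sup>+y. h (coord_vec (-K) b + graph_pt K A y) \<partial>leb_prod K) = \<psi> ((+) (coord_vec (-K) b) ` ?P)
       * (\<integral>\<^sup>+y. indicator {v. norm v \<le> 1} (graph_pt K A y + closest_point ?P (coord_vec (-K) b)) \<partial>leb_prod K)"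
      unfolding hb by (rule nn_integral_cmult) measurable
    also have "(\<integral>\<^sup>+y. indicator {v. norm v \<le> 1} (graph_pt K A y + closest_point ?P (coord_vec (-K) b)) \<partial>leb_prod K) = graph_volume K A"
      unfolding graph_volume_def by (rule nn_integral_graph_translate[OF p]) measurable
    finally show "(\<integral>\<^sup>+y. h (coord_vec (-K) b + graph_pt K A y) \<partial>leb_prod K) = \<psi> ((+) (coord_vec (-K) b) ` ?P) * graph_volume K A" .
  qed
  also have "\<dots> = (\<integral>\<^sup>+b. \<psi> ((+) (coord_vec (-K) b) ` ?P) \<partial>leb_prod (-K)) * graph_volume K A"
    by (rule nn_integral_multc) measurable
  finally show ?thesis unfolding h_def .
qed

lemma nn_integral_plane_lebesgue_unit_ball:
  fixes K :: "'n::finite set"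
  shows "(\<integral>\<^sup>+x. indicator {v. norm v \<le> 1} x \<partial>plane_lebesgue (graph_plane K A)) = coord_ball_volume K"
proof -
  let ?P = "graph_plane K A"
  have aff: "?P \<in> affine_planes (card K)" using graph_plane_linear_planes[of K A] by (simp add: linear_planes_def)
  have "0 \<in> ?P" using subspace_0[OF subspace_graph_plane] by blast
  then have c0: "closest_point ?P 0 = 0" by (rule closest_point_self)
  obtain T where T: "orthogonal_transformation T"
     "plane_lebesgue ?P = distr (leb_prod K) borel (\<lambda>y. closest_point ?P 0 + T (coord_vec K y))"
    using plane_lebesgue_coord[OF aff] by blast
  have [measurable]: "T \<in> borel_measurable borel"
    by (intro borel_measurable_continuous_onI linear_continuous_on)
       (use orthogonal_transformation_linear[OF T(1)] in \<open>simp add: linear_conv_bounded_linear\<close>)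
  have "(\<integral>\<^sup>+x. indicator {v. norm v \<le> 1} x \<partial>plane_lebesgue ?P) = (\<integral>\<^sup>+y. indicator {v. norm v \<le> 1} (T (coord_vec K y)) \<partial>leb_prod K)"
    unfolding T(2) c0 add_0 by (rule nn_integral_distr) measurable
  also have "\<dots> = coord_ball_volume K"
    unfolding nn_integral_coord_ball[symmetric] by (simp add: indicator_def orthogonal_transformation_norm[OF T(1)])
  finally show ?thesis .
qed

text \<open>The integral over the unit tube around the plane is computed twice, by orthogonal
  projection and in sheared coordinates. Hence both sides are proportional, with a factor that
  depends neither on the integrand nor on b; the unit ball of the linear plane then determines the
  factor.\<close>

lemma nn_integral_plane_lebesgue_graph:
  fixes K :: "'n::finite set"
  assumes h[measurable]: "h \<in> borel_measurable borel"
  shows "(\<integral>\<^sup>+x. h x \<partial>plane_lebesgue ((+) b ` graph_plane K A)) = ennreal (graph_jacobian K A) * (\<integral>\<^sup>+y. h (b + graph_pt K A y) \<partial>leb_prod K)"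
proof -
  let ?P = "graph_plane K A"
  interpret LK: sigma_finite_measure "leb_prod K" by (rule sigma_finite_leb_prod) simp
  interpret LC: sigma_finite_measure "leb_prod (-K)" by (rule sigma_finite_leb_prod) simp
  interpret PP: pair_sigma_finite "leb_prod K" "leb_prod (-K)" ..
  have s: "subspace ?P" by (rule subspace_graph_plane)
  have aff: "affine ?P" "?P \<noteq> {}" using s subspace_0[OF s] by (auto simp: subspace_imp_affine)
  have cpm[measurable]: "closest_point ?P \<in> borel_measurable borel"
    by (rule borel_measurable_closest_point_affine) fact+
  have [measurable]: "(\<lambda>v. infdist v Q) \<in> borel_measurable borel" for Q :: "(real^'n) set"
    by (intro borel_measurable_continuous_onI continuous_intros)
  have [measurable]: "coord_vec (-K) \<in> borel_measurable (leb_prod (-K))" by (rule coord_vec_measurable_same)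
  note [measurable] = graph_pt_measurable_point
  \<comment> \<open>The measure of the offsets at distance at most 1 from the linear plane.\<close>
  define V where "V = (\<integral>\<^sup>+c. indicator {v. infdist v ?P \<le> 1} (coord_vec (-K) c) \<partial>leb_prod (-K))"
  have key: "coord_ball_volume (-K) * (\<integral>\<^sup>+x. h x \<partial>plane_lebesgue ((+) b ` ?P)) = V * (\<integral>\<^sup>+y. h (b + graph_pt K A y) \<partial>leb_prod K)"
    if [measurable]: "h \<in> borel_measurable borel" for h b
  proof -
    have affb: "affine ((+) b ` ?P)" "(+) b ` ?P \<noteq> {}" using aff affine_translation[of ?P b] by auto
    have bP: "(+) b ` ?P \<in> affine_planes (card K)" by (rule affine_planes_translate) (rule graph_plane_linear_planes)
    have [measurable]: "closest_point ((+) b ` ?P) \<in> borel_measurable borel"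
      by (rule borel_measurable_closest_point_affine) fact+
    have id: "infdist (b + v) ((+) b ` ?P) = infdist v ?P" for v
      unfolding infdist_affine[OF affb] infdist_affine[OF aff] closest_point_translation[OF aff] by simp
    have "coord_ball_volume (-K) * (\<integral>\<^sup>+x. h x \<partial>plane_lebesgue ((+) b ` ?P))
       = (\<integral>\<^sup>+v. h (closest_point ((+) b ` ?P) v) * indicator {v. infdist v ((+) b ` ?P) \<le> 1} v \<partial>lborel)"
      by (rule nn_integral_plane_lebesgue[OF bP]) measurable
    also have "\<dots> = (\<integral>\<^sup>+v. h (closest_point ((+) b ` ?P) (b + id v)) * indicator {v. infdist v ((+) b ` ?P) \<le> 1} (b + id v) \<partial>lborel)"
      by (rule nn_integral_lborel_orthogonal[symmetric, of id]) (simp add: id_def, measurable)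
    also have "\<dots> = (\<integral>\<^sup>+v. h (b + closest_point ?P v) * indicator {v. infdist v ?P \<le> 1} v \<partial>lborel)"
      unfolding id_apply closest_point_translation[OF aff] by (intro nn_integral_cong) (simp add: indicator_def id)
    also have "\<dots> = (\<integral>\<^sup>+y. (\<integral>\<^sup>+c. h (b + closest_point ?P (coord_vec (-K) c + graph_pt K A y)) * indicator {v. infdist v ?P \<le> 1} (coord_vec (-K) c + graph_pt K A y) \<partial>leb_prod (-K)) \<partial>leb_prod K)"
      by (rule nn_integral_lborel_graph) measurable
    also have "\<dots> = (\<integral>\<^sup>+y. (\<integral>\<^sup>+c. h (b + (graph_pt K A y + closest_point ?P (coord_vec (-K) c))) * indicator {v. infdist v ?P \<le> 1} (coord_vec (-K) c) \<partial>leb_prod (-K)) \<partial>leb_prod K)"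
    proof (intro nn_integral_cong arg_cong2[where f="(*)"])
      fix y c
      have e: "closest_point ?P (coord_vec (-K) c + graph_pt K A y) = graph_pt K A y + closest_point ?P (coord_vec (-K) c)"
        using closest_point_subspace_add[OF s graph_pt_in, of y "coord_vec (-K) c"] by (simp only: add.commute)
      then show "h (b + closest_point ?P (coord_vec (-K) c + graph_pt K A y)) = h (b + (graph_pt K A y + closest_point ?P (coord_vec (-K) c)))" by simp
      have "infdist (coord_vec (-K) c + graph_pt K A y) ?P = infdist (coord_vec (-K) c) ?P"
        unfolding infdist_affine[OF aff] e by simp
      then show "indicator {v. infdist v ?P \<le> 1} (coord_vec (-K) c + graph_pt K A y) = (indicator {v. infdist v ?P \<le> 1} (coord_vec (-K) c) :: ennreal)"
        by (simp add: indicator_def)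
    qed
    also have "\<dots> = (\<integral>\<^sup>+c. (\<integral>\<^sup>+y. h (b + (graph_pt K A y + closest_point ?P (coord_vec (-K) c))) * indicator {v. infdist v ?P \<le> 1} (coord_vec (-K) c) \<partial>leb_prod K) \<partial>leb_prod (-K))"
      by (rule PP.Fubini'[symmetric]) measurable
    also have "\<dots> = (\<integral>\<^sup>+c. (\<integral>\<^sup>+y. h (b + graph_pt K A y) \<partial>leb_prod K) * indicator {v. infdist v ?P \<le> 1} (coord_vec (-K) c) \<partial>leb_prod (-K))"
    proof (rule nn_integral_cong)
      fix c
      have p: "closest_point ?P (coord_vec (-K) c) \<in> ?P" by (rule closest_point_affine_in[OF aff])
      have "(\<integral>\<^sup>+y. h (b + (graph_pt K A y + closest_point ?P (coord_vec (-K) c))) * indicator {v. infdist v ?P \<le> 1} (coord_vec (-K) c) \<partial>leb_prod K)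
        = (\<integral>\<^sup>+y. h (b + (graph_pt K A y + closest_point ?P (coord_vec (-K) c))) \<partial>leb_prod K) * indicator {v. infdist v ?P \<le> 1} (coord_vec (-K) c)"
        by (rule nn_integral_multc) measurable
      also have "(\<integral>\<^sup>+y. h (b + (graph_pt K A y + closest_point ?P (coord_vec (-K) c))) \<partial>leb_prod K) = (\<integral>\<^sup>+y. h (b + graph_pt K A y) \<partial>leb_prod K)"
        using nn_integral_graph_translate[OF p, of "\<lambda>v. h (b + v)"] by simp
      finally show "(\<integral>\<^sup>+y. h (b + (graph_pt K A y + closest_point ?P (coord_vec (-K) c))) * indicator {v. infdist v ?P \<le> 1} (coord_vec (-K) c) \<partial>leb_prod K)
        = (\<integral>\<^sup>+y. h (b + graph_pt K A y) \<partial>leb_prod K) * indicator {v. infdist v ?P \<le> 1} (coord_vec (-K) c)" .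
    qed
    also have "\<dots> = (\<integral>\<^sup>+y. h (b + graph_pt K A y) \<partial>leb_prod K) * V"
      unfolding V_def by (rule nn_integral_cmult) measurable
    finally show ?thesis by (simp only: mult.commute)
  qed
  have "(+) 0 ` ?P = ?P" by simp
  \<comment> \<open>Calibration by the unit ball of the plane through 0.\<close>
  then have vol: "coord_ball_volume (-K) * coord_ball_volume K = V * graph_volume K A"
    using key[of "indicator {v. norm v \<le> 1}" 0] by (simp add: nn_integral_plane_lebesgue_unit_ball graph_volume_def)
  have c1: "coord_ball_volume K \<noteq> 0" "coord_ball_volume K \<noteq> \<infinity>" "coord_ball_volume (-K) \<noteq> 0" "coord_ball_volume (-K) \<noteq> \<infinity>"
    using coord_ball_volume_pos[of K] coord_ball_volume_finite[of K] coord_ball_volume_pos[of "-K"] coord_ball_volume_finite[of "-K"] by auto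
  have V: "V = coord_ball_volume (-K) * ennreal (graph_jacobian K A)"
  proof -
    have g0: "graph_volume K A \<noteq> 0" using graph_volume[of K A] c1(1) by auto
    have g1: "graph_volume K A \<noteq> \<infinity>"
      using graph_volume[of K A] c1(2) graph_jacobian_pos[of K A] by (auto simp: ennreal_mult_top)
    have "graph_volume K A * V = coord_ball_volume (-K) * coord_ball_volume K"
      unfolding vol by (rule mult.commute)
    also have "\<dots> = graph_volume K A * (coord_ball_volume (-K) * ennreal (graph_jacobian K A))"
      unfolding graph_volume[of K A, symmetric] by (simp only: mult_ac)
    finally show ?thesis by (rule ennreal_mult_cancelI[OF g0 g1])
  qed
  show ?thesis
    using key[OF h, of b] unfolding V mult.assoc by (rule ennreal_mult_cancelI[OF c1(3,4)])
qed

lemma invariant_plane_prob_locale: "invariant_plane_prob (card K) \<mu> \<Longrightarrow> plane_prob \<mu> K"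
  unfolding invariant_plane_prob_def by (elim conjE) (rule plane_prob.intro)

text \<open>The exponent CARD('n) + 1 is the sum of CARD('n), from the density of the direction, and
  1, from the replacement of the orthogonal offset by an offset along the coordinates outside
  \<open>K\<close>.\<close>

theorem nn_integral_plane_measure_graph:
  fixes K :: "'n::finite set"
  assumes K: "K \<noteq> UNIV" and \<mu>: "invariant_plane_prob (card K) \<mu>"
    and \<psi>: "\<psi> \<in> borel_measurable (plane_algebra (affine_planes (card K)))"
  shows "column_law K (\<lambda>_. 1) * (\<integral>\<^sup>+Q. \<psi> Q \<partial>plane_measure (card K) \<mu>)
     = (\<integral>\<^sup>+A. (\<integral>\<^sup>+b. \<psi> ((+) (coord_vec (-K) b) ` graph_plane K A) * (graph_weight K (\<lambda>_. 0) * ennreal (1 / graph_jacobian K A ^ (CARD('n) + 1))) \<partial>leb_prod (-K)) \<partial>leb_prod ((-K) \<times> K))"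
proof -
  interpret plane_prob \<mu> K by (rule invariant_plane_prob_locale[OF \<mu>])
  interpret LC: sigma_finite_measure "leb_prod (-K)" by (rule sigma_finite_leb_prod) simp
  let ?c = "coord_ball_volume K" and ?m = "column_law K (\<lambda>_. 1)" and ?w = "graph_weight K (\<lambda>_. 0)"
  let ?MA = "leb_prod ((-K) \<times> K)"
  have c: "?c \<noteq> 0" "?c \<noteq> \<infinity>" using coord_ball_volume_pos[of K] coord_ball_volume_finite[of K] by auto
  define \<Phi> where "\<Phi> P = (\<integral>\<^sup>+v. \<psi> ((+) v ` P) * indicator {v. norm (closest_point P v) \<le> 1} v \<partial>lborel)" for P
  have \<Phi>: "\<Phi> \<in> borel_measurable (plane_algebra (linear_planes (card K)))"
  proof -
    have "(\<lambda>w. \<psi> ((+) (snd w) ` fst w)) \<in> borel_measurable (\<mu> \<Otimes>\<^sub>M borel)"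
      by (rule measurable_compose[OF measurable_translate_pair \<psi>])
    then have "(\<lambda>w. \<psi> ((+) (snd w) ` fst w) * unit_slab w) \<in> borel_measurable (\<mu> \<Otimes>\<^sub>M borel)"
      using measurable_unit_slab by (rule borel_measurable_times_ennreal)
    then have "(\<lambda>w. \<psi> ((+) (snd w) ` fst w) * unit_slab w) \<in> borel_measurable (\<mu> \<Otimes>\<^sub>M lborel)"
      by (simp only: measurable_cong_sets[OF sets_pair_measure_cong[OF refl sets_lborel] refl])
    from lborel.borel_measurable_nn_integral_fst[OF this] have "\<Phi> \<in> borel_measurable \<mu>"
      unfolding \<Phi>_def[abs_def] by (simp add: unit_slab_def)
    then show ?thesis using measurable_cong_sets[OF sets_mu refl] by blast
  qed
  have tm: "(\<lambda>w. (+) (coord_vec (-K) (snd w)) ` graph_plane K (fst w)) \<in> measurable (?MA \<Otimes>\<^sub>M leb_prod (-K)) (plane_algebra (affine_planes (card K)))"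
    by (rule measurable_translate_plane[OF measurable_compose[OF measurable_fst graph_plane_measurable]
          measurable_compose[OF measurable_snd coord_vec_measurable_same]])
  have bm: "(\<lambda>A. \<integral>\<^sup>+b. \<psi> ((+) (coord_vec (-K) b) ` graph_plane K A) \<partial>leb_prod (-K)) \<in> borel_measurable ?MA"
    using LC.borel_measurable_nn_integral_fst[OF measurable_compose[OF tm \<psi>]] by simp
  have \<psi>A: "(\<lambda>b. \<psi> ((+) (coord_vec (-K) b) ` graph_plane K A)) \<in> borel_measurable (leb_prod (-K))" if "A \<in> space ?MA" for A
    using measurable_compose[OF measurable_Pair1'[OF that] measurable_compose[OF tm \<psi>]] by simp
  \<comment> \<open>\<open>graph_volume\<close> contributes one inverse power of the Jacobian and
    \<open>graph_weight\<close> the other CARD('n).\<close>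
  have J: "graph_volume K A * graph_weight K A = ?c * (?w * ennreal (1 / graph_jacobian K A ^ (CARD('n) + 1)))" for A
  proof -
    define j where "j = graph_jacobian K A"
    have j: "0 < j" by (simp add: j_def graph_jacobian_pos)
    have e: "ennreal j ^ (CARD('n) + 1) * (graph_volume K A * graph_weight K A) = ?c * ?w"
      unfolding graph_volume[of K A, symmetric] graph_weight_jacobian[of K A, symmetric] j_def by (simp add: mult_ac)
    have "ennreal (1 / j ^ (CARD('n) + 1)) * ennreal j ^ (CARD('n) + 1) = 1"
      using j by (simp add: ennreal_power flip: ennreal_mult)
    then have "graph_volume K A * graph_weight K A = ennreal (1 / j ^ (CARD('n) + 1)) * (ennreal j ^ (CARD('n) + 1) * (graph_volume K A * graph_weight K A))"
      by (simp only: mult.assoc[symmetric] mult_1_left)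
    also have "\<dots> = ?c * (?w * ennreal (1 / j ^ (CARD('n) + 1)))" unfolding e by (simp only: mult_ac)
    finally show ?thesis unfolding j_def .
  qed
  have jm: "(\<lambda>A. \<integral>\<^sup>+b. \<psi> ((+) (coord_vec (-K) b) ` graph_plane K A) * (?w * ennreal (1 / graph_jacobian K A ^ (CARD('n) + 1))) \<partial>leb_prod (-K)) \<in> borel_measurable ?MA"
  proof -
    have gv: "graph_volume K \<in> borel_measurable ?MA"
    proof -
      interpret LK: sigma_finite_measure "leb_prod K" by (rule sigma_finite_leb_prod) simp
      have "(\<lambda>w. graph_pt K (fst w) (\<lambda>i. snd w i)) \<in> borel_measurable (?MA \<Otimes>\<^sub>M leb_prod K)"
        by (rule graph_pt_measurable) (auto intro!: measurable_leb_prod_component[OF measurable_snd])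
      then have "(\<lambda>w. indicator {v. norm v \<le> 1} (graph_pt K (fst w) (\<lambda>i. snd w i)) :: ennreal) \<in> borel_measurable (?MA \<Otimes>\<^sub>M leb_prod K)"
        by (intro measurable_compose[OF _ borel_measurable_indicator]) auto
      from LK.borel_measurable_nn_integral_fst[OF this] show ?thesis by (simp add: graph_volume_def[abs_def])
    qed
    have "(\<lambda>A. (\<integral>\<^sup>+b. \<psi> ((+) (coord_vec (-K) b) ` graph_plane K A) \<partial>leb_prod (-K)) * (graph_volume K A * graph_weight K A) / ?c) \<in> borel_measurable ?MA"
      using bm gv graph_weight_measurable by measurable
    then show ?thesis
    proof (rule measurable_cong[THEN iffD1, rotated])
      fix A assume A: "A \<in> space ?MA"
      show "(\<integral>\<^sup>+b. \<psi> ((+) (coord_vec (-K) b) ` graph_plane K A) \<partial>leb_prod (-K)) * (graph_volume K A * graph_weight K A) / ?c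
        = (\<integral>\<^sup>+b. \<psi> ((+) (coord_vec (-K) b) ` graph_plane K A) * (?w * ennreal (1 / graph_jacobian K A ^ (CARD('n) + 1))) \<partial>leb_prod (-K))"
        unfolding J nn_integral_multc[OF \<psi>A[OF A]]
        by (rule ennreal_eq_divideI[OF c, symmetric]) (simp only: mult_ac)
    qed
  qed
  have "?c * (?m * (\<integral>\<^sup>+Q. \<psi> Q \<partial>plane_measure (card K) \<mu>)) = ?m * (\<integral>\<^sup>+P. \<Phi> P \<partial>\<mu>)"
    by (subst mult.left_commute) (simp only: \<Phi>_def[abs_def] nn_integral_plane_measure[OF \<psi>])
  also have "\<dots> = (\<integral>\<^sup>+A. \<Phi> (graph_plane K A) * graph_weight K A \<partial>?MA)"
    by (rule nn_integral_invariant_plane_prob[OF K \<mu> \<Phi>])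
  also have "\<dots> = (\<integral>\<^sup>+A. ?c * (\<integral>\<^sup>+b. \<psi> ((+) (coord_vec (-K) b) ` graph_plane K A) * (?w * ennreal (1 / graph_jacobian K A ^ (CARD('n) + 1))) \<partial>leb_prod (-K)) \<partial>?MA)"
  proof (rule nn_integral_cong)
    fix A assume A: "A \<in> space ?MA"
    have "\<Phi> (graph_plane K A) * graph_weight K A = (\<integral>\<^sup>+b. \<psi> ((+) (coord_vec (-K) b) ` graph_plane K A) \<partial>leb_prod (-K)) * (graph_volume K A * graph_weight K A)"
      unfolding \<Phi>_def nn_integral_graph_slab[OF \<psi>] by (simp only: mult.assoc)
    then show "\<Phi> (graph_plane K A) * graph_weight K A = ?c * (\<integral>\<^sup>+b. \<psi> ((+) (coord_vec (-K) b) ` graph_plane K A) * (?w * ennreal (1 / graph_jacobian K A ^ (CARD('n) + 1))) \<partial>leb_prod (-K))"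
      unfolding J nn_integral_multc[OF \<psi>A[OF A]] by (simp only: mult_ac)
  qed
  also have "\<dots> = ?c * (\<integral>\<^sup>+A. (\<integral>\<^sup>+b. \<psi> ((+) (coord_vec (-K) b) ` graph_plane K A) * (?w * ennreal (1 / graph_jacobian K A ^ (CARD('n) + 1))) \<partial>leb_prod (-K)) \<partial>?MA)"
    by (rule nn_integral_cmult[OF jm])
  finally show ?thesis by (rule ennreal_mult_cancelI[OF c])
qed

section \<open>The chart of affine planes and the exchange of two columns\<close>

text \<open>Slopes and offset are stored in one matrix with rows outside \<open>K\<close>. The
  offset occupies an extra column, labelled by an index \<open>f\<close> outside \<open>K\<close>,
  so that the projective inversion becomes an exchange of columns.\<close>

definition chart_pt :: "'n::finite set \<Rightarrow> 'n \<Rightarrow> ('n \<times> 'n \<Rightarrow> real) \<Rightarrow> ('n \<Rightarrow> real) \<Rightarrow> real^'n" where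
  "chart_pt K f \<theta> y = coord_vec (-K) (\<lambda>i. \<theta> (i, f)) + graph_pt K \<theta> y"

definition chart_plane :: "'n::finite set \<Rightarrow> 'n \<Rightarrow> ('n \<times> 'n \<Rightarrow> real) \<Rightarrow> (real^'n) set" where
  "chart_plane K f \<theta> = (+) (coord_vec (-K) (\<lambda>i. \<theta> (i, f))) ` graph_plane K \<theta>"

lemma chart_plane_affine_planes: "chart_plane K f \<theta> \<in> affine_planes (card K)"
  unfolding chart_plane_def by (rule affine_planes_translate) (rule graph_plane_linear_planes)

lemma graph_pt_param_cong:
  "(\<And>i j. i \<notin> K \<Longrightarrow> j \<in> K \<Longrightarrow> A (i, j) = B (i, j)) \<Longrightarrow> graph_pt K A = graph_pt K B"
  by (intro ext) (simp add: vec_eq_iff)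

lemma graph_param_restrict:
  "graph_pt K (restrict \<theta> ((-K) \<times> K)) = graph_pt K \<theta>"
  "graph_plane K (restrict \<theta> ((-K) \<times> K)) = graph_plane K \<theta>"
  "graph_jacobian K (restrict \<theta> ((-K) \<times> K)) = graph_jacobian K \<theta>"
proof -
  show e: "graph_pt K (restrict \<theta> ((-K) \<times> K)) = graph_pt K \<theta>" by (rule graph_pt_param_cong) simp
  show "graph_plane K (restrict \<theta> ((-K) \<times> K)) = graph_plane K \<theta>"
    "graph_jacobian K (restrict \<theta> ((-K) \<times> K)) = graph_jacobian K \<theta>"
    unfolding graph_plane_def graph_jacobian_def e by simp_all
qed

lemma graph_jacobian_measurable: "graph_jacobian K \<in> borel_measurable (leb_prod ((-K) \<times> K))"
proof -
  interpret LK: sigma_finite_measure "leb_prod K" by (rule sigma_finite_leb_prod) simp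
  have "(\<lambda>w. graph_pt K (fst w) (\<lambda>i. snd w i)) \<in> borel_measurable (leb_prod ((-K) \<times> K) \<Otimes>\<^sub>M leb_prod K)"
    by (rule graph_pt_measurable) (auto intro!: measurable_leb_prod_component[OF measurable_snd])
  then have "(\<lambda>w. indicator {v. norm v \<le> 1} (graph_pt K (fst w) (\<lambda>i. snd w i)) :: ennreal) \<in> borel_measurable (leb_prod ((-K) \<times> K) \<Otimes>\<^sub>M leb_prod K)"
    by (intro measurable_compose[OF _ borel_measurable_indicator]) auto
  from LK.borel_measurable_nn_integral_fst[OF this]
  have [measurable]: "graph_volume K \<in> borel_measurable (leb_prod ((-K) \<times> K))" by (simp add: graph_volume_def[abs_def])
  have "graph_jacobian K A = enn2real (coord_ball_volume K / graph_volume K A)" for A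
  proof -
    have c: "coord_ball_volume K \<noteq> 0" "coord_ball_volume K \<noteq> \<infinity>"
      using coord_ball_volume_pos[of K] coord_ball_volume_finite[of K] by auto
    have g0: "graph_volume K A \<noteq> 0" using graph_volume[of K A] c(1) by auto
    have g1: "graph_volume K A \<noteq> \<infinity>"
      using graph_volume[of K A] c(2) graph_jacobian_pos[of K A] by (auto simp: ennreal_mult_top)
    have "graph_volume K A * ennreal (graph_jacobian K A) = coord_ball_volume K"
      using graph_volume[of K A] by (simp only: mult.commute)
    from ennreal_eq_divideI[OF g0 g1 this]
    have "coord_ball_volume K / graph_volume K A = ennreal (graph_jacobian K A)" by simp
    then show ?thesis using graph_jacobian_pos[of K A] by simp
  qed
  then show ?thesis by (subst measurable_cong) auto
qed

lemma chart_jacobian_measurable: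
  "graph_jacobian K \<in> borel_measurable (leb_prod ((-K) \<times> insert f K))"
proof -
  have "(\<lambda>\<theta>. graph_jacobian K (restrict \<theta> ((-K) \<times> K))) \<in> borel_measurable (leb_prod ((-K) \<times> insert f K))"
    by (rule measurable_compose[OF measurable_restrict_subset graph_jacobian_measurable]) auto
  then show ?thesis by (simp only: graph_param_restrict)
qed

lemma chart_plane_measurable:
  assumes "f \<notin> K"
  shows "chart_plane K f \<in> measurable (leb_prod ((-K) \<times> insert f K)) (plane_algebra (affine_planes (card K)))"
proof -
  let ?L = "leb_prod ((-K) \<times> insert f K)"
  have 1: "graph_plane K \<in> measurable ?L (plane_algebra (linear_planes (card K)))"
  proof -
    have "(\<lambda>\<theta>. graph_plane K (restrict \<theta> ((-K) \<times> K))) \<in> measurable ?L (plane_algebra (linear_planes (card K)))"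
      by (rule measurable_compose[OF measurable_restrict_subset graph_plane_measurable]) auto
    then show ?thesis by (simp only: graph_param_restrict)
  qed
  have 2: "(\<lambda>\<theta>. coord_vec (-K) (\<lambda>i. \<theta> (i, f))) \<in> borel_measurable ?L"
    by (rule coord_vec_measurable') auto
  show ?thesis unfolding chart_plane_def[abs_def] by (rule measurable_translate_plane[OF 1 2])
qed

definition chart_density :: "'n::finite set \<Rightarrow> ('n \<times> 'n \<Rightarrow> real) \<Rightarrow> ennreal" where
  "chart_density K \<theta> = graph_weight K (\<lambda>_. 0) * ennreal (1 / graph_jacobian K \<theta> ^ (CARD('n) + 1))"

lemma nn_integral_plane_measure_chart:
  fixes K :: "'n::finite set"
  assumes f: "f \<notin> K" and \<mu>: "invariant_plane_prob (card K) \<mu>"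
    and \<psi>: "\<psi> \<in> borel_measurable (plane_algebra (affine_planes (card K)))"
  shows "column_law K (\<lambda>_. 1) * (\<integral>\<^sup>+Q. \<psi> Q \<partial>plane_measure (card K) \<mu>)
     = (\<integral>\<^sup>+\<theta>. \<psi> (chart_plane K f \<theta>) * chart_density K \<theta> \<partial>leb_prod ((-K) \<times> insert f K))"
proof -
  have K: "K \<noteq> UNIV" using f by auto
  have U: "(-K) \<times> insert f K = (-K) \<times> K \<union> (-K) \<times> {f}" by auto
  have disj: "(-K) \<times> K \<inter> (-K) \<times> {f} = {}" using f by auto
  define g where "g \<theta> = \<psi> (chart_plane K f \<theta>) * chart_density K \<theta>" for \<theta>
  have gm: "g \<in> borel_measurable (leb_prod ((-K) \<times> K \<union> (-K) \<times> {f}))"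
    unfolding U[symmetric] g_def chart_density_def
    using measurable_compose[OF chart_plane_measurable[OF f] \<psi>] chart_jacobian_measurable[of K f] by measurable
  have b: "bij_betw (\<lambda>i. (i, f)) (-K) ((-K) \<times> {f})" by (auto simp: bij_betw_def inj_on_def)
  have "(\<integral>\<^sup>+\<theta>. g \<theta> \<partial>leb_prod ((-K) \<times> insert f K))
     = (\<integral>\<^sup>+A. (\<integral>\<^sup>+B. g (merge ((-K) \<times> K) ((-K) \<times> {f}) (A, B)) \<partial>leb_prod ((-K) \<times> {f})) \<partial>leb_prod ((-K) \<times> K))"
    unfolding U by (rule leb_prod.product_nn_integral_fold[OF disj _ _ gm]) auto
  also have "\<dots> = (\<integral>\<^sup>+A. (\<integral>\<^sup>+b. \<psi> ((+) (coord_vec (-K) b) ` graph_plane K A) * chart_density K A \<partial>leb_prod (-K)) \<partial>leb_prod ((-K) \<times> K))"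
  proof (rule nn_integral_cong)
    fix A assume A: "A \<in> space (leb_prod ((-K) \<times> K))"
    let ?h = "\<lambda>b. \<psi> ((+) (coord_vec (-K) b) ` graph_plane K A) * chart_density K A"
    have eq: "g (merge ((-K) \<times> K) ((-K) \<times> {f}) (A, B)) = ?h (\<lambda>i\<in>-K. B (i, f))" for B
    proof -
      let ?\<theta> = "merge ((-K) \<times> K) ((-K) \<times> {f}) (A, B)"
      have p: "graph_pt K ?\<theta> = graph_pt K A" by (rule graph_pt_param_cong) (simp add: merge_def)
      then have "graph_plane K ?\<theta> = graph_plane K A" "graph_jacobian K ?\<theta> = graph_jacobian K A"
        unfolding graph_plane_def graph_jacobian_def by simp_all
      moreover have "coord_vec (-K) (\<lambda>i. ?\<theta> (i, f)) = coord_vec (-K) (\<lambda>i\<in>-K. B (i, f))"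
        using f by (simp add: vec_eq_iff merge_def)
      ultimately show ?thesis unfolding g_def chart_plane_def chart_density_def by (simp only:)
    qed
    have "(\<lambda>b. (+) (coord_vec (-K) b) ` graph_plane K A) \<in> measurable (leb_prod (-K)) (plane_algebra (affine_planes (card K)))"
      by (rule measurable_translate_plane[OF _ coord_vec_measurable_same]) (simp add: graph_plane_linear_planes)
    from measurable_compose[OF this \<psi>] have h: "?h \<in> borel_measurable (leb_prod (-K))" by simp
    show "(\<integral>\<^sup>+B. g (merge ((-K) \<times> K) ((-K) \<times> {f}) (A, B)) \<partial>leb_prod ((-K) \<times> {f})) = (\<integral>\<^sup>+b. ?h b \<partial>leb_prod (-K))"
      unfolding eq by (rule nn_integral_leb_prod_reindex[OF b _ h]) simp
  qed
  also have "\<dots> = column_law K (\<lambda>_. 1) * (\<integral>\<^sup>+Q. \<psi> Q \<partial>plane_measure (card K) \<mu>)"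
    unfolding chart_density_def by (rule nn_integral_plane_measure_graph[OF K \<mu> \<psi>, symmetric])
  finally show ?thesis unfolding g_def ..
qed

text \<open>If the constant vanished, all graph weights would vanish, against the positive mass of
  the column law.\<close>

lemma chart_density_nz:
  fixes K :: "'n::finite set"
  assumes "K \<noteq> UNIV"
  shows "chart_density K \<theta> \<noteq> 0"
proof -
  have "graph_weight K (\<lambda>_. 0) \<noteq> 0"
  proof
    assume z: "graph_weight K (\<lambda>_. 0) = 0"
    have "graph_weight K A = 0" for A
      using graph_weight_jacobian[of K A] graph_jacobian_pos[of K A] unfolding z by auto
    then have "column_law K (\<lambda>_. 1) = 0"
      using nn_integral_graph_weight[OF assms, of "\<lambda>_. 1"] by simp
    then show False using column_law_one(1)[of K] by simp
  qed
  then show ?thesis using graph_jacobian_pos[of K \<theta>] by (auto simp: chart_density_def ennreal_eq_0_iff not_le)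
qed

text \<open>Null sets of planes pull back to null sets of parameters because the density vanishes
  nowhere.\<close>

lemma AE_plane_measure_chart:
  fixes K :: "'n::finite set"
  assumes f: "f \<notin> K" and \<mu>: "invariant_plane_prob (card K) \<mu>"
    and ae: "AE Q in plane_measure (card K) \<mu>. p Q"
  shows "AE \<theta> in leb_prod ((-K) \<times> insert f K). p (chart_plane K f \<theta>)"
proof -
  interpret plane_prob \<mu> K by (rule invariant_plane_prob_locale[OF \<mu>])
  let ?L = "leb_prod ((-K) \<times> insert f K)"
  obtain N where N: "{Q \<in> space (plane_measure (card K) \<mu>). \<not> p Q} \<subseteq> N" "emeasure (plane_measure (card K) \<mu>) N = 0"
    "N \<in> sets (plane_measure (card K) \<mu>)"
    using ae by (rule AE_E)
  have N': "N \<in> sets (plane_algebra (affine_planes (card K)))" using N(3) by simp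
  have sp: "space (plane_measure (card K) \<mu>) = affine_planes (card K)"
    using sets_eq_imp_space_eq[OF sets_plane_measure] by simp
  have i: "indicator N \<in> borel_measurable (plane_algebra (affine_planes (card K)))" using N' by simp
  have "(\<integral>\<^sup>+\<theta>. indicator N (chart_plane K f \<theta>) * chart_density K \<theta> \<partial>?L) = column_law K (\<lambda>_. 1) * (\<integral>\<^sup>+Q. indicator N Q \<partial>plane_measure (card K) \<mu>)"
    by (rule nn_integral_plane_measure_chart[OF f \<mu> i, symmetric])
  also have "\<dots> = 0" using N(2,3) by (subst nn_integral_indicator) auto
  finally have z: "(\<integral>\<^sup>+\<theta>. indicator N (chart_plane K f \<theta>) * chart_density K \<theta> \<partial>?L) = 0" .
  have "(\<lambda>\<theta>. indicator N (chart_plane K f \<theta>) * chart_density K \<theta>) \<in> borel_measurable ?L"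
    unfolding chart_density_def
    using measurable_compose[OF chart_plane_measurable[OF f] i] chart_jacobian_measurable[of K f] by measurable
  then have "AE \<theta> in ?L. indicator N (chart_plane K f \<theta>) * chart_density K \<theta> = 0"
    using z by (simp add: nn_integral_0_iff_AE)
  then show ?thesis
  proof eventually_elim
    case (elim \<theta>)
    have "K \<noteq> UNIV" using f by auto
    then have "indicator N (chart_plane K f \<theta>) = (0 :: ennreal)" using elim chart_density_nz by auto
    then have "chart_plane K f \<theta> \<notin> N" by (auto simp: indicator_def split: if_splits)
    then show ?case using N(1) chart_plane_affine_planes unfolding sp by blast
  qed
qed

text \<open>On parameters of planes this is the projective inversion in direction \<open>e\<close>;
  see \<open>proj_inv_chart_pt\<close>.\<close>

definition chart_swap :: "'n set \<Rightarrow> 'n \<Rightarrow> 'n \<Rightarrow> ('n \<times> 'n \<Rightarrow> real) \<Rightarrow> 'n \<times> 'n \<Rightarrow> real" where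
  "chart_swap K e f \<theta> = (\<lambda>p\<in>(-K) \<times> insert f K. \<theta> (fst p, Transposition.transpose e f (snd p)))"

lemma chart_swap_bij:
  assumes "e \<in> K"
  shows "bij_betw (\<lambda>p. (fst p, Transposition.transpose e f (snd p))) ((-K) \<times> insert f K) ((-K) \<times> insert f K)"
proof -
  have t: "Transposition.transpose e f j \<in> insert f K" if "j \<in> insert f K" for j
    using assms that by (auto simp: Transposition.transpose_def)
  show ?thesis
    by (intro bij_betw_byWitness[where f'="\<lambda>p. (fst p, Transposition.transpose e f (snd p))"])
       (use t in \<open>force simp del: insert_iff\<close>)+
qed

lemma chart_swap_measurable:
  assumes "e \<in> K"
  shows "chart_swap K e f \<in> measurable (leb_prod ((-K) \<times> insert f K)) (leb_prod ((-K) \<times> insert f K))"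
  unfolding chart_swap_def
  by (intro measurable_restrict measurable_component_singleton) (use assms in \<open>auto simp: Transposition.transpose_def\<close>)

lemma nn_integral_chart_swap:
  fixes K :: "'n::finite set"
  assumes "e \<in> K" "g \<in> borel_measurable (leb_prod ((-K) \<times> insert f K))"
  shows "(\<integral>\<^sup>+\<theta>. g (chart_swap K e f \<theta>) \<partial>leb_prod ((-K) \<times> insert f K)) = (\<integral>\<^sup>+\<theta>. g \<theta> \<partial>leb_prod ((-K) \<times> insert f K))"
  unfolding chart_swap_def by (rule nn_integral_leb_prod_reindex[OF chart_swap_bij]) (use assms in auto)

lemma AE_chart_swap:
  fixes K :: "'n::finite set"
  assumes e: "e \<in> K" and ae: "AE \<theta> in leb_prod ((-K) \<times> insert f K). p \<theta>"
  shows "AE \<theta> in leb_prod ((-K) \<times> insert f K). p (chart_swap K e f \<theta>)"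
proof -
  let ?L = "leb_prod ((-K) \<times> insert f K)"
  have "distr ?L ?L (chart_swap K e f) = ?L"
    unfolding chart_swap_def by (rule leb_prod_reindex[OF chart_swap_bij[OF e]]) simp
  then have "AE \<theta> in distr ?L ?L (chart_swap K e f). p \<theta>" using ae by (simp only:)
  then show ?thesis by (rule AE_distrD[OF chart_swap_measurable[OF e]])
qed

lemma chart_pt_measurable_point: "chart_pt K f \<theta> \<in> borel_measurable (leb_prod K)"
  unfolding chart_pt_def[abs_def] using graph_pt_measurable_point[of K \<theta>] by measurable

text \<open>Comparing measures rather than integrals makes the formula hold for every Borel
  function, integrable on the plane or not.\<close>

lemma plane_transform_chart:
  fixes K :: "'n::finite set" and h :: "real^'n \<Rightarrow> real"
  assumes h[measurable]: "h \<in> borel_measurable borel"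
  shows "plane_transform h (chart_plane K f \<theta>) = graph_jacobian K \<theta> * (\<integral>y. h (chart_pt K f \<theta> y) \<partial>leb_prod K)"
proof -
  note [measurable] = chart_pt_measurable_point
  let ?J = "graph_jacobian K \<theta>"
  have J: "0 \<le> ?J" using graph_jacobian_pos[of K \<theta>] by simp
  have "plane_lebesgue (chart_plane K f \<theta>) = density (distr (leb_prod K) borel (chart_pt K f \<theta>)) (\<lambda>_. ennreal ?J)"
  proof (rule measure_eqI)
    fix B assume "B \<in> sets (plane_lebesgue (chart_plane K f \<theta>))"
    then have B[measurable]: "B \<in> sets borel" by simp
    have "emeasure (plane_lebesgue (chart_plane K f \<theta>)) B = (\<integral>\<^sup>+x. indicator B x \<partial>plane_lebesgue (chart_plane K f \<theta>))"
      by simp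
    also have "\<dots> = ennreal ?J * (\<integral>\<^sup>+y. indicator B (chart_pt K f \<theta> y) \<partial>leb_prod K)"
      unfolding chart_plane_def chart_pt_def by (rule nn_integral_plane_lebesgue_graph) measurable
    also have "(\<integral>\<^sup>+y. indicator B (chart_pt K f \<theta> y) \<partial>leb_prod K) = (\<integral>\<^sup>+x. indicator B x \<partial>distr (leb_prod K) borel (chart_pt K f \<theta>))"
      by (rule nn_integral_distr[symmetric]) measurable
    also have "\<dots> = emeasure (distr (leb_prod K) borel (chart_pt K f \<theta>)) B" by simp
    finally show "emeasure (plane_lebesgue (chart_plane K f \<theta>)) B = emeasure (density (distr (leb_prod K) borel (chart_pt K f \<theta>)) (\<lambda>_. ennreal ?J)) B"
      by (simp add: emeasure_density_const)
  qed simp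
  then have "plane_transform h (chart_plane K f \<theta>) = (\<integral>x. h x \<partial>density (distr (leb_prod K) borel (chart_pt K f \<theta>)) (\<lambda>_. ennreal ?J))"
    by (simp add: plane_transform_def)
  also have "\<dots> = (\<integral>x. ?J *\<^sub>R h x \<partial>distr (leb_prod K) borel (chart_pt K f \<theta>))"
    by (rule integral_density) (use J in auto)
  also have "\<dots> = (\<integral>y. ?J *\<^sub>R h (chart_pt K f \<theta> y) \<partial>leb_prod K)" by (rule integral_distr) measurable
  finally show ?thesis by simp
qed

section \<open>The projective inversion and its effect on the plane transform\<close>

definition proj_inv :: "'n::finite \<Rightarrow> real^'n \<Rightarrow> real^'n" where
  "proj_inv e x = (\<chi> i. if i = e then 1 / x $ e else x $ i / x $ e)"

text \<open>With m = k + 1 the weight is the Jacobian of the inversion within k-planes parametrised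
  over coordinates that include e. Raised to the source exponent it is the Jacobian in the whole
  space.\<close>

definition proj_twist :: "'n::finite \<Rightarrow> nat \<Rightarrow> (real^'n \<Rightarrow> real) \<Rightarrow> real^'n \<Rightarrow> real" where
  "proj_twist e m f x = inverse (\<bar>x $ e\<bar> ^ m) * f (proj_inv e x)"

lemma proj_inv_measurable [measurable]: "proj_inv e \<in> borel_measurable borel"
  unfolding proj_inv_def[abs_def] by (rule borel_measurable_vec_lambda) auto

lemma proj_twist_measurable:
  "f \<in> borel_measurable borel \<Longrightarrow> proj_twist e m f \<in> borel_measurable borel"
  unfolding proj_twist_def[abs_def]
  by (intro borel_measurable_times measurable_compose[OF proj_inv_measurable]) simp_all

lemma nn_integral_proj_inv:
  fixes q :: "real^'n \<Rightarrow> ennreal"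
  assumes [measurable]: "q \<in> borel_measurable borel"
  shows "(\<integral>\<^sup>+x. ennreal (inverse (\<bar>x $ e\<bar> ^ (CARD('n) + 1))) * q (proj_inv e x) \<partial>lborel) = (\<integral>\<^sup>+x. q x \<partial>lborel)"
proof -
  have pv: "proj_inv e (\<chi> i. x i) = (\<chi> i. projective_inversion UNIV e x i)" for x
    by (simp add: proj_inv_def projective_inversion_def vec_eq_iff)
  have "(\<integral>\<^sup>+x. ennreal (inverse (\<bar>x $ e\<bar> ^ (CARD('n) + 1))) * q (proj_inv e x) \<partial>lborel)
     = (\<integral>\<^sup>+x. ennreal (inverse (\<bar>x e\<bar> ^ (CARD('n) + 1))) * q (\<chi> i. projective_inversion UNIV e x i) \<partial>leb_prod UNIV)"
    by (subst nn_integral_lborel_vec) (simp_all add: pv)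
  also have "\<dots> = (\<integral>\<^sup>+x. q (\<chi> i. x i) \<partial>leb_prod UNIV)"
    using nn_integral_projective_inversion[of UNIV e "\<lambda>x. q (\<chi> i. x i)"] by simp
  also have "\<dots> = (\<integral>\<^sup>+x. q x \<partial>lborel)" by (rule nn_integral_lborel_vec[symmetric]) measurable
  finally show ?thesis .
qed

lemma integral_projective_inversion:
  fixes h :: "('i \<Rightarrow> real) \<Rightarrow> real"
  assumes K: "finite K" "e \<in> K" and h[measurable]: "h \<in> borel_measurable (leb_prod K)"
  shows "(\<integral>y. inverse (\<bar>y e\<bar> ^ (card K + 1)) * h (projective_inversion K e y) \<partial>leb_prod K) = (\<integral>y. h y \<partial>leb_prod K)"
proof -
  note [measurable] = projective_inversion_measurable[OF K(2)]
  have [measurable]: "(\<lambda>y. y e) \<in> borel_measurable (leb_prod K)" using K(2) by (rule leb_prod_component)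
  let ?w = "\<lambda>y. inverse (\<bar>y e\<bar> ^ (card K + 1))"
  have "distr (density (leb_prod K) (\<lambda>y. ennreal (?w y))) (leb_prod K) (projective_inversion K e) = leb_prod K"
  proof (rule measure_eqI)
    fix B assume "B \<in> sets (distr (density (leb_prod K) (\<lambda>y. ennreal (?w y))) (leb_prod K) (projective_inversion K e))"
    then have B[measurable]: "B \<in> sets (leb_prod K)" by simp
    have "emeasure (distr (density (leb_prod K) (\<lambda>y. ennreal (?w y))) (leb_prod K) (projective_inversion K e)) B
       = (\<integral>\<^sup>+y. indicator B y \<partial>distr (density (leb_prod K) (\<lambda>y. ennreal (?w y))) (leb_prod K) (projective_inversion K e))"
      by simp
    also have "\<dots> = (\<integral>\<^sup>+y. indicator B (projective_inversion K e y) \<partial>density (leb_prod K) (\<lambda>y. ennreal (?w y)))"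
      by (rule nn_integral_distr) measurable
    also have "\<dots> = (\<integral>\<^sup>+y. ennreal (?w y) * indicator B (projective_inversion K e y) \<partial>leb_prod K)"
      by (rule nn_integral_density) measurable
    also have "\<dots> = (\<integral>\<^sup>+y. indicator B y \<partial>leb_prod K)"
      by (rule nn_integral_projective_inversion[OF K]) measurable
    finally show "emeasure (distr (density (leb_prod K) (\<lambda>y. ennreal (?w y))) (leb_prod K) (projective_inversion K e)) B = emeasure (leb_prod K) B"
      by simp
  qed simp
  then have "(\<integral>y. h y \<partial>leb_prod K) = (\<integral>y. h y \<partial>distr (density (leb_prod K) (\<lambda>y. ennreal (?w y))) (leb_prod K) (projective_inversion K e))"
    by (simp only:)
  also have "\<dots> = (\<integral>y. h (projective_inversion K e y) \<partial>density (leb_prod K) (\<lambda>y. ennreal (?w y)))"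
    by (rule integral_distr) measurable
  also have "\<dots> = (\<integral>y. ?w y *\<^sub>R h (projective_inversion K e y) \<partial>leb_prod K)"
    by (rule integral_density) auto
  finally show ?thesis by simp
qed

text \<open>Divide the affine form theta_f + sum_j theta_j y_j by y_e: the slope theta_e becomes the
  constant term and the offset theta_f becomes the coefficient of 1 / y_e.\<close>

lemma proj_inv_chart_pt:
  assumes e: "e \<in> K" and f: "f \<notin> K" and nz: "y e \<noteq> 0"
  shows "proj_inv e (chart_pt K f \<theta> y) = chart_pt K f (chart_swap K e f \<theta>) (projective_inversion K e y)"
proof (subst vec_eq_iff, rule allI)
  fix i
  have ye: "chart_pt K f \<theta> y $ e = y e" using e by (simp add: chart_pt_def)
  show "proj_inv e (chart_pt K f \<theta> y) $ i = chart_pt K f (chart_swap K e f \<theta>) (projective_inversion K e y) $ i"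
  proof (cases "i \<in> K")
    case True
    then have "proj_inv e (chart_pt K f \<theta> y) $ i = (if i = e then 1 / y e else y i / y e)"
      unfolding proj_inv_def ye by (simp add: chart_pt_def)
    then show ?thesis using True by (simp add: chart_pt_def projective_inversion_def)
  next
    case False
    then have ie: "i \<noteq> e" using e by auto
    have "proj_inv e (chart_pt K f \<theta> y) $ i = (\<theta> (i, f) + (\<Sum>j\<in>K. \<theta> (i, j) * y j)) / y e"
      unfolding proj_inv_def ye using False ie by (simp add: chart_pt_def)
    also have "\<dots> = (\<theta> (i, f) + (\<theta> (i, e) * y e + (\<Sum>j\<in>K-{e}. \<theta> (i, j) * y j))) / y e"
      using e by (simp add: sum.remove[of K e])
    also have "\<dots> = \<theta> (i, e) + (\<theta> (i, f) * (1 / y e) + (\<Sum>j\<in>K-{e}. \<theta> (i, j) * (y j / y e)))"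
      using nz by (simp add: add_divide_distrib sum_divide_distrib)
    also have "(\<Sum>j\<in>K-{e}. \<theta> (i, j) * (y j / y e)) = (\<Sum>j\<in>K-{e}. chart_swap K e f \<theta> (i, j) * projective_inversion K e y j)"
    proof (rule sum.cong)
      fix j assume "j \<in> K - {e}"
      then show "\<theta> (i, j) * (y j / y e) = chart_swap K e f \<theta> (i, j) * projective_inversion K e y j"
        using False f by (auto simp: chart_swap_def projective_inversion_def Transposition.transpose_def)
    qed simp
    also have "\<theta> (i, f) * (1 / y e) = chart_swap K e f \<theta> (i, e) * projective_inversion K e y e"
      using False e by (simp add: chart_swap_def projective_inversion_def)
    also have "chart_swap K e f \<theta> (i, e) * projective_inversion K e y e + (\<Sum>j\<in>K-{e}. chart_swap K e f \<theta> (i, j) * projective_inversion K e y j)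
       = (\<Sum>j\<in>K. chart_swap K e f \<theta> (i, j) * projective_inversion K e y j)"
      using e by (simp add: sum.remove[of K e])
    also have "\<theta> (i, e) = chart_swap K e f \<theta> (i, f)"
      using False by (simp add: chart_swap_def)
    finally show ?thesis using False by (simp add: chart_pt_def)
  qed
qed

text \<open>In the chart, the projective inversion only exchanges the offset of the plane with one of its
  slopes.\<close>

lemma plane_transform_proj_twist:
  fixes K :: "'n::finite set" and h :: "real^'n \<Rightarrow> real"
  assumes e: "e \<in> K" and f: "f \<notin> K" and h[measurable]: "h \<in> borel_measurable borel"
  shows "plane_transform (proj_twist e (card K + 1) h) (chart_plane K f \<theta>)
     = graph_jacobian K \<theta> / graph_jacobian K (chart_swap K e f \<theta>) * plane_transform h (chart_plane K f (chart_swap K e f \<theta>))"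
proof -
  let ?\<theta> = "chart_swap K e f \<theta>"
  note [measurable] = chart_pt_measurable_point
  have "proj_twist e (card K + 1) h (chart_pt K f \<theta> y) = inverse (\<bar>y e\<bar> ^ (card K + 1)) * h (chart_pt K f ?\<theta> (projective_inversion K e y))" for y
  \<comment> \<open>Where y e = 0, both weights are the inverse of 0, so the sides agree whatever
    the points are.\<close>
  proof (cases "y e = 0")
    case True
    then show ?thesis using e by (simp add: proj_twist_def chart_pt_def)
  next
    case False
    have "chart_pt K f \<theta> y $ e = y e" using e by (simp add: chart_pt_def)
    then show ?thesis unfolding proj_twist_def proj_inv_chart_pt[of e K f y, OF e f False] by (simp only:)
  qed
  then have "(\<integral>y. proj_twist e (card K + 1) h (chart_pt K f \<theta> y) \<partial>leb_prod K)
     = (\<integral>y. inverse (\<bar>y e\<bar> ^ (card K + 1)) * h (chart_pt K f ?\<theta> (projective_inversion K e y)) \<partial>leb_prod K)"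
    by (simp only:)
  also have "\<dots> = (\<integral>y. h (chart_pt K f ?\<theta> y) \<partial>leb_prod K)"
    by (rule integral_projective_inversion[of K e "\<lambda>y. h (chart_pt K f ?\<theta> y)"]) (use e in auto)
  finally have eq: "(\<integral>y. proj_twist e (card K + 1) h (chart_pt K f \<theta> y) \<partial>leb_prod K) = (\<integral>y. h (chart_pt K f ?\<theta> y) \<partial>leb_prod K)" .
  have aux: "a * c = a / b * (b * c)" if "b \<noteq> 0" for a b c :: real using that by simp
  have nz: "graph_jacobian K ?\<theta> \<noteq> 0" using graph_jacobian_pos[of K ?\<theta>] by simp
  show ?thesis
    unfolding plane_transform_chart[OF proj_twist_measurable[OF h], of e "card K + 1" K f \<theta>] plane_transform_chart[OF h, of K f ?\<theta>] eq
    by (rule aux[OF nz])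
qed

section \<open>Compactly supported continuous functions and their transforms in L^p\<close>

lemma compactly_supported_continuous_bounds:
  fixes F :: "'a::euclidean_space \<Rightarrow> real"
  assumes "compactly_supported_continuous F"
  obtains B R where "0 \<le> B" "0 \<le> R" "\<And>x. \<bar>F x\<bar> \<le> B" "\<And>x. R < norm x \<Longrightarrow> F x = 0"
proof -
  let ?S = "closure {x. F x \<noteq> 0}"
  have c: "continuous_on UNIV F" "compact ?S" using assms by (auto simp: compactly_supported_continuous_def)
  obtain R where R: "\<And>x. x \<in> ?S \<Longrightarrow> norm x \<le> R"
    using compact_imp_bounded[OF c(2)] unfolding bounded_iff by blast
  have "bounded (F ` ?S)"
    by (intro compact_imp_bounded compact_continuous_image continuous_on_subset[OF c(1)] c(2)) simp
  then obtain B where "\<And>y. y \<in> F ` ?S \<Longrightarrow> norm y \<le> B" unfolding bounded_iff by blast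
  then have B: "\<bar>F x\<bar> \<le> B" if "x \<in> ?S" for x using that by force
  have S: "x \<in> ?S" if "F x \<noteq> 0" for x
    by (rule subsetD[OF closure_subset]) (simp add: that)
  show thesis
  proof (rule that[of "max 0 B" "max 0 R"])
    show "\<bar>F x\<bar> \<le> max 0 B" for x
    proof (cases "F x = 0")
      case False
      from B[OF S[OF False]] show ?thesis by simp
    qed simp
    show "F x = 0" if "max 0 R < norm x" for x
    proof (rule ccontr)
      assume "F x \<noteq> 0"
      from R[OF S[OF this]] that show False by simp
    qed
  qed auto
qed

lemma compactly_supported_continuousI:
  fixes F :: "'a::euclidean_space \<Rightarrow> real"
  assumes "continuous_on UNIV F" "\<And>x. R < norm x \<Longrightarrow> F x = 0"
  shows "compactly_supported_continuous F"
proof -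
  have "{x. F x \<noteq> 0} \<subseteq> cball 0 R"
  proof (intro subsetI)
    fix x assume "x \<in> {x. F x \<noteq> 0}"
    then have "\<not> R < norm x" using assms(2)[of x] by auto
    then show "x \<in> cball 0 R" by simp
  qed
  then have "bounded {x. F x \<noteq> 0}" by (rule bounded_subset[OF bounded_cball])
  then show ?thesis using assms(1) by (simp add: compactly_supported_continuous_def compact_closure)
qed

lemma compactly_supported_continuous_measurable:
  "compactly_supported_continuous F \<Longrightarrow> F \<in> borel_measurable borel"
  by (auto simp: compactly_supported_continuous_def intro: borel_measurable_continuous_onI)

lemma Lp_space_bounded_support:
  assumes f: "f \<in> borel_measurable M" "\<And>x. \<bar>f x\<bar> \<le> B"
    and S: "S \<in> sets M" "emeasure M S < \<infinity>" "\<And>x. x \<in> space M \<Longrightarrow> x \<notin> S \<Longrightarrow> f x = 0" and p: "0 < p"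
  shows "f \<in> Lp_space M p"
proof -
  have "integrable M (\<lambda>x. \<bar>f x\<bar> powr p)"
  proof (rule integrableI_bounded_set[where A=S and B="B powr p"])
    show "(\<lambda>x. \<bar>f x\<bar> powr p) \<in> borel_measurable M" using f(1) by measurable
    show "AE x\<in>S in M. norm (\<bar>f x\<bar> powr p) \<le> B powr p"
      using f(2) p by (auto intro!: AE_I2 powr_mono2)
    show "AE x in M. x \<notin> S \<longrightarrow> \<bar>f x\<bar> powr p = 0" using S(3) by (auto intro!: AE_I2)
  qed (use S in auto)
  then show ?thesis using f(1) by (simp add: Lp_space_def)
qed

lemma abs_add_powr_le:
  fixes a b p :: real
  assumes "0 < p"
  shows "\<bar>a + b\<bar> powr p \<le> 2 powr p * (\<bar>a\<bar> powr p + \<bar>b\<bar> powr p)"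
proof -
  have "\<bar>a + b\<bar> powr p \<le> (2 * max \<bar>a\<bar> \<bar>b\<bar>) powr p" using assms by (intro powr_mono2) auto
  also have "\<dots> = 2 powr p * (max \<bar>a\<bar> \<bar>b\<bar> powr p)" by (simp add: powr_mult)
  also have "max \<bar>a\<bar> \<bar>b\<bar> powr p \<le> \<bar>a\<bar> powr p + \<bar>b\<bar> powr p" by (simp add: max_def)
  finally show ?thesis by simp
qed

lemma Lp_space_add:
  assumes p: "0 < p" and f: "f \<in> Lp_space M p" and g: "g \<in> Lp_space M p"
  shows "(\<lambda>x. f x + g x) \<in> Lp_space M p"
    "(\<integral>x. \<bar>f x + g x\<bar> powr p \<partial>M) \<le> 2 powr p * ((\<integral>x. \<bar>f x\<bar> powr p \<partial>M) + (\<integral>x. \<bar>g x\<bar> powr p \<partial>M))"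
proof -
  have [measurable]: "f \<in> borel_measurable M" "g \<in> borel_measurable M" and
    i: "integrable M (\<lambda>x. \<bar>f x\<bar> powr p)" "integrable M (\<lambda>x. \<bar>g x\<bar> powr p)"
    using f g by (auto simp: Lp_space_def)
  have i2: "integrable M (\<lambda>x. 2 powr p * (\<bar>f x\<bar> powr p + \<bar>g x\<bar> powr p))" using i by simp
  have i3: "integrable M (\<lambda>x. \<bar>f x + g x\<bar> powr p)"
    by (rule Bochner_Integration.integrable_bound[OF i2]) (auto intro!: AE_I2 abs_add_powr_le p order_trans[OF _ abs_ge_self])
  then show "(\<lambda>x. f x + g x) \<in> Lp_space M p" by (simp add: Lp_space_def)
  have "(\<integral>x. \<bar>f x + g x\<bar> powr p \<partial>M) \<le> (\<integral>x. 2 powr p * (\<bar>f x\<bar> powr p + \<bar>g x\<bar> powr p) \<partial>M)"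
    by (rule integral_mono[OF i3 i2]) (rule abs_add_powr_le[OF p])
  also have "\<dots> = 2 powr p * ((\<integral>x. \<bar>f x\<bar> powr p \<partial>M) + (\<integral>x. \<bar>g x\<bar> powr p \<partial>M))" using i by simp
  finally show "(\<integral>x. \<bar>f x + g x\<bar> powr p \<partial>M) \<le> 2 powr p * ((\<integral>x. \<bar>f x\<bar> powr p \<partial>M) + (\<integral>x. \<bar>g x\<bar> powr p \<partial>M))" .
qed

lemma Lp_space_uminus: "f \<in> Lp_space M p \<Longrightarrow> (\<lambda>x. - f x) \<in> Lp_space M p"
  by (auto simp: Lp_space_def)

lemma Lp_norm_tendsto_0_iff:
  assumes "0 < p"
  shows "(\<lambda>n. Lp_norm M p (u n)) \<longlonglongrightarrow> 0 \<longleftrightarrow> (\<lambda>n. \<integral>x. \<bar>u n x\<bar> powr p \<partial>M) \<longlonglongrightarrow> 0"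
proof
  let ?I = "\<lambda>n. \<integral>x. \<bar>u n x\<bar> powr p \<partial>M"
  have nn: "0 \<le> ?I n" for n by (rule integral_nonneg_AE) simp
  show "(\<lambda>n. Lp_norm M p (u n)) \<longlonglongrightarrow> 0" if "?I \<longlonglongrightarrow> 0"
    unfolding Lp_norm_def using that nn assms by (intro tendsto_zero_powrI[where b="1/p"]) auto
  assume "(\<lambda>n. Lp_norm M p (u n)) \<longlonglongrightarrow> 0"
  then have "(\<lambda>n. Lp_norm M p (u n) powr p) \<longlonglongrightarrow> 0"
    using assms by (intro tendsto_zero_powrI[where b=p]) (auto simp: Lp_norm_def)
  moreover have "Lp_norm M p (u n) powr p = ?I n" for n
    using nn[of n] assms by (simp add: Lp_norm_def powr_powr)
  ultimately show "?I \<longlonglongrightarrow> 0" by simp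
qed

lemma Lp_converges_iff:
  assumes "0 < p"
  shows "Lp_converges M p F f \<longleftrightarrow> (\<forall>n. (\<lambda>x. F n x - f x) \<in> Lp_space M p) \<and> (\<lambda>n. \<integral>x. \<bar>F n x - f x\<bar> powr p \<partial>M) \<longlonglongrightarrow> 0"
  unfolding Lp_converges_def using Lp_norm_tendsto_0_iff[OF assms, of M "\<lambda>n x. F n x - f x"] by simp

lemma Lp_converges_trans:
  assumes p: "0 < p" and F: "Lp_converges M p F f" and G: "Lp_converges M p (\<lambda>n x. G n x - F n x) (\<lambda>_. 0)"
  shows "Lp_converges M p G f"
proof -
  have F': "\<And>n. (\<lambda>x. F n x - f x) \<in> Lp_space M p" "(\<lambda>n. \<integral>x. \<bar>F n x - f x\<bar> powr p \<partial>M) \<longlonglongrightarrow> 0"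
    using F by (auto simp: Lp_converges_iff[OF p])
  have G': "\<And>n. (\<lambda>x. G n x - F n x) \<in> Lp_space M p" "(\<lambda>n. \<integral>x. \<bar>G n x - F n x\<bar> powr p \<partial>M) \<longlonglongrightarrow> 0"
    using G by (auto simp: Lp_converges_iff[OF p])
  have eq: "G n x - f x = (G n x - F n x) + (F n x - f x)" for n x by simp
  show ?thesis
    unfolding Lp_converges_iff[OF p]
  proof (intro conjI allI)
    show "(\<lambda>x. G n x - f x) \<in> Lp_space M p" for n
      unfolding eq by (rule Lp_space_add(1)[OF p G'(1) F'(1)])
    show "(\<lambda>n. \<integral>x. \<bar>G n x - f x\<bar> powr p \<partial>M) \<longlonglongrightarrow> 0"
    proof (rule tendsto_sandwich[OF _ _ tendsto_const])
      show "\<forall>\<^sub>F n in sequentially. 0 \<le> (\<integral>x. \<bar>G n x - f x\<bar> powr p \<partial>M)" by (auto intro!: always_eventually integral_nonneg_AE)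
      show "\<forall>\<^sub>F n in sequentially. (\<integral>x. \<bar>G n x - f x\<bar> powr p \<partial>M) \<le> 2 powr p * ((\<integral>x. \<bar>G n x - F n x\<bar> powr p \<partial>M) + (\<integral>x. \<bar>F n x - f x\<bar> powr p \<partial>M))"
        unfolding eq by (intro always_eventually allI Lp_space_add(2)[OF p G'(1) F'(1)])
      show "(\<lambda>n. 2 powr p * ((\<integral>x. \<bar>G n x - F n x\<bar> powr p \<partial>M) + (\<integral>x. \<bar>F n x - f x\<bar> powr p \<partial>M))) \<longlonglongrightarrow> 0"
        using tendsto_mult_right_zero[OF tendsto_add_zero[OF G'(2) F'(2)]] by simp
    qed
  qed
qed

text \<open>The tube formula for integrands of any sign. The plane enters only through its
  projection and distance functions, so the transform is a measurable function of the plane.\<close>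

lemma plane_transform_tube:
  fixes K :: "'n::finite set" and h :: "real^'n \<Rightarrow> real"
  assumes Q: "Q \<in> affine_planes (card K)" and h[measurable]: "h \<in> borel_measurable borel"
  shows "plane_transform h Q = (\<integral>v. indicator {v. infdist v Q \<le> 1} v * h (closest_point Q v) \<partial>lborel) / enn2real (coord_ball_volume (-K))"
proof -
  let ?c = "coord_ball_volume (-K)"
  have c: "?c \<noteq> 0" "?c \<noteq> \<infinity>" using coord_ball_volume_pos[of "-K"] coord_ball_volume_finite[of "-K"] by auto
  have aff: "affine Q" "Q \<noteq> {}" using Q by (auto simp: affine_planes_def)
  have [measurable]: "closest_point Q \<in> borel_measurable borel" by (rule borel_measurable_closest_point_affine) fact+
  have [measurable]: "(\<lambda>v. infdist v Q) \<in> borel_measurable borel"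
    by (intro borel_measurable_continuous_onI continuous_intros)
  let ?i = "\<lambda>v. indicator {v. infdist v Q \<le> 1} v :: real"
  let ?D = "distr (density lborel (\<lambda>v. ennreal (?i v / enn2real ?c))) borel (closest_point Q)"
  have c': "0 < enn2real ?c" using c by (simp add: enn2real_positive_iff less_top zero_less_iff_neq_zero)
  have "plane_lebesgue Q = ?D"
  proof (rule measure_eqI)
    fix B assume "B \<in> sets (plane_lebesgue Q)"
    then have B[measurable]: "B \<in> sets borel" by simp
    have "emeasure ?D B = (\<integral>\<^sup>+x. indicator B x \<partial>?D)" by simp
    also have "\<dots> = (\<integral>\<^sup>+v. indicator B (closest_point Q v) \<partial>density lborel (\<lambda>v. ennreal (?i v / enn2real ?c)))"
      by (rule nn_integral_distr) measurable
    also have "\<dots> = (\<integral>\<^sup>+v. ennreal (?i v / enn2real ?c) * indicator B (closest_point Q v) \<partial>lborel)"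
      by (rule nn_integral_density) measurable
    finally have "?c * emeasure ?D B = (\<integral>\<^sup>+v. ?c * (ennreal (?i v / enn2real ?c) * indicator B (closest_point Q v)) \<partial>lborel)"
      by (simp add: nn_integral_cmult)
    also have "\<dots> = (\<integral>\<^sup>+v. indicator B (closest_point Q v) * indicator {v. infdist v Q \<le> 1} v \<partial>lborel)"
    proof (rule nn_integral_cong)
      fix v
      have "?c = ennreal (enn2real ?c)" using c(2) by (simp add: less_top)
      then have "?c * ennreal (?i v / enn2real ?c) = ennreal (enn2real ?c * (?i v / enn2real ?c))"
        using c' by (subst ennreal_mult) auto
      also have "enn2real ?c * (?i v / enn2real ?c) = ?i v" using c' by simp
      finally show "?c * (ennreal (?i v / enn2real ?c) * indicator B (closest_point Q v)) = indicator B (closest_point Q v) * indicator {v. infdist v Q \<le> 1} v"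
        unfolding mult.assoc[symmetric] by (simp add: indicator_def)
    qed
    also have "\<dots> = ?c * (\<integral>\<^sup>+x. indicator B x \<partial>plane_lebesgue Q)"
      by (rule nn_integral_plane_lebesgue[OF Q, symmetric]) measurable
    finally have "emeasure ?D B = (\<integral>\<^sup>+x. indicator B x \<partial>plane_lebesgue Q)" by (rule ennreal_mult_cancelI[OF c])
    then show "emeasure (plane_lebesgue Q) B = emeasure ?D B" by simp
  qed simp
  then have "plane_transform h Q = (\<integral>x. h x \<partial>?D)" unfolding plane_transform_def by (simp only:)
  also have "\<dots> = (\<integral>v. h (closest_point Q v) \<partial>density lborel (\<lambda>v. ennreal (?i v / enn2real ?c)))"
    by (rule integral_distr) measurable
  also have "\<dots> = (\<integral>v. (?i v / enn2real ?c) *\<^sub>R h (closest_point Q v) \<partial>lborel)"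
    by (rule integral_density) (auto intro!: AE_I2)
  also have "\<dots> = (\<integral>v. ?i v * h (closest_point Q v) / enn2real ?c \<partial>lborel)" by simp
  also have "\<dots> = (\<integral>v. ?i v * h (closest_point Q v) \<partial>lborel) / enn2real ?c" by (rule integral_divide_zero)
  finally show ?thesis .
qed

lemma plane_transform_measurable:
  fixes K :: "'n::finite set" and h :: "real^'n \<Rightarrow> real"
  assumes h: "h \<in> borel_measurable borel"
  shows "plane_transform h \<in> borel_measurable (plane_algebra (affine_planes (card K)))"
proof -
  let ?M = "plane_algebra (affine_planes (card K)) :: (real^'n) set measure"
  have G: "\<And>P. P \<in> affine_planes (card K) \<Longrightarrow> affine P \<and> P \<noteq> ({} :: (real^'n) set)" by (rule affine_planes_affine)
  have 1: "(\<lambda>w. closest_point (fst w) (snd w)) \<in> borel_measurable (?M \<Otimes>\<^sub>M lborel)"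
    by (rule measurable_closest_point_plane[OF G]) auto
  have 2: "(\<lambda>w. infdist (snd w) (fst w)) \<in> borel_measurable (?M \<Otimes>\<^sub>M lborel)"
    by (rule measurable_infdist_plane'[OF G]) auto
  have "(\<lambda>w. indicator {v. infdist v (fst w) \<le> 1} (snd w) * h (closest_point (fst w) (snd w))) \<in> borel_measurable (?M \<Otimes>\<^sub>M lborel)"
  proof (rule borel_measurable_times)
    have "(\<lambda>w. if infdist (snd w) (fst w) \<le> 1 then 1 else 0 :: real) \<in> borel_measurable (?M \<Otimes>\<^sub>M lborel)"
      using 2 by measurable
    then show "(\<lambda>w. indicator {v. infdist v (fst w) \<le> 1} (snd w) :: real) \<in> borel_measurable (?M \<Otimes>\<^sub>M lborel)"
      by (simp add: indicator_def of_bool_def)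
    show "(\<lambda>w. h (closest_point (fst w) (snd w))) \<in> borel_measurable (?M \<Otimes>\<^sub>M lborel)" by (rule measurable_compose[OF 1 h])
  qed
  then have "(\<lambda>Q. \<integral>v. indicator {v. infdist v Q \<le> 1} v * h (closest_point Q v) \<partial>lborel) \<in> borel_measurable ?M"
    by (intro lborel.borel_measurable_lebesgue_integral) (simp add: split_def)
  then have "(\<lambda>Q. (\<integral>v. indicator {v. infdist v Q \<le> 1} v * h (closest_point Q v) \<partial>lborel) / enn2real (coord_ball_volume (-K))) \<in> borel_measurable ?M"
    by measurable
  then show ?thesis
    by (rule measurable_cong[THEN iffD1, rotated]) (simp add: plane_transform_tube[OF _ h])
qed

text \<open>The part of the unit tube around Q that projects into the ball of radius R lies in the
  ball of radius R + 1. The bound is uniform in Q.\<close>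

lemma plane_lebesgue_cball:
  fixes K :: "'n::finite set" and Q :: "(real^'n) set"
  assumes Q: "Q \<in> affine_planes (card K)" and R: "0 \<le> R"
  shows "emeasure (plane_lebesgue Q) (cball 0 R) \<le> emeasure lborel (cball (0 :: real^'n) (R + 1)) / coord_ball_volume (-K)"
proof -
  let ?c = "coord_ball_volume (-K)"
  have c: "?c \<noteq> 0" "?c \<noteq> \<infinity>" using coord_ball_volume_pos[of "-K"] coord_ball_volume_finite[of "-K"] by auto
  have aff: "affine Q" "Q \<noteq> {}" using Q by (auto simp: affine_planes_def)
  have "?c * emeasure (plane_lebesgue Q) (cball 0 R) = ?c * (\<integral>\<^sup>+x. indicator (cball 0 R) x \<partial>plane_lebesgue Q)"
    by simp
  also have "\<dots> = (\<integral>\<^sup>+v. indicator (cball 0 R) (closest_point Q v) * indicator {v. infdist v Q \<le> 1} v \<partial>lborel)"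
    by (rule nn_integral_plane_lebesgue[OF Q]) (intro borel_measurable_indicator borel_closed closed_cball)
  also have "\<dots> \<le> (\<integral>\<^sup>+v. indicator (cball (0 :: real^'n) (R + 1)) v \<partial>lborel)"
  proof (rule nn_integral_mono)
    fix v
    have "norm v \<le> norm (closest_point Q v) + infdist v Q"
      unfolding infdist_affine[OF aff] using norm_triangle_ineq[of "closest_point Q v" "v - closest_point Q v"] by simp
    then show "indicator (cball 0 R) (closest_point Q v) * indicator {v. infdist v Q \<le> 1} v \<le> (indicator (cball 0 (R + 1)) v :: ennreal)"
      by (auto simp: indicator_def)
  qed
  also have "\<dots> = emeasure lborel (cball (0 :: real^'n) (R + 1))" by simp
  finally have "?c * emeasure (plane_lebesgue Q) (cball 0 R) \<le> emeasure lborel (cball (0 :: real^'n) (R + 1))" .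
  then have "(?c * emeasure (plane_lebesgue Q) (cball 0 R)) / ?c \<le> emeasure lborel (cball (0 :: real^'n) (R + 1)) / ?c"
    by (rule divide_right_mono_ennreal)
  then show ?thesis using ennreal_eq_divideI[OF c refl] by simp
qed

text \<open>A bound uniform in the plane and vanishing on planes far from the origin are what put
  the transform into L^q.\<close>

lemma plane_transform_cc:
  fixes K :: "'n::finite set" and Q :: "(real^'n) set" and F :: "real^'n \<Rightarrow> real"
  assumes Q: "Q \<in> affine_planes (card K)" and F: "compactly_supported_continuous F"
  shows "integrable (plane_lebesgue Q) F"
    and "0 \<le> B \<Longrightarrow> 0 \<le> R \<Longrightarrow> (\<And>x. \<bar>F x\<bar> \<le> B) \<Longrightarrow> (\<And>x. R < norm x \<Longrightarrow> F x = 0) \<Longrightarrow>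
      \<bar>plane_transform F Q\<bar> \<le> B * enn2real (emeasure lborel (cball (0 :: real^'n) (R + 1)) / coord_ball_volume (-K))"
    and "(\<And>x. R < norm x \<Longrightarrow> F x = 0) \<Longrightarrow> R < infdist 0 Q \<Longrightarrow> plane_transform F Q = 0"
proof -
  let ?m = "\<lambda>R. emeasure lborel (cball (0 :: real^'n) (R + 1)) / coord_ball_volume (-K)"
  have c: "coord_ball_volume (-K) \<noteq> 0" using coord_ball_volume_pos[of "-K"] by auto
  have fin: "?m R < \<infinity>" for R
  proof -
    have "emeasure lborel (cball (0 :: real^'n) (R + 1)) < \<infinity>" by (rule emeasure_bounded_finite) simp
    then show ?thesis using c by (auto simp: ennreal_divide_eq_top_iff less_top[symmetric])
  qed
  have Fm: "F \<in> borel_measurable borel" by (rule compactly_supported_continuous_measurable[OF F])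
  have int: "integrable (plane_lebesgue Q) F" if "0 \<le> R" "\<And>x. \<bar>F x\<bar> \<le> B" "\<And>x. R < norm x \<Longrightarrow> F x = 0" for B R
  proof (rule integrableI_bounded_set[where A="cball 0 R" and B=B])
    show "emeasure (plane_lebesgue Q) (cball 0 R) < \<infinity>" using plane_lebesgue_cball[OF Q that(1)] fin[of R] by (rule le_less_trans)
    show "AE x in plane_lebesgue Q. x \<notin> cball 0 R \<longrightarrow> F x = 0" using that(3) by (auto intro!: AE_I2)
  qed (use that Fm in auto)
  show "integrable (plane_lebesgue Q) F" by (rule compactly_supported_continuous_bounds[OF F]) (rule int)
  show "\<bar>plane_transform F Q\<bar> \<le> B * enn2real (?m R)" if "0 \<le> B" "0 \<le> R" "\<And>x. \<bar>F x\<bar> \<le> B" "\<And>x. R < norm x \<Longrightarrow> F x = 0"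
  proof -
    have fb: "emeasure (plane_lebesgue Q) (cball 0 R) < \<infinity>" using plane_lebesgue_cball[OF Q that(2)] fin[of R] by (rule le_less_trans)
    have i: "integrable (plane_lebesgue Q) (\<lambda>x. B * indicator (cball 0 R) x)" using fb by simp
    have "\<bar>plane_transform F Q\<bar> \<le> (\<integral>x. B * indicator (cball 0 R) x \<partial>plane_lebesgue Q)"
      unfolding plane_transform_def real_norm_def[symmetric]
    proof (rule Bochner_Integration.integral_norm_bound_integral[OF int[OF that(2,3,4)] i])
      show "norm (F x) \<le> B * indicator (cball 0 R) x" for x
        using that(3)[of x] that(4)[of x] by (cases "norm x \<le> R") auto
    qed
    also have "\<dots> = B * measure (plane_lebesgue Q) (cball 0 R)" by simp
    also have "measure (plane_lebesgue Q) (cball 0 R) \<le> enn2real (?m R)"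
      unfolding measure_def by (rule enn2real_mono[OF plane_lebesgue_cball[OF Q that(2)]]) (use fin[of R] in simp)
    finally show ?thesis using that(1) by (simp add: mult_left_mono)
  qed
  show "plane_transform F Q = 0" if "\<And>x. R < norm x \<Longrightarrow> F x = 0" "R < infdist 0 Q"
  proof -
    have aff: "affine Q" "Q \<noteq> {}" using Q by (auto simp: affine_planes_def)
    have "F (closest_point Q v) = 0" for v
    proof (rule that(1))
      have "infdist 0 Q \<le> dist 0 (closest_point Q v)" by (rule infdist_le) (rule closest_point_affine_in[OF aff])
      then show "R < norm (closest_point Q v)" using that(2) by simp
    qed
    then show ?thesis unfolding plane_transform_tube[OF Q Fm] by simp
  qed
qed

context plane_prob
begin

text \<open>In slab coordinates a plane at distance at most R from 0 comes from a vector of norm at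
  most R + 1, whatever its direction.\<close>

lemma plane_measure_near_finite:
  assumes R: "0 \<le> R"
  shows "{Q \<in> affine_planes (card K). infdist 0 Q \<le> R} \<in> sets (plane_measure (card K) \<mu>)"
    "emeasure (plane_measure (card K) \<mu>) {Q \<in> affine_planes (card K). infdist 0 Q \<le> R} < \<infinity>"
proof -
  let ?S = "{Q \<in> affine_planes (card K). infdist (0 :: real^'n) Q \<le> R}"
  let ?M = "plane_algebra (affine_planes (card K)) :: (real^'n) set measure"
  have "(\<lambda>Q. infdist (0 :: real^'n) Q) \<in> borel_measurable ?M"
    by (rule measurable_infdist_plane'[where G="affine_planes (card K)"]) (simp_all add: affine_planes_affine)
  then have "{Q \<in> space ?M. infdist 0 Q \<le> R} \<in> sets ?M" by measurable
  then have S: "?S \<in> sets ?M" by simp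
  then show S': "?S \<in> sets (plane_measure (card K) \<mu>)" by simp
  interpret prob_space \<mu> by (rule prob)
  have "coord_ball_volume K * emeasure (plane_measure (card K) \<mu>) ?S = coord_ball_volume K * (\<integral>\<^sup>+Q. indicator ?S Q \<partial>plane_measure (card K) \<mu>)"
    using S' by simp
  also have "\<dots> = (\<integral>\<^sup>+P. (\<integral>\<^sup>+v. indicator ?S ((+) v ` P) * indicator {v. norm (closest_point P v) \<le> 1} v \<partial>lborel) \<partial>\<mu>)"
    by (rule nn_integral_plane_measure) (use S in simp)
  also have "\<dots> \<le> (\<integral>\<^sup>+P. (\<integral>\<^sup>+v. indicator (cball 0 (R + 1)) v \<partial>(lborel :: (real^'n) measure)) \<partial>\<mu>)"
  proof (intro nn_integral_mono)
    fix P v assume "P \<in> space \<mu>"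
    then have P: "subspace P" by (simp add: space_mu linear_planes_iff)
    then have aff: "affine P" "P \<noteq> {}" using subspace_0 by (auto simp: subspace_imp_affine)
    have affv: "affine ((+) v ` P)" "(+) v ` P \<noteq> {}" using aff affine_translation[of P v] by auto
    have "closest_point ((+) v ` P) 0 = v + closest_point P (- v)" using closest_point_translation[OF aff, of v "- v"] by simp
    moreover have "closest_point P (- v) = - closest_point P v"
    proof (rule closest_point_affine_unique[OF aff(1)])
      have cP: "closest_point P v \<in> P" by (rule closest_point_affine_in[OF aff])
      then show "- closest_point P v \<in> P" by (rule subspace_neg[OF P])
      fix x assume "x \<in> P"
      then have "- x \<in> P" by (rule subspace_neg[OF P])
      from closest_point_affine_orth[OF aff(1) this, of v]
      have "(v - closest_point P v) \<bullet> (- x - closest_point P v) = 0" .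
      moreover have "(- v - - closest_point P v) \<bullet> (x - - closest_point P v) = (v - closest_point P v) \<bullet> (- x - closest_point P v)"
        by (simp add: inner_diff_left inner_diff_right inner_add_right)
      ultimately show "(- v - - closest_point P v) \<bullet> (x - - closest_point P v) = 0" by simp
    qed
    ultimately have "infdist 0 ((+) v ` P) = norm (v - closest_point P v)"
      unfolding infdist_affine[OF affv] by (simp add: norm_minus_commute)
    moreover have "norm v \<le> norm (closest_point P v) + norm (v - closest_point P v)"
      using norm_triangle_ineq[of "closest_point P v" "v - closest_point P v"] by simp
    ultimately show "indicator ?S ((+) v ` P) * indicator {v. norm (closest_point P v) \<le> 1} v \<le> (indicator (cball 0 (R + 1)) v :: ennreal)"
      by (auto simp: indicator_def)
  qed
  also have "\<dots> = emeasure lborel (cball (0 :: real^'n) (R + 1))" by (simp add: emeasure_space_1)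
  also have "\<dots> < \<infinity>" by (rule emeasure_bounded_finite) simp
  finally show "emeasure (plane_measure (card K) \<mu>) ?S < \<infinity>"
    using coord_ball_volume_pos[of K] by (auto simp: ennreal_mult_less_top)
qed

lemma plane_transform_cc_Lp:
  assumes F: "compactly_supported_continuous F" and q: "0 < q"
  shows "plane_transform F \<in> Lp_space (plane_measure (card K) \<mu>) q"
proof -
  obtain B R where B: "0 \<le> B" "0 \<le> R" "\<And>x. \<bar>F x\<bar> \<le> B" "\<And>x. R < norm x \<Longrightarrow> F x = 0"
    by (rule compactly_supported_continuous_bounds[OF F]) (rule that)
  let ?M = "plane_measure (card K) \<mu>"
  let ?B = "B * enn2real (emeasure lborel (cball (0 :: real^'n) (R + 1)) / coord_ball_volume (-K))"
  have sp: "space ?M = affine_planes (card K)" using sets_eq_imp_space_eq[OF sets_plane_measure] by simp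
  define h where "h Q = (if Q \<in> affine_planes (card K) then plane_transform F Q else 0)" for Q
  have Fm: "plane_transform F \<in> borel_measurable ?M"
    using plane_transform_measurable[OF compactly_supported_continuous_measurable[OF F], of K]
      measurable_cong_sets[OF sets_plane_measure refl] by blast
  have "h \<in> Lp_space ?M q"
  proof (rule Lp_space_bounded_support[where B="max 0 ?B" and S="{Q \<in> affine_planes (card K). infdist 0 Q \<le> R}"])
    show "h \<in> borel_measurable ?M"
      by (rule measurable_cong[THEN iffD1, OF _ Fm]) (simp add: h_def sp)
    show "\<bar>h Q\<bar> \<le> max 0 ?B" for Q
    proof (cases "Q \<in> affine_planes (card K)")
      case True
      have "\<bar>plane_transform F Q\<bar> \<le> ?B" using plane_transform_cc(2)[OF True F B(1,2)] B(3,4) by blast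
      then show ?thesis using True by (simp add: h_def)
    qed (simp add: h_def)
    fix Q assume Q: "Q \<in> space ?M" "Q \<notin> {Q \<in> affine_planes (card K). infdist 0 Q \<le> R}"
    then have "R < infdist 0 Q" by (simp add: sp)
    then show "h Q = 0" using plane_transform_cc(3)[of Q K F R, OF _ F] Q(1) B(4) by (simp add: h_def sp)
  qed (use plane_measure_near_finite[OF B(2)] q in auto)
  moreover have "integrable ?M (\<lambda>x. \<bar>h x\<bar> powr q) \<longleftrightarrow> integrable ?M (\<lambda>x. \<bar>plane_transform F x\<bar> powr q)"
    by (rule Bochner_Integration.integrable_cong) (simp_all add: h_def sp)
  ultimately show ?thesis using Fm by (simp add: Lp_space_def)
qed

end

lemma compactly_supported_continuous_Lp:
  fixes F :: "'a::euclidean_space \<Rightarrow> real"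
  assumes F: "compactly_supported_continuous F" and p: "0 < p"
  shows "F \<in> Lp_space lborel p"
proof -
  obtain B R where B: "0 \<le> B" "0 \<le> R" "\<And>x. \<bar>F x\<bar> \<le> B" "\<And>x. R < norm x \<Longrightarrow> F x = 0"
    by (rule compactly_supported_continuous_bounds[OF F]) (rule that)
  show ?thesis
  proof (rule Lp_space_bounded_support[where B=B and S="cball 0 R"])
    show "F \<in> borel_measurable lborel" using compactly_supported_continuous_measurable[OF F] by simp
    show "emeasure lborel (cball (0 :: 'a) R) < \<infinity>" by (rule emeasure_bounded_finite) simp
    show "F x = 0" if "x \<notin> cball 0 R" for x using B(4)[of x] that by simp
  qed (use B p in auto)
qed

section \<open>The twist preserves the norms on both sides of the inequality\<close>

lemma abs_powr_Suc: "\<bar>x :: real\<bar> powr (real n + 1) = \<bar>x\<bar> ^ (n + 1)"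
proof (cases "x = 0")
  case False
  then show ?thesis using powr_realpow[of "\<bar>x\<bar>" "n + 1"] by (simp add: add.commute)
qed simp

text \<open>The density 1 / j^d absorbs the numerator of the factor (j / j')^d and leaves the
  density at the exchanged parameter. With d = CARD('n) + 1 this is the cancellation that singles
  out the target exponent.\<close>

lemma ennreal_power_ratio:
  fixes a j j' :: real
  assumes "0 < j" "0 < j'"
  shows "ennreal (\<bar>j / j' * a\<bar> ^ d) * ennreal (1 / j ^ d) = ennreal (\<bar>a\<bar> ^ d) * ennreal (1 / j' ^ d)"
proof -
  have "\<bar>j / j' * a\<bar> ^ d * (1 / j ^ d) = \<bar>a\<bar> ^ d * (1 / j' ^ d)"
    using assms by (simp add: abs_mult power_mult_distrib power_divide)
  then have "ennreal (\<bar>j / j' * a\<bar> ^ d * (1 / j ^ d)) = ennreal (\<bar>a\<bar> ^ d * (1 / j' ^ d))" by (rule arg_cong)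
  then show ?thesis using assms by (subst (asm) (1 2) ennreal_mult) auto
qed

text \<open>In the chart, the power of |u| times the density equals the power of |v| times the
  density at the exchanged parameter, and exchanging columns preserves Lebesgue measure.\<close>

lemma nn_integral_plane_measure_swap:
  fixes K :: "'n::finite set" and u v :: "(real^'n) set \<Rightarrow> real"
  assumes e: "e \<in> K" and f: "f \<notin> K" and \<mu>: "invariant_plane_prob (card K) \<mu>"
    and u: "u \<in> borel_measurable (plane_algebra (affine_planes (card K)))"
    and v: "v \<in> borel_measurable (plane_algebra (affine_planes (card K)))"
    and ae: "AE \<theta> in leb_prod ((-K) \<times> insert f K). u (chart_plane K f \<theta>)
      = graph_jacobian K \<theta> / graph_jacobian K (chart_swap K e f \<theta>) * v (chart_plane K f (chart_swap K e f \<theta>))"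
  shows "(\<integral>\<^sup>+Q. ennreal (\<bar>u Q\<bar> powr (real CARD('n) + 1)) \<partial>plane_measure (card K) \<mu>)
     = (\<integral>\<^sup>+Q. ennreal (\<bar>v Q\<bar> powr (real CARD('n) + 1)) \<partial>plane_measure (card K) \<mu>)"
proof -
  let ?L = "leb_prod ((-K) \<times> insert f K)" and ?c = "column_law K (\<lambda>_. 1)" and ?d = "CARD('n) + 1"
  let ?w = "graph_weight K (\<lambda>_. 0)" and ?J = "graph_jacobian K"
  have c: "?c \<noteq> 0" "?c \<noteq> \<infinity>" using column_law_one[of K] by auto
  define G where "G \<theta> = ennreal (\<bar>v (chart_plane K f \<theta>)\<bar> ^ ?d) * chart_density K \<theta>" for \<theta>
  have vm: "(\<lambda>\<theta>. v (chart_plane K f \<theta>)) \<in> borel_measurable ?L"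
    by (rule measurable_compose[OF chart_plane_measurable[OF f] v])
  have G: "G \<in> borel_measurable ?L"
    unfolding G_def chart_density_def using vm chart_jacobian_measurable[of K f] by measurable
  have pu: "(\<lambda>Q. ennreal (\<bar>u Q\<bar> ^ ?d)) \<in> borel_measurable (plane_algebra (affine_planes (card K)))"
    and pv: "(\<lambda>Q. ennreal (\<bar>v Q\<bar> ^ ?d)) \<in> borel_measurable (plane_algebra (affine_planes (card K)))"
    using u v by measurable
  have "?c * (\<integral>\<^sup>+Q. ennreal (\<bar>u Q\<bar> ^ ?d) \<partial>plane_measure (card K) \<mu>)
     = (\<integral>\<^sup>+\<theta>. ennreal (\<bar>u (chart_plane K f \<theta>)\<bar> ^ ?d) * chart_density K \<theta> \<partial>?L)"
    by (rule nn_integral_plane_measure_chart[OF f \<mu> pu])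
  also have "\<dots> = (\<integral>\<^sup>+\<theta>. G (chart_swap K e f \<theta>) \<partial>?L)"
  proof (rule nn_integral_cong_AE, use ae in eventually_elim)
    case (elim \<theta>)
    let ?t = "chart_swap K e f \<theta>"
    have J: "0 < ?J \<theta>" "0 < ?J ?t" by (rule graph_jacobian_pos)+
    have "ennreal (\<bar>u (chart_plane K f \<theta>)\<bar> ^ ?d) * ennreal (1 / ?J \<theta> ^ ?d) = ennreal (\<bar>v (chart_plane K f ?t)\<bar> ^ ?d) * ennreal (1 / ?J ?t ^ ?d)"
      unfolding elim by (rule ennreal_power_ratio[OF J])
    then show "ennreal (\<bar>u (chart_plane K f \<theta>)\<bar> ^ ?d) * chart_density K \<theta> = G ?t"
      unfolding G_def chart_density_def mult.left_commute[of _ ?w] by (rule arg_cong)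
  qed
  also have "\<dots> = (\<integral>\<^sup>+\<theta>. G \<theta> \<partial>?L)" by (rule nn_integral_chart_swap[OF e G])
  also have "\<dots> = ?c * (\<integral>\<^sup>+Q. ennreal (\<bar>v Q\<bar> ^ ?d) \<partial>plane_measure (card K) \<mu>)"
    unfolding G_def by (rule nn_integral_plane_measure_chart[OF f \<mu> pv, symmetric])
  finally show ?thesis unfolding abs_powr_Suc by (rule ennreal_mult_cancelI[OF c])
qed

lemma Lp_space_iff_nn_integral:
  assumes "f \<in> borel_measurable M"
  shows "f \<in> Lp_space M p \<longleftrightarrow> (\<integral>\<^sup>+x. ennreal (\<bar>f x\<bar> powr p) \<partial>M) < \<infinity>"
proof -
  have [measurable]: "f \<in> borel_measurable M" by fact
  show ?thesis unfolding Lp_space_def by (simp add: integrable_iff_bounded assms)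
qed

lemma integral_powr_eq_nn_integral:
  assumes "f \<in> borel_measurable M"
  shows "(\<integral>x. \<bar>f x\<bar> powr p \<partial>M) = enn2real (\<integral>\<^sup>+x. ennreal (\<bar>f x\<bar> powr p) \<partial>M)"
  using assms by (intro integral_eq_nn_integral) auto

text \<open>The source exponent times k + 1 is d + 1, the exponent of the Jacobian of
  \<open>proj_inv\<close>.\<close>

lemma proj_twist_powr:
  fixes x :: "real^'n"
  shows "\<bar>proj_twist e (k + 1) h x\<bar> powr ((real CARD('n) + 1) / (real k + 1))
    = inverse (\<bar>x $ e\<bar> ^ (CARD('n) + 1)) * \<bar>h (proj_inv e x)\<bar> powr ((real CARD('n) + 1) / (real k + 1))"
proof (cases "x $ e = 0")
  case True
  then show ?thesis by (simp add: proj_twist_def)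
next
  case False
  define s where "s = \<bar>x $ e\<bar>"
  have s: "0 < s" using False by (simp add: s_def)
  let ?p = "(real CARD('n) + 1) / (real k + 1)"
  have "inverse (s ^ (k + 1)) = s powr (- (real k + 1))"
    using powr_realpow[OF s, of "k + 1"] by (simp only: powr_minus) (simp add: add.commute)
  then have "inverse (s ^ (k + 1)) powr ?p = s powr (- (real k + 1) * ?p)" by (simp only: powr_powr)
  also have "- (real k + 1) * ?p = - (real CARD('n) + 1)" by (simp add: field_simps)
  also have "s powr (- (real CARD('n) + 1)) = inverse (s ^ (CARD('n) + 1))"
    using powr_realpow[OF s, of "CARD('n) + 1"] by (simp only: powr_minus) (simp add: add.commute)
  finally have "inverse (s ^ (k + 1)) powr ?p = inverse (s ^ (CARD('n) + 1))" .
  moreover have "\<bar>proj_twist e (k + 1) h x\<bar> = inverse (s ^ (k + 1)) * \<bar>h (proj_inv e x)\<bar>"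
    using s unfolding proj_twist_def s_def[symmetric] by (simp only: abs_mult) simp
  ultimately show ?thesis
    using s unfolding s_def[symmetric] by (simp only: powr_mult)
qed

lemma nn_integral_proj_twist:
  fixes h :: "real^'n \<Rightarrow> real"
  assumes [measurable]: "h \<in> borel_measurable borel"
  shows "(\<integral>\<^sup>+x. ennreal (\<bar>proj_twist e (k + 1) h x\<bar> powr ((real CARD('n) + 1) / (real k + 1))) \<partial>lborel)
    = (\<integral>\<^sup>+x. ennreal (\<bar>h x\<bar> powr ((real CARD('n) + 1) / (real k + 1))) \<partial>lborel)"
proof -
  let ?p = "(real CARD('n) + 1) / (real k + 1)"
  have "(\<integral>\<^sup>+x. ennreal (\<bar>proj_twist e (k + 1) h x\<bar> powr ?p) \<partial>lborel)
     = (\<integral>\<^sup>+x. ennreal (inverse (\<bar>x $ e\<bar> ^ (CARD('n) + 1))) * ennreal (\<bar>h (proj_inv e x)\<bar> powr ?p) \<partial>lborel)"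
    unfolding proj_twist_powr by (intro nn_integral_cong ennreal_mult) auto
  also have "\<dots> = (\<integral>\<^sup>+x. ennreal (\<bar>h x\<bar> powr ?p) \<partial>lborel)"
    by (rule nn_integral_proj_inv) measurable
  finally show ?thesis .
qed

text \<open>The inversion exchanges the hyperplane x_e = 0 with infinity. Compact support of G makes
  the twist vanish near the hyperplane, where continuity could fail; vanishing of G near the
  hyperplane gives the twist bounded support.\<close>

lemma proj_twist_compactly_supported_continuous:
  fixes G :: "real^'n \<Rightarrow> real"
  assumes G: "compactly_supported_continuous G" and \<delta>: "0 < \<delta>" and z: "\<And>x. \<bar>x $ e\<bar> \<le> \<delta> \<Longrightarrow> G x = 0"
  shows "compactly_supported_continuous (proj_twist e m G)"
proof -
  obtain B R where B: "0 \<le> B" "0 \<le> R" "\<And>x. \<bar>G x\<bar> \<le> B" "\<And>x. R < norm x \<Longrightarrow> G x = 0"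
    by (rule compactly_supported_continuous_bounds[OF G]) (rule that; assumption)
  have pe: "proj_inv e x $ e = 1 / x $ e" for x by (simp add: proj_inv_def)
  \<comment> \<open>If 0 < |x_e| < 1 / (R + 1), the inverted point has a coordinate larger than R +
    1 in modulus and so lies outside the support of G.\<close>
  let ?A = "{x :: real^'n. x $ e \<noteq> 0}" and ?B = "{x :: real^'n. \<bar>x $ e\<bar> < 1 / (R + 1)}"
  have oA: "open ?A" by (intro open_Collect_neq continuous_intros)
  have oB: "open ?B" by (intro open_Collect_less continuous_intros)
  have zB: "proj_twist e m G x = 0" if "x \<in> ?B" for x
  proof (cases "x $ e = 0")
    \<comment> \<open>With 1 / 0 = 0 the inverted point lies on the hyperplane, where G
      vanishes.\<close>
    case True
    then show ?thesis
      using z[of "proj_inv e x"] \<delta> by (simp add: proj_twist_def pe)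
  next
    case False
    have "R + 1 < 1 / \<bar>x $ e\<bar>" using that False B(2) by (simp add: field_simps)
    also have "1 / \<bar>x $ e\<bar> = \<bar>proj_inv e x $ e\<bar>" by (simp add: pe)
    also have "\<dots> \<le> norm (proj_inv e x)" by (rule component_le_norm_cart)
    finally have "R < norm (proj_inv e x)" by simp
    then show ?thesis by (simp add: proj_twist_def B(4))
  qed
  have c1: "continuous_on ?A (\<lambda>x. proj_inv e x)"
    unfolding proj_inv_def
  proof (intro continuous_on_vec_lambda)
    fix i show "continuous_on ?A (\<lambda>x. if i = e then 1 / x $ e else x $ i / x $ e)"
      by (cases "i = e") (auto intro!: continuous_intros)
  qed
  have c2: "continuous_on UNIV G" using G by (simp add: compactly_supported_continuous_def)
  have "continuous_on ?A (\<lambda>x. G (proj_inv e x))"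
    by (rule continuous_on_compose2[OF c2 c1]) simp
  then have cA: "continuous_on ?A (proj_twist e m G)"
    unfolding proj_twist_def[abs_def] by (intro continuous_intros) auto
  have cB: "continuous_on ?B (proj_twist e m G)"
    by (rule continuous_on_eq[of _ "\<lambda>_. 0"]) (simp_all only: zB continuous_on_const)
  have "?A \<union> ?B = UNIV" using B(2) by auto
  then have "continuous_on UNIV (proj_twist e m G)" using continuous_on_open_Un[OF oA oB cA cB] by simp
  then show ?thesis
  \<comment> \<open>Where the twist is nonzero, |x_e| < 1 / delta since G vanishes near the
    hyperplane, and |x_i| <= R |x_e| since the inverted point has norm at most R. Hence (R + 1) /
    delta bounds all coordinates.\<close>
  proof (rule compactly_supported_continuousI[where R="real CARD('n) * ((R + 1) / \<delta>)"])
    fix x :: "real^'n" assume x: "real CARD('n) * ((R + 1) / \<delta>) < norm x"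
    show "proj_twist e m G x = 0"
    proof (rule ccontr)
      assume nz: "proj_twist e m G x \<noteq> 0"
      then have g: "G (proj_inv e x) \<noteq> 0" and "x \<notin> ?B" using zB by (auto simp: proj_twist_def)
      then have xe: "x $ e \<noteq> 0" using B(2) by auto
      have "\<delta> < \<bar>proj_inv e x $ e\<bar>" using z[of "proj_inv e x"] g by force
      then have e1: "\<bar>x $ e\<bar> < 1 / \<delta>" using xe \<delta> by (simp add: pe field_simps)
      have R: "norm (proj_inv e x) \<le> R" using B(4)[of "proj_inv e x"] g by force
      have "\<bar>x $ i\<bar> \<le> (R + 1) / \<delta>" for i
      proof (cases "i = e")
        case True
        have "1 / \<delta> \<le> (R + 1) / \<delta>" using \<delta> B(2) by (intro divide_right_mono) auto
        then show ?thesis using True e1 by simp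
      next
        case False
        have "\<bar>x $ i / x $ e\<bar> \<le> R" using component_le_norm_cart[of "proj_inv e x" i] R False by (simp add: proj_inv_def)
        then have "\<bar>x $ i\<bar> \<le> R * \<bar>x $ e\<bar>" using xe by (simp add: abs_divide field_simps)
        also have "\<dots> \<le> R * (1 / \<delta>)" using e1 B(2) by (intro mult_left_mono) auto
        also have "\<dots> \<le> (R + 1) / \<delta>" using \<delta> by (simp add: divide_right_mono)
        finally show ?thesis .
      qed
      from norm_vec_le_card[OF this] x show False by simp
    qed
  qed
qed

lemma AE_lborel_component_nz: "AE x in (lborel :: (real^'n) measure). x $ e \<noteq> 0"
proof -
  have "negligible {x :: real^'n. x $ e = 0}" by (rule negligible_standard_hyperplane_cart)
  then have "{x :: real^'n. x $ e = 0} \<in> null_sets lebesgue" by (simp add: negligible_iff_null_sets)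
  moreover have "{x :: real^'n. x $ e = 0} \<in> sets lborel"
  proof -
    have "closed {x :: real^'n. x $ e = 0}" by (intro closed_Collect_eq continuous_intros)
    then show ?thesis by (simp add: borel_closed)
  qed
  ultimately have "{x :: real^'n. x $ e = 0} \<in> null_sets lborel" by (simp add: null_sets_completion_iff)
  then show ?thesis by (rule AE_I') auto
qed

text \<open>Cut off continuously in |x_e|. The hyperplane is a null set, so the error tends to zero
  by dominated convergence.\<close>

lemma compactly_supported_cutoff:
  fixes F :: "real^'n \<Rightarrow> real"
  assumes F: "compactly_supported_continuous F" and p: "0 < p" and \<epsilon>: "0 < \<epsilon>"
  shows "\<exists>G \<delta>. 0 < \<delta> \<and> compactly_supported_continuous G \<and> (\<forall>x. \<bar>x $ e\<bar> \<le> \<delta> \<longrightarrow> G x = 0)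
     \<and> (\<integral>x. \<bar>G x - F x\<bar> powr p \<partial>lborel) < \<epsilon>"
proof -
  obtain B R where B: "0 \<le> B" "0 \<le> R" "\<And>x. \<bar>F x\<bar> \<le> B" "\<And>x. R < norm x \<Longrightarrow> F x = 0"
    by (rule compactly_supported_continuous_bounds[OF F]) (rule that; assumption)
  have cF: "continuous_on UNIV F" using F by (simp add: compactly_supported_continuous_def)
  have [measurable]: "F \<in> borel_measurable borel" by (rule compactly_supported_continuous_measurable[OF F])
  \<comment> \<open>The factor vanishes for |x_e| <= 1 / j and is 1 for |x_e| >= 2 / j.\<close>
  define cut where "cut j x = min 1 (max 0 (real j * \<bar>x $ e\<bar> - 1))" for j :: nat and x :: "real^'n"
  have cut: "0 \<le> cut j x" "cut j x \<le> 1" for j x by (auto simp: cut_def)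
  define G where "G j x = F x * cut j x" for j x
  have cG: "continuous_on UNIV (G j)" for j
    unfolding G_def cut_def by (intro continuous_intros cF)
  have ccG: "compactly_supported_continuous (G j)" for j
    by (rule compactly_supported_continuousI[OF cG, of R]) (simp add: G_def B(4))
  have [measurable]: "G j \<in> borel_measurable borel" for j
    by (rule compactly_supported_continuous_measurable[OF ccG])
  have i: "integrable lborel (\<lambda>x. \<bar>F x\<bar> powr p)"
    using compactly_supported_continuous_Lp[OF F p] by (simp add: Lp_space_def)
  have "(\<lambda>j. \<integral>x. \<bar>G j x - F x\<bar> powr p \<partial>lborel) \<longlonglongrightarrow> (\<integral>x. 0 \<partial>(lborel :: (real^'n) measure))"
  proof (rule integral_dominated_convergence[where w="\<lambda>x. \<bar>F x\<bar> powr p"])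
    show "AE x in lborel. (\<lambda>j. \<bar>G j x - F x\<bar> powr p) \<longlonglongrightarrow> 0"
      using AE_lborel_component_nz[of e]
    proof eventually_elim
      case (elim x)
      have "\<forall>\<^sub>F j in sequentially. 2 / \<bar>x $ e\<bar> \<le> real j"
        using filterlim_real_sequentially by (simp add: filterlim_at_top)
      then have "\<forall>\<^sub>F j in sequentially. \<bar>G j x - F x\<bar> powr p = 0"
      proof eventually_elim
        case (elim j)
        then have "2 \<le> real j * \<bar>x $ e\<bar>" using \<open>x $ e \<noteq> 0\<close> by (simp add: field_simps)
        then have "cut j x = 1" by (simp add: cut_def)
        then show ?case by (simp add: G_def)
      qed
      then show ?case by (rule tendsto_eventually)
    qed
    show "AE x in lborel. norm (\<bar>G j x - F x\<bar> powr p) \<le> \<bar>F x\<bar> powr p" for j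
    proof (rule AE_I2)
      fix x
      have "\<bar>G j x - F x\<bar> = \<bar>F x\<bar> * (1 - cut j x)"
      proof -
        have "G j x - F x = - (F x * (1 - cut j x))" by (simp add: G_def algebra_simps)
        then show ?thesis using cut[of j x] by (simp add: abs_mult)
      qed
      also have "\<dots> \<le> \<bar>F x\<bar> * 1" using cut[of j x] by (intro mult_left_mono) auto
      finally show "norm (\<bar>G j x - F x\<bar> powr p) \<le> \<bar>F x\<bar> powr p" using p by (auto intro!: powr_mono2)
    qed
  qed (use i in auto)
  then have "\<forall>\<^sub>F j in sequentially. (\<integral>x. \<bar>G j x - F x\<bar> powr p \<partial>lborel) < \<epsilon>"
    using \<epsilon> by (intro order_tendstoD(2)[where y=0]) simp_all
  then have "\<forall>\<^sub>F j in sequentially. (\<integral>x. \<bar>G j x - F x\<bar> powr p \<partial>lborel) < \<epsilon> \<and> 0 < j"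
    using eventually_gt_at_top[of 0] by eventually_elim simp
  then obtain j where j: "(\<integral>x. \<bar>G j x - F x\<bar> powr p \<partial>lborel) < \<epsilon>" "0 < j"
    by (auto simp: eventually_sequentially)
  have "G j x = 0" if "\<bar>x $ e\<bar> \<le> 1 / real j" for x
  proof -
    have "real j * \<bar>x $ e\<bar> \<le> 1" using that j(2) by (simp add: field_simps)
    then have "cut j x = 0" by (simp add: cut_def)
    then show ?thesis by (simp add: G_def)
  qed
  then show ?thesis using j ccG[of j] by (intro exI[of _ "G j"] exI[of _ "1 / real j"]) simp
qed

lemma plane_transform_diff:
  fixes K :: "'n::finite set" and F G :: "real^'n \<Rightarrow> real"
  assumes "Q \<in> affine_planes (card K)" "compactly_supported_continuous F" "compactly_supported_continuous G"
  shows "plane_transform (\<lambda>x. F x - G x) Q = plane_transform F Q - plane_transform G Q"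
  unfolding plane_transform_def
  by (rule Bochner_Integration.integral_diff) (use plane_transform_cc(1)[OF assms(1)] assms in auto)

lemma compactly_supported_continuous_diff:
  fixes F G :: "'a::euclidean_space \<Rightarrow> real"
  assumes F: "compactly_supported_continuous F" and G: "compactly_supported_continuous G"
  shows "compactly_supported_continuous (\<lambda>x. F x - G x)"
proof -
  obtain B R where B: "\<And>x. R < norm x \<Longrightarrow> F x = 0"
    by (rule compactly_supported_continuous_bounds[OF F]) (rule that; assumption)
  obtain B' R' where B': "\<And>x. R' < norm x \<Longrightarrow> G x = 0"
    by (rule compactly_supported_continuous_bounds[OF G]) (rule that; assumption)
  show ?thesis
    using F G B B' unfolding compactly_supported_continuous_def
    by (intro compactly_supported_continuousI[unfolded compactly_supported_continuous_def, where R="max R R'"] continuous_intros) auto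
qed

lemma Lp_norm_pos:
  assumes p: "0 < p" and f: "f \<in> Lp_space M p" and nz: "\<not> (AE x in M. f x = 0)"
  shows "0 < Lp_norm M p f"
proof -
  have i: "integrable M (\<lambda>x. \<bar>f x\<bar> powr p)" using f by (simp add: Lp_space_def)
  have "(\<integral>x. \<bar>f x\<bar> powr p \<partial>M) \<noteq> 0"
  proof
    assume "(\<integral>x. \<bar>f x\<bar> powr p \<partial>M) = 0"
    then have "AE x in M. \<bar>f x\<bar> powr p = 0" using integral_nonneg_eq_0_iff_AE[OF i] by simp
    then have "AE x in M. f x = 0" by eventually_elim simp
    then show False using nz by blast
  qed
  then show ?thesis unfolding Lp_norm_def by simp
qed

lemma Lp_cong:
  assumes "\<And>x. x \<in> space M \<Longrightarrow> u x = v x"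
  shows "u \<in> Lp_space M p \<longleftrightarrow> v \<in> Lp_space M p" "(\<integral>x. \<bar>u x\<bar> powr p \<partial>M) = (\<integral>x. \<bar>v x\<bar> powr p \<partial>M)" "Lp_norm M p u = Lp_norm M p v"
proof -
  have "u \<in> borel_measurable M \<longleftrightarrow> v \<in> borel_measurable M" by (rule measurable_cong) (rule assms)
  moreover have "integrable M (\<lambda>x. \<bar>u x\<bar> powr p) \<longleftrightarrow> integrable M (\<lambda>x. \<bar>v x\<bar> powr p)"
    by (rule Bochner_Integration.integrable_cong) (simp_all add: assms)
  ultimately show "u \<in> Lp_space M p \<longleftrightarrow> v \<in> Lp_space M p" by (simp add: Lp_space_def)
  show "(\<integral>x. \<bar>u x\<bar> powr p \<partial>M) = (\<integral>x. \<bar>v x\<bar> powr p \<partial>M)"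
    by (rule Bochner_Integration.integral_cong) (simp_all add: assms)
  then show "Lp_norm M p u = Lp_norm M p v" by (simp only: Lp_norm_def)
qed

lemma Lp_transfer:
  assumes "u \<in> borel_measurable M" "v \<in> borel_measurable N"
    and "(\<integral>\<^sup>+x. ennreal (\<bar>u x\<bar> powr p) \<partial>M) = (\<integral>\<^sup>+x. ennreal (\<bar>v x\<bar> powr p) \<partial>N)"
  shows "u \<in> Lp_space M p \<longleftrightarrow> v \<in> Lp_space N p" "(\<integral>x. \<bar>u x\<bar> powr p \<partial>M) = (\<integral>x. \<bar>v x\<bar> powr p \<partial>N)" "Lp_norm M p u = Lp_norm N p v"
proof -
  show "u \<in> Lp_space M p \<longleftrightarrow> v \<in> Lp_space N p"
    by (simp only: Lp_space_iff_nn_integral assms)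
  show "(\<integral>x. \<bar>u x\<bar> powr p \<partial>M) = (\<integral>x. \<bar>v x\<bar> powr p \<partial>N)"
    by (simp only: integral_powr_eq_nn_integral assms)
  then show "Lp_norm M p u = Lp_norm N p v" by (simp only: Lp_norm_def)
qed

lemma Lp_converges_const: "Lp_converges M p (\<lambda>n. u) u"
  by (simp add: Lp_converges_def Lp_norm_def Lp_space_def)

section \<open>The twist of an extremizer is an extremizer\<close>

context plane_prob
begin

definition src :: real where "src = (real CARD('n) + 1) / (real (card K) + 1)"
definition tgt :: real where "tgt = real CARD('n) + 1"

lemma src_pos: "0 < src" and tgt_pos: "0 < tgt"
  by (simp_all add: src_def tgt_def)

lemma exponents: "target_exponent TYPE(real^'n) = tgt" "tgt / (real (card K) + 1) = src"
  by (simp_all add: src_def tgt_def)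

lemma plane_transform_ext_cc:
  assumes F: "compactly_supported_continuous F"
  shows "plane_transform_ext (card K) \<mu> F (plane_transform F)"
  unfolding plane_transform_ext_def exponents
proof (intro conjI exI[of _ "\<lambda>_. F"] allI)
  show "F \<in> Lp_space lborel src" by (rule compactly_supported_continuous_Lp[OF F src_pos])
  show "plane_transform F \<in> Lp_space (plane_measure (card K) \<mu>) tgt" by (rule plane_transform_cc_Lp[OF F tgt_pos])
qed (rule F Lp_converges_const)+

text \<open>An extremizer can only exist if the optimal constant is finite.\<close>

lemma extremizer_bound:
  assumes E: "extremizer (card K) \<mu> f"
  obtains C where "0 \<le> C" "\<And>F. compactly_supported_continuous F \<Longrightarrow>
    Lp_norm (plane_measure (card K) \<mu>) tgt (plane_transform F) \<le> C * Lp_norm lborel src F"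
proof -
  obtain g where nz: "\<not> (AE x in lborel. f x = 0)" and ext: "plane_transform_ext (card K) \<mu> f g"
    and eq: "ennreal (Lp_norm (plane_measure (card K) \<mu>) tgt g) = optimal_constant (card K) \<mu> * ennreal (Lp_norm lborel src f)"
    using E unfolding extremizer_def exponents by blast
  have "f \<in> Lp_space lborel src" using ext unfolding plane_transform_ext_def exponents by blast
  then have pos: "0 < Lp_norm lborel src f" using nz by (rule Lp_norm_pos[OF src_pos])
  have "optimal_constant (card K) \<mu> \<noteq> \<top>"
  proof
    assume "optimal_constant (card K) \<mu> = \<top>"
    then have "ennreal (Lp_norm (plane_measure (card K) \<mu>) tgt g) = \<top>" using eq pos by (simp add: ennreal_top_mult)
    then show False by simp
  qed
  then have "optimal_constant (card K) \<mu> < \<top>" by (simp add: less_top)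
  then obtain C where C: "C < \<top>" and b: "\<And>f g. plane_transform_ext (card K) \<mu> f g \<Longrightarrow>
      ennreal (Lp_norm (plane_measure (card K) \<mu>) tgt g) \<le> C * ennreal (Lp_norm lborel src f)"
    unfolding optimal_constant_def Inf_less_iff exponents by blast
  show thesis
  proof (rule that[of "enn2real C"])
    fix F :: "real^'n \<Rightarrow> real" assume F: "compactly_supported_continuous F"
    have "ennreal (Lp_norm (plane_measure (card K) \<mu>) tgt (plane_transform F)) \<le> C * ennreal (Lp_norm lborel src F)"
      by (rule b[OF plane_transform_ext_cc[OF F]])
    also have "C = ennreal (enn2real C)" using C by simp
    also have "ennreal (enn2real C) * ennreal (Lp_norm lborel src F) = ennreal (enn2real C * Lp_norm lborel src F)"
      by (rule ennreal_mult[symmetric]) (simp_all add: Lp_norm_def)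
    finally show "Lp_norm (plane_measure (card K) \<mu>) tgt (plane_transform F) \<le> enn2real C * Lp_norm lborel src F"
      by (rule ennreal_le_iff[THEN iffD1, rotated]) (simp add: Lp_norm_def)
  qed simp
qed

end

text \<open>For compactly supported functions vanishing near x_e = 0 the twist is again compactly
  supported and continuous, and its transform is known in the chart. Such functions approximate f,
  their transforms approximate g, and since differences keep both norms under the twist, the twisted
  functions and their transforms converge as well. Equal norms on both sides preserve equality in
  the inequality.\<close>

theorem extremizer_proj_twist:
  fixes K :: "'n::finite set" and f :: "real^'n \<Rightarrow> real"
  assumes e: "e \<in> K" and c: "c \<notin> K" and \<mu>: "invariant_plane_prob (card K) \<mu>"
    and E: "extremizer (card K) \<mu> f"
  shows "extremizer (card K) \<mu> (proj_twist e (card K + 1) f)"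
proof -
  interpret plane_prob \<mu> K by (rule invariant_plane_prob_locale[OF \<mu>])
  let ?\<sigma> = "plane_measure (card K) \<mu>" and ?R = "plane_transform :: (real^'n \<Rightarrow> real) \<Rightarrow> (real^'n) set \<Rightarrow> real"
  let ?A = "plane_algebra (affine_planes (card K)) :: (real^'n) set measure"
  let ?t = "proj_twist e (card K + 1)"
  let ?L = "leb_prod ((-K) \<times> insert c K)"
  have sp: "space ?\<sigma> = affine_planes (card K)" using sets_eq_imp_space_eq[OF sets_plane_measure] by simp
  have bm: "borel_measurable ?\<sigma> = borel_measurable ?A" by (rule measurable_cong_sets[OF sets_plane_measure refl])
  obtain g where nz: "\<not> (AE x in lborel. f x = 0)" and ext: "plane_transform_ext (card K) \<mu> f g"
    and eq: "ennreal (Lp_norm ?\<sigma> tgt g) = optimal_constant (card K) \<mu> * ennreal (Lp_norm lborel src f)"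
    using E unfolding extremizer_def exponents by blast
  obtain F where f: "f \<in> Lp_space lborel src" and g: "g \<in> Lp_space ?\<sigma> tgt" and F: "\<And>n. compactly_supported_continuous (F n)"
    and Ff: "Lp_converges lborel src F f" and RFg: "Lp_converges ?\<sigma> tgt (\<lambda>n. ?R (F n)) g"
    using ext unfolding plane_transform_ext_def exponents by blast
  obtain C where C: "0 \<le> C" "\<And>F. compactly_supported_continuous F \<Longrightarrow> Lp_norm ?\<sigma> tgt (?R F) \<le> C * Lp_norm lborel src F"
    using extremizer_bound[OF E] by blast
  \<comment> \<open>The sequence given by the extension is replaced by one that vanishes near the
    hyperplane, which alone can be twisted within continuous compactly supported functions.\<close>
  have "\<forall>n. \<exists>G \<delta>. 0 < \<delta> \<and> compactly_supported_continuous G \<and> (\<forall>x. \<bar>x $ e\<bar> \<le> \<delta> \<longrightarrow> G x = 0)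
     \<and> (\<integral>x. \<bar>G x - F n x\<bar> powr src \<partial>lborel) < 1 / real (Suc n)"
    by (intro allI compactly_supported_cutoff[OF F src_pos]) (simp only: zero_less_divide_1_iff of_nat_0_less_iff zero_less_Suc)
  then obtain G \<delta> where G: "\<And>n. (0::real) < \<delta> n" "\<And>n. compactly_supported_continuous (G n)" "\<And>n x. \<bar>x $ e\<bar> \<le> \<delta> n \<Longrightarrow> G n x = 0"
     "\<And>n. (\<integral>x. \<bar>G n x - F n x\<bar> powr src \<partial>lborel) < 1 / real (Suc n)"
    unfolding choice_iff by blast
  have Gm: "G n \<in> borel_measurable borel" for n by (rule compactly_supported_continuous_measurable[OF G(2)])
  have D: "compactly_supported_continuous (\<lambda>x. G n x - F n x)" for n
    by (rule compactly_supported_continuous_diff[OF G(2) F])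
  have z0: "(\<lambda>n. \<integral>x. \<bar>G n x - F n x\<bar> powr src \<partial>lborel) \<longlonglongrightarrow> 0"
  proof (rule tendsto_sandwich[OF _ _ tendsto_const LIMSEQ_inverse_real_of_nat])
    show "\<forall>\<^sub>F n in sequentially. 0 \<le> (\<integral>x. \<bar>G n x - F n x\<bar> powr src \<partial>lborel)" by (auto intro!: always_eventually integral_nonneg_AE)
    show "\<forall>\<^sub>F n in sequentially. (\<integral>x. \<bar>G n x - F n x\<bar> powr src \<partial>lborel) \<le> inverse (real (Suc n))"
      using G(4) by (intro always_eventually allI less_imp_le) (simp only: inverse_eq_divide)
  qed
  have GF: "Lp_converges lborel src (\<lambda>n x. G n x - F n x) (\<lambda>_. 0)"
    unfolding Lp_converges_iff[OF src_pos] diff_zero using z0 compactly_supported_continuous_Lp[OF D src_pos] by blast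
  have Gf: "Lp_converges lborel src G f" by (rule Lp_converges_trans[OF src_pos Ff GF])
  have RD: "?R (\<lambda>x. G n x - F n x) Q = ?R (G n) Q - ?R (F n) Q" if "Q \<in> space ?\<sigma>" for n Q
    using that unfolding sp by (intro plane_transform_diff[of Q K] G(2) F)
  \<comment> \<open>Changing the approximating sequence changes the transforms little because the
    optimal constant is finite.\<close>
  have RGF: "Lp_converges ?\<sigma> tgt (\<lambda>n Q. ?R (G n) Q - ?R (F n) Q) (\<lambda>_. 0)"
    unfolding Lp_converges_def diff_zero
  proof (intro conjI allI)
    show "(\<lambda>Q. ?R (G n) Q - ?R (F n) Q) \<in> Lp_space ?\<sigma> tgt" for n
      by (rule Lp_cong(1)[OF RD, THEN iffD1]) (assumption | rule plane_transform_cc_Lp[OF D tgt_pos])+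
    have le: "Lp_norm ?\<sigma> tgt (\<lambda>Q. ?R (G n) Q - ?R (F n) Q) \<le> C * Lp_norm lborel src (\<lambda>x. G n x - F n x)" for n
      by (rule ord_eq_le_trans[OF Lp_cong(3)[OF RD, symmetric] C(2)[OF D]])
    have lim: "(\<lambda>n. C * Lp_norm lborel src (\<lambda>x. G n x - F n x)) \<longlonglongrightarrow> 0"
      by (rule tendsto_mult_right_zero[OF Lp_norm_tendsto_0_iff[OF src_pos, THEN iffD2, OF z0]])
    show "(\<lambda>n. Lp_norm ?\<sigma> tgt (\<lambda>Q. ?R (G n) Q - ?R (F n) Q)) \<longlonglongrightarrow> 0"
      by (rule tendsto_sandwich[OF always_eventually always_eventually tendsto_const lim])
        (simp only: Lp_norm_def powr_ge_zero simp_thms, intro allI le)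
  qed
  have RGg: "Lp_converges ?\<sigma> tgt (\<lambda>n. ?R (G n)) g" by (rule Lp_converges_trans[OF tgt_pos RFg RGF])
  have RGg': "(\<lambda>Q. ?R (G n) Q - g Q) \<in> Lp_space ?\<sigma> tgt" "(\<lambda>n. \<integral>Q. \<bar>?R (G n) Q - g Q\<bar> powr tgt \<partial>?\<sigma>) \<longlonglongrightarrow> 0" for n
    using RGg unfolding Lp_converges_iff[OF tgt_pos] by blast+
  have int: "integrable ?\<sigma> (\<lambda>Q. \<bar>?R (G n) Q - g Q\<bar> powr tgt)" for n using RGg'(1)[of n] by (simp add: Lp_space_def)
  \<comment> \<open>A subsequence converges almost everywhere, so that limits can be compared plane
    by plane in the chart.\<close>
  have "\<exists>r. strict_mono r \<and> (AE Q in ?\<sigma>. (\<lambda>n. \<bar>?R (G (r n)) Q - g Q\<bar> powr tgt) \<longlonglongrightarrow> 0)"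
    by (rule tendsto_L1_AE_subseq[OF int]) (use RGg'(2) in simp)
  then obtain r where r: "strict_mono r" and ae: "AE Q in ?\<sigma>. (\<lambda>n. \<bar>?R (G (r n)) Q - g Q\<bar> powr tgt) \<longlonglongrightarrow> 0"
    by blast
  have ae2: "AE Q in ?\<sigma>. (\<lambda>n. ?R (G (r n)) Q) \<longlonglongrightarrow> g Q"
    using ae
  proof eventually_elim
    case (elim Q)
    then have "(\<lambda>n. (\<bar>?R (G (r n)) Q - g Q\<bar> powr tgt) powr (1 / tgt)) \<longlonglongrightarrow> 0"
      using tendsto_powr'[OF elim tendsto_const, of "1 / tgt"] tgt_pos by simp
    then have "(\<lambda>n. \<bar>?R (G (r n)) Q - g Q\<bar>) \<longlonglongrightarrow> 0" using tgt_pos by (simp add: powr_powr)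
    then have "(\<lambda>n. ?R (G (r n)) Q - g Q) \<longlonglongrightarrow> 0" by (rule tendsto_rabs_zero_cancel)
    then show ?case by (simp only: LIM_zero_iff)
  qed
  define H where "H n = ?t (G (r n))" for n
  have H: "compactly_supported_continuous (H n)" for n
    unfolding H_def by (rule proj_twist_compactly_supported_continuous[OF G(2) G(1) G(3)])
  have Hm: "?R (H n) \<in> borel_measurable ?A" for n
    by (rule plane_transform_measurable[OF compactly_supported_continuous_measurable[OF H]])
  \<comment> \<open>The candidate transform of the twist is a pointwise limit, hence measurable as a
    function of the plane without recovering chart parameters from the plane. In the chart it is
    related to \<open>g\<close> by the same factor as the transforms themselves.\<close>
  define g' where "g' Q = lim (\<lambda>n. ?R (H n) Q)" for Q
  have g'm: "g' \<in> borel_measurable ?A" unfolding g'_def by (rule borel_measurable_lim_metric) (rule Hm)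
  have gm: "g \<in> borel_measurable ?A" using g by (simp add: Lp_space_def bm)
  have RH: "?R (H n) (chart_plane K c \<theta>) = graph_jacobian K \<theta> / graph_jacobian K (chart_swap K e c \<theta>) * ?R (G (r n)) (chart_plane K c (chart_swap K e c \<theta>))" for n \<theta>
    unfolding H_def by (rule plane_transform_proj_twist[OF e c Gm])
  have aeg: "AE \<theta> in ?L. g' (chart_plane K c \<theta>) = graph_jacobian K \<theta> / graph_jacobian K (chart_swap K e c \<theta>) * g (chart_plane K c (chart_swap K e c \<theta>))"
    using AE_chart_swap[OF e AE_plane_measure_chart[OF c \<mu> ae2]]
  proof eventually_elim
    case (elim \<theta>)
    show ?case unfolding g'_def RH by (intro limI tendsto_mult_left elim)
  qed
  have n1: "(\<integral>\<^sup>+Q. ennreal (\<bar>g' Q\<bar> powr tgt) \<partial>?\<sigma>) = (\<integral>\<^sup>+Q. ennreal (\<bar>g Q\<bar> powr tgt) \<partial>?\<sigma>)"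
    unfolding tgt_def by (rule nn_integral_plane_measure_swap[OF e c \<mu> g'm gm aeg])
  have Rm: "?R (G n) \<in> borel_measurable ?A" for n by (rule plane_transform_measurable[OF Gm])
  have d1: "(\<lambda>Q. ?R (H n) Q - g' Q) \<in> borel_measurable ?A" "(\<lambda>Q. ?R (G (r n)) Q - g Q) \<in> borel_measurable ?A" for n
    by (intro borel_measurable_diff Hm g'm Rm gm)+
  have n2: "(\<integral>\<^sup>+Q. ennreal (\<bar>?R (H n) Q - g' Q\<bar> powr tgt) \<partial>?\<sigma>) = (\<integral>\<^sup>+Q. ennreal (\<bar>?R (G (r n)) Q - g Q\<bar> powr tgt) \<partial>?\<sigma>)" for n
    unfolding tgt_def
  proof (rule nn_integral_plane_measure_swap[OF e c \<mu> d1])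
    show "AE \<theta> in ?L. ?R (H n) (chart_plane K c \<theta>) - g' (chart_plane K c \<theta>) = graph_jacobian K \<theta> / graph_jacobian K (chart_swap K e c \<theta>) *
        (?R (G (r n)) (chart_plane K c (chart_swap K e c \<theta>)) - g (chart_plane K c (chart_swap K e c \<theta>)))"
      using aeg by eventually_elim (simp only: RH right_diff_distrib)
  qed
  have g'L: "g' \<in> Lp_space ?\<sigma> tgt" "Lp_norm ?\<sigma> tgt g' = Lp_norm ?\<sigma> tgt g"
    using Lp_transfer[OF g'm[folded bm] gm[folded bm] n1] g by simp_all
  have RHg: "Lp_converges ?\<sigma> tgt (\<lambda>n. ?R (H n)) g'"
    unfolding Lp_converges_iff[OF tgt_pos]
  proof (intro conjI allI)
    show "(\<lambda>Q. ?R (H n) Q - g' Q) \<in> Lp_space ?\<sigma> tgt" for n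
      using Lp_transfer(1)[OF d1(1)[folded bm] d1(2)[folded bm] n2, of n] RGg'(1) by blast
    have "(\<lambda>n. \<integral>Q. \<bar>?R (G (r n)) Q - g Q\<bar> powr tgt \<partial>?\<sigma>) \<longlonglongrightarrow> 0"
      using LIMSEQ_subseq_LIMSEQ[OF RGg'(2) r] by (simp add: comp_def)
    then show "(\<lambda>n. \<integral>Q. \<bar>?R (H n) Q - g' Q\<bar> powr tgt \<partial>?\<sigma>) \<longlonglongrightarrow> 0"
      by (simp only: Lp_transfer(2)[OF d1(1)[folded bm] d1(2)[folded bm] n2])
  qed
  have fm: "f \<in> borel_measurable borel" using f by (simp add: Lp_space_def)
  have tt: "?t h \<in> borel_measurable lborel" "(\<integral>\<^sup>+x. ennreal (\<bar>?t h x\<bar> powr src) \<partial>lborel) = (\<integral>\<^sup>+x. ennreal (\<bar>h x\<bar> powr src) \<partial>lborel)"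
    if "h \<in> borel_measurable borel" for h
    using proj_twist_measurable[OF that, of e "card K + 1"] nn_integral_proj_twist[OF that, of e "card K"] by (simp_all add: src_def)
  have tf: "?t f \<in> Lp_space lborel src" "Lp_norm lborel src (?t f) = Lp_norm lborel src f"
    using Lp_transfer[OF tt(1)[OF fm] _ tt(2)[OF fm]] fm f by simp_all
  have Hf: "Lp_converges lborel src H (?t f)"
    unfolding Lp_converges_iff[OF src_pos]
  proof (intro conjI allI)
    have Gf': "(\<lambda>x. G n x - f x) \<in> Lp_space lborel src" "(\<lambda>n. \<integral>x. \<bar>G n x - f x\<bar> powr src \<partial>lborel) \<longlonglongrightarrow> 0" for n
      using Gf unfolding Lp_converges_iff[OF src_pos] by blast+
    have eqt: "H n x - ?t f x = ?t (\<lambda>x. G (r n) x - f x) x" for n x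
      by (simp only: H_def proj_twist_def right_diff_distrib)
    have m: "(\<lambda>x. G (r n) x - f x) \<in> borel_measurable borel" for n by (intro borel_measurable_diff Gm fm)
    have m': "(\<lambda>x. G (r n) x - f x) \<in> borel_measurable lborel" for n using m[of n] by simp
    note tr = Lp_transfer[OF tt(1)[OF m] m' tt(2)[OF m]]
    show "(\<lambda>x. H n x - ?t f x) \<in> Lp_space lborel src" for n
      unfolding eqt using tr(1)[of n] Gf'(1)[of "r n"] by blast
    have "(\<lambda>n. \<integral>x. \<bar>G (r n) x - f x\<bar> powr src \<partial>lborel) \<longlonglongrightarrow> 0"
      using LIMSEQ_subseq_LIMSEQ[OF Gf'(2) r] by (simp add: comp_def)
    then show "(\<lambda>n. \<integral>x. \<bar>H n x - ?t f x\<bar> powr src \<partial>lborel) \<longlonglongrightarrow> 0"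
      unfolding eqt by (simp only: tr(2))
  qed
  have "plane_transform_ext (card K) \<mu> (?t f) g'"
    unfolding plane_transform_ext_def exponents using tf(1) g'L(1) H Hf RHg by blast
  moreover have "\<not> (AE x in lborel. ?t f x = 0)"
  proof
    assume "AE x in lborel. ?t f x = 0"
    then have "(\<integral>x. \<bar>?t f x\<bar> powr src \<partial>lborel) = (\<integral>x. 0 \<partial>(lborel :: (real^'n) measure))"
      using tt(1)[OF fm] by (intro integral_cong_AE) auto
    then have "Lp_norm lborel src (?t f) = 0" by (simp add: Lp_norm_def)
    then show False using tf(2) Lp_norm_pos[OF src_pos f nz] by simp
  qed
  ultimately show ?thesis unfolding extremizer_def exponents using eq[folded g'L(2) tf(2)] by blast
qed

section \<open>Equations almost everywhere, invariance along a direction, and reflections\<close>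

lemma AE_lborel_affine:
  fixes A :: "real^'n \<Rightarrow> real^'n"
  assumes A: "linear A" "inj A" and P: "AE x in lborel. P x"
  shows "AE x in lborel. P (A x + b)"
proof -
  obtain N where N: "{x \<in> space lborel. \<not> P x} \<subseteq> N" "emeasure lborel N = 0" "N \<in> sets lborel"
    using P by (rule AE_E)
  have [measurable]: "N \<in> sets borel" using N(3) by simp
  have [measurable]: "A \<in> borel_measurable borel"
    by (rule borel_measurable_continuous_onI) (rule linear_continuous_on[OF A(1)[unfolded linear_conv_bounded_linear]])
  have mw: "matrix A *v x = A x" for x using A(1) by (simp add: matrix_works)
  have d: "det (matrix A) \<noteq> 0"
  proof
    assume "det (matrix A) = 0"
    then obtain v where "v \<noteq> 0" "A v = 0" using det_eq_0_imp_kernel[of "matrix A"] unfolding mw by blast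
    then show False using A linear_injective_0[OF A(1)] by blast
  qed
  have "ennreal \<bar>det (matrix A)\<bar> * (\<integral>\<^sup>+v. indicator N (b + matrix A *v v) \<partial>lborel) = (\<integral>\<^sup>+v. indicator N (b + v) \<partial>lborel)"
    by (rule nn_integral_lborel_matrix[OF d]) measurable
  also have "\<dots> = (\<integral>\<^sup>+v. indicator N v \<partial>lborel)"
    using nn_integral_lborel_orthogonal[of "\<lambda>x. x" "indicator N" b] orthogonal_transformation_id by (simp add: id_def)
  also have "\<dots> = 0" using N by simp
  finally have "(\<integral>\<^sup>+v. indicator N (b + A v) \<partial>lborel) = 0" using d by (simp add: mw)
  then have "AE v in lborel. indicator N (b + A v) = (0::ennreal)" by (subst (asm) nn_integral_0_iff_AE) measurable
  then show ?thesis
  proof eventually_elim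
    case (elim x)
    then have "A x + b \<notin> N" by (simp add: indicator_eq_0_iff add.commute)
    then show ?case using N(1) by auto
  qed
qed

lemma AE_lborel_proj_inv:
  fixes P :: "real^'n \<Rightarrow> bool"
  assumes P: "AE x in lborel. P x"
  shows "AE x in lborel. P (proj_inv e x)"
proof -
  obtain N where N: "{x \<in> space lborel. \<not> P x} \<subseteq> N" "emeasure lborel N = 0" "N \<in> sets lborel"
    using P by (rule AE_E)
  have [measurable]: "N \<in> sets borel" using N(3) by simp
  have [measurable]: "proj_inv e \<in> borel_measurable borel" by (rule proj_inv_measurable)
  have "(\<integral>\<^sup>+x. ennreal (inverse (\<bar>x $ e\<bar> ^ (CARD('n) + 1))) * indicator N (proj_inv e x) \<partial>lborel) = (\<integral>\<^sup>+v. indicator N v \<partial>(lborel :: (real^'n) measure))"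
    by (rule nn_integral_proj_inv) measurable
  also have "\<dots> = 0" using N by simp
  finally have "AE x in lborel. ennreal (inverse (\<bar>x $ e\<bar> ^ (CARD('n) + 1))) * indicator N (proj_inv e x) = (0::ennreal)"
    by (subst (asm) nn_integral_0_iff_AE) measurable
  then show ?thesis using AE_lborel_component_nz[of e]
  proof eventually_elim
    case (elim x)
    have "0 < \<bar>x $ e\<bar> ^ (CARD('n) + 1)" using elim(2) by (intro zero_less_power) simp
    then have "ennreal (inverse (\<bar>x $ e\<bar> ^ (CARD('n) + 1))) \<noteq> 0" by (simp only: ennreal_eq_0_iff not_le positive_imp_inverse_positive)
    then have "proj_inv e x \<notin> N" using elim(1) by (simp only: mult_eq_0_iff indicator_eq_0_iff simp_thms)
    then show ?case using N(1) by auto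
  qed
qed

text \<open>A nonempty open set is not null. Equations known only almost everywhere are evaluated
  through this at some point of a given open condition.\<close>

lemma AE_lborel_dense:
  fixes U :: "'a::euclidean_space set"
  assumes P: "AE x in lborel. P x" and U: "open U" "U \<noteq> {}"
  shows "\<exists>x\<in>U. P x"
proof (rule ccontr)
  assume "\<not> (\<exists>x\<in>U. P x)"
  then have "AE x in lborel. x \<notin> U" using P by (auto elim: eventually_mono)
  moreover have "U \<in> sets lborel" using U(1) by simp
  ultimately have "U \<in> null_sets lborel" by (simp add: AE_iff_null_sets)
  then have "U \<in> null_sets lebesgue" by (rule null_sets_completionI)
  then have "negligible U" by (simp only: negligible_iff_null_sets)
  then show False using open_not_negligible[OF U] by blast
qed

text \<open>Rotate v to a coordinate axis. By Fubini the integral is a constant times the infinite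
  length of that axis, so it can only be 0 or infinite.\<close>

lemma nn_integral_direction_invariant:
  fixes q :: "real^'n \<Rightarrow> ennreal"
  assumes q: "q \<in> borel_measurable borel" and v: "v \<noteq> 0" and inv: "\<And>x t. q (x + t *\<^sub>R v) = q x"
    and fin: "(\<integral>\<^sup>+x. q x \<partial>lborel) < \<top>"
  shows "(\<integral>\<^sup>+x. q x \<partial>lborel) = 0"
proof -
  note [measurable] = q
  let ?u = "(1 / norm v) *\<^sub>R v"
  obtain i :: 'n where True by blast
  have "norm (axis i 1 :: real^'n) = 1" "norm ?u = 1" using v by (simp_all add: norm_axis_1)
  then have "\<exists>T :: real^'n \<Rightarrow> real^'n. orthogonal_transformation T \<and> T (axis i 1) = ?u"
    by (rule orthogonal_transformation_exists_1) blast
  then obtain T :: "real^'n \<Rightarrow> real^'n" where T: "orthogonal_transformation T" "T (axis i 1) = ?u" by blast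
  have lT: "linear T" using T(1) by (rule orthogonal_transformation_linear)
  have [measurable]: "T \<in> borel_measurable borel"
    by (rule borel_measurable_continuous_onI) (rule linear_continuous_on[OF lT[unfolded linear_conv_bounded_linear]])
  have cv: "coord_vec {i} y = y i *\<^sub>R axis i 1" for y by (simp add: vec_eq_iff axis_def)
  define Z where "Z = (\<integral>\<^sup>+z. q (T (coord_vec (-{i}) z)) \<partial>leb_prod (-{i}))"
  have h: "q (T (coord_vec {i} y + w)) = q (T w)" for y w
  proof -
    have "T (coord_vec {i} y + w) = T w + (y i / norm v) *\<^sub>R v"
      unfolding cv linear_add[OF lT] linear_scale[OF lT] T(2) by simp
    then show ?thesis by (simp only: inv)
  qed
  have "(\<integral>\<^sup>+x. q x \<partial>lborel) = (\<integral>\<^sup>+x. q (T x) \<partial>lborel)"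
    using nn_integral_lborel_orthogonal[OF T(1) q, of 0] by simp
  also have "\<dots> = (\<integral>\<^sup>+y. (\<integral>\<^sup>+z. q (T (coord_vec {i} y + coord_vec (-{i}) z)) \<partial>leb_prod (-{i})) \<partial>leb_prod {i})"
    by (rule nn_integral_lborel_split) measurable
  also have "\<dots> = (\<integral>\<^sup>+y. Z \<partial>leb_prod {i})" unfolding h Z_def ..
  also have "\<dots> = Z * emeasure (leb_prod {i}) (space (leb_prod {i}))" by (rule nn_integral_const)
  also have "emeasure (leb_prod {i}) (space (leb_prod {i})) = emeasure (leb_prod {i}) (Pi\<^sub>E {i} (\<lambda>_. UNIV))" by (simp add: space_PiM)
  also have "\<dots> = (\<Prod>j\<in>{i}. emeasure lborel (UNIV :: real set))" by (rule leb_prod.emeasure_PiM) auto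
  also have "\<dots> = \<top>" by (simp add: emeasure_lborel_UNIV)
  finally have *: "(\<integral>\<^sup>+x. q x \<partial>lborel) = Z * \<top>" .
  show ?thesis
  proof (cases "Z = 0")
    case True
    then show ?thesis using * by simp
  next
    case False
    then have "Z * \<top> = \<top>" by (simp add: ennreal_mult_eq_top_iff)
    then show ?thesis using * fin by simp
  qed
qed

text \<open>The reflection in the hyperplane orthogonal to \<open>w\<close>; for w = 0 it is the
  identity.\<close>

definition refl_along :: "real^'n \<Rightarrow> real^'n \<Rightarrow> real^'n" where
  "refl_along w x = x - (2 * (w \<bullet> x) / (w \<bullet> w)) *\<^sub>R w"

lemma refl_along_linear: "linear (refl_along w)"
  unfolding refl_along_def
  by (rule linearI) (simp_all add: inner_add_right algebra_simps add_divide_distrib scaleR_add_left)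

lemma refl_along_involution: "refl_along w (refl_along w x) = x"
proof -
  have "w \<bullet> refl_along w x = - (w \<bullet> x)" by (simp add: refl_along_def inner_diff_right)
  then have "refl_along w (refl_along w x) = refl_along w x + (2 * (w \<bullet> x) / (w \<bullet> w)) *\<^sub>R w"
    unfolding refl_along_def[of w "refl_along w x"] by simp
  then show ?thesis by (simp add: refl_along_def)
qed

lemma refl_along_orthogonal: "orthogonal_transformation (refl_along w)"
  unfolding orthogonal_transformation_def
proof (intro conjI allI refl_along_linear)
  fix x y
  show "refl_along w x \<bullet> refl_along w y = x \<bullet> y"
    by (cases "w = 0") (simp_all add: refl_along_def inner_diff_left inner_diff_right inner_commute[of x w] field_simps)
qed

section \<open>Separation of variables for monotone functions\<close>

lemma antimono_right_limit:
  fixes f :: "real \<Rightarrow> real"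
  assumes f: "antimono_on {0<..} f" and X: "0 < X"
  obtains l where "(f \<longlongrightarrow> l) (at_right X)" "l \<le> f X" "\<And>Y. X < Y \<Longrightarrow> f Y \<le> l"
proof -
  let ?l = "Sup (f ` {X<..})"
  have mono: "f b \<le> f a" if "0 < a" "a \<le> b" for a b using f that by (auto simp: monotone_on_def)
  have ne: "f ` {X<..} \<noteq> {}" by (simp add: gt_ex)
  have bdd: "bdd_above (f ` {X<..})" using mono[OF X] by (intro bdd_aboveI[of _ "f X"]) auto
  have up: "f Y \<le> ?l" if "X < Y" for Y using that by (intro cSup_upper bdd) simp
  have le: "?l \<le> f X" using mono[OF X] by (intro cSup_least ne) auto
  have "(f \<longlongrightarrow> ?l) (at_right X)"
  proof (rule order_tendstoI)
    fix a assume "a < ?l"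
    then obtain Y where Y: "X < Y" "a < f Y" by (subst (asm) less_cSup_iff[OF ne bdd]) auto
    show "eventually (\<lambda>x. a < f x) (at_right X)"
      unfolding eventually_at_right[OF Y(1)] using Y mono X by (intro exI[of _ Y]) (meson le_less_trans less_imp_le less_le_trans order.strict_trans)
  next
    fix a assume "?l < a"
    then show "eventually (\<lambda>x. f x < a) (at_right X)"
      unfolding eventually_at_right[OF gt_ex[of X, THEN someI_ex]] using up by (intro exI[of _ "SOME y. X < y"]) (meson gt_ex le_less_trans someI_ex)
  qed
  then show thesis using le up by (rule that)
qed

text \<open>The equation is only known on a dense set; passing to right limits, which exist by
  monotonicity, turns it into an equation that separates the variables.\<close>

lemma monotone_separation:
  fixes f g :: "real \<Rightarrow> real"
  assumes f: "antimono_on {0<..} f" and g: "antimono_on {0<..} g" and c: "0 \<le> c"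
    and u: "continuous_on {0<..} u" "\<And>X. 0 < X \<Longrightarrow> 0 < u X" and w: "continuous_on {0<..} w" "\<And>X. 0 < X \<Longrightarrow> 0 < w X"
    and dense: "\<And>X W \<epsilon>. 0 < X \<Longrightarrow> 0 < W \<Longrightarrow> c < X * W \<Longrightarrow> 0 < \<epsilon> \<Longrightarrow>
      \<exists>X' W'. X < X' \<and> X' < X + \<epsilon> \<and> W < W' \<and> W' < W + \<epsilon> \<and> u X' * f X' = w W' * g W'"
  shows "\<exists>k. \<forall>X>0. u X * f X = (k::real)"
proof -
  have "\<forall>X. \<exists>l. 0 < X \<longrightarrow> (f \<longlongrightarrow> l) (at_right X) \<and> l \<le> f X \<and> (\<forall>Y>X. f Y \<le> l)"
    using antimono_right_limit[OF f] by metis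
  then obtain F where F: "\<And>X. 0 < X \<Longrightarrow> (f \<longlongrightarrow> F X) (at_right X)" "\<And>X. 0 < X \<Longrightarrow> F X \<le> f X" "\<And>X Y. 0 < X \<Longrightarrow> X < Y \<Longrightarrow> f Y \<le> F X"
    unfolding choice_iff by blast
  have "\<forall>X. \<exists>l. 0 < X \<longrightarrow> (g \<longlongrightarrow> l) (at_right X)" using antimono_right_limit[OF g] by metis
  then obtain G where G: "\<And>X. 0 < X \<Longrightarrow> (g \<longlongrightarrow> G X) (at_right X)" unfolding choice_iff by blast
  have cont: "isCont u X" "isCont w X" if "0 < X" for X
    using u(1) w(1) that by (simp_all add: continuous_on_eq_continuous_at)
  \<comment> \<open>Admissible pairs approach (X, W) from the upper right, where one-sided limits of
    monotone functions exist.\<close>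
  have sep: "u X * F X = w W * G W" if XW: "0 < X" "0 < W" "c < X * W" for X W
  proof -
    have "\<forall>n. \<exists>X' W'. X < X' \<and> X' < X + inverse (real (Suc n)) \<and> W < W' \<and> W' < W + inverse (real (Suc n)) \<and> u X' * f X' = w W' * g W'"
      using dense[OF XW] by simp
    then obtain x y where xy: "\<And>n. X < x n" "\<And>n. x n < X + inverse (real (Suc n))" "\<And>n. W < y n" "\<And>n. y n < W + inverse (real (Suc n))"
        "\<And>n. u (x n) * f (x n) = w (y n) * g (y n)"
      unfolding choice_iff by blast
    have lim: "z \<longlonglongrightarrow> Z" if "\<And>n. Z < z n" "\<And>n. z n < Z + inverse (real (Suc n))" for z :: "nat \<Rightarrow> real" and Z
    proof (rule tendsto_sandwich[OF always_eventually always_eventually tendsto_const])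
      show "(\<lambda>n. Z + inverse (real (Suc n))) \<longlonglongrightarrow> Z" by (rule LIMSEQ_inverse_real_of_nat_add)
    qed (use that less_imp_le in blast)+
    have fl: "filterlim z (at_right Z) sequentially" if "z \<longlonglongrightarrow> Z" "\<And>n. Z < z n" for z :: "nat \<Rightarrow> real" and Z
      using that by (intro filterlim_at_withinI) (auto simp: less_imp_neq[symmetric] intro!: always_eventually)
    have lx: "x \<longlonglongrightarrow> X" by (rule lim[OF xy(1,2)])
    have ly: "y \<longlonglongrightarrow> W" by (rule lim[OF xy(3,4)])
    have "(\<lambda>n. u (x n) * f (x n)) \<longlonglongrightarrow> u X * F X"
      by (rule tendsto_mult[OF isCont_tendsto_compose[OF cont(1)[OF XW(1)] lx] filterlim_compose[OF F(1)[OF XW(1)] fl[OF lx xy(1)]]])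
    moreover have "(\<lambda>n. w (y n) * g (y n)) \<longlonglongrightarrow> w W * G W"
      by (rule tendsto_mult[OF isCont_tendsto_compose[OF cont(2)[OF XW(2)] ly] filterlim_compose[OF G[OF XW(2)] fl[OF ly xy(3)]]])
    ultimately show ?thesis unfolding xy(5) by (rule LIMSEQ_unique)
  qed
  define k where "k = u 1 * F 1"
  have Fk: "F X = k / u X" if X: "0 < X" for X
  proof -
    \<comment> \<open>A value of W admissible together with 1 and with X, so that both values of u F
      are compared with the same right-hand side.\<close>
    define W where "W = c + c / X + 1"
    have W: "0 < W" "c < 1 * W" "c < X * W"
      using c X by (auto simp: W_def field_simps add_pos_nonneg intro: add_nonneg_pos)
    have "u X * F X = k" using sep[OF X W(1,3)] sep[OF zero_less_one W(1,2)] by (simp add: k_def)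
    then show ?thesis using u(2)[OF X] by (simp add: field_simps)
  qed
  \<comment> \<open>The right limits of f form a continuous function. Since f X lies above its right
    limit and below the right limits at all smaller points, f has no jump at X.\<close>
  have "f X = k / u X" if X: "0 < X" for X
  proof (rule antisym)
    show "k / u X \<le> f X" using F(2)[OF X] by (simp add: Fk[OF X])
    have "isCont (\<lambda>Y. k / u Y) X" using cont(1)[OF X] u(2)[OF X] by (intro continuous_divide continuous_const) auto
    then have "((\<lambda>Y. k / u Y) \<longlongrightarrow> k / u X) (at_left X)"
      unfolding isCont_def by (rule filterlim_mono[OF _ order_refl]) (simp add: at_le)
    moreover have "eventually (\<lambda>Y. f X \<le> k / u Y) (at_left X)"
      unfolding eventually_at_left[OF X]
      using F(3)[of _ X] Fk X by (intro exI[of _ 0]) auto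
    ultimately show "f X \<le> k / u X" by (rule tendsto_lowerbound) simp
  qed
  then have "u X * f X = k" if "0 < X" for X using u(2)[OF that] that by simp
  then show ?thesis by blast
qed

section \<open>Symmetries of level ellipsoids\<close>

lemma level_radius:
  fixes g :: "real \<Rightarrow> real"
  assumes g: "antimono_on {0<..} g" and r: "0 < r0" "0 < r1" "t < g r0" "g r1 < t"
  obtains \<rho> where "0 < \<rho>" "\<And>r. 0 < r \<Longrightarrow> r < \<rho> \<Longrightarrow> t < g r" "\<And>r. \<rho> < r \<Longrightarrow> g r \<le> t"
proof -
  let ?S = "{r. 0 < r \<and> t < g r}"
  have mono: "g b \<le> g a" if "0 < a" "a \<le> b" for a b using g that by (auto simp: monotone_on_def)
  have ne: "?S \<noteq> {}" using r by blast
  have bdd: "bdd_above ?S" using mono[OF r(2)] r(4) by (intro bdd_aboveI[of _ r1]) (smt (verit) mem_Collect_eq)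
  have "0 < Sup ?S" using cSup_upper[OF _ bdd, of r0] r by auto
  moreover have "t < g r" if r: "0 < r" "r < Sup ?S" for r
  proof -
    obtain r' where "r' \<in> ?S" "r < r'" using r(2) less_cSup_iff[OF ne bdd] by blast
    then show ?thesis using mono[OF r(1), of r'] by simp
  qed
  moreover have "g r \<le> t" if "Sup ?S < r" for r
  proof (rule ccontr)
    assume "\<not> g r \<le> t"
    then have "r \<in> ?S" using that \<open>0 < Sup ?S\<close> by simp
    then show False using cSup_upper[OF _ bdd, of r] that by simp
  qed
  ultimately show thesis by (rule that)
qed

text \<open>If a point inside the level ellipsoid had its image strictly outside, the same would
  hold on an open set. The almost-everywhere equation holds somewhere in that set for both points,
  and it would equate a value above t with a value at most t.\<close>

lemma symmetry_level_set:
  fixes A T :: "real^'n \<Rightarrow> real^'n" and g :: "real \<Rightarrow> real"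
  assumes A: "linear A" "inj A" and T: "orthogonal_transformation T" and G: "\<And>x. G (T x) = G x"
    and eq: "AE x in lborel. G x = g (norm (A x + b))"
    and \<rho>: "\<And>r. 0 < r \<Longrightarrow> r < \<rho> \<Longrightarrow> t < g r" "\<And>r. \<rho> < r \<Longrightarrow> g r \<le> t"
    and x: "0 < norm (A x + b)" "norm (A x + b) < \<rho>"
  shows "norm (A (T x) + b) \<le> \<rho>"
proof (rule ccontr)
  assume "\<not> norm (A (T x) + b) \<le> \<rho>"
  have lT: "linear T" "inj T" using T orthogonal_transformation_linear orthogonal_transformation_inj by blast+
  have "AE x in lborel. G (T x + 0) = g (norm (A (T x + 0) + b))" by (rule AE_lborel_affine[OF lT eq])
  then have ae: "AE x in lborel. g (norm (A x + b)) = g (norm (A (T x) + b))"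
    using eq by eventually_elim (simp add: G)
  have cA: "continuous_on UNIV A" "continuous_on UNIV T"
    using A(1) lT(1) by (simp_all add: linear_continuous_on linear_conv_bounded_linear)
  have c: "continuous_on UNIV (\<lambda>x. norm (A x + b))" "continuous_on UNIV (\<lambda>x. norm (A (T x) + b))"
    by (intro continuous_on_norm continuous_on_add continuous_on_const cA(1))
       (intro continuous_on_norm continuous_on_add continuous_on_const continuous_on_compose2[OF cA(1) cA(2)] subset_UNIV)
  let ?U = "{x. 0 < norm (A x + b)} \<inter> {x. norm (A x + b) < \<rho>} \<inter> {x. \<rho> < norm (A (T x) + b)}"
  have "open ?U" by (intro open_Int open_Collect_less c continuous_on_const)
  moreover have "x \<in> ?U" using x \<open>\<not> norm (A (T x) + b) \<le> \<rho>\<close> by simp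
  ultimately obtain y where y: "y \<in> ?U" "g (norm (A y + b)) = g (norm (A (T y) + b))"
    using AE_lborel_dense[OF ae, of ?U] by blast
  then show False using \<rho>(1)[of "norm (A y + b)"] \<rho>(2)[of "norm (A (T y) + b)"] by simp
qed

text \<open>An ellipsoid symmetric about the origin has its centre there.\<close>

lemma central_symmetry_offset:
  fixes A :: "real^'n \<Rightarrow> real^'n"
  assumes A: "linear A" "inj A" and \<rho>: "0 < \<rho>"
    and sym: "\<And>x. 0 < norm (A x + b) \<Longrightarrow> norm (A x + b) < \<rho> \<Longrightarrow> norm (A (- x) + b) \<le> \<rho>"
  shows "b = 0"
proof (rule ccontr)
  assume b: "b \<noteq> 0"
  have "surj A" using A by (rule linear_injective_imp_surjective) simp
  \<comment> \<open>The chosen x has A x + b of norm s, pointing against b, and its mirror image has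
    norm s + 2 norm b. Here s < rho keeps x inside, while s >= rho - norm b puts the mirror image
    strictly outside.\<close>
  define s where "s = max (\<rho> / 2) (\<rho> - norm b)"
  have s: "0 < s" "s < \<rho>" "\<rho> - norm b \<le> s" using \<rho> b by (auto simp: s_def)
  obtain x where x: "A x = (- (s / norm b) - 1) *\<^sub>R b" using \<open>surj A\<close> by (metis surjD)
  have "A x + b = (- (s / norm b)) *\<^sub>R b" unfolding x by (simp add: algebra_simps)
  then have "norm (A x + b) = s" using s b by simp
  moreover have "A (- x) + b = (s / norm b + 2) *\<^sub>R b" unfolding linear_neg[OF A(1)] x by (simp add: scaleR_left_diff_distrib scaleR_add_left scaleR_2)
  then have "norm (A (- x) + b) = s + 2 * norm b" using s b by (simp add: field_simps)
  ultimately have "s + 2 * norm b \<le> \<rho>" using sym[of x] s by simp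
  then show False using s b by simp
qed

text \<open>By homogeneity x can be scaled to lie just inside the ellipsoid; the scaling factor z
  tends to 1.\<close>

lemma level_set_contraction:
  fixes A :: "real^'n \<Rightarrow> real^'n"
  assumes A: "linear A" "inj A" and T: "linear T" and \<rho>: "0 < \<rho>"
    and sym: "\<And>x. 0 < norm (A x) \<Longrightarrow> norm (A x) < \<rho> \<Longrightarrow> norm (A (T x)) \<le> \<rho>"
  shows "norm (A (T x)) \<le> norm (A x)"
proof (cases "A x = 0")
  case True
  then have "x = 0" using A linear_injective_0 by blast
  then show ?thesis using T A by (simp add: linear_0)
next
  case False
  show ?thesis
  proof (rule field_le_mult_one_interval)
    fix z :: real assume z: "0 < z" "z < 1"
    define c where "c = z * \<rho> / norm (A x)"
    have c: "0 < c" using z \<rho> False by (simp add: c_def)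
    have "norm (A (c *\<^sub>R x)) = z * \<rho>" using c False by (simp add: linear_scale[OF A(1)] c_def abs_mult) (use z \<rho> in simp)
    then have "norm (A (T (c *\<^sub>R x))) \<le> \<rho>" using sym[of "c *\<^sub>R x"] z \<rho> by simp
    then have "c * norm (A (T x)) \<le> \<rho>" using c by (simp add: linear_scale[OF A(1)] linear_scale[OF T])
    then show "z * norm (A (T x)) \<le> norm (A x)" using False \<rho> by (simp add: c_def field_simps)
  qed
qed

text \<open>Reflections act transitively on the spheres of the hyperplane x_e = 0, so there norm (A
  x) is a multiple of norm x. The reflection along the axis e makes the images of the axis and of
  the hyperplane orthogonal. The index c supplies a unit vector in the hyperplane.\<close>

lemma reflection_symmetric_norm:
  fixes A :: "real^'n \<Rightarrow> real^'n"
  assumes A: "linear A" "inj A" and c: "c \<noteq> e"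
    and sym: "\<And>w x. (w = axis e 1 \<or> w $ e = 0) \<Longrightarrow> norm (A (refl_along w x)) = norm (A x)"
  shows "\<exists>\<alpha> \<beta>. 0 < \<alpha> \<and> 0 < \<beta> \<and> (\<forall>x. (norm (A x))\<^sup>2 = \<alpha> * ((norm x)\<^sup>2 - (x $ e)\<^sup>2) + \<beta> * (x $ e)\<^sup>2)"
proof -
  let ?E = "axis e 1 :: real^'n" and ?C = "axis c 1 :: real^'n"
  have nz: "A v \<noteq> 0" if "v \<noteq> 0" for v using A that linear_injective_0 by blast
  have EE: "?E \<bullet> ?E = 1" by (simp add: inner_axis_axis)
  have Ex: "?E \<bullet> x = x $ e" for x by (simp add: inner_axis')
  have Cn: "norm ?C = 1" by (simp add: norm_axis_1)
  \<comment> \<open>The reflection along u - u' exchanges two vectors of equal norm.\<close>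
  have tr: "norm (A u) = norm (A u')" if "norm u = norm u'" "u $ e = 0" "u' $ e = 0" for u u'
  proof (cases "u = u'")
    case False
    let ?w = "u - u'"
    have uu: "u \<bullet> u = u' \<bullet> u'" using that(1) by (simp add: norm_eq)
    have ww: "?w \<bullet> ?w = 2 * (?w \<bullet> u)" by (simp add: inner_diff_left inner_diff_right inner_commute uu)
    have "?w \<bullet> ?w \<noteq> 0" using False by simp
    then have "refl_along ?w u = u'" unfolding refl_along_def using ww by simp
    then show ?thesis using sym[of ?w u] that by simp
  qed simp
  have perp: "norm (A u) = norm u * norm (A ?C)" if "u $ e = 0" for u
  proof -
    have "norm u = norm (norm u *\<^sub>R ?C)" by (simp add: Cn)
    moreover have "(norm u *\<^sub>R ?C) $ e = 0" using c by (simp add: axis_def)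
    ultimately have "norm (A u) = norm (A (norm u *\<^sub>R ?C))" using that by (intro tr)
    then show ?thesis by (simp add: linear_scale[OF A(1)])
  qed
  have main: "(norm (A x))\<^sup>2 = (norm (A ?C))\<^sup>2 * ((norm x)\<^sup>2 - (x $ e)\<^sup>2) + (norm (A ?E))\<^sup>2 * (x $ e)\<^sup>2" for x
  proof -
    define u where "u = x - (x $ e) *\<^sub>R ?E"
    have u: "u $ e = 0" by (simp add: u_def axis_def)
    have Eu: "?E \<bullet> u = 0" using u by (simp add: Ex)
    have x: "x = u + (x $ e) *\<^sub>R ?E" by (simp add: u_def)
    have nu: "(norm u)\<^sup>2 = (norm x)\<^sup>2 - (x $ e)\<^sup>2"
      unfolding power2_norm_eq_inner u_def
      by (simp add: inner_diff_left inner_diff_right EE Ex inner_commute[of x ?E] power2_eq_square)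
    have r: "refl_along ?E (u + s *\<^sub>R ?E) = u - s *\<^sub>R ?E" for s
    proof -
      have "(2 * s) *\<^sub>R ?E = s *\<^sub>R ?E + s *\<^sub>R ?E" by (simp add: scaleR_add_left[symmetric])
      then show ?thesis by (simp add: refl_along_def EE Eu inner_add_right)
    qed
    \<comment> \<open>Equality of these two norms says that A u and the image of the axis are
      orthogonal.\<close>
    have "norm (A (u - 1 *\<^sub>R ?E)) = norm (A (u + 1 *\<^sub>R ?E))" using sym[of ?E "u + 1 *\<^sub>R ?E"] unfolding r by simp
    then have "(A u - A ?E) \<bullet> (A u - A ?E) = (A u + A ?E) \<bullet> (A u + A ?E)"
      by (simp add: norm_eq linear_diff[OF A(1)] linear_add[OF A(1)])
    then have orth: "A u \<bullet> A ?E = 0" by (simp add: inner_diff_left inner_diff_right inner_add_left inner_add_right inner_commute)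
    have "A x = A (u + (x $ e) *\<^sub>R ?E)" by (rule arg_cong[OF x])
    also have "\<dots> = A u + (x $ e) *\<^sub>R A ?E" by (simp only: linear_add[OF A(1)] linear_scale[OF A(1)])
    finally have "(norm (A x))\<^sup>2 = (norm (A u))\<^sup>2 + (x $ e)\<^sup>2 * (norm (A ?E))\<^sup>2"
      unfolding power2_norm_eq_inner
      by (simp add: inner_add_left inner_add_right orth inner_commute[of "A ?E" "A u"] power2_eq_square)
    then show ?thesis by (simp add: perp[OF u] power_mult_distrib nu mult.commute)
  qed
  have "A ?C \<noteq> 0" "A ?E \<noteq> 0" by (intro nz, simp add: axis_eq_0_iff)+
  then have "0 < (norm (A ?C))\<^sup>2" "0 < (norm (A ?E))\<^sup>2" by simp_all
  then show ?thesis using main by blast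
qed

text \<open>A level set of the right-hand side is the ellipsoid \<open>norm (A x + b) \<le> \<rho>\<close>; it inherits every
  orthogonal symmetry of \<open>G\<close>.\<close>

lemma axially_symmetric_ellipsoid:
  fixes A :: "real^'n \<Rightarrow> real^'n" and g :: "real \<Rightarrow> real"
  assumes A: "linear A" "inj A" and c: "c \<noteq> e"
    and G: "\<And>x y. \<bar>x $ e\<bar> = \<bar>y $ e\<bar> \<Longrightarrow> norm x = norm y \<Longrightarrow> G x = G y"
    and eq: "AE x in lborel. G x = g (norm (A x + b))"
    and g: "antimono_on {0<..} g" and r: "0 < r0" "0 < r1" "t < g r0" "g r1 < t"
  shows "\<exists>\<alpha> \<beta>. 0 < \<alpha> \<and> 0 < \<beta> \<and> (\<forall>x. (norm (A x + b))\<^sup>2 = \<alpha> * ((norm x)\<^sup>2 - (x $ e)\<^sup>2) + \<beta> * (x $ e)\<^sup>2)"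
proof -
  obtain \<rho> where \<rho>: "0 < \<rho>" "\<And>r. 0 < r \<Longrightarrow> r < \<rho> \<Longrightarrow> t < g r" "\<And>r. \<rho> < r \<Longrightarrow> g r \<le> t"
    using level_radius[OF g r] by blast
  have lev: "norm (A (T x) + b) \<le> \<rho>"
    if "orthogonal_transformation T" "\<And>x. \<bar>T x $ e\<bar> = \<bar>x $ e\<bar>" "0 < norm (A x + b)" "norm (A x + b) < \<rho>" for T x
    by (rule symmetry_level_set[OF A that(1) G eq \<rho>(2,3) that(3,4)])
      (simp_all add: that(2) orthogonal_transformation_norm[OF that(1)])
  \<comment> \<open>The symmetry under x to -x removes the offset, after which the level condition
    is homogeneous.\<close>
  have "orthogonal_transformation (\<lambda>x :: real^'n. - x)"
    by (simp add: orthogonal_transformation_def linear_uminus)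
  then have b: "b = 0"
    by (intro central_symmetry_offset[OF A \<rho>(1)] lev) simp_all
  have re: "\<bar>refl_along w x $ e\<bar> = \<bar>x $ e\<bar>" if "w = axis e 1 \<or> w $ e = 0" for w x
    using that
  proof
    assume "w = axis e 1"
    then have "w \<bullet> x = x $ e" "w \<bullet> w = 1" by (simp_all add: inner_axis' inner_axis_axis)
    moreover have "w $ e = 1" using \<open>w = axis e 1\<close> by (simp add: axis_def)
    ultimately show ?thesis by (simp add: refl_along_def)
  qed (simp add: refl_along_def)
  have le: "norm (A (refl_along w x)) \<le> norm (A x)" if "w = axis e 1 \<or> w $ e = 0" for w x
    by (rule level_set_contraction[OF A orthogonal_transformation_linear[OF refl_along_orthogonal] \<rho>(1)])
      (use lev[OF refl_along_orthogonal re[OF that]] b in simp)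
  \<comment> \<open>A reflection is its own inverse, so the contraction inequality holds in both
    directions.\<close>
  have "norm (A (refl_along w x)) = norm (A x)" if "w = axis e 1 \<or> w $ e = 0" for w x
    using le[OF that, of x] le[OF that, of "refl_along w x"] by (simp add: refl_along_involution)
  from reflection_symmetric_norm[OF A c this] show ?thesis unfolding b by simp
qed

section \<open>From the twisted equation to the profile\<close>

lemma extremizer_Lp:
  assumes "extremizer k \<mu> (f :: 'a::euclidean_space \<Rightarrow> real)"
  shows "f \<in> Lp_space lborel (source_exponent TYPE('a) k)" "\<not> (AE x in lborel. f x = 0)"
  using assms unfolding extremizer_def plane_transform_ext_def by blast+

text \<open>If A killed a vector, |h|^p would agree almost everywhere with a function invariant
  along it; having a finite integral, this function would have integral 0, making h zero.\<close>

lemma extremizer_affine_inj: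
  fixes A :: "real^'n \<Rightarrow> real^'n"
  assumes h: "extremizer k \<mu> h" and f: "f \<in> borel_measurable borel" and A: "linear A"
    and eq: "AE x in lborel. h x = f (A x + b)"
  shows "inj A"
proof (rule ccontr)
  assume "\<not> inj A"
  then obtain v where v: "v \<noteq> 0" "A v = 0" using linear_injective_0[OF A] by blast
  let ?p = "source_exponent TYPE(real^'n) k"
  let ?q = "\<lambda>x. ennreal (\<bar>f (A x + b)\<bar> powr ?p)"
  note hL = extremizer_Lp[OF h]
  have [measurable]: "f \<in> borel_measurable borel" "A \<in> borel_measurable borel"
    using f borel_measurable_continuous_onI[OF linear_continuous_on[OF A[unfolded linear_conv_bounded_linear]]] by auto
  have q: "(\<integral>\<^sup>+x. ?q x \<partial>lborel) = (\<integral>\<^sup>+x. ennreal (\<bar>h x\<bar> powr ?p) \<partial>lborel)"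
    by (rule nn_integral_cong_AE) (use eq in eventually_elim, simp)
  also have "\<dots> < \<top>" using hL(1) unfolding Lp_space_def by (simp add: integrable_iff_bounded)
  finally have "(\<integral>\<^sup>+x. ?q x \<partial>lborel) = 0"
    by (intro nn_integral_direction_invariant[OF _ v(1)]) (simp_all add: linear_add[OF A] linear_scale[OF A] v(2))
  then have "AE x in lborel. ?q x = 0" by (subst (asm) nn_integral_0_iff_AE) measurable
  then have "AE x in lborel. h x = 0" using eq by eventually_elim (simp add: ennreal_eq_0_iff)
  then show False using hL(2) by blast
qed

text \<open>Monotonicity turns information almost everywhere into information at every radius. The
  profile comes below every positive t because a function bounded below by t is not in L^p.\<close>

lemma radial_profile:
  fixes f :: "real^'n \<Rightarrow> real"
  assumes p: "0 < p" and f: "f \<in> Lp_space lborel p" and nz: "\<not> (AE x in lborel. f x = 0)"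
    and nn: "AE x in lborel. 0 \<le> f x" and \<phi>: "antimono_on {0<..} \<phi>" and eq: "AE x in lborel. f x = \<phi> (norm x)"
  shows "\<And>r. 0 < r \<Longrightarrow> 0 \<le> \<phi> r" "\<exists>r>0. 0 < \<phi> r" "\<And>t. 0 < t \<Longrightarrow> \<exists>r>0. \<phi> r < t"
proof -
  have x0: "AE x in lborel. x \<noteq> (0 :: real^'n)" by (rule AE_lborel_singleton)
  show nonneg: "0 \<le> \<phi> r" if r: "0 < r" for r
  proof -
    let ?U = "{x :: real^'n. r < norm x}"
    have "open ?U" by (intro open_Collect_less continuous_intros)
    moreover have "?U \<noteq> {}"
    proof -
      have "norm ((r + 1) *\<^sub>R axis undefined 1 :: real^'n) = r + 1" using r by (simp add: norm_axis_1)
      then have "(r + 1) *\<^sub>R axis undefined 1 \<in> ?U" by simp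
      then show ?thesis by blast
    qed
    moreover have "AE x in lborel. 0 \<le> \<phi> (norm (x :: real^'n))" using nn eq by eventually_elim simp
    ultimately obtain x :: "real^'n" where "r < norm x" "0 \<le> \<phi> (norm x)" using AE_lborel_dense[of _ ?U] by blast
    moreover have "\<phi> (norm x) \<le> \<phi> r" using \<phi>[unfolded monotone_on_def, rule_format, of r "norm x"] r \<open>r < norm x\<close> by (cases "x = 0") simp_all
    ultimately show ?thesis by simp
  qed
  show "\<exists>r>0. 0 < \<phi> r"
  proof (rule ccontr)
    assume "\<not> (\<exists>r>0. 0 < \<phi> r)"
    then have z: "\<phi> r = 0" if "0 < r" for r using nonneg[OF that] that less_eq_real_def by metis
    have "AE x in lborel. f x = 0" using eq x0
    proof eventually_elim
      case (elim x)
      then show ?case using z[of "norm x"] by simp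
    qed
    then show False using nz by blast
  qed
  show "\<exists>r>0. \<phi> r < t" if t: "0 < t" for t
  proof (rule ccontr)
    assume "\<not> (\<exists>r>0. \<phi> r < t)"
    then have ge: "t \<le> \<phi> r" if "0 < r" for r using that not_less by blast
    have "\<top> = (\<integral>\<^sup>+x. ennreal (t powr p) \<partial>(lborel :: (real^'n) measure))"
      using t by (simp add: emeasure_lborel_UNIV ennreal_mult_top)
    also have "\<dots> \<le> (\<integral>\<^sup>+x. ennreal (\<bar>f x\<bar> powr p) \<partial>lborel)"
    proof (rule nn_integral_mono_AE)
      show "AE x in lborel. ennreal (t powr p) \<le> ennreal (\<bar>f x\<bar> powr p)"
        using eq x0
      proof eventually_elim
        case (elim x)
        then have "t \<le> \<bar>f x\<bar>" using ge[of "norm x"] by simp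
        then show ?case using t p by (intro ennreal_leI powr_mono2) auto
      qed
    qed
    also have "\<dots> < \<top>" using f unfolding Lp_space_def by (simp add: integrable_iff_bounded)
    finally show False by simp
  qed
qed

text \<open>The norm of the inverted point depends only on |x_e| and norm x; this makes the twist of
  a radial function symmetric about the axis e.\<close>

lemma norm_proj_inv: "(norm (proj_inv e x))\<^sup>2 = (1 + ((norm x)\<^sup>2 - (x $ e)\<^sup>2)) / (x $ e)\<^sup>2"
proof (cases "x $ e = 0")
  case True
  then have "proj_inv e x = 0" by (simp add: proj_inv_def vec_eq_iff)
  then show ?thesis using True by simp
next
  case False
  let ?E = "axis e 1 :: real^'a"
  have E: "?E \<bullet> ?E = 1" "?E \<bullet> x = x $ e" "x \<bullet> ?E = x $ e" by (simp_all add: inner_axis_axis inner_axis' inner_axis)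
  \<comment> \<open>Multiplied by x_e, the inverted point is x with its coordinate e replaced by
    1.\<close>
  have "(x $ e) *\<^sub>R proj_inv e x = x + (1 - x $ e) *\<^sub>R ?E"
    using False by (simp add: proj_inv_def vec_eq_iff axis_def)
  then have "(norm ((x $ e) *\<^sub>R proj_inv e x))\<^sup>2 = (x + (1 - x $ e) *\<^sub>R ?E) \<bullet> (x + (1 - x $ e) *\<^sub>R ?E)"
    by (simp only: power2_norm_eq_inner)
  also have "\<dots> = x \<bullet> x + 2 * (1 - x $ e) * (x $ e) + (1 - x $ e)\<^sup>2"
    by (simp add: inner_add_left inner_add_right E power2_eq_square algebra_simps)
  also have "\<dots> = 1 + ((norm x)\<^sup>2 - (x $ e)\<^sup>2)" unfolding power2_norm_eq_inner by (simp add: power2_eq_square algebra_simps)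
  finally have "(x $ e)\<^sup>2 * (norm (proj_inv e x))\<^sup>2 = 1 + ((norm x)\<^sup>2 - (x $ e)\<^sup>2)" by (simp add: power_mult_distrib)
  then show ?thesis using False by (simp add: field_simps)
qed

text \<open>Once the ellipsoid is axially symmetric, the equation involves only X = (1 + S) / x_e^2
  and W = alpha S + beta x_e^2, with S = norm x ^ 2 - x_e^2. The weight |x_e|^-m splits into a
  function of X and a function of W because W + alpha = x_e^2 (alpha X + beta), and the variables
  separate.\<close>

lemma profile_rigidity:
  fixes A :: "real^'n \<Rightarrow> real^'n" and \<phi> g :: "real \<Rightarrow> real"
  assumes c: "c \<noteq> e" and A: "linear A" "inj A" and \<phi>: "antimono_on {0<..} \<phi>" and g: "antimono_on {0<..} g"
    and eq: "AE x in lborel. inverse (\<bar>x $ e\<bar> ^ m) * \<phi> (norm (proj_inv e x)) = g (norm (A x + b))"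
    and r: "0 < r0" "0 < r1" "t < g r0" "g r1 < t"
  shows "\<exists>\<alpha> \<beta> K. 0 < \<alpha> \<and> 0 < \<beta> \<and> (\<forall>r>0. (\<alpha> * r\<^sup>2 + \<beta>) powr (real m / 2) * \<phi> r = K)"
proof -
  have N: "norm (proj_inv e x) = norm (proj_inv e y)" if "\<bar>x $ e\<bar> = \<bar>y $ e\<bar>" "norm x = norm y" for x y :: "real^'n"
  proof (rule power2_eq_imp_eq)
    have "(x $ e)\<^sup>2 = (y $ e)\<^sup>2" using arg_cong[OF that(1), of "\<lambda>z. z\<^sup>2"] by (simp only: power2_abs)
    then show "(norm (proj_inv e x))\<^sup>2 = (norm (proj_inv e y))\<^sup>2" by (simp only: norm_proj_inv that(2))
  qed simp_all
  have G: "inverse (\<bar>x $ e\<bar> ^ m) * \<phi> (norm (proj_inv e x)) = inverse (\<bar>y $ e\<bar> ^ m) * \<phi> (norm (proj_inv e y))"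
    if "\<bar>x $ e\<bar> = \<bar>y $ e\<bar>" "norm x = norm y" for x y :: "real^'n" by (simp only: that(1) N[OF that])
  have "\<exists>\<alpha> \<beta>. 0 < \<alpha> \<and> 0 < \<beta> \<and> (\<forall>x. (norm (A x + b))\<^sup>2 = \<alpha> * ((norm x)\<^sup>2 - (x $ e)\<^sup>2) + \<beta> * (x $ e)\<^sup>2)"
    by (rule axially_symmetric_ellipsoid[where G="\<lambda>x. inverse (\<bar>x $ e\<bar> ^ m) * \<phi> (norm (proj_inv e x))", OF A c _ eq g r])
      (rule G)
  then obtain \<alpha> \<beta> where pos: "0 < \<alpha>" "0 < \<beta>" and ell: "\<And>x. (norm (A x + b))\<^sup>2 = \<alpha> * ((norm x)\<^sup>2 - (x $ e)\<^sup>2) + \<beta> * (x $ e)\<^sup>2"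
    by (elim exE conjE) (rule that, assumption, assumption, erule spec)
  define S where "S x = (norm x)\<^sup>2 - (x $ e)\<^sup>2" for x :: "real^'n"
  have ellS: "norm (A x + b) = sqrt (\<alpha> * S x + \<beta> * (x $ e)\<^sup>2)" for x
    by (rule real_sqrt_unique[symmetric]) (simp_all add: ell S_def)
  have invS: "norm (proj_inv e x) = sqrt ((1 + S x) / (x $ e)\<^sup>2)" for x
    by (rule real_sqrt_unique[symmetric]) (simp_all add: norm_proj_inv S_def)
  let ?u = "\<lambda>X. (\<alpha> * X + \<beta>) powr (real m / 2)" and ?w = "\<lambda>W. (W + \<alpha>) powr (real m / 2)"
  have sq: "antimono_on {0<..} (\<lambda>X. f (sqrt X))" if f: "antimono_on {0<..} f" for f :: "real \<Rightarrow> real"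
    using f by (auto simp: monotone_on_def)
  have "\<exists>K. \<forall>X>0. ?u X * \<phi> (sqrt X) = K"
  proof (rule monotone_separation[OF sq[OF \<phi>] sq[OF g], where c=\<beta> and w="?w"])
    show "0 \<le> \<beta>" using pos by simp
    show "continuous_on {0<..} ?u"
      using pos by (intro continuous_intros) (auto simp: add_nonneg_eq_0_iff)
    show "continuous_on {0<..} ?w"
      using pos by (intro continuous_intros) (auto simp: add_nonneg_eq_0_iff)
    show "0 < ?u X" if "0 < X" for X
    proof -
      have "0 < \<alpha> * X + \<beta>" using that pos by (simp add: add_pos_pos)
      then show ?thesis by simp
    qed
    show "0 < ?w W" if "0 < W" for W using that pos by simp
    fix X W \<epsilon> :: real assume XW: "0 < X" "0 < W" "\<beta> < X * W" and \<epsilon>: "0 < \<epsilon>"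
    \<comment> \<open>Interior points of the two windows, so that the inequalities to be met define
      an open set.\<close>
    define X1 W1 where "X1 = X + \<epsilon> / 2" and "W1 = W + \<epsilon> / 2"
    define D where "D = \<alpha> * X1 + \<beta>"
    have X1: "0 < X1" "X < X1" "X1 < X + \<epsilon>" and W1: "0 < W1" "W < W1" "W1 < W + \<epsilon>" using XW \<epsilon> by (simp_all add: X1_def W1_def)
    have D: "0 < D" using pos X1 by (simp add: D_def add_pos_pos)
    have "X * W \<le> X1 * W1" using XW X1 W1 by (intro mult_mono) auto
    then have XW1: "\<beta> < X1 * W1" using XW(3) by simp
    \<comment> \<open>Solving (1 + S) / x_e^2 = X1 and alpha S + beta x_e^2 = W1 gives x_e^2 = (W1 +
      alpha) / D and S = (X1 W1 - beta) / D. The condition beta < X1 W1 makes S positive; a second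
      axis c provides a point with this S.\<close>
    define s \<tau> where "s = sqrt ((W1 + \<alpha>) / D)" and "\<tau> = sqrt ((X1 * W1 - \<beta>) / D)"
    have s: "0 < s" and s2: "s\<^sup>2 = (W1 + \<alpha>) / D" using D W1 pos by (simp_all add: s_def)
    have \<tau>2: "\<tau>\<^sup>2 = (X1 * W1 - \<beta>) / D" using D XW1 by (simp add: \<tau>_def)
    have id1: "1 + \<tau>\<^sup>2 = X1 * s\<^sup>2" unfolding s2 \<tau>2 using D by (simp add: field_simps) (simp add: D_def algebra_simps)
    have id2: "\<alpha> * \<tau>\<^sup>2 + \<beta> * s\<^sup>2 = W1"
    proof -
      have "\<alpha> * \<tau>\<^sup>2 + \<beta> * s\<^sup>2 = (\<alpha> * (X1 * W1 - \<beta>) + \<beta> * (W1 + \<alpha>)) / D" unfolding s2 \<tau>2 by (simp only: times_divide_eq_right add_divide_distrib[symmetric])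
      also have "\<alpha> * (X1 * W1 - \<beta>) + \<beta> * (W1 + \<alpha>) = W1 * D" by (simp add: D_def algebra_simps)
      finally show ?thesis using D by simp
    qed
    define x0 :: "real^'n" where "x0 = \<tau> *\<^sub>R axis c 1 + s *\<^sub>R axis e 1"
    have xe: "x0 $ e = s" using c by (simp add: x0_def axis_def)
    have "(norm x0)\<^sup>2 = \<tau>\<^sup>2 + s\<^sup>2"
      unfolding power2_norm_eq_inner x0_def using c
      by (simp add: inner_add_left inner_add_right inner_axis_axis power2_eq_square)
    then have Sx: "S x0 = \<tau>\<^sup>2" by (simp add: S_def xe)
    let ?U = "{x :: real^'n. 0 < x $ e} \<inter> {x. X * (x $ e)\<^sup>2 < 1 + S x} \<inter> {x. 1 + S x < (X + \<epsilon>) * (x $ e)\<^sup>2}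
      \<inter> {x. W < \<alpha> * S x + \<beta> * (x $ e)\<^sup>2} \<inter> {x. \<alpha> * S x + \<beta> * (x $ e)\<^sup>2 < W + \<epsilon>}"
    have "open ?U" unfolding S_def by (intro open_Int open_Collect_less continuous_intros)
    moreover have "x0 \<in> ?U"
      using s X1 W1 by (simp add: xe Sx id1 id2)
    ultimately obtain x where x: "x \<in> ?U" and ex: "inverse (\<bar>x $ e\<bar> ^ m) * \<phi> (norm (proj_inv e x)) = g (norm (A x + b))"
      using AE_lborel_dense[OF eq, of ?U] by blast
    let ?X = "(1 + S x) / (x $ e)\<^sup>2" and ?W = "\<alpha> * S x + \<beta> * (x $ e)\<^sup>2"
    have xe0: "0 < x $ e" and bX: "X < ?X" "?X < X + \<epsilon>" and bW: "W < ?W" "?W < W + \<epsilon>"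
      using x by (simp_all add: pos_less_divide_eq pos_divide_less_eq)
    \<comment> \<open>The identity that separates the variables.\<close>
    have "?W + \<alpha> = (x $ e)\<^sup>2 * (\<alpha> * ?X + \<beta>)" using xe0 by (simp add: field_simps)
    then have "?w ?W = ((x $ e)\<^sup>2) powr (real m / 2) * ?u ?X"
      using xe0 pos bX XW by (simp only: powr_mult)
    also have "((x $ e)\<^sup>2) powr (real m / 2) = \<bar>x $ e\<bar> ^ m"
    proof -
      have "((x $ e)\<^sup>2) powr (real m / 2) = (x $ e) powr (2 * (real m / 2))"
        unfolding powr_powr[symmetric] using xe0 by (simp add: powr_numeral)
      also have "\<dots> = (x $ e) ^ m" using xe0 by (simp add: powr_realpow)
      finally show ?thesis using xe0 by simp
    qed
    finally have w: "?w ?W = \<bar>x $ e\<bar> ^ m * ?u ?X" .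
    have "?w ?W * g (sqrt ?W) = ?u ?X * \<phi> (sqrt ?X)"
      unfolding w ex[unfolded ellS invS, symmetric] using xe0 by simp
    then show "\<exists>X' W'. X < X' \<and> X' < X + \<epsilon> \<and> W < W' \<and> W' < W + \<epsilon> \<and> ?u X' * \<phi> (sqrt X') = ?w W' * g (sqrt W')"
      using bX bW by (intro exI[of _ ?X] exI[of _ ?W]) simp
  qed
  then obtain K where K: "\<And>X. 0 < X \<Longrightarrow> ?u X * \<phi> (sqrt X) = K" by blast
  have "?u (r\<^sup>2) * \<phi> r = K" if "0 < r" for r using K[of "r\<^sup>2"] that by simp
  then show ?thesis using pos by blast
qed

lemma AE_lborel_affine_cancel:
  fixes A :: "real^'n \<Rightarrow> real^'n"
  assumes A: "linear A" "inj A" and P: "AE x in lborel. P (A x + b)"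
  shows "AE x in lborel. P x"
proof -
  have "surj A" using A by (rule linear_injective_imp_surjective) simp
  then obtain g where g: "linear g" "A \<circ> g = id" using linear_surjective_right_inverse[OF A(1)] by blast
  have Ag: "A (g x) = x" for x using fun_cong[OF g(2), of x] by simp
  have "inj g" by (rule inj_on_inverseI[of _ A]) (rule Ag)
  from AE_lborel_affine[OF g(1) this P, of "- g b"] show ?thesis
    by (simp add: linear_add[OF A(1)] linear_diff[OF A(1)] Ag)
qed

text \<open>The assumption of the theorem in usable form: the affine map is invertible, and the radial
  extremizer is again nonnegative.\<close>

lemma radial_form:
  fixes h :: "real^'n \<Rightarrow> real"
  assumes h: "nonneg_extremizer k \<mu> h"
    and ex: "\<exists>f L. extremizer k \<mu> f \<and> radial_nonincreasing f \<and> affine_map L \<and> (AE x in lborel. h x = f (L x))"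
  obtains f \<phi> A b where "extremizer k \<mu> f" "AE x in lborel. 0 \<le> f x" "antimono_on {0<..} \<phi>" "AE x in lborel. f x = \<phi> (norm x)"
    "linear A" "inj A" "AE x in lborel. h x = f (A x + b)"
proof -
  obtain f L where f: "extremizer k \<mu> f" "radial_nonincreasing f" "affine_map L" "AE x in lborel. h x = f (L x)"
    using ex by blast
  obtain \<phi> where \<phi>: "antimono_on {0<..} \<phi>" "AE x in lborel. f x = \<phi> (norm x)"
    using f(2) unfolding radial_nonincreasing_def by blast
  obtain A b where A: "linear A" "L = (\<lambda>x. A x + b)" using f(3) unfolding affine_map_def by blast
  have eq: "AE x in lborel. h x = f (A x + b)" using f(4) unfolding A(2) .
  have hE: "extremizer k \<mu> h" and h0: "AE x in lborel. 0 \<le> h x" using h by (simp_all add: nonneg_extremizer_def)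
  have "f \<in> borel_measurable borel" using extremizer_Lp(1)[OF f(1)] by (simp add: Lp_space_def)
  from extremizer_affine_inj[OF hE this A(1) eq] have inj: "inj A" .
  have "AE x in lborel. 0 \<le> f (A x + b)" using eq h0 by eventually_elim simp
  then have "AE x in lborel. 0 \<le> f x" by (rule AE_lborel_affine_cancel[OF A(1) inj])
  from that[OF f(1) this \<phi> A(1) inj eq] show thesis .
qed

text \<open>The twist of f in a direction e is a nonnegative extremizer, so the hypothesis
  \<open>ex\<close> makes it radial up to an affine map, and the rigidity of the resulting equation
  determines the profile of f. A direction e in \<open>K\<close> exists since k is at least 1, an
  index c outside \<open>K\<close> since k is less than the dimension.\<close>

lemma radial_extremizer_profile:
  fixes f :: "real^'d \<Rightarrow> real"
  assumes f: "extremizer k \<mu> f" "AE x in lborel. 0 \<le> f x" "antimono_on {0<..} \<phi>" "AE x in lborel. f x = \<phi> (norm x)"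
    and k: "1 \<le> k" "k < CARD('d)" and \<mu>: "invariant_plane_prob k \<mu>"
    and ex: "\<And>h. nonneg_extremizer k \<mu> h \<Longrightarrow>
      \<exists>f L. extremizer k \<mu> f \<and> radial_nonincreasing f \<and> affine_map L \<and> (AE x in lborel. h x = f (L x))"
  shows "\<exists>\<alpha> \<beta> M. 0 < \<alpha> \<and> 0 < \<beta> \<and> (0::real) < M \<and> (\<forall>r>0. (\<alpha> * r\<^sup>2 + \<beta>) powr ((real k + 1) / 2) * \<phi> r = M)"
proof -
  obtain K :: "'d set" where K: "card K = k" using obtain_subset_with_card_n[of k "UNIV :: 'd set"] k(2) by auto
  have "K \<noteq> {}" "K \<noteq> UNIV" using K k by auto
  then obtain e c where e: "e \<in> K" and c: "c \<notin> K" by blast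
  let ?h = "proj_twist e (k + 1) f"
  have "extremizer k \<mu> ?h" using extremizer_proj_twist[OF e c, of \<mu> f] \<mu> f(1) by (simp only: K)
  moreover have "AE x in lborel. 0 \<le> ?h x"
    using AE_lborel_proj_inv[OF f(2), of e] by eventually_elim (simp add: proj_twist_def)
  ultimately have h: "nonneg_extremizer k \<mu> ?h" by (simp add: nonneg_extremizer_def)
  obtain g \<psi> A b where g: "extremizer k \<mu> g" "AE x in lborel. 0 \<le> g x" "antimono_on {0<..} \<psi>" "AE x in lborel. g x = \<psi> (norm x)"
    and A: "linear A" "inj A" "AE x in lborel. ?h x = g (A x + b)"
    by (rule radial_form[OF h ex[OF h]]) (rule that, assumption+)
  have p: "0 < (real DIM(real^'d) + 1) / (real k + 1)" by simp
  note prof_f = radial_profile[OF p extremizer_Lp[OF f(1)] f(2-4)]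
  note prof_g = radial_profile[OF p extremizer_Lp[OF g(1)] g(2-4)]
  obtain r0 where r0: "0 < r0" "0 < \<psi> r0" using prof_g(2) by blast
  \<comment> \<open>The level psi r0 / 2 lies strictly between two values of the profile, so its
    level set is a genuine ellipsoid.\<close>
  obtain r1 where r1: "0 < r1" "\<psi> r1 < \<psi> r0 / 2" using prof_g(3)[of "\<psi> r0 / 2"] r0 by auto
  have eq: "AE x in lborel. inverse (\<bar>x $ e\<bar> ^ (k + 1)) * \<phi> (norm (proj_inv e x)) = \<psi> (norm (A x + b))"
    using AE_lborel_proj_inv[OF f(4), of e] AE_lborel_affine[OF A(1,2) g(4), of b] A(3)
    by eventually_elim (simp only: proj_twist_def)
  have ce: "c \<noteq> e" using e c by blast
  have "\<psi> r0 / 2 < \<psi> r0" using r0 by simp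
  from profile_rigidity[OF ce A(1,2) f(3) g(3) eq r0(1) r1(1) this r1(2)]
  obtain \<alpha> \<beta> M where pos: "0 < \<alpha>" "0 < \<beta>" and M: "\<And>r. 0 < r \<Longrightarrow> (\<alpha> * r\<^sup>2 + \<beta>) powr (real (k + 1) / 2) * \<phi> r = M"
    by (elim exE conjE) (rule that, assumption, assumption, erule allE, erule mp, assumption)
  obtain r where r: "0 < r" "0 < \<phi> r" using prof_f(2) by blast
  have "0 < \<alpha> * r\<^sup>2 + \<beta>" using pos by (simp add: add_nonneg_pos)
  then have "0 < (\<alpha> * r\<^sup>2 + \<beta>) powr (real (k + 1) / 2)" by simp
  from mult_pos_pos[OF this r(2)] have "0 < M" unfolding M[OF r(1)] .
  moreover have "(\<alpha> * r\<^sup>2 + \<beta>) powr ((real k + 1) / 2) * \<phi> r = M" if "0 < r" for r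
    using M[OF that] by (simp add: add.commute)
  ultimately show ?thesis using pos by (intro exI[of _ \<alpha>] exI[of _ \<beta>] exI[of _ M] conjI allI impI)
qed

theorem theorem5p2:
  fixes k :: nat and \<mu> :: "(real ^ 'd) set measure"
  assumes "CARD('d) \<ge> 3" and "1 \<le> k" and "k \<le> CARD('d) - 1"
    and "invariant_plane_prob k \<mu>"
    and "\<And>h. nonneg_extremizer k \<mu> h \<Longrightarrow>
           \<exists>f L. extremizer k \<mu> f \<and> radial_nonincreasing f \<and> affine_map L \<and>
                 (AE x in lborel. h x = f (L x))"
  shows "\<forall>h. nonneg_extremizer k \<mu> h \<longrightarrow>
           (\<exists>C L. C > 0 \<and> affine_map L \<and> bij L \<and>
                  (AE x in lborel. h x = (C / (1 + (norm (L x))\<^sup>2)) powr ((real k + 1) / 2)))"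
proof (intro allI impI)
  fix h assume h: "nonneg_extremizer k \<mu> h"
  have k: "k < CARD('d)" using assms(1,3) by simp
  obtain f \<phi> A b where f: "extremizer k \<mu> f" "AE x in lborel. 0 \<le> f x" "antimono_on {0<..} \<phi>" "AE x in lborel. f x = \<phi> (norm x)"
    and A: "linear A" "inj A" "AE x in lborel. h x = f (A x + b)"
    by (rule radial_form[OF h assms(5)[OF h]]) (rule that, assumption+)
  have "\<exists>\<alpha> \<beta> M. 0 < \<alpha> \<and> 0 < \<beta> \<and> (0::real) < M \<and> (\<forall>r>0. (\<alpha> * r\<^sup>2 + \<beta>) powr ((real k + 1) / 2) * \<phi> r = M)"
    by (rule radial_extremizer_profile[OF f assms(2) k assms(4)]) (rule assms(5))
  then obtain \<alpha> \<beta> M where pos: "0 < \<alpha>" "0 < \<beta>" "0 < M" and M: "\<And>r. 0 < r \<Longrightarrow> (\<alpha> * r\<^sup>2 + \<beta>) powr ((real k + 1) / 2) * \<phi> r = M"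
    by (elim exE conjE) (rule that, assumption, assumption, assumption, erule allE, erule mp, assumption)
  let ?m = "(real k + 1) / 2"
  \<comment> \<open>With m = (k + 1) / 2, factoring out beta gives M (alpha r^2 + beta)^(-m) =
    ((M^(1/m) / beta) / (1 + (alpha / beta) r^2))^m. The scaling sqrt (alpha / beta) is absorbed
    into the affine map.\<close>
  define C where "C = M powr (1 / ?m) / \<beta>"
  define \<gamma> where "\<gamma> = sqrt (\<alpha> / \<beta>)"
  let ?L = "\<lambda>x. \<gamma> *\<^sub>R (A x + b)"
  have \<gamma>: "0 < \<gamma>" "\<gamma>\<^sup>2 = \<alpha> / \<beta>" using pos by (simp_all add: \<gamma>_def)
  have C: "0 < C" using pos by (simp add: C_def)
  have form: "\<phi> r = (C / (1 + (\<gamma> * r)\<^sup>2)) powr ?m" if r: "0 < r" for r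
  proof -
    have D: "0 < \<alpha> * r\<^sup>2 + \<beta>" using pos by (simp add: add_nonneg_pos)
    have "1 + (\<gamma> * r)\<^sup>2 = (\<alpha> * r\<^sup>2 + \<beta>) / \<beta>" using pos by (simp add: power_mult_distrib \<gamma> field_simps)
    then have "C / (1 + (\<gamma> * r)\<^sup>2) = M powr (1 / ?m) / (\<alpha> * r\<^sup>2 + \<beta>)" using pos D by (simp add: C_def)
    then have "(C / (1 + (\<gamma> * r)\<^sup>2)) powr ?m = (M powr (1 / ?m)) powr ?m / (\<alpha> * r\<^sup>2 + \<beta>) powr ?m"
      using D by (simp only: powr_divide)
    also have "(M powr (1 / ?m)) powr ?m = M"
    proof -
      have "1 / c * c = 1" if "c \<noteq> 0" for c :: real using that by simp
      moreover have "?m \<noteq> 0" by simp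
      ultimately have "1 / ?m * ?m = 1" by blast
      then show ?thesis using powr_one[of M] pos(3) by (simp only: powr_powr less_imp_le)
    qed
    also have "M / (\<alpha> * r\<^sup>2 + \<beta>) powr ?m = \<phi> r" using M[OF r] D by (simp add: field_simps)
    finally show ?thesis ..
  qed
  have aff: "affine_map ?L"
    unfolding affine_map_def
    by (intro exI[of _ "\<lambda>x. \<gamma> *\<^sub>R A x"] exI[of _ "\<gamma> *\<^sub>R b"] conjI)
      (simp_all add: linear_compose_scale_right A(1) scaleR_add_right)
  have "surj A" using A(1,2) by (rule linear_injective_imp_surjective) simp
  have "\<exists>x. y = ?L x" for y
  proof -
    obtain x where "A x = (1 / \<gamma>) *\<^sub>R y - b" using \<open>surj A\<close> by (metis surjD)
    then show ?thesis using \<gamma>(1) by (intro exI[of _ x]) simp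
  qed
  moreover have "inj ?L" using \<gamma>(1) A(2) by (auto simp: inj_def)
  ultimately have bij: "bij ?L" unfolding bij_def surj_def by blast
  \<comment> \<open>The profile is known only at positive radii; the one point sent to 0 by the
    affine map is discarded.\<close>
  have "AE x in lborel. x \<noteq> (0 :: real^'d)" by (rule AE_lborel_singleton)
  from AE_lborel_affine[OF A(1,2) this, of b] AE_lborel_affine[OF A(1,2) f(4), of b] A(3)
  have "AE x in lborel. h x = (C / (1 + (norm (?L x))\<^sup>2)) powr ?m"
  proof eventually_elim
    case (elim x)
    have "norm (?L x) = \<gamma> * norm (A x + b)" using \<gamma>(1) by simp
    then show ?case using elim form[of "norm (A x + b)"] by simp
  qed
  then show "\<exists>C L. C > 0 \<and> affine_map L \<and> bij L \<and>
      (AE x in lborel. h x = (C / (1 + (norm (L x))\<^sup>2)) powr ((real k + 1) / 2))"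
    using C aff bij by blast
qed

end
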